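(* Let $\mathbf d\in\{\mathbb W_p,\mathbb W_p^{\rm ad}\}$, let $g:\mathcal P_p(\mathbb R^2)\to\mathbb R$ satisfy the regularity condition (R), and let $\mu\in\mathcal P_p(\mathbb R^2)$ satisfy condition $\mathbf B_{\mathbf d}$. For $r\ge0$ set $$\overline G^{\rm m}_{\mathbf d}(r)=\inf_{f_1,f_2\in C_b^1(\mathbb R)}\ \sup_{\mu'\in B_{\mathbf d}(\mu,r)}\Big\{g(\mu')+\int(f_1\oplus f_2)\,d(\mu'-\mu)\Big\},\qquad\underline G^{\rm m}_{\mathbf d}(r)=\sup_{\mu'\in B_{\mathbf d}(\mu,r)\cap\Pi(\mu_1,\mu_2)}g(\mu').$$ Then both maps are differentiable at $r=0$ and $$(\overline G^{\rm m}_{\mathbf d})'(0)=(\underline G^{\rm m}_{\mathbf d})'(0)=\inf_{f\in\mathbb L^{p'}(\mu_1)\times\mathbb L^{p'}(\mu_2)}U^{\rm m}_{\mathbf d}(f)^{1/p'},\qquad U^{\rm m}_{\mathbf d}(f)=\|\partial_x^{\mathbf d}\delta_mg+f\|_{\mathbb L^{p'}(\mu)}^{p'},$$ where $f=(f_1,f_2)$ is identified with the vector $(f_1(X_1),f_2(X_2))$. $U^{\rm m}_{\mathbf d}$ is strictly convex, continuous and coercive; hence this optimization problem admits a unique solution $f^{\rm m}_{\mathbf d}=(f^{\rm m}_{\mathbf d,1},f^{\rm m}_{\mathbf d,2})$, characterized by $$\mathbb E_1^\mu[T^{\rm m}_{\mathbf d,1}]=0,\quad\mathbb E_2^\mu[T^{\rm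 m}_{\mathbf d,2}]=0,\qquad T^{\rm m}_{\mathbf d}=(T^{\rm m}_{\mathbf d,1},T^{\rm m}_{\mathbf d,2})=\frac1c\mathbf N_{\mathbf d}\big(\partial_x^{\mathbf d}\delta_mg+f^{\rm m}_{\mathbf d}\big),$$ with $c$ uniquely defined by $\|T^{\rm m}_{\mathbf d}\|_{\mathbb L^p(\mu)}=1$. Furthermore, when $p=2$, this first-order condition simplifies to $f^{\rm m}_{\mathbf d,1}=-\mathbb E_1^\mu[\partial_{x_1}\delta_mg]$, $f^{\rm m}_{\mathbf d,2}=-\mathbb E_2^\mu[\partial_{x_2}\delta_mg]$, and the sensitivities are $$(\overline G^{\rm m}_{\mathbb W_2})'(0)=(\underline G^{\rm m}_{\mathbb W_2})'(0)=\mathbb E^\mu\big[(\partial_{x_1}\delta_mg-\mathbb E_1^\mu[\partial_{x_1}\delta_mg])^2+(\partial_{x_2}\delta_mg-\mathbb E_2^\mu[\partial_{x_2}\delta_mg])^2\big]^{1/2},$$ $$(\overline G^{\rm m}_{\mathbb W_2^{\rm ad}})'(0)=(\underline G^{\rm m}_{\mathbb W_2^{\rm ad}})'(0)=\mathbb E^\mu\big[(\partial_{x_2}\delta_mg-\mathbb E_2^\mu[\partial_{x_2}\delta_mg])^2\big]^{1/2}.$$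
   Context: $p>1$, $p'=p/(p-1)$; $\mathbb R^2=\mathbb R\times\mathbb R$, points $x=(x_1,x_2)$, Euclidean norm $|\cdot|$. $\mathcal P_p(\mathbb R^2)$: probability measures with finite $p$-th moment. $X=(X_1,X_2)$ is the canonical variable, $(X,X')$ the coordinate projections on $\mathbb R^2\times\mathbb R^2$. $\mu_i=\mu\circ X_i^{-1}$; $\mathbb E_i^\mu[\cdot]=\mathbb E^\mu[\cdot|X_i]$. $\|T\|_{\mathbb L^q(\mu)}^q=\mathbb E^\mu[|T|^q]$, with the Euclidean norm on $\mathbb R^2$ if $T$ is $\mathbb R^2$-valued. $(f_1\oplus f_2)(x)=f_1(x_1)+f_2(x_2)$. $C_b^1(\mathbb R)$: bounded $C^1$ functions with bounded derivative. $\Pi(\mu_1,\mu_2)$: probability measures on $\mathbb R^2$ with marginals $\mu_1,\mu_2$. Uniqueness is up to $\mu_i$-a.s. equality of the $i$-th component. Distances: $\mathbb W_p(\mu,\mu')=\inf_\pi\mathbb E^\pi[|X-X'|^p]^{1/p}$ over couplings $\pi$ of $\mu,\mu'$. A probability $\pi$ on $\mathbb R^2\times\mathbb R^2$ is causal if for all bounded Borel $f:\mathbb R^2\to\mathbb R$, $g:\mathbb R\to\mathbb R$, $\mathbb E^\pi[f(X_1,X_2)g(X_1')|X_1]=\mathbb E^\pi[f(X_1,X_2)|X_1]\,\mathbb E^\pi[g(X_1')|X_1]$; bi-causal if $\pi$ and $\pi\circ(X',X)^{-1}$ are causal. $\mathbb W_p^{\rm ad}(\mu,\mu')=\inf_\pi\mathbb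 E^\pi[|X-X'|^p]^{1/p}$ over bi-causal couplings $\pi$ of $\mu,\mu'$. $B_{\mathbf d}(\mu,r)=\{\mu'\in\mathcal P_p(\mathbb R^2):\mathbf d(\mu,\mu')\le r\}$. A function $g$ on $\mathcal P_p(\mathbb R^2)$ has linear functional derivative $\delta_mg:\mathcal P_p(\mathbb R^2)\times\mathbb R^2\to\mathbb R$ if $\delta_mg$ is continuous (for $\mathbb W_p$ on measures), has $p$-polynomial growth in $x$ (bounded by $C(1+|x|^p)$) locally uniformly in $m$, and $\lambda^{-1}(g(\mu+\lambda(\mu'-\mu))-g(\mu))\to\int\delta_mg(\mu,x)(\mu'-\mu)(dx)$ as $\lambda\searrow0$ for all $\mu,\mu'$. Condition (R): $g$ has a linear functional derivative which is $C^1$ in $x$, and $\partial_x\delta_mg$ is jointly continuous with $(p-1)$-polynomial growth in $x$, locally in $m$. $\delta_mg$ is evaluated at $(\mu,X)$. $\partial_x^{\mathbf d}u=\partial_xu$ if $\mathbf d=\mathbb W_p$; $\partial_x^{\mathbf d}u=(\mathbb E_1^\mu[\partial_{x_1}u],\partial_{x_2}u)$ if $\mathbf d=\mathbb W_p^{\rm ad}$. $\mathbf N(y)=y/|y|^{2-p'}$ ($\mathbf N(0)=0$); $\mathbf N_{\mathbf d}(x)=\mathbf N(x)$ for $x\in\mathbb R^2$ if $\mathbf d=\mathbb W_p$, and $\mathbf N_{\mathbf d}(x)=(\mathbf N(x_1),\mathbf N(x_2))$ if $\mathbf d=\mathbb W_p^{\rm ad}$. A real function on a normed space is coercive if it tends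 to $+\infty$ as the norm tends to infinity. Condition $\mathbf B_{\mathbb W_p}$: $\mu$ admits a density $q$, and for $i=1,2$, $\mu_i(dx)=q_i(x)\mathbf 1_{\{x\in I_i\}}dx$ where $I_i$ is an interval and $q_i\in C(I_i,\mathbb R_+)$; moreover $\mu=k(x_1,x_2)\,dx_2\,\mu_1(dx_1)$ with $k$ bounded. Condition $\mathbf B_{\mathbb W_p^{\rm ad}}$: $\mu(dx)=\kappa(x)\,dx_2\,\mu_1(dx_1)$ with $\kappa$ bounded, and $\mu_2$ is supported in an interval $I_2$, where its density $q_2(x_2)=\int\kappa(x)\mu_1(dx_1)$ is continuous. Standing assumption: a constant $c>0$ normalizing $T^{\rm m}_{\mathbf d}$ exists, i.e. $\partial_x^{\mathbf d}\delta_mg+f^{\rm m}_{\mathbf d}$ is not $\mu$-a.s. zero. *)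

theory Defs
  imports "HOL-Probability.Probability"
begin

text \<open>The plane is \<open>real \<times> real\<close>, whose norm is the Euclidean one and whose Borel sigma-algebra
  is the product one.\<close>

type_synonym plane = "real \<times> real"

definition marg1 :: "plane measure \<Rightarrow> real measure" where
  "marg1 \<mu> = distr \<mu> borel fst"

definition marg2 :: "plane measure \<Rightarrow> real measure" where
  "marg2 \<mu> = distr \<mu> borel snd"

definition Pp :: "real \<Rightarrow> plane measure set" where
  "Pp p = {\<mu>. prob_space \<mu> \<and> sets \<mu> = sets borel \<and> integrable \<mu> (\<lambda>x. norm x powr p)}"

definition cexp :: "'a measure \<Rightarrow> ('a \<Rightarrow> real) \<Rightarrow> ('a \<Rightarrow> real) \<Rightarrow> 'a \<Rightarrow> real" where
  "cexp M Y h = real_cond_exp M (vimage_algebra (space M) Y borel) h"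

text \<open>For real marginals this is \<open>\<Pi>(\<mu>\<^sub>1, \<mu>\<^sub>2)\<close>; for marginals on the plane it is the
  set of couplings in the definition of the distances.\<close>

definition couplings ::
  "'a::topological_space measure \<Rightarrow> 'b::topological_space measure \<Rightarrow> ('a \<times> 'b) measure set" where
  "couplings M N = {\<pi>. prob_space \<pi> \<and> sets \<pi> = sets borel \<and>
      distr \<pi> borel fst = M \<and> distr \<pi> borel snd = N}"

definition causal :: "(plane \<times> plane) measure \<Rightarrow> bool" where
  "causal \<pi> \<longleftrightarrow>
    (\<forall>f\<in>borel_measurable borel. \<forall>g\<in>borel_measurable borel. bounded (range f) \<longrightarrow> bounded (range g) \<longrightarrow>
      (AE z in \<pi>.
        cexp \<pi> (\<lambda>z. fst (fst z)) (\<lambda>z. f (fst z) * g (fst (snd z))) z =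
        cexp \<pi> (\<lambda>z. fst (fst z)) (\<lambda>z. f (fst z)) z *
        cexp \<pi> (\<lambda>z. fst (fst z)) (\<lambda>z. g (fst (snd z))) z))"

definition bicausal :: "(plane \<times> plane) measure \<Rightarrow> bool" where
  "bicausal \<pi> \<longleftrightarrow> causal \<pi> \<and> causal (distr \<pi> borel prod.swap)"

text \<open>The two distances. On \<^term>\<open>Pp p\<close> every coupling has a finite cost and the product
  coupling is bicausal, so the integrals and infima are the intended ones.\<close>

definition transport_cost :: "real \<Rightarrow> (plane \<times> plane) measure \<Rightarrow> real" where
  "transport_cost p \<pi> = (\<integral>z. norm (fst z - snd z) powr p \<partial>\<pi>) powr (1 / p)"

definition wasserstein :: "real \<Rightarrow> plane measure \<Rightarrow> plane measure \<Rightarrow> real" where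
  "wasserstein p \<mu> \<nu> = (INF \<pi>\<in>couplings \<mu> \<nu>. transport_cost p \<pi>)"

definition adapted_wasserstein :: "real \<Rightarrow> plane measure \<Rightarrow> plane measure \<Rightarrow> real" where
  "adapted_wasserstein p \<mu> \<nu> = (INF \<pi>\<in>{\<pi>\<in>couplings \<mu> \<nu>. bicausal \<pi>}. transport_cost p \<pi>)"

datatype distance_kind = Wass | AdWass

fun distance :: "distance_kind \<Rightarrow> real \<Rightarrow> plane measure \<Rightarrow> plane measure \<Rightarrow> real" where
  "distance Wass p = wasserstein p"
| "distance AdWass p = adapted_wasserstein p"

definition dball :: "distance_kind \<Rightarrow> real \<Rightarrow> plane measure \<Rightarrow> real \<Rightarrow> plane measure set" where
  "dball d p \<mu> r = {\<mu>'\<in>Pp p. distance d p \<mu> \<mu>' \<le> r}"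

text \<open>\<open>mix l \<mu> \<mu>'\<close> is \<open>\<mu> + l (\<mu>' - \<mu>)\<close>, meant for \<open>0 \<le> l \<le> 1\<close>.\<close>

definition mix :: "real \<Rightarrow> plane measure \<Rightarrow> plane measure \<Rightarrow> plane measure" where
  "mix l \<mu> \<mu>' = measure_of UNIV (sets borel)
     (\<lambda>A. ennreal (1 - l) * emeasure \<mu> A + ennreal l * emeasure \<mu>' A)"

definition jointly_continuous ::
  "real \<Rightarrow> (plane measure \<Rightarrow> plane \<Rightarrow> 'b::metric_space) \<Rightarrow> bool" where
  "jointly_continuous p h \<longleftrightarrow>
    (\<forall>m\<in>Pp p. \<forall>x. \<forall>e>0. \<exists>s>0. \<forall>m'\<in>Pp p. \<forall>x'.
       wasserstein p m m' < s \<and> dist x x' < s \<longrightarrow> dist (h m x) (h m' x') < e)"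

definition locally_poly_growth ::
  "real \<Rightarrow> real \<Rightarrow> (plane measure \<Rightarrow> plane \<Rightarrow> 'b::real_normed_vector) \<Rightarrow> bool" where
  "locally_poly_growth p q h \<longleftrightarrow>
    (\<forall>m\<in>Pp p. \<exists>s>0. \<exists>C. \<forall>m'\<in>Pp p. wasserstein p m m' < s \<longrightarrow>
       (\<forall>x. norm (h m' x) \<le> C * (1 + norm x powr q)))"

definition linear_functional_derivative ::
  "real \<Rightarrow> (plane measure \<Rightarrow> real) \<Rightarrow> (plane measure \<Rightarrow> plane \<Rightarrow> real) \<Rightarrow> bool" where
  "linear_functional_derivative p g \<delta>g \<longleftrightarrow>
    jointly_continuous p \<delta>g \<and> locally_poly_growth p p \<delta>g \<and>
    (\<forall>\<mu>\<in>Pp p. \<forall>\<mu>'\<in>Pp p.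
      ((\<lambda>l. (g (mix l \<mu> \<mu>') - g \<mu>) / l)
         \<longlongrightarrow> (\<integral>x. \<delta>g \<mu> x \<partial>\<mu>') - (\<integral>x. \<delta>g \<mu> x \<partial>\<mu>)) (at_right 0))"

definition partial1 :: "(plane \<Rightarrow> real) \<Rightarrow> plane \<Rightarrow> real" where
  "partial1 u x = deriv (\<lambda>t. u (t, snd x)) (fst x)"

definition partial2 :: "(plane \<Rightarrow> real) \<Rightarrow> plane \<Rightarrow> real" where
  "partial2 u x = deriv (\<lambda>t. u (fst x, t)) (snd x)"

definition grad :: "(plane \<Rightarrow> real) \<Rightarrow> plane \<Rightarrow> plane" where
  "grad u x = (partial1 u x, partial2 u x)"

text \<open>Condition (R) on \<open>g\<close>, with \<open>\<delta>g\<close> the linear functional derivative in question. The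
  latter is determined by \<open>g\<close> only up to an additive constant depending on the measure.\<close>

definition cond_R ::
  "real \<Rightarrow> (plane measure \<Rightarrow> real) \<Rightarrow> (plane measure \<Rightarrow> plane \<Rightarrow> real) \<Rightarrow> bool" where
  "cond_R p g \<delta>g \<longleftrightarrow>
    linear_functional_derivative p g \<delta>g \<and>
    (\<forall>m\<in>Pp p. (\<forall>x. \<delta>g m differentiable (at x)) \<and> continuous_on UNIV (grad (\<delta>g m))) \<and>
    jointly_continuous p (\<lambda>m. grad (\<delta>g m)) \<and>
    locally_poly_growth p (p - 1) (\<lambda>m. grad (\<delta>g m))"

fun cond_B :: "distance_kind \<Rightarrow> plane measure \<Rightarrow> bool" where
  "cond_B Wass \<mu> \<longleftrightarrow>
    (\<exists>q\<in>borel_measurable borel. \<mu> = density lborel q) \<and>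
    (\<forall>\<nu>\<in>{marg1 \<mu>, marg2 \<mu>}. \<exists>I q. is_interval I \<and> continuous_on I q \<and> (\<forall>x\<in>I. 0 \<le> q x) \<and>
        \<nu> = density lborel (\<lambda>x. ennreal (q x) * indicator I x)) \<and>
    (\<exists>k\<in>borel_measurable borel. (\<forall>x. 0 \<le> k x) \<and> bounded (range k) \<and>
        \<mu> = density (marg1 \<mu> \<Otimes>\<^sub>M lborel) (\<lambda>x. ennreal (k x)))"
| "cond_B AdWass \<mu> \<longleftrightarrow>
    (\<exists>k\<in>borel_measurable borel. (\<forall>x. 0 \<le> k x) \<and> bounded (range k) \<and>
        \<mu> = density (marg1 \<mu> \<Otimes>\<^sub>M lborel) (\<lambda>x. ennreal (k x)) \<and>
        (\<exists>I. is_interval I \<and> (AE x in marg2 \<mu>. x \<in> I) \<and>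
             continuous_on I (\<lambda>x2. \<integral>x1. k (x1, x2) \<partial>marg1 \<mu>)))"

definition Cb1 :: "(real \<Rightarrow> real) set" where
  "Cb1 = {f. bounded (range f) \<and>
     (\<exists>f'. (\<forall>x. (f has_real_derivative f' x) (at x)) \<and> continuous_on UNIV f' \<and> bounded (range f'))}"

text \<open>The suprema may be infinite for large radii, hence \<^typ>\<open>ereal\<close>.\<close>

definition G_upper ::
  "distance_kind \<Rightarrow> real \<Rightarrow> (plane measure \<Rightarrow> real) \<Rightarrow> plane measure \<Rightarrow> real \<Rightarrow> ereal" where
  "G_upper d p g \<mu> r = (INF f\<in>Cb1 \<times> Cb1. SUP \<mu>'\<in>dball d p \<mu> r.
     ereal (g \<mu>' + ((\<integral>x. fst f (fst x) + snd f (snd x) \<partial>\<mu>') - (\<integral>x. fst f (fst x) + snd f (snd x) \<partial>\<mu>))))"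

definition G_lower ::
  "distance_kind \<Rightarrow> real \<Rightarrow> (plane measure \<Rightarrow> real) \<Rightarrow> plane measure \<Rightarrow> real \<Rightarrow> ereal" where
  "G_lower d p g \<mu> r = (SUP \<mu>'\<in>dball d p \<mu> r \<inter> couplings (marg1 \<mu>) (marg2 \<mu>). ereal (g \<mu>'))"

text \<open>Differentiability at 0 of a function of \<open>r \<ge> 0\<close>: it has to be finite near 0.\<close>

definition has_deriv0 :: "(real \<Rightarrow> ereal) \<Rightarrow> real \<Rightarrow> bool" where
  "has_deriv0 G D \<longleftrightarrow>
    \<bar>G 0\<bar> \<noteq> \<infinity> \<and> (\<forall>\<^sub>F r in at_right 0. \<bar>G r\<bar> \<noteq> \<infinity>) \<and>
    ((\<lambda>r. real_of_ereal (G r)) has_real_derivative D) (at 0 within {0..})"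

definition conj_exp :: "real \<Rightarrow> real" where
  "conj_exp p = p / (p - 1)"

definition Lspace :: "real \<Rightarrow> real measure \<Rightarrow> (real \<Rightarrow> real) set" where
  "Lspace q \<nu> = {f\<in>borel_measurable borel. integrable \<nu> (\<lambda>x. \<bar>f x\<bar> powr q)}"

definition Lnorm :: "real \<Rightarrow> 'a measure \<Rightarrow> ('a \<Rightarrow> 'b::real_normed_vector) \<Rightarrow> real" where
  "Lnorm q M T = (\<integral>x. norm (T x) powr q \<partial>M) powr (1 / q)"

type_synonym fpair = "(real \<Rightarrow> real) \<times> (real \<Rightarrow> real)"

definition Lpair :: "real \<Rightarrow> plane measure \<Rightarrow> fpair set" where
  "Lpair q \<mu> = Lspace q (marg1 \<mu>) \<times> Lspace q (marg2 \<mu>)"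

definition pair_norm :: "real \<Rightarrow> plane measure \<Rightarrow> fpair \<Rightarrow> real" where
  "pair_norm q \<mu> f = Lnorm q (marg1 \<mu>) (fst f) + Lnorm q (marg2 \<mu>) (snd f)"

definition pair_lin :: "real \<Rightarrow> fpair \<Rightarrow> real \<Rightarrow> fpair \<Rightarrow> fpair" where
  "pair_lin a f b h =
     ((\<lambda>t. a * fst f t + b * fst h t), (\<lambda>t. a * snd f t + b * snd h t))"

text \<open>Equality of pairs as elements of the product of the two Lebesgue spaces.\<close>

definition pair_eq :: "plane measure \<Rightarrow> fpair \<Rightarrow> fpair \<Rightarrow> bool" where
  "pair_eq \<mu> f h \<longleftrightarrow>
    (AE t in marg1 \<mu>. fst f t = fst h t) \<and> (AE t in marg2 \<mu>. snd f t = snd h t)"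

definition pair_vec :: "fpair \<Rightarrow> plane \<Rightarrow> plane" where
  "pair_vec f x = (fst f (fst x), snd f (snd x))"

definition Lstrictly_convex :: "real \<Rightarrow> plane measure \<Rightarrow> (fpair \<Rightarrow> real) \<Rightarrow> bool" where
  "Lstrictly_convex q \<mu> F \<longleftrightarrow>
    (\<forall>f\<in>Lpair q \<mu>. \<forall>h\<in>Lpair q \<mu>. \<forall>t. 0 < t \<and> t < 1 \<and> \<not> pair_eq \<mu> f h \<longrightarrow>
       F (pair_lin (1 - t) f t h) < (1 - t) * F f + t * F h)"

definition Lcontinuous :: "real \<Rightarrow> plane measure \<Rightarrow> (fpair \<Rightarrow> real) \<Rightarrow> bool" where
  "Lcontinuous q \<mu> F \<longleftrightarrow>
    (\<forall>f\<in>Lpair q \<mu>. \<forall>e>0. \<exists>s>0. \<forall>h\<in>Lpair q \<mu>.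
       pair_norm q \<mu> (pair_lin 1 h (-1) f) < s \<longrightarrow> \<bar>F h - F f\<bar> < e)"

definition Lcoercive :: "real \<Rightarrow> plane measure \<Rightarrow> (fpair \<Rightarrow> real) \<Rightarrow> bool" where
  "Lcoercive q \<mu> F \<longleftrightarrow> (\<forall>K. \<exists>R. \<forall>f\<in>Lpair q \<mu>. R \<le> pair_norm q \<mu> f \<longrightarrow> K \<le> F f)"

fun dgrad :: "distance_kind \<Rightarrow> plane measure \<Rightarrow> (plane \<Rightarrow> real) \<Rightarrow> plane \<Rightarrow> plane" where
  "dgrad Wass \<mu> u x = grad u x"
| "dgrad AdWass \<mu> u x = (cexp \<mu> fst (partial1 u) x, partial2 u x)"

definition resid :: "distance_kind \<Rightarrow> plane measure \<Rightarrow> (plane \<Rightarrow> real) \<Rightarrow> fpair \<Rightarrow> plane \<Rightarrow> plane" where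
  "resid d \<mu> u f x = dgrad d \<mu> u x + pair_vec f x"

definition U :: "distance_kind \<Rightarrow> real \<Rightarrow> plane measure \<Rightarrow> (plane \<Rightarrow> real) \<Rightarrow> fpair \<Rightarrow> real" where
  "U d p \<mu> u f = (\<integral>x. norm (resid d \<mu> u f x) powr conj_exp p \<partial>\<mu>)"

definition is_solution ::
  "distance_kind \<Rightarrow> real \<Rightarrow> plane measure \<Rightarrow> (plane \<Rightarrow> real) \<Rightarrow> fpair \<Rightarrow> bool" where
  "is_solution d p \<mu> u =
     is_arg_min (\<lambda>f. U d p \<mu> u f powr (1 / conj_exp p)) (\<lambda>f. f \<in> Lpair (conj_exp p) \<mu>)"

definition Nmap :: "real \<Rightarrow> 'a::real_normed_vector \<Rightarrow> 'a" where
  "Nmap p y = y /\<^sub>R (norm y powr (2 - conj_exp p))"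

fun Nd :: "distance_kind \<Rightarrow> real \<Rightarrow> plane \<Rightarrow> plane" where
  "Nd Wass p x = Nmap p x"
| "Nd AdWass p x = (Nmap p (fst x), Nmap p (snd x))"

definition Tmap ::
  "distance_kind \<Rightarrow> real \<Rightarrow> plane measure \<Rightarrow> (plane \<Rightarrow> real) \<Rightarrow> real \<Rightarrow> fpair \<Rightarrow> plane \<Rightarrow> plane" where
  "Tmap d p \<mu> u c f x = (1 / c) *\<^sub>R Nd d p (resid d \<mu> u f x)"

end

theory Submission
  imports Defs
begin

text \<open>
  Upper bound. Let \<open>f\<close> be an admissible pair, approximated by continuous functions with bounded support, whose
  antiderivatives \<open>\<Phi>\<close> lie in \<open>Cb1\<close>. For a nearly optimal coupling of \<open>\<mu>\<close> and \<open>\<mu>'\<close> the objective with test functions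
  \<open>\<Phi>\<close> exceeds \<open>g \<mu>\<close> by at most the expectation of \<open>(\<partial>\<delta>g + f) \<bullet> (X' - X)\<close> plus \<open>o(r)\<close>, and Hoelder's inequality
  bounds this by \<open>r\<close> times the dual norm. Under causality \<open>X'\<^sub>1\<close> is conditionally independent of \<open>X\<^sub>2\<close> given \<open>X\<^sub>1\<close>,
  whence \<open>\<partial>\<^sub>1\<delta>g\<close> may be replaced by its conditional expectation.

  Lower bound. The first-order condition of the dual problem says that the components of the Hoelder extremal \<open>T\<close>
  have conditional mean zero given the respective coordinates. Hence \<open>X + r T\<close> has the marginals of \<open>\<mu>\<close> up to \<open>o(r)\<close>,
  and a monotone rearrangement of each coordinate restores them exactly at the cost \<open>o(r)\<close> in \<open>L\<^sup>p\<close>. In the adapted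
  case \<open>T\<^sub>1 = 0\<close>: the first coordinate is left alone, and any coupling that fixes it is bicausal.
\<close>

section \<open>Powers of norms\<close>

text \<open>Two bounds suffice: for competitors with the marginals of \<open>\<mu>\<close> the test
  terms cancel, so the lower value never exceeds the upper one. The construction of competitors is
  shaped by the passage from \<open>L\<^sup>1\<close> to \<open>L\<^sup>p\<close>. Distribution
  functions of translates are differentiated in \<open>L\<^sup>1\<close>, where merely integrable
  densities are enough, while the correction must be \<open>o(r)\<close> in
  \<open>L\<^sup>p\<close>; interpolation with a uniform bound of order \<open>r\<close> on the same
  difference bridges the gap. That bound needs a density bounded above, and inverting the
  distribution function needs one bounded below, so the field is first cut off over a compact set on
  which the density is continuous and positive. Finitely many labels turn the perturbed law into a
  finite sum of translates; the error they leave is of order \<open>\<eta>\<close> to the power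
  \<open>p\<close> times a number of labels of order \<open>1 / \<eta>\<close>, which tends to 0
  because \<open>p > 1\<close>. The optimal pair is an almost everywhere limit of a minimizing
  sequence, and this mode of convergence keeps each component a function of its own
  coordinate.\<close>

lemma powr_gt_tangent:
  fixes s m q :: real
  assumes q: "q > 1" and s: "s \<ge> 0" and m: "m \<ge> 0" and ne: "s \<noteq> m"
  shows "m powr q + q * m powr (q - 1) * (s - m) < s powr q"
proof (cases "m = 0")
  case True
  then show ?thesis using assms by (auto simp: powr_eq_0_iff)
next
  case False
  then have m: "m > 0" using m by auto
  \<comment> \<open>By homogeneity only the ratio \<open>s / m\<close> matters, which leaves the
    strict Bernoulli inequality; the mean value theorem gives it on each side of 1.\<close>
  have bern: "1 + q * (x - 1) < x powr q" if x: "x > 0" "x \<noteq> 1" for x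
  proof (cases "x > 1")
    case True
    have "\<exists>z. 1 < z \<and> z < x \<and> x powr q - 1 powr q = (x - 1) * (q * z powr (q - 1))"
      using True by (intro MVT2) (auto intro!: derivative_eq_intros)
    then obtain z where z: "1 < z" "z < x" "x powr q - 1 powr q = (x - 1) * (q * z powr (q - 1))" by blast
    have "z powr (q - 1) > 1" using z q by (simp add: gr_one_powr)
    then have "(x - 1) * (q * z powr (q - 1)) > (x - 1) * (q * 1)" 
      using True q by (intro mult_strict_left_mono) auto
    then show ?thesis using z by (auto simp: algebra_simps)
  next
    case False
    then have x1: "x < 1" using x by auto
    have "\<exists>z. x < z \<and> z < 1 \<and> 1 powr q - x powr q = (1 - x) * (q * z powr (q - 1))"
      using x1 x by (intro MVT2) (auto intro!: derivative_eq_intros)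
    then obtain z where z: "x < z" "z < 1" "1 powr q - x powr q = (1 - x) * (q * z powr (q - 1))" by blast
    have "z powr (q - 1) < 1 powr (q - 1)" using z q x by (intro powr_less_mono2) auto
    then have "(1 - x) * (q * z powr (q - 1)) < (1 - x) * (q * 1)" 
      using x1 q by (intro mult_strict_left_mono) auto
    then show ?thesis using z by (auto simp: algebra_simps)
  qed
  have "1 + q * (s / m - 1) < (s / m) powr q"
  proof (cases "s = 0")
    case True then show ?thesis using q by simp
  next
    case False then show ?thesis using bern[of "s/m"] s m ne by auto
  qed
  then have "m powr q * (1 + q * (s / m - 1)) < m powr q * (s / m) powr q"
    using m by (intro mult_strict_left_mono) auto
  also have "m powr q * (s / m) powr q = s powr q" using s m by (simp add: powr_divide)
  also have "m powr q * (1 + q * (s / m - 1)) = m powr q + q * m powr (q - 1) * (s - m)"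
    using m by (simp add: field_simps powr_diff)
  finally show ?thesis .
qed

text \<open>The vector paired with \<open>b - a\<close> is the gradient of
  \<open>norm a powr q / q\<close>. Strictness has two sources: the scalar inequality if the norms
  differ, and strict Cauchy-Schwarz if they agree.\<close>

lemma norm_powr_gt_tangent:
  fixes a b :: "'a::real_inner"
  assumes q: "q > 1" and ne: "a \<noteq> b"
  shows "norm a powr q + q * ((norm a powr (q - 2) *\<^sub>R a) \<bullet> (b - a)) < norm b powr q"
proof -
  have aa: "norm a powr (q - 2) * (a \<bullet> a) = norm a powr q"
    by (cases "a = 0") (auto simp: dot_square_norm powr_diff power2_eq_square powr_add field_simps)
  have nq: "norm a powr (q - 2) * norm a = norm a powr (q - 1)"
    by (cases "a = 0") (auto simp: powr_diff power2_eq_square field_simps)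
  have nq': "norm a powr (q - 1) * norm a = norm a powr q"
    by (cases "a = 0") (auto simp: powr_diff power2_eq_square field_simps)
  have eq: "norm a powr q + q * ((norm a powr (q - 2) *\<^sub>R a) \<bullet> (b - a)) =
     norm a powr q + q * (norm a powr (q - 2) * (a \<bullet> b) - norm a powr q)"
    by (simp add: inner_diff_right aa right_diff_distrib[symmetric])
  have le: "norm a powr (q - 2) * (a \<bullet> b) \<le> norm a powr (q - 1) * norm b"
  proof -
    have "norm a powr (q - 2) * (a \<bullet> b) \<le> norm a powr (q - 2) * (norm a * norm b)"
      by (intro mult_left_mono norm_cauchy_schwarz) auto
    then show ?thesis using nq by (simp add: mult.assoc[symmetric])
  qed
  show ?thesis
  proof (cases "norm a = norm b")
    case False
    have "norm a powr q + q * norm a powr (q - 1) * (norm b - norm a) < norm b powr q"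
      using powr_gt_tangent[OF q, of "norm b" "norm a"] False by auto
    moreover have "q * norm a powr (q - 1) * (norm b - norm a) = q * (norm a powr (q - 1) * norm b - norm a powr q)"
      using nq' by (simp add: algebra_simps)
    moreover have "q * (norm a powr (q - 2) * (a \<bullet> b) - norm a powr q) \<le> q * (norm a powr (q - 1) * norm b - norm a powr q)"
      using le q by (intro mult_left_mono) auto
    ultimately show ?thesis unfolding eq by linarith
  next
    case True
    then have a0: "a \<noteq> 0" using ne by auto
    have "a \<bullet> b \<noteq> norm a * norm b" using True ne norm_cauchy_schwarz_eq[of a b] a0 by auto
    then have "a \<bullet> b < norm a * norm b" using norm_cauchy_schwarz[of a b] by linarith
    then have "norm a powr (q - 2) * (a \<bullet> b) < norm a powr (q - 2) * (norm a * norm b)"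
      using a0 by (intro mult_strict_left_mono) auto
    also have "\<dots> = norm a powr q" using True nq nq' by (simp add: mult.assoc[symmetric])
    finally have "q * (norm a powr (q - 2) * (a \<bullet> b) - norm a powr q) < 0" using q by (simp add: mult_less_0_iff)
    then show ?thesis unfolding eq using True by simp
  qed
qed

lemma norm_powr_ge_tangent:
  fixes a b :: "'a::real_inner"
  assumes q: "q > 1"
  shows "norm a powr q + q * ((norm a powr (q - 2) *\<^sub>R a) \<bullet> (b - a)) \<le> norm b powr q"
  using norm_powr_gt_tangent[OF q, of a b] by (cases "a = b") auto

text \<open>Average the tangent inequalities at the intermediate point \<open>m\<close>; the
  first-order terms cancel.\<close>

lemma norm_powr_strict_convex:
  fixes a b :: "'a::real_inner"
  assumes q: "q > 1" and ne: "a \<noteq> b" and t: "0 < t" "t < 1"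
  shows "norm ((1 - t) *\<^sub>R a + t *\<^sub>R b) powr q < (1 - t) * norm a powr q + t * norm b powr q"
proof -
  define m where "m = (1 - t) *\<^sub>R a + t *\<^sub>R b"
  define v where "v = norm m powr (q - 2) *\<^sub>R m"
  have am: "a - m = t *\<^sub>R (a - b)" and bm: "b - m = (1 - t) *\<^sub>R (b - a)"
    by (auto simp: m_def algebra_simps)
  have "m \<noteq> a" using am ne t by auto
  moreover have "m \<noteq> b" using bm ne t by auto
  ultimately have 1: "norm m powr q + q * (v \<bullet> (a - m)) < norm a powr q"
    and 2: "norm m powr q + q * (v \<bullet> (b - m)) < norm b powr q"
    using norm_powr_gt_tangent[OF q] unfolding v_def by auto
  have "(1 - t) * (norm m powr q + q * (v \<bullet> (a - m))) + t * (norm m powr q + q * (v \<bullet> (b - m)))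
     < (1 - t) * norm a powr q + t * norm b powr q"
    using 1 2 t by (intro add_strict_mono mult_strict_left_mono) auto
  moreover have "(1 - t) * (v \<bullet> (a - m)) + t * (v \<bullet> (b - m)) = 0"
    unfolding am bm by (simp add: inner_diff_right algebra_simps)
  then have "(1 - t) * (q * (v \<bullet> (a - m))) + t * (q * (v \<bullet> (b - m))) = 0"
    by (metis (no_types, opaque_lifting) distrib_left mult.left_commute mult_zero_right)
  ultimately show ?thesis unfolding m_def[symmetric] by (simp add: algebra_simps)
qed

lemma norm_powr_convex:
  fixes a b :: "'a::real_inner"
  assumes q: "q > 1" and t: "0 \<le> t" "t \<le> 1"
  shows "norm ((1 - t) *\<^sub>R a + t *\<^sub>R b) powr q \<le> (1 - t) * norm a powr q + t * norm b powr q"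
proof (cases "a = b \<or> t = 0 \<or> t = 1")
  case True
  moreover have "(1 - t) *\<^sub>R b + t *\<^sub>R b = b" by (simp add: scaleR_left_distrib[symmetric])
  moreover have "(1 - t) * x + t * x = x" for x :: real by (simp add: algebra_simps)
  ultimately show ?thesis by auto
next
  case False
  then show ?thesis using norm_powr_strict_convex[OF q, of a b t] t by auto
qed

text \<open>The crude constant comes from bounding the sum by twice the maximum. In this form the
  inequality also covers exponents below 1, which occur as \<open>p - 1\<close>.\<close>

lemma add_powr_le:
  fixes x y q :: real
  assumes "x \<ge> 0" "y \<ge> 0" "q \<ge> 0"
  shows "(x + y) powr q \<le> 2 powr q * (x powr q + y powr q)"
proof -
  have "(x + y) powr q \<le> (2 * max x y) powr q" using assms by (intro powr_mono2) auto
  also have "\<dots> = 2 powr q * (max x y) powr q" using assms by (simp add: powr_mult)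
  also have "(max x y) powr q \<le> x powr q + y powr q" by (auto simp: max_def)
  finally show ?thesis by simp
qed

section \<open>Lebesgue spaces\<close>

definition in_Lp :: "real \<Rightarrow> 'a measure \<Rightarrow> ('a \<Rightarrow> 'b::{real_normed_vector, second_countable_topology}) \<Rightarrow> bool" where
  "in_Lp q M f \<longleftrightarrow> f \<in> borel_measurable M \<and> integrable M (\<lambda>x. norm (f x) powr q)"

lemma in_Lp_measurable [measurable_dest]: "in_Lp q M f \<Longrightarrow> f \<in> borel_measurable M"
  by (simp add: in_Lp_def)

lemma in_Lp_integrable: "in_Lp q M f \<Longrightarrow> integrable M (\<lambda>x. norm (f x) powr q)"
  by (simp add: in_Lp_def)

lemma in_Lp_bound:
  assumes "in_Lp q M f" "g \<in> borel_measurable M" "AE x in M. norm (g x) \<le> norm (f x)" "q \<ge> 0"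
  shows "in_Lp q M g"
  unfolding in_Lp_def
proof
  have m[measurable]: "g \<in> borel_measurable M" by fact
  show "g \<in> borel_measurable M" by fact
  have "AE x in M. norm (norm (g x) powr q) \<le> norm (norm (f x) powr q)"
    using assms(3) by eventually_elim (use assms(4) in \<open>auto intro!: powr_mono2\<close>)
  then show "integrable M (\<lambda>x. norm (g x) powr q)"
    by (intro Bochner_Integration.integrable_bound[OF in_Lp_integrable[OF assms(1)]]) auto
qed

lemma in_Lp_norm [simp]: "f \<in> borel_measurable M \<Longrightarrow> in_Lp q M (\<lambda>x. norm (f x)) \<longleftrightarrow> in_Lp q M f"
  by (auto simp: in_Lp_def)

lemma in_Lp_add [intro]:
  assumes "in_Lp q M f" "in_Lp q M g" "q \<ge> 0"
  shows "in_Lp q M (\<lambda>x. f x + g x)"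
  unfolding in_Lp_def
proof
  have [measurable]: "f \<in> borel_measurable M" "g \<in> borel_measurable M" using assms by (auto simp: in_Lp_def)
  show "(\<lambda>x. f x + g x) \<in> borel_measurable M" by measurable
  have "norm (f x + g x) powr q \<le> 2 powr q * (norm (f x) powr q + norm (g x) powr q)" for x
    using powr_mono2[OF assms(3) norm_ge_zero norm_triangle_ineq[of "f x" "g x"]]
      add_powr_le[OF norm_ge_zero norm_ge_zero assms(3), of "f x" "g x"] by linarith
  then show "integrable M (\<lambda>x. norm (f x + g x) powr q)"
    by (intro Bochner_Integration.integrable_bound[OF integrable_mult_right[OF Bochner_Integration.integrable_add[OF in_Lp_integrable[OF assms(1)] in_Lp_integrable[OF assms(2)]], of "2 powr q"]])
       (auto simp: abs_of_nonneg)
qed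

lemma in_Lp_scaleR [intro]: "in_Lp q M f \<Longrightarrow> in_Lp q M (\<lambda>x. c *\<^sub>R f x)"
  unfolding in_Lp_def by (auto simp: powr_mult)

lemma in_Lp_cmult [intro]: "in_Lp q M f \<Longrightarrow> in_Lp q M (\<lambda>x. c * f x :: real)"
  using in_Lp_scaleR[of q M f c] by simp

lemma in_Lp_uminus [intro]: "in_Lp q M f \<Longrightarrow> in_Lp q M (\<lambda>x. - f x)"
  unfolding in_Lp_def by auto

lemma in_Lp_diff [intro]:
  assumes "in_Lp q M f" "in_Lp q M g" "q \<ge> 0"
  shows "in_Lp q M (\<lambda>x. f x - g x)"
  using in_Lp_add[OF assms(1) in_Lp_uminus[OF assms(2)] assms(3)] by simp

lemma in_Lp_const [intro]: "finite_measure M \<Longrightarrow> in_Lp q M (\<lambda>x. c)"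
  unfolding in_Lp_def by (auto intro: finite_measure.integrable_const)

lemma in_Lp_bounded:
  assumes "finite_measure M" "f \<in> borel_measurable M" "\<And>x. x \<in> space M \<Longrightarrow> norm (f x) \<le> B" "q \<ge> 0"
  shows "in_Lp q M f"
proof (rule in_Lp_bound[OF in_Lp_const[OF assms(1), where c = B]])
  show "AE x in M. norm (f x) \<le> norm B" using assms(3) by (intro AE_I2) fastforce
qed (use assms in auto)

lemma in_Lp_imp_integrable:
  fixes f :: "'a \<Rightarrow> 'b::{banach, second_countable_topology}"
  assumes "finite_measure M" "in_Lp q M f" "q \<ge> 1"
  shows "integrable M f"
proof (rule Bochner_Integration.integrable_bound[where f="\<lambda>x. 1 + norm (f x) powr q"])
  show "integrable M (\<lambda>x. 1 + norm (f x) powr q)"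
    using assms by (auto intro: finite_measure.integrable_const in_Lp_integrable)
  have "t \<le> 1 + t powr q" if "t \<ge> 0" for t :: real
  proof (cases "t \<le> 1")
    case False
    then have "t powr 1 \<le> t powr q" using assms by (intro powr_mono) auto
    then show ?thesis using False by simp
  qed (simp add: add_increasing2)
  then show "AE x in M. norm (f x) \<le> norm (1 + norm (f x) powr q)" by (simp add: abs_of_nonneg)
qed (use assms in \<open>auto simp: in_Lp_def\<close>)

lemma Lnorm_nonneg [simp]: "Lnorm q M f \<ge> 0" by (simp add: Lnorm_def)

lemma Lnorm_powr: "q > 0 \<Longrightarrow> Lnorm q M f powr q = (\<integral>x. norm (f x) powr q \<partial>M)"
  by (simp add: Lnorm_def powr_powr integral_nonneg_AE)

lemma Lnorm_mono:
  fixes f :: "'a \<Rightarrow> 'b::{real_normed_vector, second_countable_topology}"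
    and g :: "'a \<Rightarrow> 'c::{real_normed_vector, second_countable_topology}"
  assumes "in_Lp q M f" "AE x in M. norm (g x) \<le> norm (f x)" "g \<in> borel_measurable M" "q \<ge> 0"
  shows "Lnorm q M g \<le> Lnorm q M f"
  unfolding Lnorm_def
proof (intro powr_mono2 integral_mono_AE)
  show "integrable M (\<lambda>x. norm (g x) powr q)" 
    using in_Lp_bound[OF assms(1,3,2,4)] by (simp add: in_Lp_def)
  show "AE x in M. norm (g x) powr q \<le> norm (f x) powr q"
    using assms(2) by eventually_elim (use assms(4) in \<open>auto intro!: powr_mono2\<close>)
qed (use assms in \<open>auto intro: in_Lp_integrable integral_nonneg_AE\<close>)

lemma Lnorm_cong_AE:
  assumes "f \<in> borel_measurable M" "g \<in> borel_measurable M" "AE x in M. norm (f x) = norm (g x)"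
  shows "Lnorm q M f = Lnorm q M g"
proof -
  have [measurable]: "f \<in> borel_measurable M" "g \<in> borel_measurable M" using assms by auto
  have "(\<integral>x. norm (f x) powr q \<partial>M) = (\<integral>x. norm (g x) powr q \<partial>M)"
    by (rule integral_cong_AE) (use assms(3) in auto)
  then show ?thesis by (simp add: Lnorm_def)
qed

lemma Lnorm_scaleR: "q > 0 \<Longrightarrow> Lnorm q M (\<lambda>x. c *\<^sub>R f x) = \<bar>c\<bar> * Lnorm q M f"
  by (simp add: Lnorm_def powr_mult integral_nonneg_AE powr_powr)

lemma Lnorm_minus [simp]: "Lnorm q M (\<lambda>x. - f x) = Lnorm q M f" by (simp add: Lnorm_def)

lemma Lnorm_norm [simp]: "Lnorm q M (\<lambda>x. norm (f x)) = Lnorm q M f" by (simp add: Lnorm_def)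

lemma Lnorm_eq_0_iff:
  assumes "in_Lp q M f" "q > 0"
  shows "Lnorm q M f = 0 \<longleftrightarrow> (AE x in M. f x = 0)"
proof -
  have "Lnorm q M f = 0 \<longleftrightarrow> (\<integral>x. norm (f x) powr q \<partial>M) = 0" using assms by (simp add: Lnorm_def)
  also have "\<dots> \<longleftrightarrow> (AE x in M. norm (f x) powr q = 0)"
    by (rule integral_nonneg_eq_0_iff_AE[OF in_Lp_integrable[OF assms(1)]]) auto
  finally show ?thesis by simp
qed

text \<open>Minkowski from convexity: \<open>(f + g) / (\<alpha> + \<beta>)\<close> is a convex
  combination of \<open>f / \<alpha>\<close> and \<open>g / \<beta>\<close>, whose
  \<open>q\<close>-th moments are at most 1.\<close>

lemma Lnorm_triangle_real:
  fixes f g :: "'a \<Rightarrow> real"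
  assumes f: "in_Lp q M f" and g: "in_Lp q M g" and q: "q > 1"
    and nn: "\<And>x. f x \<ge> 0" "\<And>x. g x \<ge> 0"
  shows "Lnorm q M (\<lambda>x. f x + g x) \<le> Lnorm q M f + Lnorm q M g"
proof (rule field_le_epsilon)
  fix e :: real assume e: "e > 0"
  have [measurable]: "f \<in> borel_measurable M" "g \<in> borel_measurable M" using f g by (auto simp: in_Lp_def)
  \<comment> \<open>The slack keeps both scales positive even when a norm vanishes.\<close>
  define \<alpha> \<beta> where "\<alpha> = Lnorm q M f + e / 2" and "\<beta> = Lnorm q M g + e / 2"
  have pos: "\<alpha> > 0" "\<beta> > 0" using e by (auto simp: \<alpha>_def \<beta>_def add_nonneg_pos)
  define t where "t = \<beta> / (\<alpha> + \<beta>)"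
  have t: "0 \<le> t" "t \<le> 1" "1 - t = \<alpha> / (\<alpha> + \<beta>)" using pos by (auto simp: t_def field_simps)
  have le1: "(\<integral>x. f x powr q \<partial>M) \<le> \<alpha> powr q"
    using Lnorm_powr[of q M f] powr_mono2[of q "Lnorm q M f" \<alpha>] q e nn by (auto simp: \<alpha>_def)
  have le2: "(\<integral>x. g x powr q \<partial>M) \<le> \<beta> powr q"
    using Lnorm_powr[of q M g] powr_mono2[of q "Lnorm q M g" \<beta>] q e nn by (auto simp: \<beta>_def)
  have pt: "(f x + g x) powr q \<le> (\<alpha> + \<beta>) powr q * ((1 - t) * (f x powr q / \<alpha> powr q) + t * (g x powr q / \<beta> powr q))" for x
  proof -
    have "(1 - t) *\<^sub>R (f x / \<alpha>) + t *\<^sub>R (g x / \<beta>) = (f x + g x) / (\<alpha> + \<beta>)"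
      using pos unfolding t(3) by (simp add: t_def add_divide_distrib)
    then have "((f x + g x) / (\<alpha> + \<beta>)) powr q \<le> (1 - t) * (f x / \<alpha>) powr q + t * (g x / \<beta>) powr q"
      using norm_powr_convex[OF q t(1,2), of "f x / \<alpha>" "g x / \<beta>"] nn[of x] pos by (simp add: abs_of_nonneg)
    then show ?thesis using pos nn[of x] by (simp add: powr_divide field_simps)
  qed
  have intf: "integrable M (\<lambda>x. f x powr q)" and intg: "integrable M (\<lambda>x. g x powr q)"
    using f g nn by (auto simp: in_Lp_def)
  have intfg: "integrable M (\<lambda>x. (f x + g x) powr q)" using in_Lp_add[OF f g] q nn by (auto simp: in_Lp_def)
  have "(\<integral>x. (f x + g x) powr q \<partial>M) \<le> (\<integral>x. (\<alpha> + \<beta>) powr q * ((1 - t) * (f x powr q / \<alpha> powr q) + t * (g x powr q / \<beta> powr q)) \<partial>M)"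
    by (intro integral_mono pt intfg) (use intf intg in auto)
  also have "\<dots> = (\<alpha> + \<beta>) powr q * ((1 - t) * ((\<integral>x. f x powr q \<partial>M) / \<alpha> powr q) + t * ((\<integral>x. g x powr q \<partial>M) / \<beta> powr q))"
    using intf intg by simp
  also have "\<dots> \<le> (\<alpha> + \<beta>) powr q * ((1 - t) * 1 + t * 1)"
    using le1 le2 pos t by (intro mult_left_mono add_mono) auto
  finally have "(\<integral>x. (f x + g x) powr q \<partial>M) \<le> (\<alpha> + \<beta>) powr q" by simp
  then have "Lnorm q M (\<lambda>x. f x + g x) \<le> ((\<alpha> + \<beta>) powr q) powr (1 / q)"
    unfolding Lnorm_def using nn q by (intro powr_mono2) (auto intro: integral_nonneg_AE)
  also have "\<dots> = \<alpha> + \<beta>" using pos q by (simp add: powr_powr)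
  finally show "Lnorm q M (\<lambda>x. f x + g x) \<le> Lnorm q M f + Lnorm q M g + e" by (simp add: \<alpha>_def \<beta>_def)
qed

lemma Lnorm_triangle:
  assumes f: "in_Lp q M f" and g: "in_Lp q M g" and q: "q > 1"
  shows "Lnorm q M (\<lambda>x. f x + g x) \<le> Lnorm q M f + Lnorm q M g"
proof -
  have [measurable]: "f \<in> borel_measurable M" "g \<in> borel_measurable M" using f g by (auto simp: in_Lp_def)
  have "Lnorm q M (\<lambda>x. f x + g x) \<le> Lnorm q M (\<lambda>x. norm (f x) + norm (g x))"
    using f g q by (intro Lnorm_mono in_Lp_add) (auto simp: norm_triangle_ineq)
  also have "\<dots> \<le> Lnorm q M (\<lambda>x. norm (f x)) + Lnorm q M (\<lambda>x. norm (g x))"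
    using f g q by (intro Lnorm_triangle_real) auto
  finally show ?thesis by simp
qed

lemma Lnorm_triangle_diff:
  assumes f: "in_Lp q M f" and g: "in_Lp q M g" and q: "q > 1"
  shows "Lnorm q M (\<lambda>x. f x - g x) \<le> Lnorm q M f + Lnorm q M g"
  using Lnorm_triangle[OF f in_Lp_uminus[OF g] q] by simp

text \<open>The three functions may take values in different spaces; typically \<open>h\<close> is
  plane-valued and \<open>f\<close>, \<open>g\<close> are its coordinates.\<close>

lemma Lnorm_le_add:
  fixes f :: "'a \<Rightarrow> 'b::{real_normed_vector, second_countable_topology}"
    and g :: "'a \<Rightarrow> 'c::{real_normed_vector, second_countable_topology}"
    and h :: "'a \<Rightarrow> 'd::{real_normed_vector, second_countable_topology}"
  assumes "in_Lp q M f" "in_Lp q M g" "q > 1" "h \<in> borel_measurable M"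
    "AE x in M. norm (h x) \<le> norm (f x) + norm (g x)"
  shows "Lnorm q M h \<le> Lnorm q M f + Lnorm q M g"
proof -
  have [measurable]: "f \<in> borel_measurable M" "g \<in> borel_measurable M" using assms by (auto simp: in_Lp_def)
  have "Lnorm q M h \<le> Lnorm q M (\<lambda>x. norm (f x) + norm (g x))"
    using assms by (intro Lnorm_mono in_Lp_add) auto
  also have "\<dots> \<le> Lnorm q M (\<lambda>x. norm (f x)) + Lnorm q M (\<lambda>x. norm (g x))"
    using assms by (intro Lnorm_triangle_real) auto
  finally show ?thesis by simp
qed

lemma Holder_integral:
  fixes f g :: "'a \<Rightarrow> real"
  assumes f: "in_Lp p M f" and g: "in_Lp q M g" and pq: "p > 1" "q > 1" "1 / p + 1 / q = 1"
  shows "integrable M (\<lambda>x. f x * g x)" "(\<integral>x. \<bar>f x * g x\<bar> \<partial>M) \<le> Lnorm p M f * Lnorm q M g"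
    "\<bar>\<integral>x. f x * g x \<partial>M\<bar> \<le> Lnorm p M f * Lnorm q M g"
proof -
  have [measurable]: "f \<in> borel_measurable M" "g \<in> borel_measurable M" using f g by (auto simp: in_Lp_def)
  have intf: "integrable M (\<lambda>x. \<bar>f x\<bar> powr p)" and intg: "integrable M (\<lambda>x. \<bar>g x\<bar> powr q)"
    using f g by (auto simp: in_Lp_def)
  have young: "\<bar>f x * g x\<bar> \<le> \<alpha> * \<beta> * (\<bar>f x\<bar> powr p / \<alpha> powr p / p + \<bar>g x\<bar> powr q / \<beta> powr q / q)"
    if "\<alpha> > 0" "\<beta> > 0" for x \<alpha> \<beta>
  proof -
    have "(\<bar>f x\<bar> / \<alpha>) * (\<bar>g x\<bar> / \<beta>) \<le> (\<bar>f x\<bar> / \<alpha>) powr p / p + (\<bar>g x\<bar> / \<beta>) powr q / q"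
      using pq that by (intro Youngs_inequality) auto
    then have "\<alpha> * \<beta> * ((\<bar>f x\<bar> / \<alpha>) * (\<bar>g x\<bar> / \<beta>)) \<le> \<alpha> * \<beta> * ((\<bar>f x\<bar> / \<alpha>) powr p / p + (\<bar>g x\<bar> / \<beta>) powr q / q)"
      using that by (intro mult_left_mono) auto
    then show ?thesis using that by (simp add: powr_divide abs_mult)
  qed
  show int: "integrable M (\<lambda>x. f x * g x)"
  proof (rule Bochner_Integration.integrable_bound)
    show "integrable M (\<lambda>x. \<bar>f x\<bar> powr p / p + \<bar>g x\<bar> powr q / q)" using intf intg by auto
    show "AE x in M. norm (f x * g x) \<le> norm (\<bar>f x\<bar> powr p / p + \<bar>g x\<bar> powr q / q)"
    proof (intro AE_I2)
      fix x
      have "\<bar>f x * g x\<bar> \<le> \<bar>f x\<bar> powr p / p + \<bar>g x\<bar> powr q / q" using young[of 1 1 x] by simp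
      then show "norm (f x * g x) \<le> norm (\<bar>f x\<bar> powr p / p + \<bar>g x\<bar> powr q / q)" by (simp only: real_norm_def)
    qed
  qed simp
  \<comment> \<open>Young's inequality after normalizing both factors. The slack \<open>e\<close>
    avoids a separate treatment of vanishing norms and is sent to 0 afterwards.\<close>
  have key: "(\<integral>x. \<bar>f x * g x\<bar> \<partial>M) \<le> (Lnorm p M f + e) * (Lnorm q M g + e)" if e: "e > 0" for e
  proof -
    define \<alpha> \<beta> where "\<alpha> = Lnorm p M f + e" and "\<beta> = Lnorm q M g + e"
    have pos: "\<alpha> > 0" "\<beta> > 0" using e by (auto simp: \<alpha>_def \<beta>_def add_nonneg_pos)
    have le1: "(\<integral>x. \<bar>f x\<bar> powr p \<partial>M) \<le> \<alpha> powr p"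
      using Lnorm_powr[of p M f] powr_mono2[of p "Lnorm p M f" \<alpha>] pq e by (auto simp: \<alpha>_def)
    have le2: "(\<integral>x. \<bar>g x\<bar> powr q \<partial>M) \<le> \<beta> powr q"
      using Lnorm_powr[of q M g] powr_mono2[of q "Lnorm q M g" \<beta>] pq e by (auto simp: \<beta>_def)
    have "(\<integral>x. \<bar>f x * g x\<bar> \<partial>M) \<le> (\<integral>x. \<alpha> * \<beta> * (\<bar>f x\<bar> powr p / \<alpha> powr p / p + \<bar>g x\<bar> powr q / \<beta> powr q / q) \<partial>M)"
      by (intro integral_mono young pos) (use int intf intg in auto)
    also have "\<dots> = \<alpha> * \<beta> * ((\<integral>x. \<bar>f x\<bar> powr p \<partial>M) / \<alpha> powr p / p + (\<integral>x. \<bar>g x\<bar> powr q \<partial>M) / \<beta> powr q / q)"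
      using intf intg by simp
    also have "\<dots> \<le> \<alpha> * \<beta> * (1 / p + 1 / q)"
      using pos pq le1 le2 by (intro mult_left_mono add_mono divide_right_mono) auto
    finally show ?thesis using pq by (simp add: \<alpha>_def \<beta>_def)
  qed
  have "((\<lambda>e. (Lnorm p M f + e) * (Lnorm q M g + e)) \<longlongrightarrow> (Lnorm p M f + 0) * (Lnorm q M g + 0)) (at_right 0)"
    by (intro tendsto_intros)
  moreover have "\<forall>\<^sub>F e in at_right 0. (\<integral>x. \<bar>f x * g x\<bar> \<partial>M) \<le> (Lnorm p M f + e) * (Lnorm q M g + e)"
    using key by (auto simp: eventually_at_right_field intro: exI[of _ 1])
  ultimately show 2: "(\<integral>x. \<bar>f x * g x\<bar> \<partial>M) \<le> Lnorm p M f * Lnorm q M g"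
    using tendsto_lowerbound by fastforce
  have "\<bar>\<integral>x. f x * g x \<partial>M\<bar> \<le> (\<integral>x. \<bar>f x * g x\<bar> \<partial>M)" using integral_abs_bound by blast
  then show "\<bar>\<integral>x. f x * g x \<partial>M\<bar> \<le> Lnorm p M f * Lnorm q M g" using 2 by linarith
qed

lemma Holder_inner:
  fixes f g :: "'a \<Rightarrow> 'b::euclidean_space"
  assumes f: "in_Lp p M f" and g: "in_Lp q M g" and pq: "p > 1" "q > 1" "1 / p + 1 / q = 1"
  shows "integrable M (\<lambda>x. f x \<bullet> g x)" "\<bar>\<integral>x. f x \<bullet> g x \<partial>M\<bar> \<le> Lnorm p M f * Lnorm q M g"
proof -
  have [measurable]: "f \<in> borel_measurable M" "g \<in> borel_measurable M" using f g by (auto simp: in_Lp_def)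
  have H: "integrable M (\<lambda>x. norm (f x) * norm (g x))" 
      "(\<integral>x. \<bar>norm (f x) * norm (g x)\<bar> \<partial>M) \<le> Lnorm p M (\<lambda>x. norm (f x)) * Lnorm q M (\<lambda>x. norm (g x))"
    using Holder_integral[of p M "\<lambda>x. norm (f x)" q "\<lambda>x. norm (g x)"] f g pq by auto
  show int: "integrable M (\<lambda>x. f x \<bullet> g x)"
    by (rule Bochner_Integration.integrable_bound[OF H(1)]) (auto simp: Cauchy_Schwarz_ineq2)
  have "\<bar>\<integral>x. f x \<bullet> g x \<partial>M\<bar> \<le> (\<integral>x. \<bar>f x \<bullet> g x\<bar> \<partial>M)" using integral_abs_bound by blast
  also have "\<dots> \<le> (\<integral>x. \<bar>norm (f x) * norm (g x)\<bar> \<partial>M)"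
    using int H(1) by (intro integral_mono) (auto simp: Cauchy_Schwarz_ineq2)
  finally show "\<bar>\<integral>x. f x \<bullet> g x \<partial>M\<bar> \<le> Lnorm p M f * Lnorm q M g" using H(2) by simp
qed

lemma Lnorm_tendsto_0:
  fixes f :: "nat \<Rightarrow> 'a \<Rightarrow> 'b::{real_normed_vector, second_countable_topology}"
  assumes "\<And>n. f n \<in> borel_measurable M" "in_Lp q M w" "\<And>n x. x \<in> space M \<Longrightarrow> norm (f n x) \<le> norm (w x)"
    "AE x in M. (\<lambda>n. f n x) \<longlonglongrightarrow> 0" "q > 0"
  shows "(\<lambda>n. Lnorm q M (f n)) \<longlonglongrightarrow> 0"
proof -
  have [measurable]: "f n \<in> borel_measurable M" for n by fact
  have "(\<lambda>n. \<integral>x. norm (f n x) powr q \<partial>M) \<longlonglongrightarrow> (\<integral>x. 0 \<partial>M)"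
  proof (rule integral_dominated_convergence[where w="\<lambda>x. norm (w x) powr q"])
    show "AE x in M. (\<lambda>n. norm (f n x) powr q) \<longlonglongrightarrow> 0"
      using assms(4)
    proof eventually_elim
      case (elim x)
      then have "(\<lambda>n. norm (f n x)) \<longlonglongrightarrow> 0" by (simp add: tendsto_norm_zero)
      then have "(\<lambda>n. norm (f n x) powr q) \<longlonglongrightarrow> 0 powr q"
        using assms(5) by (intro tendsto_powr2) auto
      then show ?case using assms(5) by simp
    qed
    show "integrable M (\<lambda>x. norm (w x) powr q)" using assms(2) by (rule in_Lp_integrable)
    show "AE x in M. norm (norm (f n x) powr q) \<le> norm (w x) powr q" for n
      using assms(5) by (intro AE_I2) (auto intro!: powr_mono2 assms(3))
  qed auto
  then have "(\<lambda>n. (\<integral>x. norm (f n x) powr q \<partial>M) powr (1 / q)) \<longlonglongrightarrow> 0 powr (1 / q)"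
    using assms(5) by (intro tendsto_powr2) (auto intro: integral_nonneg_AE)
  then show ?thesis using assms(5) by (simp add: Lnorm_def)
qed

section \<open>Density of continuous functions with bounded support\<close>

text \<open>Induction over integrable functions. For an indicator, inner regularity replaces the set
  by a compact subset \<open>K\<close>, and steep tents over \<open>K\<close> converge to the
  indicator of \<open>K\<close>.\<close>

lemma L1_density_continuous:
  fixes f :: "real \<Rightarrow> real"
  assumes "finite_measure M" and sets: "sets M = sets borel" and f: "integrable M f" and e: "e > 0"
  shows "\<exists>\<phi>. continuous_on UNIV \<phi> \<and> (\<exists>R. \<forall>x. R < \<bar>x\<bar> \<longrightarrow> \<phi> x = 0) \<and> integrable M \<phi> \<and> (\<integral>x. \<bar>f x - \<phi> x\<bar> \<partial>M) < e"
proof -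
  interpret finite_measure M by fact
  note [measurable_cong] = sets
  have space: "space M = UNIV" using sets_eq_imp_space_eq[OF sets] by simp
  define CC :: "(real \<Rightarrow> real) set" where "CC = {\<phi>. continuous_on UNIV \<phi> \<and> (\<exists>R. \<forall>x. R < \<bar>x\<bar> \<longrightarrow> \<phi> x = 0)}"
  have CCint: "integrable M \<phi>" if phi: "\<phi> \<in> CC" for \<phi>
  proof -
    obtain R where c: "continuous_on UNIV \<phi>" and R: "\<And>x. R < \<bar>x\<bar> \<Longrightarrow> \<phi> x = 0" using phi unfolding CC_def by blast
    have "compact (\<phi> ` cball 0 R)" by (intro compact_continuous_image continuous_on_subset[OF c]) auto
    then obtain B where B: "\<And>x. x \<in> cball 0 R \<Longrightarrow> norm (\<phi> x) \<le> B" by (metis bounded_iff compact_imp_bounded imageI)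
    have "norm (\<phi> x) \<le> max B 0" for x using B[of x] R[of x] by (cases "\<bar>x\<bar> \<le> R") (auto simp: max_def)
    then show ?thesis by (intro integrable_const_bound[where B="max B 0"]) (use borel_measurable_continuous_onI[OF c] in auto)
  qed
  have "\<forall>e>0. \<exists>\<phi>\<in>CC. (\<integral>x. \<bar>f x - \<phi> x\<bar> \<partial>M) < e"
    using f
  proof (induct rule: integrable_induct)
    case (base A c)
    show ?case
    proof (intro allI impI)
      fix e :: real assume e: "e > 0"
      define e' where "e' = e / (2 * (\<bar>c\<bar> + 1))"
      have e': "e' > 0" using e by (auto simp: e'_def)
      have A: "A \<in> sets borel" using base sets by simp
      have inner: "emeasure M A = (SUP K\<in>{K. K \<subseteq> A \<and> compact K}. emeasure M K)"
        by (rule inner_regular[OF sets _ A]) simp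
      have "\<exists>K. K \<subseteq> A \<and> compact K \<and> measure M A - e' < measure M K"
      proof (rule ccontr)
        assume "\<not> ?thesis"
        then have le: "\<And>K. K \<subseteq> A \<Longrightarrow> compact K \<Longrightarrow> measure M K \<le> measure M A - e'" by (meson linorder_not_le)
        have 0: "0 \<le> measure M A - e'" using le[of "{}"] by simp
        have "emeasure M A \<le> ennreal (measure M A - e')"
          unfolding inner by (rule SUP_least) (auto simp: emeasure_eq_measure intro!: ennreal_leI le)
        then show False using e' 0 by (simp add: emeasure_eq_measure)
      qed
      then obtain K where K: "K \<subseteq> A" "compact K" "measure M A - e' < measure M K" by auto
      have Ks[measurable]: "K \<in> sets borel" using K by (simp add: borel_compact)
      show "\<exists>\<phi>\<in>CC. (\<integral>x. \<bar>indicat_real A x *\<^sub>R c - \<phi> x\<bar> \<partial>M) < e"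
      \<comment> \<open>The distance to the empty set is 0 by convention, so the tents below would
        be constantly 1 in this case; the zero function approximates instead.\<close>
      proof (cases "K = {}")
        case True
        have zero: "(\<lambda>x. 0) \<in> CC" by (auto simp: CC_def)
        have val: "(\<integral>x. \<bar>indicat_real A x *\<^sub>R c - 0\<bar> \<partial>M) = measure M A * \<bar>c\<bar>"
          using A by (simp add: abs_mult space)
        have "measure M A * \<bar>c\<bar> < e"
        proof -
          have "measure M A * \<bar>c\<bar> \<le> e' * (\<bar>c\<bar> + 1)" using K True e' by (intro mult_mono) auto
          also have "e' * (\<bar>c\<bar> + 1) = e / 2" by (simp add: e'_def field_simps)
          finally show ?thesis using e by linarith
        qed
        then show ?thesis unfolding val[symmetric] using zero by (rule bexI)
      next
        case False
        \<comment> \<open>The slope is at least 1, so every tent vanishes at distance 1 from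
          \<open>K\<close>. Closedness of \<open>K\<close> makes the tents converge to 0 off
          \<open>K\<close>.\<close>
        define \<psi> where "\<psi> n x = max 0 (1 - real (Suc n) * infdist x K)" for n x
        obtain B where B: "\<And>x. x \<in> K \<Longrightarrow> \<bar>x\<bar> \<le> B" using K(2) by (metis bounded_iff compact_imp_bounded real_norm_def)
        have psi_CC: "(\<lambda>x. c * \<psi> n x) \<in> CC" for n
          unfolding CC_def
        proof (intro CollectI conjI exI[of _ "B + 1"] allI impI)
          show "continuous_on UNIV (\<lambda>x. c * \<psi> n x)" unfolding \<psi>_def by (intro continuous_intros)
          fix x assume x: "B + 1 < \<bar>x\<bar>"
          obtain y where y: "y \<in> K" "infdist x K = dist x y" using infdist_attains_inf[of K x] K(2) False by (auto intro: compact_imp_closed)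
          have "infdist x K > 1" using x B[OF y(1)] by (auto simp: y(2) dist_real_def)
          then have "real (Suc n) * infdist x K \<ge> 1 * 1" by (intro mult_mono) auto
          then show "c * \<psi> n x = 0" by (simp add: \<psi>_def)
        qed
        have lim: "(\<lambda>n. \<integral>x. \<bar>indicat_real K x - \<psi> n x\<bar> \<partial>M) \<longlonglongrightarrow> (\<integral>x. 0 \<partial>M)"
        proof (rule integral_dominated_convergence[where w="\<lambda>x. 1"])
          show "(\<lambda>x. \<bar>indicat_real K x - \<psi> n x\<bar>) \<in> borel_measurable M" for n unfolding \<psi>_def 
            using borel_measurable_continuous_onI[OF continuous_on_infdist[OF continuous_on_id, of UNIV K]] by measurable
          have pp: "0 \<le> \<psi> n x \<and> \<psi> n x \<le> 1" for n x by (auto simp: \<psi>_def infdist_nonneg)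
          show "AE x in M. norm \<bar>indicat_real K x - \<psi> n x\<bar> \<le> 1" for n
          proof (intro AE_I2)
            fix x show "norm \<bar>indicat_real K x - \<psi> n x\<bar> \<le> 1" using pp[of n x] by (cases "x \<in> K") auto
          qed
          show "AE x in M. (\<lambda>n. \<bar>indicat_real K x - \<psi> n x\<bar>) \<longlonglongrightarrow> 0"
          proof (intro AE_I2)
            fix x
            show "(\<lambda>n. \<bar>indicat_real K x - \<psi> n x\<bar>) \<longlonglongrightarrow> 0"
            proof (cases "x \<in> K")
              case True then show ?thesis by (simp add: \<psi>_def)
            next
              case xK: False
              then have d: "infdist x K > 0" using in_closed_iff_infdist_zero[of K x] K(2) False 
                by (metis compact_imp_closed infdist_nonneg less_eq_real_def)
              obtain N where N: "1 / infdist x K < real N" using reals_Archimedean2 by blast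
              have "\<bar>indicat_real K x - \<psi> n x\<bar> = 0" if "n \<ge> N" for n
              proof -
                have "1 < real N * infdist x K" using N d by (simp add: field_simps)
                also have "\<dots> \<le> real (Suc n) * infdist x K" using that d by (intro mult_right_mono) auto
                finally show ?thesis using xK by (simp add: \<psi>_def)
              qed
              then show ?thesis by (intro tendsto_eventually) (auto simp: eventually_sequentially)
            qed
          qed
        qed auto
        then have "(\<lambda>n. \<integral>x. \<bar>indicat_real K x - \<psi> n x\<bar> \<partial>M) \<longlonglongrightarrow> 0" by simp
        then have "\<forall>\<^sub>F n in sequentially. (\<integral>x. \<bar>indicat_real K x - \<psi> n x\<bar> \<partial>M) < e'" using e' by (rule order_tendstoD)
        then obtain n where n: "(\<integral>x. \<bar>indicat_real K x - \<psi> n x\<bar> \<partial>M) < e'" by (auto simp: eventually_sequentially)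
        have [measurable]: "\<psi> n \<in> borel_measurable borel" unfolding \<psi>_def 
            using borel_measurable_continuous_onI[OF continuous_on_infdist[OF continuous_on_id, of UNIV K]] by measurable
        have pp: "0 \<le> \<psi> n x \<and> \<psi> n x \<le> 1" for x by (auto simp: \<psi>_def infdist_nonneg)
        have int1: "integrable M (\<lambda>x. \<bar>indicat_real K x - \<psi> n x\<bar>)"
        proof (intro integrable_const_bound[where B=1] AE_I2)
          fix x show "norm \<bar>indicat_real K x - \<psi> n x\<bar> \<le> 1" using pp[of x] by (cases "x \<in> K") auto
        qed simp
        have int2: "integrable M (\<lambda>x. indicat_real (A - K) x)" using A by (intro integrable_const_bound[where B=1]) auto
        have int3: "integrable M (\<lambda>x. \<bar>indicat_real A x *\<^sub>R c - c * \<psi> n x\<bar>)"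
        proof (intro integrable_const_bound[where B="\<bar>c\<bar>"] AE_I2)
          fix x
          have "\<bar>indicat_real A x - \<psi> n x\<bar> \<le> 1" using pp[of x] by (cases "x \<in> A") auto
          then have "\<bar>c\<bar> * \<bar>indicat_real A x - \<psi> n x\<bar> \<le> \<bar>c\<bar> * 1" by (intro mult_left_mono) auto
          moreover have "\<bar>indicat_real A x *\<^sub>R c - c * \<psi> n x\<bar> = \<bar>c\<bar> * \<bar>indicat_real A x - \<psi> n x\<bar>"
            by (simp add: abs_mult[symmetric] algebra_simps)
          ultimately show "norm \<bar>indicat_real A x *\<^sub>R c - c * \<psi> n x\<bar> \<le> \<bar>c\<bar>" by simp
        qed (use A in simp)
        have "(\<integral>x. \<bar>indicat_real A x *\<^sub>R c - c * \<psi> n x\<bar> \<partial>M) \<le> (\<integral>x. \<bar>c\<bar> * (indicat_real (A - K) x + \<bar>indicat_real K x - \<psi> n x\<bar>) \<partial>M)"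
        proof (rule integral_mono[OF int3])
          fix x
          have "\<bar>indicat_real A x *\<^sub>R c - c * \<psi> n x\<bar> = \<bar>c\<bar> * \<bar>indicat_real A x - \<psi> n x\<bar>"
            by (simp add: abs_mult[symmetric] algebra_simps)
          also have "\<dots> \<le> \<bar>c\<bar> * (indicat_real (A - K) x + \<bar>indicat_real K x - \<psi> n x\<bar>)"
            using K(1) by (intro mult_left_mono) (auto simp: indicator_def)
          finally show "\<bar>indicat_real A x *\<^sub>R c - c * \<psi> n x\<bar> \<le> \<bar>c\<bar> * (indicat_real (A - K) x + \<bar>indicat_real K x - \<psi> n x\<bar>)" .
        qed (use int1 int2 in auto)
        also have "\<dots> = \<bar>c\<bar> * (measure M (A - K) + (\<integral>x. \<bar>indicat_real K x - \<psi> n x\<bar> \<partial>M))"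
          using int1 int2 A by (simp add: space)
        also have "\<dots> \<le> \<bar>c\<bar> * (e' + e')"
          using n K finite_measure_Diff[of A K] A by (intro mult_left_mono add_mono) (auto simp: sets)
        also have "\<dots> < (\<bar>c\<bar> + 1) * (e' + e')" using e' by simp
        also have "\<dots> = e"
        proof -
          have "e' + e' = e / (\<bar>c\<bar> + 1)" unfolding e'_def by (metis add_divide_distrib divide_divide_eq_left' field_sum_of_halves mult.commute)
          moreover have "\<bar>c\<bar> + 1 \<noteq> 0" using abs_ge_zero[of c] by linarith
          ultimately show ?thesis by simp
        qed
        finally show ?thesis using psi_CC[of n] by (rule bexI)
      qed
    qed
  next
    case (add f g)
    show ?case
    proof (intro allI impI)
      fix e :: real assume e: "e > 0"
      obtain \<phi> \<psi> where p: "\<phi> \<in> CC" "(\<integral>x. \<bar>f x - \<phi> x\<bar> \<partial>M) < e / 2" "\<psi> \<in> CC" "(\<integral>x. \<bar>g x - \<psi> x\<bar> \<partial>M) < e / 2"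
        using add(2)[rule_format, of "e / 2"] add(4)[rule_format, of "e / 2"] e by auto
      obtain R R' where R: "\<And>x. R < \<bar>x\<bar> \<Longrightarrow> \<phi> x = 0" "\<And>x. R' < \<bar>x\<bar> \<Longrightarrow> \<psi> x = 0" using p unfolding CC_def by blast
      have cc: "(\<lambda>x. \<phi> x + \<psi> x) \<in> CC" using p R by (auto simp: CC_def intro!: continuous_intros exI[of _ "max R R'"])
      have "(\<integral>x. \<bar>f x + g x - (\<phi> x + \<psi> x)\<bar> \<partial>M) \<le> (\<integral>x. \<bar>f x - \<phi> x\<bar> + \<bar>g x - \<psi> x\<bar> \<partial>M)"
        using add CCint[OF p(1)] CCint[OF p(3)] by (intro integral_mono) auto
      also have "\<dots> < e" using add CCint[OF p(1)] CCint[OF p(3)] p by simp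
      finally show "\<exists>\<phi>\<in>CC. (\<integral>x. \<bar>f x + g x - \<phi> x\<bar> \<partial>M) < e" using cc by (rule bexI)
    qed
  next
    case (lim f s)
    show ?case
    proof (intro allI impI)
      fix e :: real assume e: "e > 0"
      have [measurable]: "s i \<in> borel_measurable M" "f \<in> borel_measurable M" for i using lim by auto
      have "(\<lambda>i. \<integral>x. \<bar>f x - s i x\<bar> \<partial>M) \<longlonglongrightarrow> (\<integral>x. 0 \<partial>M)"
      \<comment> \<open>The induction rule provides approximants bounded by twice the norm of
        \<open>f\<close>.\<close>
      proof (rule integral_dominated_convergence[where w="\<lambda>x. 3 * norm (f x)"])
        show "AE x in M. (\<lambda>i. \<bar>f x - s i x\<bar>) \<longlonglongrightarrow> 0"
        proof (intro AE_I2)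
          fix x assume "x \<in> space M"
          then have "(\<lambda>i. s i x) \<longlonglongrightarrow> f x" using lim by auto
          from tendsto_rabs[OF tendsto_diff[OF tendsto_const[of "f x"] this]]
          show "(\<lambda>i. \<bar>f x - s i x\<bar>) \<longlonglongrightarrow> 0" by simp
        qed
        show "AE x in M. norm \<bar>f x - s i x\<bar> \<le> 3 * norm (f x)" for i
          using lim(4)[of _ i] by (intro AE_I2) (auto simp: abs_le_iff, smt+)
      qed (use lim in auto)
      then have "(\<lambda>i. \<integral>x. \<bar>f x - s i x\<bar> \<partial>M) \<longlonglongrightarrow> 0" by simp
      then have "\<forall>\<^sub>F i in sequentially. (\<integral>x. \<bar>f x - s i x\<bar> \<partial>M) < e / 2" using e by (intro order_tendstoD) auto
      then obtain i where i: "(\<integral>x. \<bar>f x - s i x\<bar> \<partial>M) < e / 2" by (auto simp: eventually_sequentially)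
      obtain \<phi> where p: "\<phi> \<in> CC" "(\<integral>x. \<bar>s i x - \<phi> x\<bar> \<partial>M) < e / 2" using lim(2)[of i, rule_format, of "e / 2"] e by auto
      have "(\<integral>x. \<bar>f x - \<phi> x\<bar> \<partial>M) \<le> (\<integral>x. \<bar>f x - s i x\<bar> + \<bar>s i x - \<phi> x\<bar> \<partial>M)"
        using lim CCint[OF p(1)] by (intro integral_mono) auto
      also have "\<dots> < e" using lim CCint[OF p(1)] p i by simp
      finally show "\<exists>\<phi>\<in>CC. (\<integral>x. \<bar>f x - \<phi> x\<bar> \<partial>M) < e" using p(1) by (rule bexI)
    qed
  qed
  then obtain \<phi> where "\<phi> \<in> CC" "(\<integral>x. \<bar>f x - \<phi> x\<bar> \<partial>M) < e" using e by blast
  then show ?thesis using CCint[of \<phi>] by (auto simp: CC_def)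
qed

text \<open>After truncation at level \<open>n\<close> all differences are bounded by
  \<open>2 * n\<close>, so that the \<open>q\<close>-th moment of a difference is at most a constant
  times its \<open>L\<^sup>1\<close> norm, and the previous lemma applies.\<close>

lemma Lp_density_continuous:
  fixes f :: "real \<Rightarrow> real"
  assumes fin: "finite_measure M" and sets: "sets M = sets borel" and f: "in_Lp q M f" and q: "q > 1" and e: "e > 0"
  shows "\<exists>\<phi>. continuous_on UNIV \<phi> \<and> (\<exists>R. \<forall>x. R < \<bar>x\<bar> \<longrightarrow> \<phi> x = 0) \<and> in_Lp q M \<phi> \<and> Lnorm q M (\<lambda>x. f x - \<phi> x) < e"
proof -
  interpret finite_measure M by fact
  note [measurable_cong] = sets
  have [measurable]: "f \<in> borel_measurable borel" using f by (auto simp: in_Lp_def)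
  define F where "F n x = max (- real n) (min (real n) (f x))" for n x
  have [measurable]: "F n \<in> borel_measurable borel" for n unfolding F_def by measurable
  have "(\<lambda>n. Lnorm q M (\<lambda>x. f x - F n x)) \<longlonglongrightarrow> 0"
  proof (rule Lnorm_tendsto_0[OF _ f])
    show "AE x in M. (\<lambda>n. f x - F n x) \<longlonglongrightarrow> 0"
    proof (intro AE_I2)
      fix x
      obtain N where "\<bar>f x\<bar> \<le> real N" using real_arch_simple by blast
      then have "f x - F n x = 0" if "n \<ge> N" for n using that by (auto simp: F_def)
      then show "(\<lambda>n. f x - F n x) \<longlonglongrightarrow> 0" by (intro tendsto_eventually) (auto simp: eventually_sequentially)
    qed
  qed (use q in \<open>auto simp: F_def\<close>)
  then have "\<forall>\<^sub>F n in sequentially. Lnorm q M (\<lambda>x. f x - F n x) < e / 2" using e by (intro order_tendstoD) auto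
  then obtain n where n: "Lnorm q M (\<lambda>x. f x - F n x) < e / 2" by (auto simp: eventually_sequentially)
  have Fb: "\<bar>F n x\<bar> \<le> real n" for x by (auto simp: F_def)
  have FL: "in_Lp q M (F n)" by (rule in_Lp_bounded[OF fin, where B="real n"]) (use Fb q in auto)
  \<comment> \<open>Solves \<open>(2 * real n + 1) powr (q - 1) * d = (e / 2) powr q\<close>. The
    added 1 keeps the base positive for \<open>n = 0\<close>.\<close>
  define d where "d = (e / 2) powr q / (2 * real n + 1) powr (q - 1)"
  have d: "d > 0" using e by (auto simp: d_def)
  obtain \<psi> R where psi: "continuous_on UNIV \<psi>" "\<And>x. R < \<bar>x\<bar> \<Longrightarrow> \<psi> x = 0" "integrable M \<psi>" "(\<integral>x. \<bar>F n x - \<psi> x\<bar> \<partial>M) < d"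
    using L1_density_continuous[OF fin sets in_Lp_imp_integrable[OF fin FL] d] q by auto
  \<comment> \<open>Clipping fixes the values of \<open>F n\<close> and does not increase distances,
    so the approximation gets no worse; zeros are preserved, hence the support stays
    bounded.\<close>
  define \<phi> where "\<phi> x = max (- real n) (min (real n) (\<psi> x))" for x
  have c: "continuous_on UNIV \<phi>" unfolding \<phi>_def using psi(1) by (intro continuous_intros)
  have [measurable]: "\<phi> \<in> borel_measurable borel" using c by (rule borel_measurable_continuous_onI)
  have phib: "\<bar>\<phi> x\<bar> \<le> real n" for x by (auto simp: \<phi>_def)
  have phiL: "in_Lp q M \<phi>" by (rule in_Lp_bounded[OF fin, where B="real n"]) (use phib q in auto)
  have supp: "\<And>x. R < \<bar>x\<bar> \<Longrightarrow> \<phi> x = 0" using psi(2) by (auto simp: \<phi>_def)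
  have int: "integrable M (F n)" using in_Lp_imp_integrable[OF fin FL] q by auto
  have "(\<integral>x. norm (F n x - \<phi> x) powr q \<partial>M) \<le> (\<integral>x. (2 * real n + 1) powr (q - 1) * \<bar>F n x - \<psi> x\<bar> \<partial>M)"
  proof (rule integral_mono)
    show "integrable M (\<lambda>x. norm (F n x - \<phi> x) powr q)" using in_Lp_diff[OF FL phiL] q by (auto simp: in_Lp_def)
    show "integrable M (\<lambda>x. (2 * real n + 1) powr (q - 1) * \<bar>F n x - \<psi> x\<bar>)" using int psi(3) by auto
    fix x
    have "norm (F n x - \<phi> x) powr q = norm (F n x - \<phi> x) powr (q - 1) * norm (F n x - \<phi> x)"
      by (cases "F n x = \<phi> x") (auto simp: powr_diff)
    also have "\<dots> \<le> (2 * real n + 1) powr (q - 1) * \<bar>F n x - \<psi> x\<bar>"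
    proof (rule mult_mono)
      show "norm (F n x - \<phi> x) powr (q - 1) \<le> (2 * real n + 1) powr (q - 1)"
        using Fb[of x] phib[of x] q by (intro powr_mono2) auto
      show "norm (F n x - \<phi> x) \<le> \<bar>F n x - \<psi> x\<bar>" using Fb[of x] by (auto simp: \<phi>_def)
    qed auto
    finally show "norm (F n x - \<phi> x) powr q \<le> (2 * real n + 1) powr (q - 1) * \<bar>F n x - \<psi> x\<bar>" .
  qed
  also have "\<dots> = (2 * real n + 1) powr (q - 1) * (\<integral>x. \<bar>F n x - \<psi> x\<bar> \<partial>M)" by simp
  also have "\<dots> \<le> (2 * real n + 1) powr (q - 1) * d" using psi(4) by (intro mult_left_mono) auto
  also have "\<dots> = (e / 2) powr q" by (simp add: d_def)
  finally have "Lnorm q M (\<lambda>x. F n x - \<phi> x) \<le> ((e / 2) powr q) powr (1 / q)"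
    unfolding Lnorm_def using q by (intro powr_mono2) (auto intro: integral_nonneg_AE)
  then have "Lnorm q M (\<lambda>x. F n x - \<phi> x) \<le> e / 2" using q e by (simp add: powr_powr)
  moreover have "Lnorm q M (\<lambda>x. (f x - F n x) + (F n x - \<phi> x)) \<le> Lnorm q M (\<lambda>x. f x - F n x) + Lnorm q M (\<lambda>x. F n x - \<phi> x)"
    using f FL phiL q by (intro Lnorm_triangle in_Lp_diff) auto
  ultimately have "Lnorm q M (\<lambda>x. f x - \<phi> x) < e" using n by simp
  then show ?thesis using c supp phiL by blast
qed

section \<open>Conditional expectations given a coordinate\<close>

locale borel_prob = prob_space \<mu> for \<mu> :: "'a::topological_space measure" +
  assumes sets_eq [measurable_cong]: "sets \<mu> = sets borel"
begin

lemma space_eq [simp]: "space \<mu> = UNIV" using sets_eq_imp_space_eq[OF sets_eq] by simp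

lemma prob_UNIV [simp]: "measure \<mu> UNIV = 1" using prob_space by simp

end

locale plane_prob = borel_prob \<mu> for \<mu> :: "plane measure"

lemma borel_measurable_fst_plane [measurable]: "(fst :: plane \<Rightarrow> real) \<in> borel_measurable borel"
  by (intro borel_measurable_continuous_onI continuous_intros)

lemma borel_measurable_snd_plane [measurable]: "(snd :: plane \<Rightarrow> real) \<in> borel_measurable borel"
  by (intro borel_measurable_continuous_onI continuous_intros)

text \<open>The right inverse \<open>e\<close> gives an explicit factorization through
  \<open>X\<close>, valid everywhere and not only almost surely. The locale serves both coordinates
  of the plane and the first coordinate of the first point of a pair.\<close>

locale coord = borel_prob \<mu> for \<mu> :: "'a::topological_space measure" +
  fixes X :: "'a \<Rightarrow> real" and e :: "real \<Rightarrow> 'a"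
  assumes X_meas [measurable]: "X \<in> borel_measurable borel"
    and e_meas [measurable]: "e \<in> borel_measurable borel"
    and X_e [simp]: "X (e t) = t"
begin

abbreviation F :: "'a measure" where "F \<equiv> vimage_algebra UNIV X borel"

abbreviation \<nu> :: "real measure" where "\<nu> \<equiv> distr \<mu> borel X"

sublocale ce: finite_measure_subalgebra \<mu> F
proof (unfold_locales)
  have "X -` A \<in> sets \<mu>" if "A \<in> sets borel" for A
    using measurable_sets_borel[OF X_meas that] by (simp add: sets_eq)
  then show "subalgebra \<mu> F" by (auto simp: subalgebra_def sets_vimage_algebra2)
qed

lemma cexp_eq: "cexp \<mu> X h = real_cond_exp \<mu> F h" by (simp add: cexp_def)

text \<open>A level set of \<open>f\<close> is a preimage under \<open>X\<close>, and the points
  \<open>x\<close> and \<open>e (X x)\<close> have the same value of \<open>X\<close>.\<close>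

lemma F_factor:
  fixes f :: "'a \<Rightarrow> real"
  assumes "f \<in> borel_measurable F"
  shows "f x = f (e (X x))"
proof -
  have "f -` {f x} \<inter> space F \<in> sets F" using assms by (intro measurable_sets) auto
  then obtain A where A: "f -` {f x} = X -` A" by (auto simp: sets_vimage_algebra2)
  have "x \<in> X -` A" using A by auto
  then have "e (X x) \<in> X -` A" by simp
  then have "e (X x) \<in> f -` {f x}" by (simp only: A)
  then show ?thesis by simp
qed

lemma measurable_F_comp: "\<phi> \<in> borel_measurable borel \<Longrightarrow> (\<lambda>x. \<phi> (X x) :: real) \<in> borel_measurable F"
  using measurable_compose[OF measurable_vimage_algebra1[of X UNIV borel]] by auto

text \<open>A version of the conditional expectation of \<open>h\<close> given \<open>X = t\<close>,
  as a function on the line.\<close>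

definition ce :: "('a \<Rightarrow> real) \<Rightarrow> real \<Rightarrow> real" where "ce h t = cexp \<mu> X h (e t)"

lemma cexp_meas_F: "cexp \<mu> X h \<in> borel_measurable F" by (simp add: cexp_eq)

lemma cexp_meas [measurable]: "cexp \<mu> X h \<in> borel_measurable borel"
  using measurable_from_subalg[OF ce.subalg cexp_meas_F, of h] by (simp cong: measurable_cong_sets add: sets_eq)

lemma ce_meas [measurable]: "ce h \<in> borel_measurable borel" unfolding ce_def by measurable

lemma cexp_factor: "cexp \<mu> X h x = ce h (X x)"
  unfolding ce_def by (rule F_factor[OF cexp_meas_F])

lemma cexp_integral:
  assumes "integrable \<mu> (\<lambda>x. \<phi> (X x) * h x)" "\<phi> \<in> borel_measurable borel" "h \<in> borel_measurable borel"
  shows "integrable \<mu> (\<lambda>x. \<phi> (X x) * cexp \<mu> X h x)"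
    "(\<integral>x. \<phi> (X x) * cexp \<mu> X h x \<partial>\<mu>) = (\<integral>x. \<phi> (X x) * h x \<partial>\<mu>)"
  using ce.real_cond_exp_intg[OF assms(1) measurable_F_comp[OF assms(2)]] assms(3)
  by (auto simp: cexp_eq cong: measurable_cong_sets simp: sets_eq)

lemma cexp_char:
  assumes h: "integrable \<mu> h" and \<psi>: "integrable \<mu> (\<lambda>x. \<psi> (X x))" "\<psi> \<in> borel_measurable borel"
    and eq: "\<And>A. A \<in> sets borel \<Longrightarrow> (\<integral>x. indicator A (X x) * h x \<partial>\<mu>) = (\<integral>x. indicator A (X x) * \<psi> (X x) \<partial>\<mu>)"
  shows "AE x in \<mu>. cexp \<mu> X h x = \<psi> (X x)"
  unfolding cexp_eq
proof (rule ce.real_cond_exp_charact[OF _ h \<psi>(1) measurable_F_comp[OF \<psi>(2)]])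
  fix A assume "A \<in> sets F"
  then obtain B where B: "B \<in> sets borel" "A = X -` B" by (auto simp: sets_vimage_algebra2)
  have ind: "indicat_real A x = indicator B (X x)" for x using B by (auto simp: indicator_def)
  show "(\<integral>x\<in>A. h x \<partial>\<mu>) = (\<integral>x\<in>A. \<psi> (X x) \<partial>\<mu>)"
    unfolding set_lebesgue_integral_def ind using eq[OF B(1)] by simp
qed

lemma cexp_zero_iff:
  assumes h: "integrable \<mu> h"
  shows "(AE x in \<mu>. cexp \<mu> X h x = 0) \<longleftrightarrow> (\<forall>A\<in>sets borel. (\<integral>x. indicator A (X x) * h x \<partial>\<mu>) = 0)"
proof
  have [measurable]: "h \<in> borel_measurable borel"
    using borel_measurable_integrable[OF h] by (simp cong: measurable_cong_sets add: sets_eq)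
  assume L: "AE x in \<mu>. cexp \<mu> X h x = 0"
  show "\<forall>A\<in>sets borel. (\<integral>x. indicator A (X x) * h x \<partial>\<mu>) = 0"
  proof
    fix A :: "real set" assume [measurable]: "A \<in> sets borel"
    have "integrable \<mu> (\<lambda>x. indicat_real A (X x) * h x)"
      by (rule Bochner_Integration.integrable_bound[OF h]) (auto simp: indicator_def)
    then have "(\<integral>x. indicator A (X x) * h x \<partial>\<mu>) = (\<integral>x. indicator A (X x) * cexp \<mu> X h x \<partial>\<mu>)"
      using cexp_integral(2)[of "indicator A" h] by simp
    also have "\<dots> = (\<integral>x. 0 \<partial>\<mu>)" using L by (intro integral_cong_AE) auto
    finally show "(\<integral>x. indicator A (X x) * h x \<partial>\<mu>) = 0" by simp
  qed
next
  assume R: "\<forall>A\<in>sets borel. (\<integral>x. indicator A (X x) * h x \<partial>\<mu>) = 0"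
  show "AE x in \<mu>. cexp \<mu> X h x = 0"
    using cexp_char[OF h, of "\<lambda>_. 0"] R by simp
qed

lemma cexp_zero_integral:
  assumes "integrable \<mu> (\<lambda>x. \<phi> (X x) * h x)" "\<phi> \<in> borel_measurable borel" "h \<in> borel_measurable borel"
    and "AE x in \<mu>. cexp \<mu> X h x = 0"
  shows "(\<integral>x. \<phi> (X x) * h x \<partial>\<mu>) = 0"
proof -
  have [measurable]: "\<phi> \<in> borel_measurable borel" by fact
  have "(\<integral>x. \<phi> (X x) * h x \<partial>\<mu>) = (\<integral>x. \<phi> (X x) * cexp \<mu> X h x \<partial>\<mu>)"
    using cexp_integral(2)[OF assms(1-3)] by simp
  also have "\<dots> = (\<integral>x. 0 \<partial>\<mu>)" using assms(4) by (intro integral_cong_AE) auto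
  finally show ?thesis by simp
qed

text \<open>Conditional Jensen for the convex function \<open>\<bar>x\<bar> powr q\<close>.\<close>

lemma cexp_in_Lp:
  assumes h: "in_Lp q \<mu> h" and q: "q > 1"
  shows "in_Lp q \<mu> (cexp \<mu> X h)" "Lnorm q \<mu> (cexp \<mu> X h) \<le> Lnorm q \<mu> h"
proof -
  have int: "integrable \<mu> h" using in_Lp_imp_integrable[OF finite_measure_axioms h] q by simp
  have intq: "integrable \<mu> (\<lambda>x. \<bar>h x\<bar> powr q)" using h by (simp add: in_Lp_def)
  have conv: "convex_on UNIV (\<lambda>x::real. \<bar>x\<bar> powr q)"
    using norm_powr_convex[OF q, where 'a=real] by (intro convex_onI) (auto simp: algebra_simps)
  have meas: "(\<lambda>x::real. \<bar>x\<bar> powr q) \<in> borel_measurable borel" by simp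
  have J: "AE x in \<mu>. \<bar>cexp \<mu> X h x\<bar> powr q \<le> real_cond_exp \<mu> F (\<lambda>x. \<bar>h x\<bar> powr q) x"
    using ce.real_cond_exp_jensens_inequality(2)[OF int _ _ intq conv meas] by (simp add: cexp_eq)
  have intc: "integrable \<mu> (\<lambda>x. \<bar>cexp \<mu> X h x\<bar> powr q)"
    using ce.integrable_convex_cond_exp[OF int _ _ intq conv meas] by (simp add: cexp_eq)
  show 1: "in_Lp q \<mu> (cexp \<mu> X h)" using intc by (auto simp: in_Lp_def)
  have "(\<integral>x. \<bar>cexp \<mu> X h x\<bar> powr q \<partial>\<mu>) \<le> (\<integral>x. real_cond_exp \<mu> F (\<lambda>x. \<bar>h x\<bar> powr q) x \<partial>\<mu>)"
    using J by (intro integral_mono_AE intc ce.real_cond_exp_int intq)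
  also have "\<dots> = (\<integral>x. \<bar>h x\<bar> powr q \<partial>\<mu>)" by (rule ce.real_cond_exp_int(2)[OF intq])
  finally show "Lnorm q \<mu> (cexp \<mu> X h) \<le> Lnorm q \<mu> h"
    unfolding Lnorm_def using q by (intro powr_mono2) (auto intro: integral_nonneg_AE)
qed

lemma cexp_integrable: "integrable \<mu> h \<Longrightarrow> integrable \<mu> (cexp \<mu> X h)"
  unfolding cexp_eq by (rule ce.real_cond_exp_int)

lemma cexp_of_X: "\<phi> \<in> borel_measurable borel \<Longrightarrow> integrable \<mu> (\<lambda>x. \<phi> (X x)) \<Longrightarrow> AE x in \<mu>. cexp \<mu> X (\<lambda>x. \<phi> (X x)) x = \<phi> (X x)"
  unfolding cexp_eq by (rule ce.real_cond_exp_F_meas[OF _ measurable_F_comp])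

lemma cexp_add: "integrable \<mu> f \<Longrightarrow> integrable \<mu> h \<Longrightarrow> AE x in \<mu>. cexp \<mu> X (\<lambda>x. f x + h x) x = cexp \<mu> X f x + cexp \<mu> X h x"
  unfolding cexp_eq by (rule ce.real_cond_exp_add)

lemma cexp_diff: "integrable \<mu> f \<Longrightarrow> integrable \<mu> h \<Longrightarrow> AE x in \<mu>. cexp \<mu> X (\<lambda>x. f x - h x) x = cexp \<mu> X f x - cexp \<mu> X h x"
  unfolding cexp_eq by (rule ce.real_cond_exp_diff)

lemma cexp_cmult: "integrable \<mu> f \<Longrightarrow> AE x in \<mu>. cexp \<mu> X (\<lambda>x. c * f x) x = c * cexp \<mu> X f x"
  unfolding cexp_eq by (rule ce.real_cond_exp_cmult)

lemma in_Lp_comp_iff: "\<phi> \<in> borel_measurable borel \<Longrightarrow> in_Lp q \<mu> (\<lambda>x. \<phi> (X x) :: real) \<longleftrightarrow> \<phi> \<in> Lspace q \<nu>"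
  unfolding in_Lp_def Lspace_def by (auto simp: integrable_distr_eq)

lemma in_Lp_distr_iff: "\<phi> \<in> borel_measurable borel \<Longrightarrow> in_Lp q \<nu> \<phi> \<longleftrightarrow> in_Lp q \<mu> (\<lambda>x. \<phi> (X x) :: real)"
  unfolding in_Lp_def by (auto simp: integrable_distr_eq)

lemma Lnorm_comp: "\<phi> \<in> borel_measurable borel \<Longrightarrow> Lnorm q \<mu> (\<lambda>x. \<phi> (X x) :: real) = Lnorm q \<nu> \<phi>"
  unfolding Lnorm_def by (auto simp: integral_distr)

lemma AE_comp_iff: "Measurable.pred borel P \<Longrightarrow> (AE t in \<nu>. P t) \<longleftrightarrow> (AE x in \<mu>. P (X x))"
  by (rule AE_distr_iff) auto

end

context plane_prob
begin

sublocale c1: coord \<mu> fst "\<lambda>t. (t, 0)" by unfold_locales auto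

sublocale c2: coord \<mu> snd "\<lambda>t. (0, t)" by unfold_locales auto

lemma marg1_eq: "marg1 \<mu> = distr \<mu> borel fst" by (simp add: marg1_def)

lemma marg2_eq: "marg2 \<mu> = distr \<mu> borel snd" by (simp add: marg2_def)

lemma Lpair_iff:
  "f \<in> Lpair q \<mu> \<longleftrightarrow> fst f \<in> borel_measurable borel \<and> snd f \<in> borel_measurable borel \<and>
     in_Lp q \<mu> (\<lambda>x. fst f (fst x)) \<and> in_Lp q \<mu> (\<lambda>x. snd f (snd x))"
proof -
  have "f \<in> Lpair q \<mu> \<longleftrightarrow> fst f \<in> Lspace q (marg1 \<mu>) \<and> snd f \<in> Lspace q (marg2 \<mu>)"
    by (cases f) (auto simp: Lpair_def)
  then show ?thesis
    using c1.in_Lp_comp_iff[of "fst f" q] c2.in_Lp_comp_iff[of "snd f" q] by (auto simp: marg1_eq marg2_eq Lspace_def)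
qed

end

section \<open>The dual functional\<close>

lemma conj_exp_props:
  assumes "p > 1"
  shows "conj_exp p > 1" "1 / p + 1 / conj_exp p = 1" "1 / conj_exp p + 1 / p = 1"
    "(conj_exp p - 1) * p = conj_exp p" "(p - 1) * conj_exp p = p"
  using assms by (auto simp: conj_exp_def field_simps)

section \<open>The normalization map as the gradient of the dual power of the norm\<close>

lemma Nmap_eq: "Nmap p y = norm y powr (conj_exp p - 2) *\<^sub>R y"
  by (simp add: Nmap_def powr_minus[symmetric] powr_diff divide_inverse)

lemma norm_Nmap: "norm (Nmap p y) = norm y powr (conj_exp p - 1)"
  by (cases "y = 0") (auto simp: Nmap_eq powr_diff power2_eq_square field_simps)

lemma Nmap_inner_self: 
  fixes y :: "'a::real_inner"
  shows "Nmap p y \<bullet> y = norm y powr conj_exp p"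
  by (cases "y = 0") (auto simp: Nmap_eq dot_square_norm powr_diff power2_eq_square field_simps)

lemma Nmap_eq_0_iff [simp]: "Nmap p y = 0 \<longleftrightarrow> y = 0"
  by (simp add: Nmap_eq)

text \<open>For exponents \<open>conj_exp p\<close> below 2 the scalar factor blows up at the
  origin; there continuity comes from the norm of the image, a positive power of the norm of the
  argument.\<close>

lemma continuous_Nmap:
  assumes p: "p > 1"
  shows "continuous_on UNIV (Nmap p :: 'a::real_inner \<Rightarrow> 'a)"
proof -
  have "isCont (Nmap p) y" for y :: 'a
  proof (cases "y = 0")
    case True
    have "((\<lambda>y::'a. norm y powr (conj_exp p - 1)) \<longlongrightarrow> 0 powr (conj_exp p - 1)) (at 0)"
      using conj_exp_props(1)[OF p] by (intro tendsto_powr2 tendsto_norm_zero tendsto_ident_at) auto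
    then have "((\<lambda>y::'a. norm (Nmap p y)) \<longlongrightarrow> 0) (at 0)"
      by (simp add: norm_Nmap)
    then have "((Nmap p :: 'a \<Rightarrow> 'a) \<longlongrightarrow> 0) (at 0)" by (rule tendsto_norm_zero_cancel)
    then show ?thesis using True by (simp add: isCont_def Nmap_eq)
  next
    case False
    then show ?thesis unfolding Nmap_eq by (intro continuous_intros) auto
  qed
  then show ?thesis by (simp add: continuous_on_eq_continuous_at)
qed

lemma Nmap_measurable [measurable]: "p > 1 \<Longrightarrow> (Nmap p :: 'a::real_inner \<Rightarrow> 'a) \<in> borel_measurable borel"
  by (intro borel_measurable_continuous_onI continuous_Nmap)

lemma norm_plane_le: "norm (a, b) \<le> \<bar>a\<bar> + \<bar>b :: real\<bar>" for a :: real
  using norm_Pair_le[of a b] by simp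

text \<open>Makes minimizing sequences of the dual functional Cauchy, without reflexivity of the Lebesgue spaces.\<close>

lemma norm_diff_le_convexity_gap:
  assumes q: "q > 1" and e: "e > 0"
  shows "\<exists>C\<ge>0. \<forall>a b :: 'a::euclidean_space. norm (a - b) \<le> e + e * (norm a powr q + norm b powr q) +
      C * (norm a powr q / 2 + norm b powr q / 2 - norm ((1/2) *\<^sub>R (a + b)) powr q)"
proof -
  define \<kappa> where "\<kappa> = (\<lambda>z::'a \<times> 'a. norm (fst z) powr q / 2 + norm (snd z) powr q / 2 - norm ((1/2) *\<^sub>R (fst z + snd z)) powr q)"
  have k0: "\<kappa> (a, b) \<ge> 0" for a b
    using norm_powr_convex[OF q, of "1/2" a b] by (simp add: \<kappa>_def scaleR_add_right)
  have kpos: "\<kappa> (a, b) > 0" if "a \<noteq> b" for a b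
    using norm_powr_strict_convex[OF q that, of "1/2"] by (simp add: \<kappa>_def scaleR_add_right)
  \<comment> \<open>Beyond this radius \<open>2 * t \<le> e * t powr q\<close>, so for large vectors
    the difference is already absorbed by the moment term.\<close>
  define R where "R = max 1 ((2 / e) powr (1 / (q - 1)))"
  have R: "R \<ge> 1" by (simp add: R_def)
  have big: "2 * t \<le> e * t powr q" if "t \<ge> R" for t
  proof -
    have t: "t \<ge> 1" using that R by simp
    have "2 / e = ((2 / e) powr (1 / (q - 1))) powr (q - 1)" using q e by (simp add: powr_powr)
    also have "\<dots> \<le> t powr (q - 1)" using that q by (intro powr_mono2) (auto simp: R_def)
    finally have "2 \<le> e * t powr (q - 1)" using e by (simp add: field_simps)
    then have "2 * t \<le> e * t powr (q - 1) * t" using t by (intro mult_right_mono) auto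
    also have "\<dots> = e * t powr q" using t by (simp add: powr_diff)
    finally show ?thesis .
  qed
  \<comment> \<open>The only remaining case, bounded vectors at distance at least \<open>e\<close>.
    This set is compact and the convexity gap is continuous and positive on it, hence at least some
    \<open>c > 0\<close>; as the distance is at most \<open>2 * R\<close>, the coefficient
    \<open>2 * R / c\<close> results.\<close>
  define S where "S = {z::'a \<times> 'a. norm (fst z) \<le> R \<and> norm (snd z) \<le> R \<and> e \<le> norm (fst z - snd z)}"
  have "S = (cball 0 R \<times> cball 0 R) \<inter> {z. e \<le> norm (fst z - snd z)}" by (auto simp: S_def)
  moreover have "closed {z::'a\<times>'a. e \<le> norm (fst z - snd z)}" by (intro closed_Collect_le continuous_intros)
  ultimately have cS: "compact S" by (simp add: compact_Int_closed compact_Times)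
  have ck: "continuous_on S \<kappa>" unfolding \<kappa>_def using q
    by (intro continuous_intros continuous_on_powr') auto
  have "\<exists>c>0. \<forall>z\<in>S. c \<le> \<kappa> z"
  proof (cases "S = {}")
    case False
    then obtain z where z: "z \<in> S" "\<And>y. y \<in> S \<Longrightarrow> \<kappa> z \<le> \<kappa> y" using continuous_attains_inf[OF cS _ ck] by blast
    have "fst z \<noteq> snd z" using z(1) e by (auto simp: S_def)
    then have "\<kappa> z > 0" using kpos[of "fst z" "snd z"] by simp
    then show ?thesis using z by blast
  qed (auto intro: exI[of _ 1])
  then obtain c where c: "c > 0" "\<And>z. z \<in> S \<Longrightarrow> c \<le> \<kappa> z" by blast
  have "norm (a - b) \<le> e + e * (norm a powr q + norm b powr q) + (2 * R / c) * \<kappa> (a, b)" for a b :: 'a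
  proof -
    have nn: "(2 * R / c) * \<kappa> (a, b) \<ge> 0" using k0[of a b] c R by auto
    have nn2: "e * (norm a powr q + norm b powr q) \<ge> 0" using e by auto
    have tri: "norm (a - b) \<le> norm a + norm b" by (rule norm_triangle_ineq4)
    consider "norm (a - b) < e" | "(a, b) \<in> S" | "norm a > R \<or> norm b > R" by (force simp: S_def)
    then show ?thesis
    proof cases
      case 1 then show ?thesis using nn nn2 by linarith
    next
      case 2
      have "2 * R / c * c \<le> 2 * R / c * \<kappa> (a, b)" using c(2)[OF 2] c R by (intro mult_left_mono) auto
      then have "2 * R \<le> 2 * R / c * \<kappa> (a, b)" using c by simp
      moreover have "norm (a - b) \<le> 2 * R" using 2 tri by (auto simp: S_def)
      ultimately show ?thesis using nn2 e by linarith
    next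
      case 3
      define t where "t = max (norm a) (norm b)"
      have "2 * t \<le> e * t powr q" using 3 by (intro big) (auto simp: t_def)
      also have "\<dots> \<le> e * (norm a powr q + norm b powr q)" using e by (intro mult_left_mono) (auto simp: t_def max_def)
      finally show ?thesis using tri nn e by (auto simp: t_def)
    qed
  qed
  then show ?thesis using c R unfolding \<kappa>_def by (intro exI[of _ "2 * R / c"]) auto
qed

lemma abs_fst_le_norm: "\<bar>fst z\<bar> \<le> norm (z :: plane)" and abs_snd_le_norm: "\<bar>snd z\<bar> \<le> norm z"
  using norm_fst_le[of "fst z" "snd z"] norm_snd_le[of "snd z" "fst z"] by auto

lemma in_Lp_plane_fst: "in_Lp r M Y \<Longrightarrow> r \<ge> 0 \<Longrightarrow> in_Lp r M (\<lambda>x. fst (Y x))"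
  and in_Lp_plane_snd: "in_Lp r M Y \<Longrightarrow> r \<ge> 0 \<Longrightarrow> in_Lp r M (\<lambda>x. snd (Y x))" for Y :: "'a \<Rightarrow> plane"
proof -
  assume Y: "in_Lp r M Y" and r: "r \<ge> 0"
  show "in_Lp r M (\<lambda>x. fst (Y x))"
  proof (rule in_Lp_bound[OF Y _ _ r])
    show "AE x in M. norm (fst (Y x)) \<le> norm (Y x)" by (intro AE_I2) (simp only: real_norm_def abs_fst_le_norm)
  qed (rule measurable_compose[OF in_Lp_measurable[OF Y] borel_measurable_fst_plane])
  show "in_Lp r M (\<lambda>x. snd (Y x))"
  proof (rule in_Lp_bound[OF Y _ _ r])
    show "AE x in M. norm (snd (Y x)) \<le> norm (Y x)" by (intro AE_I2) (simp only: real_norm_def abs_snd_le_norm)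
  qed (rule measurable_compose[OF in_Lp_measurable[OF Y] borel_measurable_snd_plane])
qed

lemma pair_vec_measurable:
  assumes [measurable]: "fst f \<in> borel_measurable borel" "snd f \<in> borel_measurable borel"
  shows "pair_vec f \<in> borel_measurable borel"
proof -
  have "pair_vec f = (\<lambda>x. (fst f (fst x), snd f (snd x)))" by (auto simp: pair_vec_def)
  then show ?thesis by simp
qed

text \<open>The dual problem for an arbitrary field \<open>G\<close> in the dual Lebesgue space.
  Both distances lead to this problem, with the full gradient or with the partly averaged
  one.\<close>

locale Lq_problem = plane_prob \<mu> for \<mu> :: "plane measure" +
  fixes p :: real and G :: "plane \<Rightarrow> plane"
  assumes p: "p > 1" and G: "in_Lp (conj_exp p) \<mu> G"
begin

abbreviation q :: real where "q \<equiv> conj_exp p"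

lemmas q1 = conj_exp_props(1)[OF p]

lemma q_pos [simp]: "q > 0" "q \<ge> 0" "q \<noteq> 0" using q1 by auto

abbreviation R :: "fpair \<Rightarrow> plane \<Rightarrow> plane" where "R f x \<equiv> G x + pair_vec f x"

definition UU :: "fpair \<Rightarrow> real" where "UU f = (\<integral>x. norm (R f x) powr q \<partial>\<mu>)"

lemma G_meas [measurable]: "G \<in> borel_measurable borel"
  using G by (simp add: in_Lp_def cong: measurable_cong_sets add: sets_eq)

lemma pair_vec_in_Lp: "f \<in> Lpair q \<mu> \<Longrightarrow> in_Lp q \<mu> (pair_vec f)"
proof -
  assume f: "f \<in> Lpair q \<mu>"
  then have [measurable]: "fst f \<in> borel_measurable borel" "snd f \<in> borel_measurable borel" by (auto simp: Lpair_iff)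
  have 1: "in_Lp q \<mu> (\<lambda>x. norm (fst f (fst x)) + norm (snd f (snd x)))"
    using f by (intro in_Lp_add) (auto simp: Lpair_iff in_Lp_def)
  show ?thesis
    by (rule in_Lp_bound[OF 1]) (auto simp: pair_vec_def norm_plane_le intro!: pair_vec_measurable simp: sets_eq cong: measurable_cong_sets)
qed

lemma pair_vec_meas [measurable]: "f \<in> Lpair q \<mu> \<Longrightarrow> pair_vec f \<in> borel_measurable borel"
  using pair_vec_in_Lp[of f] by (simp add: in_Lp_def cong: measurable_cong_sets add: sets_eq)

lemma R_in_Lp: "f \<in> Lpair q \<mu> \<Longrightarrow> in_Lp q \<mu> (R f)"
  by (intro in_Lp_add G pair_vec_in_Lp) auto

lemma R_meas: "f \<in> Lpair q \<mu> \<Longrightarrow> R f \<in> borel_measurable borel"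
  by measurable

lemma UU_Lnorm: "UU f = Lnorm q \<mu> (R f) powr q"
  by (simp add: UU_def Lnorm_powr)

lemma UU_nonneg: "UU f \<ge> 0" by (simp add: UU_Lnorm)

lemma UU_root: "UU f powr (1 / q) = Lnorm q \<mu> (R f)"
  by (simp add: UU_def Lnorm_def)

lemma pair_vec_lin: "pair_vec (pair_lin a f b h) x = a *\<^sub>R pair_vec f x + b *\<^sub>R pair_vec h x"
  by (simp add: pair_vec_def pair_lin_def)

lemma pair_lin_in: 
  assumes "f \<in> Lpair q \<mu>" "h \<in> Lpair q \<mu>"
  shows "pair_lin a f b h \<in> Lpair q \<mu>"
  using assms unfolding Lpair_iff by (auto simp: pair_lin_def intro!: in_Lp_add in_Lp_cmult)

lemma pair_norm_eq:
  assumes "f \<in> Lpair q \<mu>"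
  shows "pair_norm q \<mu> f = Lnorm q \<mu> (\<lambda>x. fst f (fst x)) + Lnorm q \<mu> (\<lambda>x. snd f (snd x))"
  using assms c1.Lnorm_comp[of "fst f" q] c2.Lnorm_comp[of "snd f" q]
  by (auto simp: pair_norm_def marg1_eq marg2_eq Lpair_iff)

lemma Lnorm_pair_vec_le:
  assumes f: "f \<in> Lpair q \<mu>"
  shows "Lnorm q \<mu> (pair_vec f) \<le> pair_norm q \<mu> f"
  unfolding pair_norm_eq[OF f] 
proof (rule Lnorm_le_add)
  show "pair_vec f \<in> borel_measurable \<mu>" using pair_vec_in_Lp[OF f] by (rule in_Lp_measurable)
  show "AE x in \<mu>. norm (pair_vec f x) \<le> norm (fst f (fst x)) + norm (snd f (snd x))"
    by (auto simp: pair_vec_def norm_plane_le)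
qed (use f q1 in \<open>auto simp: Lpair_iff\<close>)

text \<open>Together with \<open>Lnorm_pair_vec_le\<close>, this makes \<open>pair_norm\<close>
  equivalent to the norm of the vector field, so that coercivity can be read off the triangle
  inequality.\<close>

lemma pair_norm_le_Lnorm:
  assumes f: "f \<in> Lpair q \<mu>"
  shows "pair_norm q \<mu> f \<le> 2 * Lnorm q \<mu> (pair_vec f)"
proof -
  have [measurable]: "fst f \<in> borel_measurable borel" "snd f \<in> borel_measurable borel" using f by (auto simp: Lpair_iff)
  have "Lnorm q \<mu> (\<lambda>x. fst f (fst x)) \<le> Lnorm q \<mu> (pair_vec f)"
    by (intro Lnorm_mono pair_vec_in_Lp f AE_I2) (auto simp: pair_vec_def, metis norm_fst_le fst_conv real_norm_def)
  moreover have "Lnorm q \<mu> (\<lambda>x. snd f (snd x)) \<le> Lnorm q \<mu> (pair_vec f)"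
    by (intro Lnorm_mono pair_vec_in_Lp f AE_I2) (auto simp: pair_vec_def, metis norm_snd_le snd_conv real_norm_def)
  ultimately show ?thesis unfolding pair_norm_eq[OF f] by simp
qed

lemma pair_eq_iff:
  assumes "f \<in> Lpair q \<mu>" "h \<in> Lpair q \<mu>"
  shows "pair_eq \<mu> f h \<longleftrightarrow> (AE x in \<mu>. pair_vec f x = pair_vec h x)"
proof -
  have [measurable]: "fst f \<in> borel_measurable borel" "snd f \<in> borel_measurable borel" 
      "fst h \<in> borel_measurable borel" "snd h \<in> borel_measurable borel" 
    using assms by (auto simp: Lpair_iff)
  have "(AE t in marg1 \<mu>. fst f t = fst h t) \<longleftrightarrow> (AE x in \<mu>. fst f (fst x) = fst h (fst x))"
    unfolding marg1_eq by (rule c1.AE_comp_iff) measurable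
  moreover have "(AE t in marg2 \<mu>. snd f t = snd h t) \<longleftrightarrow> (AE x in \<mu>. snd f (snd x) = snd h (snd x))"
    unfolding marg2_eq by (rule c2.AE_comp_iff) measurable
  ultimately show ?thesis by (auto simp: pair_eq_def pair_vec_def)
qed

lemma R_lin: "R (pair_lin (1 - t) f t h) x = (1 - t) *\<^sub>R R f x + t *\<^sub>R R h x"
  unfolding pair_vec_lin by (simp add: algebra_simps)

lemma integrable_R: "f \<in> Lpair q \<mu> \<Longrightarrow> integrable \<mu> (\<lambda>x. norm (R f x) powr q)"
  using R_in_Lp by (simp add: in_Lp_def)

text \<open>The pointwise convexity gap \<open>D\<close> is nonnegative and vanishes only where the
  two residuals agree; a vanishing integral would force the pairs to coincide.\<close>

lemma UU_strictly_convex: "Lstrictly_convex q \<mu> UU"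
  unfolding Lstrictly_convex_def
proof (intro ballI allI impI)
  fix f h and t :: real assume f: "f \<in> Lpair q \<mu>" and h: "h \<in> Lpair q \<mu>" and t: "0 < t \<and> t < 1 \<and> \<not> pair_eq \<mu> f h"
  have [measurable]: "R f \<in> borel_measurable borel" "R h \<in> borel_measurable borel" using f h by (auto intro: R_meas)
  define D where "D x = (1 - t) * norm (R f x) powr q + t * norm (R h x) powr q - norm (R (pair_lin (1 - t) f t h) x) powr q" for x
  have int: "integrable \<mu> D" unfolding D_def using f h pair_lin_in[OF f h] by (intro Bochner_Integration.integrable_diff Bochner_Integration.integrable_add integrable_mult_right integrable_R) auto
  have D0: "D x \<ge> 0" for x
    unfolding D_def R_lin using norm_powr_convex[OF q1, of t "R f x" "R h x"] t by auto
  have Dpos: "R f x = R h x" if "D x = 0" for x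
    using norm_powr_strict_convex[OF q1, of "R f x" "R h x" t] t that unfolding D_def R_lin by fastforce
  have "(\<integral>x. D x \<partial>\<mu>) \<noteq> 0"
  proof
    assume "(\<integral>x. D x \<partial>\<mu>) = 0"
    then have "AE x in \<mu>. D x = 0" using integral_nonneg_eq_0_iff_AE[OF int] D0 by auto
    then have "AE x in \<mu>. pair_vec f x = pair_vec h x" by eventually_elim (use Dpos in fastforce)
    then show False using t pair_eq_iff[OF f h] by auto
  qed
  moreover have "(\<integral>x. D x \<partial>\<mu>) \<ge> 0" using D0 by simp
  moreover have "(\<integral>x. D x \<partial>\<mu>) = (1 - t) * UU f + t * UU h - UU (pair_lin (1 - t) f t h)"
    unfolding D_def UU_def using integrable_R[OF f] integrable_R[OF h] integrable_R[OF pair_lin_in[OF f h]] by simp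
  ultimately show "UU (pair_lin (1 - t) f t h) < (1 - t) * UU f + t * UU h" by linarith
qed

text \<open>The residual is affine in the pair. Used in both orders, the bound gives continuity; it
  also controls the error of replacing an optimal pair by a continuous one.\<close>

lemma Lnorm_R_diff:
  assumes f: "f \<in> Lpair q \<mu>" and h: "h \<in> Lpair q \<mu>"
  shows "Lnorm q \<mu> (R h) \<le> Lnorm q \<mu> (R f) + pair_norm q \<mu> (pair_lin 1 h (-1) f)"
proof -
  have "Lnorm q \<mu> (\<lambda>x. R f x + pair_vec (pair_lin 1 h (-1) f) x) \<le> Lnorm q \<mu> (R f) + Lnorm q \<mu> (pair_vec (pair_lin 1 h (-1) f))"
    using q1 by (intro Lnorm_triangle R_in_Lp pair_vec_in_Lp pair_lin_in f h)
  also have "(\<lambda>x. R f x + pair_vec (pair_lin 1 h (-1) f) x) = R h" by (auto simp: pair_vec_lin)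
  finally show ?thesis using Lnorm_pair_vec_le[OF pair_lin_in[OF h f, of 1 "-1"]] by linarith
qed

lemma pair_norm_minus:
  assumes f: "f \<in> Lpair q \<mu>" and h: "h \<in> Lpair q \<mu>"
  shows "pair_norm q \<mu> (pair_lin 1 h (-1) f) = pair_norm q \<mu> (pair_lin 1 f (-1) h)"
  by (simp add: pair_norm_def pair_lin_def Lnorm_def abs_minus_commute)

lemma UU_continuous: "Lcontinuous q \<mu> UU"
  unfolding Lcontinuous_def
proof (intro ballI allI impI)
  fix f and e :: real assume f: "f \<in> Lpair q \<mu>" and e: "e > 0"
  define K where "K = Lnorm q \<mu> (R f)"
  have "continuous_on {0..} (\<lambda>x::real. x powr q)" by (intro continuous_on_powr' continuous_intros) auto
  moreover have "K \<in> {0..}" by (simp add: K_def)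
  ultimately obtain s where s: "s > 0" "\<And>y. y \<in> {0..} \<Longrightarrow> dist y K < s \<Longrightarrow> dist (y powr q) (K powr q) < e"
    using e unfolding continuous_on_iff by metis
  show "\<exists>s>0. \<forall>h\<in>Lpair q \<mu>. pair_norm q \<mu> (pair_lin 1 h (-1) f) < s \<longrightarrow> \<bar>UU h - UU f\<bar> < e"
  proof (intro exI[of _ s] conjI ballI impI s)
    fix h assume h: "h \<in> Lpair q \<mu>" "pair_norm q \<mu> (pair_lin 1 h (-1) f) < s"
    have "dist (Lnorm q \<mu> (R h)) K < s"
      using Lnorm_R_diff[OF f h(1)] Lnorm_R_diff[OF h(1) f] pair_norm_minus[OF f h(1)] h(2) by (auto simp: K_def dist_real_def)
    then show "\<bar>UU h - UU f\<bar> < e" using s(2)[of "Lnorm q \<mu> (R h)"] by (simp add: UU_Lnorm K_def dist_real_def)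
  qed
qed

lemma UU_coercive: "Lcoercive q \<mu> UU"
  unfolding Lcoercive_def
proof
  fix K :: real
  define K' where "K' = max K 0 powr (1 / q)"
  have KK: "K \<le> K' powr q" by (simp add: K'_def powr_powr)
  show "\<exists>B. \<forall>f\<in>Lpair q \<mu>. B \<le> pair_norm q \<mu> f \<longrightarrow> K \<le> UU f"
  proof (intro exI[of _ "2 * (K' + Lnorm q \<mu> G)"] ballI impI)
    fix f assume f: "f \<in> Lpair q \<mu>" "2 * (K' + Lnorm q \<mu> G) \<le> pair_norm q \<mu> f"
    have "Lnorm q \<mu> (\<lambda>x. R f x - G x) \<le> Lnorm q \<mu> (R f) + Lnorm q \<mu> G"
      using q1 by (intro Lnorm_triangle_diff R_in_Lp f G)
    then have "K' \<le> Lnorm q \<mu> (R f)" using f(2) pair_norm_le_Lnorm[OF f(1)] by simp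
    then have "K' powr q \<le> UU f" unfolding UU_Lnorm by (intro powr_mono2) (auto simp: K'_def)
    then show "K \<le> UU f" using KK by simp
  qed
qed

lemma zero_Lpair: "((\<lambda>_. 0), (\<lambda>_. 0)) \<in> Lpair q \<mu>"
  by (auto simp: Lpair_iff in_Lp_def)

text \<open>Midpoints of nearly minimal pairs cannot go below the infimum, so the convexity gap is
  small and the residuals are Cauchy in \<open>L\<^sup>1\<close>. A subsequence converges almost
  everywhere, and Fatou's lemma gives minimality of the limit.\<close>

lemma exists_minimizer: "\<exists>f\<in>Lpair q \<mu>. \<forall>h\<in>Lpair q \<mu>. UU f \<le> UU h"
proof -
  define m where "m = (INF f\<in>Lpair q \<mu>. UU f)"
  have bdd: "bdd_below (UU ` Lpair q \<mu>)" by (intro bdd_belowI[of _ 0]) (auto simp: UU_nonneg)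
  have m_le: "m \<le> UU h" if "h \<in> Lpair q \<mu>" for h unfolding m_def by (rule cINF_lower[OF bdd that])
  have "\<exists>f\<in>Lpair q \<mu>. UU f < m + 1 / real (Suc n)" for n
    using cINF_less_iff[OF _ bdd, of "m + 1 / real (Suc n)"] zero_Lpair unfolding m_def[symmetric] by (auto simp del: of_nat_Suc)
  then obtain f where f: "\<And>n. f n \<in> Lpair q \<mu>" "\<And>n. UU (f n) < m + 1 / real (Suc n)" by metis
  have f1: "UU (f n) \<le> m + 1" for n using f(2)[of n] by (smt (verit) divide_le_eq_1_pos of_nat_0_less_iff of_nat_1 of_nat_mono zero_less_Suc Suc_le_eq One_nat_def)
  have [measurable]: "R (f n) \<in> borel_measurable borel" for n using f(1) by (auto intro: R_meas)
  have m0: "m \<ge> 0" unfolding m_def using zero_Lpair by (intro cINF_greatest) (auto simp: UU_nonneg)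
  have intR: "integrable \<mu> (R (f n))" for n using in_Lp_imp_integrable[OF finite_measure_axioms R_in_Lp[OF f(1)]] q1 by auto
  have cau: "\<exists>N. \<forall>i\<ge>N. \<forall>j\<ge>N. (\<integral>x. norm (R (f i) x - R (f j) x) \<partial>\<mu>) < e" if e: "e > 0" for e
  proof -
    \<comment> \<open>The factor \<open>2 * m + 3\<close> is 1 plus twice the bound
      \<open>m + 1\<close> on the values along the sequence.\<close>
    define e' where "e' = e / 2 / (2 * m + 3)"
    have e': "e' > 0" using e m0 by (auto simp: e'_def)
    obtain C where C: "C \<ge> 0" "\<And>a b :: plane. norm (a - b) \<le> e' + e' * (norm a powr q + norm b powr q) +
      C * (norm a powr q / 2 + norm b powr q / 2 - norm ((1/2) *\<^sub>R (a + b)) powr q)"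
      using norm_diff_le_convexity_gap[OF q1 e'] by metis
    obtain N where N: "2 * C / e < real N" using reals_Archimedean2 by blast
    show ?thesis
    proof (intro exI[of _ N] allI impI)
      fix i j assume ij: "i \<ge> N" "j \<ge> N"
      define h where "h = pair_lin (1 - 1/2) (f i) (1/2) (f j)"
      have h: "h \<in> Lpair q \<mu>" unfolding h_def by (intro pair_lin_in f)
      have Rh: "R h x = (1/2) *\<^sub>R (R (f i) x + R (f j) x)" for x unfolding h_def R_lin by (simp add: algebra_simps)
      have "(\<integral>x. norm (R (f i) x - R (f j) x) \<partial>\<mu>) \<le> (\<integral>x. e' + e' * (norm (R (f i) x) powr q + norm (R (f j) x) powr q) +
         C * (norm (R (f i) x) powr q / 2 + norm (R (f j) x) powr q / 2 - norm (R h x) powr q) \<partial>\<mu>)"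
        unfolding Rh
        by (intro integral_mono C(2) integrable_norm Bochner_Integration.integrable_diff Bochner_Integration.integrable_add integrable_mult_right integrable_divide intR integrable_R f integrable_const)
          (use integrable_R[OF h] in \<open>simp add: Rh\<close>)
      also have "\<dots> = e' + e' * (UU (f i) + UU (f j)) + C * (UU (f i) / 2 + UU (f j) / 2 - UU h)"
        unfolding UU_def using integrable_R[OF f(1)] integrable_R[OF h] by (simp add: prob_space)
      also have "\<dots> \<le> e' + e' * ((m + 1) + (m + 1)) + C * (1 / real (Suc N))"
      proof (intro add_mono mult_left_mono)
        have "1 / real (Suc i) \<le> 1 / real (Suc N)" "1 / real (Suc j) \<le> 1 / real (Suc N)" using ij by (auto simp: frac_le)
        then show "UU (f i) / 2 + UU (f j) / 2 - UU h \<le> 1 / real (Suc N)"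
          using f(2)[of i] f(2)[of j] m_le[OF h] by linarith
      qed (use e' C f1 in auto)
      also have "e' + e' * ((m + 1) + (m + 1)) = e' * (2 * m + 3)" by (simp add: algebra_simps)
      also have "e' * (2 * m + 3) = e / 2" unfolding e'_def using m0 by (intro nonzero_eq_divide_eq[THEN iffD1, rotated] refl) auto
      also have "C * (1 / real (Suc N)) < e / 2" 
      proof -
        have "2 * C < e * real (Suc N)" using N e by (simp add: field_simps)
        then show ?thesis by (simp add: field_simps del: of_nat_Suc)
      qed
      finally show "(\<integral>x. norm (R (f i) x - R (f j) x) \<partial>\<mu>) < e" by simp
    qed
  qed
  obtain r where r: "strict_mono r" "AE x in \<mu>. Cauchy (\<lambda>i. R (f (r i)) x)"
    using cauchy_L1_AE_cauchy_subseq[OF intR cau] by blast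
  \<comment> \<open>Limits are taken on the line, so that each component depends on its own
    coordinate by construction. Where a sequence diverges \<open>lim\<close> is an unspecified
    value; convergence of the residuals at almost every point makes such arguments
    negligible.\<close>
  define F1 F2 where "F1 t = lim (\<lambda>i. fst (f (r i)) t)" and "F2 t = lim (\<lambda>i. snd (f (r i)) t)" for t
  have [measurable]: "fst (f i) \<in> borel_measurable borel" "snd (f i) \<in> borel_measurable borel" for i using f(1) by (auto simp: Lpair_iff)
  have F_meas[measurable]: "F1 \<in> borel_measurable borel" "F2 \<in> borel_measurable borel"
    unfolding F1_def F2_def by (intro borel_measurable_lim_metric; simp)+
  define F where "F = (F1, F2)"
  have [measurable]: "(\<lambda>x. R F x) \<in> borel_measurable borel" unfolding F_def pair_vec_def by simp
  have lim: "AE x in \<mu>. (\<lambda>i. R (f (r i)) x) \<longlonglongrightarrow> R F x"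
    using r(2)
  proof eventually_elim
    case (elim x)
    then obtain l where l: "(\<lambda>i. R (f (r i)) x) \<longlonglongrightarrow> l" using Cauchy_convergent convergentD by blast
    have "(\<lambda>i. R (f (r i)) x - G x) \<longlonglongrightarrow> l - G x" by (intro tendsto_intros l)
    then have pv: "(\<lambda>i. pair_vec (f (r i)) x) \<longlonglongrightarrow> l - G x" by simp
    have "F1 (fst x) = fst (l - G x)" unfolding F1_def using tendsto_fst[OF pv] by (intro limI) (simp add: pair_vec_def)
    moreover have "F2 (snd x) = snd (l - G x)" unfolding F2_def using tendsto_snd[OF pv] by (intro limI) (simp add: pair_vec_def)
    ultimately have "R F x = l" by (simp add: F_def pair_vec_def prod_eq_iff)
    then show ?case using l by simp
  qed
  have lim2: "AE x in \<mu>. (\<lambda>i. ennreal (norm (R (f (r i)) x) powr q)) \<longlonglongrightarrow> ennreal (norm (R F x) powr q)"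
    using lim by eventually_elim (intro tendsto_ennrealI tendsto_powr2 tendsto_norm tendsto_const; simp)
  have "(\<integral>\<^sup>+x. ennreal (norm (R F x) powr q) \<partial>\<mu>) = (\<integral>\<^sup>+x. liminf (\<lambda>i. ennreal (norm (R (f (r i)) x) powr q)) \<partial>\<mu>)"
    using lim2 by (intro nn_integral_cong_AE) (auto elim!: eventually_mono intro!: lim_imp_Liminf[symmetric])
  also have "\<dots> \<le> liminf (\<lambda>i. \<integral>\<^sup>+x. ennreal (norm (R (f (r i)) x) powr q) \<partial>\<mu>)"
    by (intro nn_integral_liminf) measurable
  also have "\<dots> = liminf (\<lambda>i. ennreal (UU (f (r i))))"
    unfolding UU_def using integrable_R[OF f(1)] by (subst nn_integral_eq_integral) auto
  also have "\<dots> = ennreal m"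
  proof (intro lim_imp_Liminf tendsto_ennrealI)
    have "(\<lambda>i. m + 1 / real (Suc i)) \<longlonglongrightarrow> m + 0" by (intro tendsto_intros LIMSEQ_inverse_real_of_nat[unfolded inverse_eq_divide])
    then have "(\<lambda>i. UU (f i)) \<longlonglongrightarrow> m"
      by (intro tendsto_sandwich[of "\<lambda>_. m" "\<lambda>i. UU (f i)" sequentially "\<lambda>i. m + 1 / real (Suc i)"])
         (use m_le[OF f(1)] f(2) in \<open>auto intro!: always_eventually less_imp_le simp del: of_nat_Suc\<close>)
    then show "(\<lambda>i. UU (f (r i))) \<longlonglongrightarrow> m" using LIMSEQ_subseq_LIMSEQ[OF _ r(1)] by (auto simp: o_def)
  qed simp
  finally have le: "(\<integral>\<^sup>+x. ennreal (norm (R F x) powr q) \<partial>\<mu>) \<le> ennreal m" .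
  have int: "integrable \<mu> (\<lambda>x. norm (R F x) powr q)"
    using le by (intro integrableI_bounded) (auto simp: less_top[symmetric] top_unique)
  have RL: "in_Lp q \<mu> (R F)" using int by (auto simp: in_Lp_def)
  have UF: "UU F \<le> m" using le m0 unfolding UU_def by (subst (asm) nn_integral_eq_integral[OF int]) auto
  have PL: "in_Lp q \<mu> (pair_vec F)" using in_Lp_diff[OF RL G] by simp
  have le1: "norm (F1 (fst x)) \<le> norm (pair_vec F x)" and le2: "norm (F2 (snd x)) \<le> norm (pair_vec F x)" for x
    using abs_fst_le_norm[of "pair_vec F x"] abs_snd_le_norm[of "pair_vec F x"] by (simp_all add: pair_vec_def F_def)
  have "in_Lp q \<mu> (\<lambda>x. F1 (fst x))"
    by (rule in_Lp_bound[OF PL _ AE_I2[OF le1]]) simp_all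
  moreover have "in_Lp q \<mu> (\<lambda>x. F2 (snd x))"
    by (rule in_Lp_bound[OF PL _ AE_I2[OF le2]]) simp_all
  ultimately have "F \<in> Lpair q \<mu>" by (simp add: Lpair_iff F_def)
  then show ?thesis using UF m_le by (meson order_trans)
qed

text \<open>Both claims rest on \<open>(q - 1) * p = q\<close>: the \<open>p\<close>-th power of the
  norm of the image is the \<open>q\<close>-th power of the norm of the argument.\<close>

lemma Nmap_R_in_Lp:
  assumes f: "in_Lp q \<mu> f"
  shows "in_Lp p \<mu> (\<lambda>x. Nmap p (f x :: 'b::euclidean_space))" "Lnorm p \<mu> (\<lambda>x. Nmap p (f x)) = Lnorm q \<mu> f powr (q - 1)"
proof -
  have [measurable]: "f \<in> borel_measurable \<mu>" using f by (simp add: in_Lp_def)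
  have eq: "norm (Nmap p (f x)) powr p = norm (f x) powr q" for x
    using conj_exp_props(4)[OF p] by (simp add: norm_Nmap powr_powr)
  have [measurable]: "(\<lambda>x. Nmap p (f x)) \<in> borel_measurable \<mu>" by (rule measurable_compose[OF _ Nmap_measurable[OF p]]) fact
  show "in_Lp p \<mu> (\<lambda>x. Nmap p (f x))" using f unfolding in_Lp_def eq by simp
  have "1 / p = (q - 1) / q" using conj_exp_props(4)[OF p] p by (simp add: field_simps)
  then show "Lnorm p \<mu> (\<lambda>x. Nmap p (f x)) = Lnorm q \<mu> f powr (q - 1)" unfolding Lnorm_def eq 
    by (simp add: powr_powr)
qed

lemma UU_tangent:
  assumes f: "f \<in> Lpair q \<mu>" and h: "h \<in> Lpair q \<mu>"
  shows "UU f + q * (\<integral>x. Nmap p (R f x) \<bullet> (R h x - R f x) \<partial>\<mu>) \<le> UU h"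
proof -
  have N: "in_Lp p \<mu> (\<lambda>x. Nmap p (R f x))" by (rule Nmap_R_in_Lp[OF R_in_Lp[OF f]])
  have D: "in_Lp q \<mu> (\<lambda>x. R h x - R f x)" by (intro in_Lp_diff R_in_Lp f h) auto
  have int: "integrable \<mu> (\<lambda>x. Nmap p (R f x) \<bullet> (R h x - R f x))"
    by (rule Holder_inner(1)[OF N D p q1 conj_exp_props(2)[OF p]])
  have "UU f + q * (\<integral>x. Nmap p (R f x) \<bullet> (R h x - R f x) \<partial>\<mu>) = (\<integral>x. norm (R f x) powr q + q * (Nmap p (R f x) \<bullet> (R h x - R f x)) \<partial>\<mu>)"
    unfolding UU_def using integrable_R[OF f] int by simp
  also have "\<dots> \<le> UU h" unfolding UU_def
  proof (intro integral_mono Bochner_Integration.integrable_add integrable_mult_right int integrable_R f h)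
    fix x show "norm (R f x) powr q + q * (Nmap p (R f x) \<bullet> (R h x - R f x)) \<le> norm (R h x) powr q"
      unfolding Nmap_eq by (rule norm_powr_ge_tangent[OF q1])
  qed
  finally show ?thesis .
qed

lemma Nmap_inner_integrable:
  assumes f: "f \<in> Lpair q \<mu>" and h: "h \<in> Lpair q \<mu>"
  shows "integrable \<mu> (\<lambda>x. Nmap p (R f x) \<bullet> pair_vec h x)"
  by (rule Holder_inner(1)[OF Nmap_R_in_Lp(1)[OF R_in_Lp[OF f]] pair_vec_in_Lp[OF h] p q1 conj_exp_props(2)[OF p]])

text \<open>The functional is not differentiated directly. The tangent inequality at the perturbed
  pair \<open>fn n\<close>, evaluated at the minimizer, gives the sign for every positive step, and
  dominated convergence lets the step tend to 0.\<close>

lemma first_variation_nonneg: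
  assumes f: "f \<in> Lpair q \<mu>" and min: "\<And>h. h \<in> Lpair q \<mu> \<Longrightarrow> UU f \<le> UU h" and h: "h \<in> Lpair q \<mu>"
  shows "(\<integral>x. Nmap p (R f x) \<bullet> pair_vec h x \<partial>\<mu>) \<ge> 0"
proof -
  define s where "s n = 1 / real (Suc n)" for n
  have s: "0 < s n" "s n \<le> 1" for n by (auto simp: s_def)
  define fn where "fn n = pair_lin 1 f (s n) h" for n
  have fn: "fn n \<in> Lpair q \<mu>" for n unfolding fn_def by (intro pair_lin_in f h)
  have Rfn: "R (fn n) x = R f x + s n *\<^sub>R pair_vec h x" for n x unfolding fn_def pair_vec_lin by simp
  have pos: "(\<integral>x. Nmap p (R (fn n) x) \<bullet> pair_vec h x \<partial>\<mu>) \<ge> 0" for n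
  proof -
    have "UU (fn n) + q * (\<integral>x. Nmap p (R (fn n) x) \<bullet> (R f x - R (fn n) x) \<partial>\<mu>) \<le> UU f"
      by (rule UU_tangent[OF fn f])
    then have "q * (\<integral>x. Nmap p (R (fn n) x) \<bullet> (R f x - R (fn n) x) \<partial>\<mu>) \<le> 0" using min[OF fn[of n]] by linarith
    moreover have "(\<integral>x. Nmap p (R (fn n) x) \<bullet> (R f x - R (fn n) x) \<partial>\<mu>) = - (s n * (\<integral>x. Nmap p (R (fn n) x) \<bullet> pair_vec h x \<partial>\<mu>))"
      unfolding Rfn by simp
    ultimately have "0 \<le> q * (s n * (\<integral>x. Nmap p (R (fn n) x) \<bullet> pair_vec h x \<partial>\<mu>))" by simp
    then show ?thesis using s(1)[of n] q1 by (simp add: zero_le_mult_iff)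
  qed
  have [measurable]: "R f \<in> borel_measurable borel" "pair_vec h \<in> borel_measurable borel" using f h by (auto intro: R_meas)
  note [measurable] = Nmap_measurable[OF p]
  have "(\<lambda>n. \<integral>x. Nmap p (R f x + s n *\<^sub>R pair_vec h x) \<bullet> pair_vec h x \<partial>\<mu>) \<longlonglongrightarrow> (\<integral>x. Nmap p (R f x) \<bullet> pair_vec h x \<partial>\<mu>)"
  proof (rule integral_dominated_convergence[where w="\<lambda>x. (norm (R f x) + norm (pair_vec h x)) powr q"])
    have 1: "in_Lp q \<mu> (\<lambda>x. norm (R f x) + norm (pair_vec h x))"
      using R_in_Lp[OF f] pair_vec_in_Lp[OF h] by (intro in_Lp_add) (auto simp: in_Lp_def)
    then show "integrable \<mu> (\<lambda>x. (norm (R f x) + norm (pair_vec h x)) powr q)" by (simp add: in_Lp_def)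
    have s0: "s \<longlonglongrightarrow> 0" unfolding s_def using LIMSEQ_inverse_real_of_nat by (simp add: inverse_eq_divide)
    show "AE x in \<mu>. (\<lambda>n. Nmap p (R f x + s n *\<^sub>R pair_vec h x) \<bullet> pair_vec h x) \<longlonglongrightarrow> Nmap p (R f x) \<bullet> pair_vec h x"
    proof (intro AE_I2)
      fix x
      have "(\<lambda>n. R f x + s n *\<^sub>R pair_vec h x) \<longlonglongrightarrow> R f x + 0 *\<^sub>R pair_vec h x"
        by (intro tendsto_intros s0)
      then have "(\<lambda>n. Nmap p (R f x + s n *\<^sub>R pair_vec h x)) \<longlonglongrightarrow> Nmap p (R f x + 0 *\<^sub>R pair_vec h x)"
        using continuous_on_tendsto_compose[OF continuous_Nmap[OF p]] by auto
      then show "(\<lambda>n. Nmap p (R f x + s n *\<^sub>R pair_vec h x) \<bullet> pair_vec h x) \<longlonglongrightarrow> Nmap p (R f x) \<bullet> pair_vec h x"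
        by (intro tendsto_intros) simp
    qed
    show "AE x in \<mu>. norm (Nmap p (R f x + s n *\<^sub>R pair_vec h x) \<bullet> pair_vec h x) \<le> (norm (R f x) + norm (pair_vec h x)) powr q" for n
    proof (intro AE_I2)
      fix x
      let ?a = "R f x" and ?h = "pair_vec h x"
      have "norm (Nmap p (?a + s n *\<^sub>R ?h) \<bullet> ?h) \<le> norm (?a + s n *\<^sub>R ?h) powr (q - 1) * norm ?h"
        using Cauchy_Schwarz_ineq2[of "Nmap p (?a + s n *\<^sub>R ?h)" ?h] by (simp add: norm_Nmap)
      also have "\<dots> \<le> (norm ?a + norm ?h) powr (q - 1) * (norm ?a + norm ?h)"
      proof (intro mult_mono powr_mono2)
        have "norm (s n *\<^sub>R ?h) \<le> 1 * norm ?h" using s[of n] unfolding norm_scaleR by (intro mult_right_mono) auto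
        then show "norm (?a + s n *\<^sub>R ?h) \<le> norm ?a + norm ?h" using norm_triangle_ineq[of ?a "s n *\<^sub>R ?h"] by linarith
      qed (use q1 in auto)
      also have "\<dots> = (norm ?a + norm ?h) powr q"
        by (cases "norm ?a + norm ?h = 0") (auto simp: powr_diff)
      finally show "norm (Nmap p (?a + s n *\<^sub>R ?h) \<bullet> ?h) \<le> (norm ?a + norm ?h) powr q" .
    qed
  qed auto
  then show ?thesis by (rule LIMSEQ_le_const) (use pos in \<open>auto simp: Rfn\<close>)
qed

lemma minimizer_iff_variation:
  assumes f: "f \<in> Lpair q \<mu>"
  shows "(\<forall>h\<in>Lpair q \<mu>. UU f \<le> UU h) \<longleftrightarrow> (\<forall>h\<in>Lpair q \<mu>. (\<integral>x. Nmap p (R f x) \<bullet> pair_vec h x \<partial>\<mu>) = 0)"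
proof
  assume L: "\<forall>h\<in>Lpair q \<mu>. UU f \<le> UU h"
  show "\<forall>h\<in>Lpair q \<mu>. (\<integral>x. Nmap p (R f x) \<bullet> pair_vec h x \<partial>\<mu>) = 0"
  proof
    fix h assume h: "h \<in> Lpair q \<mu>"
    have 1: "(\<integral>x. Nmap p (R f x) \<bullet> pair_vec h x \<partial>\<mu>) \<ge> 0" using first_variation_nonneg[OF f _ h] L by auto
    \<comment> \<open>This is the pair \<open>- h\<close>; the reverse inequality follows because
      admissible pairs form a linear space.\<close>
    have h': "pair_lin 0 h (-1) h \<in> Lpair q \<mu>" by (intro pair_lin_in h)
    have "(\<integral>x. Nmap p (R f x) \<bullet> pair_vec (pair_lin 0 h (-1) h) x \<partial>\<mu>) \<ge> 0" using first_variation_nonneg[OF f _ h'] L by auto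
    then have "(\<integral>x. Nmap p (R f x) \<bullet> pair_vec h x \<partial>\<mu>) \<le> 0" unfolding pair_vec_lin by simp
    then show "(\<integral>x. Nmap p (R f x) \<bullet> pair_vec h x \<partial>\<mu>) = 0" using 1 by simp
  qed
next
  assume R: "\<forall>h\<in>Lpair q \<mu>. (\<integral>x. Nmap p (R f x) \<bullet> pair_vec h x \<partial>\<mu>) = 0"
  show "\<forall>h\<in>Lpair q \<mu>. UU f \<le> UU h"
  proof
    fix h assume h: "h \<in> Lpair q \<mu>"
    have "(\<integral>x. Nmap p (R f x) \<bullet> pair_vec (pair_lin 1 h (-1) f) x \<partial>\<mu>) = 0" using R pair_lin_in[OF h f] by blast
    moreover have "pair_vec (pair_lin 1 h (-1) f) x = R h x - R f x" for x unfolding pair_vec_lin by simp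
    ultimately show "UU f \<le> UU h" using UU_tangent[OF f h] by simp
  qed
qed

text \<open>Pairs with one component zero separate the two coordinates, and indicators as the other
  component test the conditional expectation. Conversely, a vanishing conditional mean annihilates
  every function of that coordinate for which the product is integrable.\<close>

lemma minimizer_iff_cexp:
  assumes f: "f \<in> Lpair q \<mu>"
  shows "(\<forall>h\<in>Lpair q \<mu>. UU f \<le> UU h) \<longleftrightarrow>
    (AE x in \<mu>. cexp \<mu> fst (\<lambda>y. fst (Nmap p (R f y))) x = 0) \<and> (AE x in \<mu>. cexp \<mu> snd (\<lambda>y. snd (Nmap p (R f y))) x = 0)"
proof -
  note [measurable] = Nmap_measurable[OF p] R_meas[OF f]
  define N where "N x = Nmap p (R f x)" for x
  have Nm[measurable]: "N \<in> borel_measurable borel" unfolding N_def by measurable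
  have NL: "in_Lp p \<mu> N" unfolding N_def by (rule Nmap_R_in_Lp(1)[OF R_in_Lp[OF f]])
  have N1: "in_Lp p \<mu> (\<lambda>x. fst (N x))" and N2: "in_Lp p \<mu> (\<lambda>x. snd (N x))"
    using in_Lp_plane_fst[OF NL] in_Lp_plane_snd[OF NL] p by simp_all
  have i1: "integrable \<mu> (\<lambda>x. fst (N x))" and i2: "integrable \<mu> (\<lambda>x. snd (N x))"
    using in_Lp_imp_integrable[OF finite_measure_axioms N1] in_Lp_imp_integrable[OF finite_measure_axioms N2] p by auto
  have eq: "(\<integral>x. N x \<bullet> pair_vec h x \<partial>\<mu>) = (\<integral>x. fst h (fst x) * fst (N x) \<partial>\<mu>) + (\<integral>x. snd h (snd x) * snd (N x) \<partial>\<mu>)"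
    and ih1: "integrable \<mu> (\<lambda>x. fst h (fst x) * fst (N x))" and ih2: "integrable \<mu> (\<lambda>x. snd h (snd x) * snd (N x))"
    if h: "h \<in> Lpair q \<mu>" for h
  proof -
    show 1: "integrable \<mu> (\<lambda>x. fst h (fst x) * fst (N x))" 
      by (rule Holder_integral(1)[OF _ N1 q1 p conj_exp_props(3)[OF p]]) (use h in \<open>auto simp: Lpair_iff\<close>)
    show 2: "integrable \<mu> (\<lambda>x. snd h (snd x) * snd (N x))" 
      by (rule Holder_integral(1)[OF _ N2 q1 p conj_exp_props(3)[OF p]]) (use h in \<open>auto simp: Lpair_iff\<close>)
    have "(\<integral>x. N x \<bullet> pair_vec h x \<partial>\<mu>) = (\<integral>x. fst h (fst x) * fst (N x) + snd h (snd x) * snd (N x) \<partial>\<mu>)"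
      by (intro Bochner_Integration.integral_cong) (auto simp: pair_vec_def inner_prod_def mult.commute)
    then show "(\<integral>x. N x \<bullet> pair_vec h x \<partial>\<mu>) = (\<integral>x. fst h (fst x) * fst (N x) \<partial>\<mu>) + (\<integral>x. snd h (snd x) * snd (N x) \<partial>\<mu>)"
      using 1 2 by simp
  qed
  have "(\<forall>h\<in>Lpair q \<mu>. (\<integral>x. N x \<bullet> pair_vec h x \<partial>\<mu>) = 0) \<longleftrightarrow>
    (AE x in \<mu>. cexp \<mu> fst (\<lambda>y. fst (N y)) x = 0) \<and> (AE x in \<mu>. cexp \<mu> snd (\<lambda>y. snd (N y)) x = 0)"
  proof (intro iffI conjI)
    assume L: "\<forall>h\<in>Lpair q \<mu>. (\<integral>x. N x \<bullet> pair_vec h x \<partial>\<mu>) = 0"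
    show "AE x in \<mu>. cexp \<mu> fst (\<lambda>y. fst (N y)) x = 0"
      unfolding c1.cexp_zero_iff[OF i1]
    proof
      fix A :: "real set" assume A[measurable]: "A \<in> sets borel"
      have h: "(indicat_real A, \<lambda>_. 0) \<in> Lpair q \<mu>"
        using q1 by (auto simp: Lpair_iff intro!: in_Lp_bounded[OF finite_measure_axioms, where B=1] in_Lp_const[OF finite_measure_axioms])
      show "(\<integral>x. indicator A (fst x) * fst (N x) \<partial>\<mu>) = 0" using eq[OF h] L h by simp
    qed
    show "AE x in \<mu>. cexp \<mu> snd (\<lambda>y. snd (N y)) x = 0"
      unfolding c2.cexp_zero_iff[OF i2]
    proof
      fix A :: "real set" assume A[measurable]: "A \<in> sets borel"
      have h: "(\<lambda>_. 0, indicat_real A) \<in> Lpair q \<mu>"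
        using q1 by (auto simp: Lpair_iff intro!: in_Lp_bounded[OF finite_measure_axioms, where B=1] in_Lp_const[OF finite_measure_axioms])
      show "(\<integral>x. indicator A (snd x) * snd (N x) \<partial>\<mu>) = 0" using eq[OF h] L h by simp
    qed
  next
    assume R: "(AE x in \<mu>. cexp \<mu> fst (\<lambda>y. fst (N y)) x = 0) \<and> (AE x in \<mu>. cexp \<mu> snd (\<lambda>y. snd (N y)) x = 0)"
    show "\<forall>h\<in>Lpair q \<mu>. (\<integral>x. N x \<bullet> pair_vec h x \<partial>\<mu>) = 0"
    proof
      fix h assume h: "h \<in> Lpair q \<mu>"
      have [measurable]: "fst h \<in> borel_measurable borel" "snd h \<in> borel_measurable borel" using h by (auto simp: Lpair_iff)
      have "(\<integral>x. fst h (fst x) * fst (N x) \<partial>\<mu>) = 0"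
        by (rule c1.cexp_zero_integral[OF ih1[OF h]]) (use R in auto)
      moreover have "(\<integral>x. snd h (snd x) * snd (N x) \<partial>\<mu>) = 0"
        by (rule c2.cexp_zero_integral[OF ih2[OF h]]) (use R in auto)
      ultimately show "(\<integral>x. N x \<bullet> pair_vec h x \<partial>\<mu>) = 0" using eq[OF h] by simp
    qed
  qed
  then show ?thesis unfolding minimizer_iff_variation[OF f] N_def .
qed

lemma minimizer_unique:
  assumes f: "f \<in> Lpair q \<mu>" "\<And>h. h \<in> Lpair q \<mu> \<Longrightarrow> UU f \<le> UU h"
    and g: "g \<in> Lpair q \<mu>" "\<And>h. h \<in> Lpair q \<mu> \<Longrightarrow> UU g \<le> UU h"
  shows "pair_eq \<mu> g f"
proof (rule ccontr)
  assume "\<not> pair_eq \<mu> g f"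
  then have 1: "UU (pair_lin (1 - 1/2) g (1/2) f) < (1 - 1/2) * UU g + (1/2) * UU f"
    using UU_strictly_convex[unfolded Lstrictly_convex_def, rule_format, OF g(1) f(1), of "1/2"] by simp
  have "UU f \<le> UU (pair_lin (1 - 1/2) g (1/2) f)" by (intro f pair_lin_in g)
  moreover have "UU g = UU f" using f g by (intro antisym) auto
  ultimately show False using 1 by simp
qed

end

section \<open>Differentiation of translations in \<open>L\<^sup>1\<close>\<close>

text \<open>Lebesgue measure is reduced to a finite measure by a Gaussian weight \<open>n\<close>:
  approximate \<open>w / n\<close> under the normal law and multiply the approximant by
  \<open>n\<close> again.\<close>

lemma L1_lborel_density_continuous:
  fixes w :: "real \<Rightarrow> real"
  assumes w: "integrable lborel w" and e: "e > 0"
  shows "\<exists>\<phi>. continuous_on UNIV \<phi> \<and> (\<exists>R. \<forall>x. R < \<bar>x\<bar> \<longrightarrow> \<phi> x = 0) \<and> integrable lborel \<phi> \<and> (\<integral>x. \<bar>w x - \<phi> x\<bar> \<partial>lborel) < e"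
proof -
  have [measurable]: "w \<in> borel_measurable borel" using borel_measurable_integrable[OF w] by simp
  define n where "n = std_normal_density"
  have n0: "n x > 0" for x unfolding n_def by (intro normal_density_pos) simp
  have nc: "continuous_on UNIV n" unfolding n_def normal_density_def[abs_def] by (intro continuous_intros) auto
  have [measurable]: "n \<in> borel_measurable borel" using nc by (rule borel_measurable_continuous_onI)
  define M where "M = density lborel (\<lambda>x. ennreal (n x))"
  have "prob_space M" unfolding M_def n_def by (rule prob_space_normal_density) simp
  then have fin: "finite_measure M" by (simp add: prob_space_def)
  have sets: "sets M = sets borel" by (simp add: M_def)
  have int: "integrable M f \<longleftrightarrow> integrable lborel (\<lambda>x. n x * f x)" if "f \<in> borel_measurable borel" for f :: "real \<Rightarrow> real"
    unfolding M_def using that n0 by (subst integrable_density) (auto intro: less_imp_le)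
  have integ: "(\<integral>x. f x \<partial>M) = (\<integral>x. n x * f x \<partial>lborel)" if "f \<in> borel_measurable borel" for f :: "real \<Rightarrow> real"
    unfolding M_def using that n0 by (subst integral_density) (auto intro: less_imp_le)
  have nn: "n x \<noteq> 0" for x using n0[of x] by simp
  have "integrable M (\<lambda>x. w x / n x)" using w nn by (subst int) auto
  then obtain \<phi> R where phi: "continuous_on UNIV \<phi>" "\<And>x. R < \<bar>x\<bar> \<Longrightarrow> \<phi> x = 0" "integrable M \<phi>" "(\<integral>x. \<bar>w x / n x - \<phi> x\<bar> \<partial>M) < e"
    using L1_density_continuous[OF fin sets _ e] by blast
  have [measurable]: "\<phi> \<in> borel_measurable borel" using phi(1) by (rule borel_measurable_continuous_onI)
  have "(\<integral>x. \<bar>w x / n x - \<phi> x\<bar> \<partial>M) = (\<integral>x. \<bar>w x - n x * \<phi> x\<bar> \<partial>lborel)"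
  proof (subst integ)
    have "n x * \<bar>w x / n x - \<phi> x\<bar> = \<bar>w x - n x * \<phi> x\<bar>" for x
    proof -
      have "n x * \<bar>w x / n x - \<phi> x\<bar> = \<bar>n x * (w x / n x - \<phi> x)\<bar>" using n0[of x] by (simp add: abs_mult)
      also have "n x * (w x / n x - \<phi> x) = w x - n x * \<phi> x" using nn[of x] by (simp add: right_diff_distrib)
      finally show ?thesis .
    qed
    then show "(\<integral>x. n x * \<bar>w x / n x - \<phi> x\<bar> \<partial>lborel) = (\<integral>x. \<bar>w x - n x * \<phi> x\<bar> \<partial>lborel)" by simp
  qed measurable
  then show ?thesis using phi nc int[of \<phi>]
    by (intro exI[of _ "\<lambda>x. n x * \<phi> x"] conjI exI[of _ R]) (auto intro!: continuous_intros)
qed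

text \<open>If \<open>W\<close> is the antiderivative of \<open>w\<close> vanishing at minus
  infinity, this is \<open>W (t - s) - W t\<close>: the change of the distribution function when
  mass of density \<open>w\<close> is moved to the right by \<open>s\<close>.\<close>

definition shift_diff :: "(real \<Rightarrow> real) \<Rightarrow> real \<Rightarrow> real \<Rightarrow> real" where
  "shift_diff w s t = (\<integral>x. w x * (indicator {..t - s} x - indicator {..t} x) \<partial>lborel)"

text \<open>As a function of \<open>t\<close> for fixed \<open>x\<close>, the kernel is supported on
  an interval of length \<open>\<bar>s\<bar>\<close>; the companion lemma says the same with the
  roles exchanged. Fubini uses the former, pointwise estimates the latter.\<close>

lemma shift_kernel_abs:
  "\<bar>indicat_real {..t - s} x - indicator {..t} x\<bar> = indicator {min x (x + s)..<max x (x + s)} t" for x t s :: real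
  by (auto simp: indicator_def min_def max_def)

lemma shift_kernel_abs':
  "\<bar>indicat_real {..t - s} x - indicator {..t} x\<bar> = indicator {min t (t - s)<..max t (t - s)} x" for x t s :: real
  by (auto simp: indicator_def min_def max_def)

lemma shift_kernel_integrable:
  fixes w :: "real \<Rightarrow> real"
  assumes w: "integrable lborel w"
  shows "integrable lborel (\<lambda>x. w x * (indicat_real {..t - s} x - indicator {..t} x))"
proof (rule Bochner_Integration.integrable_bound[OF w])
  have [measurable]: "w \<in> borel_measurable borel" using borel_measurable_integrable[OF w] by simp
  show "(\<lambda>x. w x * (indicat_real {..t - s} x - indicator {..t} x)) \<in> borel_measurable lborel" by measurable
qed (auto simp: indicator_def)

lemma shift_kernel_integral: "(\<integral>x. indicat_real {..t - s} x - indicator {..t} x \<partial>lborel) = - s"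
proof (cases "s \<ge> 0")
  case True
  have "(\<lambda>x. indicat_real {..t - s} x - indicator {..t} x) = (\<lambda>x. - indicator {t - s<..t} x)" using True by (auto simp: indicator_def fun_eq_iff)
  then show ?thesis using True by (simp only:) simp
next
  case False
  have "(\<lambda>x. indicat_real {..t - s} x - indicator {..t} x) = (\<lambda>x. indicator {t<..t - s} x)" using False by (auto simp: indicator_def fun_eq_iff)
  then show ?thesis using False by (simp only:) simp
qed

lemma shift_diff_L1:
  assumes w: "integrable lborel w"
  shows "integrable lborel (shift_diff w s)" "(\<integral>t. \<bar>shift_diff w s t\<bar> \<partial>lborel) \<le> \<bar>s\<bar> * (\<integral>x. \<bar>w x\<bar> \<partial>lborel)"
proof -
  have [measurable]: "w \<in> borel_measurable borel" using borel_measurable_integrable[OF w] by simp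
  define f where "f x t = w x * (indicat_real {..t - s} x - indicator {..t} x)" for x t :: real
  have fabs: "\<bar>f x t\<bar> = \<bar>w x\<bar> * indicator {min x (x + s)..<max x (x + s)} t" for x t
    unfolding f_def abs_mult shift_kernel_abs ..
  have f_meas: "case_prod f \<in> borel_measurable (lborel \<Otimes>\<^sub>M lborel)"
  proof -
    have "case_prod f = (\<lambda>z. w (fst z) * ((if fst z \<le> snd z - s then 1 else 0) - (if fst z \<le> snd z then 1 else 0)))"
      by (auto simp: f_def fun_eq_iff indicator_def)
    then show ?thesis by simp
  qed
  have inner: "integrable lborel (\<lambda>t. \<bar>f x t\<bar>)" "(\<integral>t. \<bar>f x t\<bar> \<partial>lborel) = \<bar>w x\<bar> * \<bar>s\<bar>" for x
    unfolding fabs by (auto simp: min_def max_def)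
  have int: "integrable (lborel \<Otimes>\<^sub>M lborel) (case_prod f)"
  proof (rule lborel_pair.Fubini_integrable[OF f_meas])
    show "integrable lborel (\<lambda>x. \<integral>y. norm (case (x, y) of (x, xa) \<Rightarrow> f x xa) \<partial>lborel)"
      using w by (simp add: inner)
    have "integrable lborel (f x)" for x
    proof -
      have "(\<lambda>t. case_prod f (x, t)) \<in> borel_measurable lborel" using f_meas by (rule measurable_compose[rotated]) simp
      then show ?thesis using inner(1)[of x] by (simp add: integrable_abs_iff)
    qed
    then show "AE x in lborel. integrable lborel (\<lambda>y. case (x, y) of (x, xa) \<Rightarrow> f x xa)" by simp
  qed
  have int_abs: "integrable (lborel \<Otimes>\<^sub>M lborel) (case_prod (\<lambda>x t. \<bar>f x t\<bar>))"
    using integrable_abs[OF int] by (simp add: case_prod_unfold)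
  have sd: "shift_diff w s t = (\<integral>x. f x t \<partial>lborel)" for t by (simp add: shift_diff_def f_def)
  show 1: "integrable lborel (shift_diff w s)" unfolding sd[abs_def] by (rule lborel_pair.integrable_snd[OF int])
  have "(\<integral>t. \<bar>shift_diff w s t\<bar> \<partial>lborel) \<le> (\<integral>t. (\<integral>x. \<bar>f x t\<bar> \<partial>lborel) \<partial>lborel)"
  proof (rule integral_mono)
    show "integrable lborel (\<lambda>t. \<bar>shift_diff w s t\<bar>)" using 1 by simp
    show "integrable lborel (\<lambda>t. \<integral>x. \<bar>f x t\<bar> \<partial>lborel)" by (rule lborel_pair.integrable_snd[OF int_abs])
    show "\<bar>shift_diff w s t\<bar> \<le> (\<integral>x. \<bar>f x t\<bar> \<partial>lborel)" for t unfolding sd by (rule integral_abs_bound)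
  qed
  also have "\<dots> = (\<integral>x. (\<integral>t. \<bar>f x t\<bar> \<partial>lborel) \<partial>lborel)" by (rule lborel_pair.Fubini_integral[OF int_abs])
  also have "\<dots> = \<bar>s\<bar> * (\<integral>x. \<bar>w x\<bar> \<partial>lborel)" by (simp add: inner)
  finally show "(\<integral>t. \<bar>shift_diff w s t\<bar> \<partial>lborel) \<le> \<bar>s\<bar> * (\<integral>x. \<bar>w x\<bar> \<partial>lborel)" .
qed

lemma shift_diff_diff:
  assumes "integrable lborel w" "integrable lborel v"
  shows "shift_diff (\<lambda>x. w x - v x) s t = shift_diff w s t - shift_diff v s t"
  unfolding shift_diff_def using shift_kernel_integrable[OF assms(1), of t s] shift_kernel_integrable[OF assms(2), of t s]
  by (simp add: left_diff_distrib flip: Bochner_Integration.integral_diff)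

text \<open>The kernel has integral \<open>- s\<close> and lives within distance
  \<open>\<bar>s\<bar>\<close> of \<open>t\<close>, so the quantity is the integral of
  \<open>\<phi> x - \<phi> t\<close> against the kernel, which uniform continuity makes
  small.\<close>

lemma shift_diff_continuous:
  fixes \<phi> :: "real \<Rightarrow> real"
  assumes c: "continuous_on UNIV \<phi>" and supp: "\<And>x. R < \<bar>x\<bar> \<Longrightarrow> \<phi> x = 0" and int: "integrable lborel \<phi>" and e: "e > 0"
  shows "\<exists>s0>0. \<forall>s. \<bar>s\<bar> < s0 \<longrightarrow> (\<integral>t. \<bar>shift_diff \<phi> s t + s * \<phi> t\<bar> \<partial>lborel) \<le> e * \<bar>s\<bar>"
proof -
  \<comment> \<open>Shifts are taken shorter than 1: if
    \<open>\<bar>t\<bar> \<le> \<bar>R\<bar> + 1\<close>, both arguments lie in the ball of radius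
    \<open>B\<close>, and for other \<open>t\<close> both values of \<open>\<phi>\<close>
    vanish.\<close>
  define B where "B = \<bar>R\<bar> + 2"
  define e' where "e' = e / (2 * B)"
  have B: "B > 0" by (auto simp: B_def)
  have e': "e' > 0" using e B by (simp add: e'_def)
  have "uniformly_continuous_on (cball 0 B) \<phi>"
    by (intro compact_uniformly_continuous continuous_on_subset[OF c]) auto
  then obtain d where d: "d > 0" "\<And>x y. x \<in> cball 0 B \<Longrightarrow> y \<in> cball 0 B \<Longrightarrow> dist y x < d \<Longrightarrow> dist (\<phi> y) (\<phi> x) < e'"
    unfolding uniformly_continuous_on_def using e' by metis
  show ?thesis
  proof (intro exI[of _ "min d 1"] conjI allI impI)
    show "min d 1 > 0" using d by simp
    fix s :: real assume s: "\<bar>s\<bar> < min d 1"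
    have pt: "\<bar>shift_diff \<phi> s t + s * \<phi> t\<bar> \<le> e' * \<bar>s\<bar> * indicator {-B..B} t" for t
    proof -
      let ?k = "\<lambda>x. indicat_real {..t - s} x - indicator {..t} x"
      have kint: "integrable lborel (\<lambda>x. \<bar>?k x\<bar>)" unfolding shift_kernel_abs' by (auto simp: min_def max_def)
      have kabs: "(\<integral>x. \<bar>?k x\<bar> \<partial>lborel) = \<bar>s\<bar>" unfolding shift_kernel_abs' by (auto simp: min_def max_def)
      have kint': "integrable lborel ?k" using kint by (subst (asm) integrable_abs_iff) auto
      have i1: "integrable lborel (\<lambda>x. \<bar>\<phi> x * ?k x - \<phi> t * ?k x\<bar>)"
        by (intro integrable_abs Bochner_Integration.integrable_diff integrable_mult_right kint' shift_kernel_integrable[OF int])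
      have i2: "integrable lborel (\<lambda>x. e' * indicator {-B..B} t * \<bar>?k x\<bar>)" by (intro integrable_mult_right kint)
      have i3: "\<bar>\<phi> x * ?k x - \<phi> t * ?k x\<bar> \<le> e' * indicator {-B..B} t * \<bar>?k x\<bar>" for x
        proof (cases "?k x = 0")
          case False
          then have "\<bar>x - t\<bar> \<le> \<bar>s\<bar>" by (cases "x \<le> t - s"; cases "x \<le> t") auto
          then have xt: "\<bar>x - t\<bar> < d" "\<bar>x - t\<bar> < 1" using s by auto
          have "\<bar>\<phi> x - \<phi> t\<bar> \<le> e' * indicator {-B..B} t"
          proof (cases "\<bar>t\<bar> \<le> \<bar>R\<bar> + 1")
            case True
            then have "dist (\<phi> x) (\<phi> t) < e'" using xt by (intro d(2)) (auto simp: dist_real_def B_def)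
            then show ?thesis using True by (auto simp: dist_real_def B_def indicator_def)
          next
            case False
            then have "\<phi> x = 0" "\<phi> t = 0" using xt by (auto intro!: supp)
            then show ?thesis using e' by simp
          qed
          then have "\<bar>\<phi> x - \<phi> t\<bar> * \<bar>?k x\<bar> \<le> e' * indicator {-B..B} t * \<bar>?k x\<bar>" by (intro mult_right_mono) auto
          then show ?thesis by (simp add: abs_mult[symmetric] left_diff_distrib)
        qed simp
      have "shift_diff \<phi> s t + s * \<phi> t = (\<integral>x. \<phi> x * ?k x \<partial>lborel) - (\<integral>x. \<phi> t * ?k x \<partial>lborel)"
        using kint' by (simp add: shift_diff_def shift_kernel_integral)
      also have "\<dots> = (\<integral>x. \<phi> x * ?k x - \<phi> t * ?k x \<partial>lborel)"
        by (rule Bochner_Integration.integral_diff[symmetric]) (use kint' shift_kernel_integrable[OF int, of t s] in auto)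
      finally have "\<bar>shift_diff \<phi> s t + s * \<phi> t\<bar> \<le> (\<integral>x. \<bar>\<phi> x * ?k x - \<phi> t * ?k x\<bar> \<partial>lborel)"
        by (simp only: integral_abs_bound)
      also have "\<dots> \<le> (\<integral>x. e' * indicator {-B..B} t * \<bar>?k x\<bar> \<partial>lborel)"
        by (rule integral_mono[OF i1 i2 i3])
      also have "\<dots> = e' * \<bar>s\<bar> * indicator {-B..B} t" using kabs by simp
      finally show ?thesis .
    qed
    have "(\<integral>t. \<bar>shift_diff \<phi> s t + s * \<phi> t\<bar> \<partial>lborel) \<le> (\<integral>t. e' * \<bar>s\<bar> * indicator {-B..B} t \<partial>lborel)"
      using pt shift_diff_L1(1)[OF int, of s] int B by (intro integral_mono) auto
    also have "\<dots> = e' * \<bar>s\<bar> * (2 * B)" using B by simp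
    also have "\<dots> = e * \<bar>s\<bar>" using B by (simp add: e'_def)
    finally show "(\<integral>t. \<bar>shift_diff \<phi> s t + s * \<phi> t\<bar> \<partial>lborel) \<le> e * \<bar>s\<bar>" .
  qed
qed

text \<open>In \<open>L\<^sup>1\<close> the derivative at \<open>s = 0\<close> is
  \<open>- w\<close>. Both the difference and the candidate derivative are bounded by
  \<open>\<bar>s\<bar>\<close> times the \<open>L\<^sup>1\<close> norm of \<open>w\<close>, so
  continuous \<open>w\<close> with bounded support suffice; the three thirds of \<open>e\<close> pay
  for the two replacements and for that case.\<close>

theorem shift_diff_derivative:
  fixes w :: "real \<Rightarrow> real"
  assumes w: "integrable lborel w" and e: "e > 0"
  shows "\<exists>s0>0. \<forall>s. \<bar>s\<bar> < s0 \<longrightarrow> (\<integral>t. \<bar>shift_diff w s t + s * w t\<bar> \<partial>lborel) \<le> e * \<bar>s\<bar>"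
proof -
  obtain \<phi> R where phi: "continuous_on UNIV \<phi>" "\<And>x. R < \<bar>x\<bar> \<Longrightarrow> \<phi> x = 0" "integrable lborel \<phi>" 
      "(\<integral>x. \<bar>w x - \<phi> x\<bar> \<partial>lborel) < e / 3"
    using L1_lborel_density_continuous[OF w, of "e / 3"] e by auto
  obtain s0 where s0: "s0 > 0" "\<And>s. \<bar>s\<bar> < s0 \<Longrightarrow> (\<integral>t. \<bar>shift_diff \<phi> s t + s * \<phi> t\<bar> \<partial>lborel) \<le> e / 3 * \<bar>s\<bar>"
    using shift_diff_continuous[OF phi(1,2,3), of R "e / 3"] e by auto
  have dint: "integrable lborel (\<lambda>x. w x - \<phi> x)" using w phi(3) by simp
  show ?thesis
  proof (intro exI[of _ s0] conjI allI impI s0(1))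
    fix s assume s: "\<bar>s\<bar> < s0"
    have "(\<integral>t. \<bar>shift_diff w s t + s * w t\<bar> \<partial>lborel) \<le>
       (\<integral>t. \<bar>shift_diff (\<lambda>x. w x - \<phi> x) s t\<bar> + \<bar>shift_diff \<phi> s t + s * \<phi> t\<bar> + \<bar>s\<bar> * \<bar>w t - \<phi> t\<bar> \<partial>lborel)"
    proof (rule integral_mono)
      show "integrable lborel (\<lambda>t. \<bar>shift_diff w s t + s * w t\<bar>)" using shift_diff_L1(1)[OF w, of s] w by auto
      show "integrable lborel (\<lambda>t. \<bar>shift_diff (\<lambda>x. w x - \<phi> x) s t\<bar> + \<bar>shift_diff \<phi> s t + s * \<phi> t\<bar> + \<bar>s\<bar> * \<bar>w t - \<phi> t\<bar>)"
        using shift_diff_L1(1)[OF dint, of s] shift_diff_L1(1)[OF phi(3), of s] phi(3) dint by auto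
      fix t
      have "shift_diff w s t + s * w t = shift_diff (\<lambda>x. w x - \<phi> x) s t + (shift_diff \<phi> s t + s * \<phi> t) + s * (w t - \<phi> t)"
        unfolding shift_diff_diff[OF w phi(3)] by (simp add: algebra_simps)
      then show "\<bar>shift_diff w s t + s * w t\<bar> \<le> \<bar>shift_diff (\<lambda>x. w x - \<phi> x) s t\<bar> + \<bar>shift_diff \<phi> s t + s * \<phi> t\<bar> + \<bar>s\<bar> * \<bar>w t - \<phi> t\<bar>"
        by (simp add: abs_mult[symmetric])
    qed
    also have "\<dots> = (\<integral>t. \<bar>shift_diff (\<lambda>x. w x - \<phi> x) s t\<bar> \<partial>lborel) + (\<integral>t. \<bar>shift_diff \<phi> s t + s * \<phi> t\<bar> \<partial>lborel) + \<bar>s\<bar> * (\<integral>t. \<bar>w t - \<phi> t\<bar> \<partial>lborel)"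
      using shift_diff_L1(1)[OF dint, of s] shift_diff_L1(1)[OF phi(3), of s] phi(3) dint by simp
    also have "\<dots> \<le> \<bar>s\<bar> * (e / 3) + e / 3 * \<bar>s\<bar> + \<bar>s\<bar> * (e / 3)"
    proof (intro add_mono mult_left_mono s0(2) s)
      have "(\<integral>t. \<bar>shift_diff (\<lambda>x. w x - \<phi> x) s t\<bar> \<partial>lborel) \<le> \<bar>s\<bar> * (\<integral>x. \<bar>w x - \<phi> x\<bar> \<partial>lborel)"
        by (rule shift_diff_L1(2)[OF dint])
      also have "\<dots> \<le> \<bar>s\<bar> * (e / 3)" using phi(4) by (intro mult_left_mono) auto
      finally show "(\<integral>t. \<bar>shift_diff (\<lambda>x. w x - \<phi> x) s t\<bar> \<partial>lborel) \<le> \<bar>s\<bar> * (e / 3)" .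
    qed (use phi(4) in auto)
    also have "\<dots> = e * \<bar>s\<bar>" by simp
    finally show "(\<integral>t. \<bar>shift_diff w s t + s * w t\<bar> \<partial>lborel) \<le> e * \<bar>s\<bar>" .
  qed
qed

section \<open>Quantile transforms\<close>

context real_distribution
begin

text \<open>The probability integral transform: a continuous distribution function evaluated at its
  own variable is uniform. The intermediate value theorem supplies a point for every level in the
  open unit interval.\<close>

lemma cdf_le_measure:
  assumes cont: "continuous_on UNIV (cdf M)" and z: "0 \<le> z" "z \<le> 1"
  shows "measure M {y. cdf M y \<le> z} = z"
proof -
  have [measurable]: "cdf M \<in> borel_measurable borel" using cont by (rule borel_measurable_continuous_onI)
  have sp: "{y. cdf M y \<le> z} \<in> sets M" for z by simp
  have ivt: "\<exists>b. cdf M b = z" if z: "0 < z" "z < 1" for z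
  proof -
    obtain a where a: "cdf M a < z"
      using order_tendstoD(2)[OF cdf_lim_at_bot z(1)] by (metis eventually_happens' trivial_limit_at_bot_linorder)
    obtain b where b: "z < cdf M b"
      using order_tendstoD(1)[OF cdf_lim_at_top_prob z(2)] by (metis eventually_happens' trivial_limit_at_top_linorder)
    have "a \<le> b" using a b cdf_nondecreasing[of b a] by (meson le_cases less_trans not_le)
    then show ?thesis using IVT'[of "cdf M" a z b] a b continuous_on_subset[OF cont] by (metis less_imp_le subset_UNIV)
  qed
  have up: "measure M {y. cdf M y \<le> z} \<le> z'" if z: "0 \<le> z" "z < z'" "z' < 1" for z z'
  proof -
    obtain b where b: "cdf M b = z'" using ivt[of z'] z by auto
    have "{y. cdf M y \<le> z} \<subseteq> {..b}"
    proof
      fix y assume "y \<in> {y. cdf M y \<le> z}"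
      then have "cdf M y < cdf M b" using b z by simp
      then show "y \<in> {..b}" using cdf_nondecreasing[of b y] by (cases "y \<le> b") auto
    qed
    then have "measure M {y. cdf M y \<le> z} \<le> measure M {..b}" by (intro finite_measure_mono) auto
    then show ?thesis using b by (simp add: cdf_def)
  qed
  have up': "measure M {y. cdf M y \<le> z} \<le> z" if "0 \<le> z" "z < 1" for z
  proof (rule dense_ge_bounded[OF that(2)])
    fix x assume "z < x" "x < 1" then show "measure M {y. cdf M y \<le> z} \<le> x" using up[of z x] that by simp
  qed
  have lo: "z \<le> measure M {y. cdf M y \<le> z}" if z: "0 \<le> z" "z < 1" for z
  proof (cases "z = 0")
    case False
    then obtain b where b: "cdf M b = z" using ivt[of z] z by auto
    have "{..b} \<subseteq> {y. cdf M y \<le> z}" using b cdf_nondecreasing by auto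
    then have "measure M {..b} \<le> measure M {y. cdf M y \<le> z}" by (intro finite_measure_mono sp)
    then show ?thesis using b by (simp add: cdf_def)
  qed simp
  show ?thesis
  proof (cases "z = 1")
    case True
    have "{y. cdf M y \<le> z} = space M" using True cdf_bounded_prob by auto
    then show ?thesis using True prob_space by simp
  next
    case False
    then show ?thesis using up'[of z] lo[of z] z by auto
  qed
qed

lemma AE_cdf_in_unit:
  assumes cont: "continuous_on UNIV (cdf M)"
  shows "AE y in M. 0 < cdf M y \<and> cdf M y < 1"
proof -
  have [measurable]: "cdf M \<in> borel_measurable borel" using cont by (rule borel_measurable_continuous_onI)
  have "measure M {y. cdf M y \<le> 0} = 0" using cdf_le_measure[OF cont, of 0] by simp
  then have "AE y in M. \<not> cdf M y \<le> 0" by (intro AE_I[where N="{y. cdf M y \<le> 0}"]) (auto simp: emeasure_eq_measure)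
  moreover have "measure M {y. cdf M y < 1} \<ge> z" if z: "0 \<le> z" "z < 1" for z
  proof -
    have "measure M {y. cdf M y \<le> z} \<le> measure M {y. cdf M y < 1}" using z by (intro finite_measure_mono) auto
    then show ?thesis using cdf_le_measure[OF cont, of z] z by simp
  qed
  then have "1 \<le> measure M {y. cdf M y < 1}" by (intro dense_le_bounded[of 0 1]) auto
  then have "measure M {y. cdf M y < 1} = 1" using measure_le_1 by (intro antisym) auto
  then have "AE y in M. y \<in> {y. cdf M y < 1}" by (subst prob_eq_1[symmetric]) auto
  ultimately show ?thesis by eventually_elim auto
qed

end

context cdf_distribution
begin

text \<open>The generalized inverse of the distribution function, extended by 0 to make it Borel on
  the whole line. Levels outside the open unit interval are reached with probability 0 when the
  level comes from a continuous distribution function.\<close>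

definition quantile :: "real \<Rightarrow> real" where "quantile z = (if z \<in> {0<..<1} then I z else 0)"

lemma quantile_le_iff: "0 < z \<Longrightarrow> z < 1 \<Longrightarrow> quantile z \<le> x \<longleftrightarrow> z \<le> cdf M x"
  using pseudoinverse[of z x] by (simp add: quantile_def)

lemma quantile_measurable [measurable]: "quantile \<in> borel_measurable borel"
  unfolding quantile_def[abs_def]
  using measurable_restrict_space_iff[of "{0<..<1::real}" borel "0::real" borel I] measurable_CI by simp

lemma quantile_transform:
  assumes N: "real_distribution N" and cont: "continuous_on UNIV (cdf N)"
  shows "distr N borel (\<lambda>y. quantile (cdf N y)) = M"
proof -
  interpret N: real_distribution N by fact
  have [measurable]: "cdf N \<in> borel_measurable borel" using cont by (rule borel_measurable_continuous_onI)
  have m: "(\<lambda>y. quantile (cdf N y)) \<in> borel_measurable N" by measurable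
  interpret D: real_distribution "distr N borel (\<lambda>y. quantile (cdf N y))" using m by (rule N.real_distribution_distr)
  show ?thesis
  proof (rule cdf_unique[OF D.real_distribution_axioms real_distribution_axioms], rule ext)
    fix t
    have "cdf (distr N borel (\<lambda>y. quantile (cdf N y))) t = measure N {y. quantile (cdf N y) \<le> t}"
      unfolding cdf_def[of "distr N borel _"] by (subst measure_distr[OF m]) (auto simp: vimage_def)
    also have "\<dots> = measure N {y. cdf N y \<le> cdf M t}"
    proof (rule N.finite_measure_eq_AE)
      show "AE x in N. (x \<in> {y. quantile (cdf N y) \<le> t}) = (x \<in> {y. cdf N y \<le> cdf M t})"
        using N.AE_cdf_in_unit[OF cont] by eventually_elim (auto simp: quantile_le_iff)
    qed auto
    also have "\<dots> = cdf M t" by (rule N.cdf_le_measure[OF cont]) (auto simp: cdf_nonneg cdf_bounded_prob)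
    finally show "cdf (distr N borel (\<lambda>y. quantile (cdf N y))) t = cdf M t" .
  qed
qed

text \<open>Pointwise the quantile of the level of \<open>x\<close> is at most \<open>x\<close>, and
  both have the same law; an ordering between equally distributed variables is an equality. The
  bounded, strictly increasing \<open>arctan\<close> makes this argument free of moments.\<close>

lemma AE_quantile_cdf:
  assumes cont: "continuous_on UNIV (cdf M)"
  shows "AE x in M. quantile (cdf M x) = x"
proof -
  have eq: "distr M borel (\<lambda>y. quantile (cdf M y)) = M" by (rule quantile_transform[OF real_distribution_axioms cont])
  have le: "AE x in M. quantile (cdf M x) \<le> x" using AE_cdf_in_unit[OF cont]
    by eventually_elim (auto simp: quantile_le_iff)
  have ab: "\<bar>arctan x\<bar> \<le> pi" for x using arctan_lbound[of x] arctan_ubound[of x] by (auto simp: abs_le_iff)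
  have int1: "integrable M (\<lambda>x. arctan x)" by (intro integrable_const_bound[where B=pi]) (auto simp: ab)
  have int2: "integrable M (\<lambda>x. arctan (quantile (cdf M x)))" by (intro integrable_const_bound[where B=pi]) (auto simp: ab)
  have "(\<integral>x. arctan x \<partial>M) = (\<integral>x. arctan x \<partial>distr M borel (\<lambda>y. quantile (cdf M y)))" by (simp only: eq)
  also have "\<dots> = (\<integral>x. arctan (quantile (cdf M x)) \<partial>M)" by (rule integral_distr) auto
  finally have "(\<integral>x. arctan x - arctan (quantile (cdf M x)) \<partial>M) = 0" using int1 int2 by simp
  moreover have "AE x in M. 0 \<le> arctan x - arctan (quantile (cdf M x))" using le by eventually_elim (simp add: arctan_le_iff)
  moreover have "integrable M (\<lambda>x. arctan x - arctan (quantile (cdf M x)))" using int1 int2 by simp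
  ultimately have "AE x in M. arctan x - arctan (quantile (cdf M x)) = 0"
    by (subst (asm) integral_nonneg_eq_0_iff_AE) auto
  then show ?thesis by eventually_elim (simp add: arctan_eq_iff)
qed

end

section \<open>Intervals differ from their interior by at most two points\<close>

lemma finite_interval_boundary:
  fixes I :: "real set"
  assumes "is_interval I"
  shows "finite (I - interior I)"
proof -
  have "I - interior I \<subseteq> {x\<in>I. \<forall>y\<in>I. x \<le> y} \<union> {x\<in>I. \<forall>y\<in>I. y \<le> x}"
  proof
    fix x assume x: "x \<in> I - interior I"
    show "x \<in> {x\<in>I. \<forall>y\<in>I. x \<le> y} \<union> {x\<in>I. \<forall>y\<in>I. y \<le> x}"
    proof (rule ccontr)
      assume "\<not> ?thesis"
      then obtain y z where yz: "y \<in> I" "z \<in> I" "y < x" "x < z" using x by (auto simp: not_le)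
      have "{y<..<z} \<subseteq> I" using mem_is_interval_1_I[OF assms yz(1,2)] by (auto intro: less_imp_le)
      then have "x \<in> interior I" using yz by (intro interiorI[of "{y<..<z}"]) auto
      then show False using x by simp
    qed
  qed
  moreover have "finite {x\<in>I. \<forall>y\<in>I. x \<le> y}"
  proof (cases "{x\<in>I. \<forall>y\<in>I. x \<le> y} = {}")
    case False
    then obtain a where "a \<in> {x\<in>I. \<forall>y\<in>I. x \<le> y}" by blast
    then have "{x\<in>I. \<forall>y\<in>I. x \<le> y} \<subseteq> {a}" by (auto intro: antisym)
    then show ?thesis by (rule finite_subset) simp
  next
    case True
    then show ?thesis by (simp only: finite.emptyI)
  qed
  moreover have "finite {x\<in>I. \<forall>y\<in>I. y \<le> x}"
  proof (cases "{x\<in>I. \<forall>y\<in>I. y \<le> x} = {}")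
    case False
    then obtain a where "a \<in> {x\<in>I. \<forall>y\<in>I. y \<le> x}" by blast
    then have "{x\<in>I. \<forall>y\<in>I. y \<le> x} \<subseteq> {a}" by (auto intro: antisym)
    then show ?thesis by (rule finite_subset) simp
  next
    case True
    then show ?thesis by (simp only: finite.emptyI)
  qed
  ultimately show ?thesis by (meson finite_UnI finite_subset)
qed

lemma interval_borel: "is_interval (I :: real set) \<Longrightarrow> I \<in> sets borel"
proof -
  assume "is_interval I"
  then have "I - interior I \<in> sets borel" using finite_interval_boundary[of I] by (simp add: finite_imp_closed borel_closed)
  moreover have "I = interior I \<union> (I - interior I)" using interior_subset by auto
  ultimately show ?thesis by (metis borel_open open_interior sets.Un)
qed

section \<open>Perturbations with a prescribed marginal\<close>

text \<open>One coordinate whose law has a continuous density on an interval. It is instantiated for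
  the second coordinate with either distance, and for the first with \<open>Wass\<close>.\<close>

locale coord_density = coord \<mu> X e for \<mu> :: "plane measure" and X e +
  fixes J :: "real set" and q0 :: "real \<Rightarrow> real"
  assumes J: "is_interval J" and q0_cont: "continuous_on J q0" and q0_nonneg: "\<And>x. x \<in> J \<Longrightarrow> 0 \<le> q0 x"
    and dens: "distr \<mu> borel X = density lborel (\<lambda>x. ennreal (q0 x) * indicator J x)"
begin

definition dq :: "real \<Rightarrow> real" where "dq x = indicator J x * q0 x"

lemma dq_meas [measurable]: "dq \<in> borel_measurable borel"
  using borel_measurable_continuous_on_indicator[OF interval_borel[OF J] q0_cont] by (simp add: dq_def[abs_def])

lemma dq_nonneg [simp]: "dq x \<ge> 0" using q0_nonneg by (auto simp: dq_def indicator_def)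

lemma \<nu>_density: "\<nu> = density lborel (\<lambda>x. ennreal (dq x))"
proof -
  have "ennreal (q0 x) * indicator J x = ennreal (dq x)" for x by (auto simp: dq_def indicator_def)
  then show ?thesis using dens by simp
qed

lemma integrable_X_iff: "f \<in> borel_measurable borel \<Longrightarrow> integrable \<mu> (\<lambda>x. f (X x) :: real) \<longleftrightarrow> integrable lborel (\<lambda>x. dq x * f x)"
proof -
  assume f: "f \<in> borel_measurable borel"
  have "integrable \<mu> (\<lambda>x. f (X x)) \<longleftrightarrow> integrable \<nu> f" using f by (simp add: integrable_distr_eq)
  also have "\<dots> \<longleftrightarrow> integrable lborel (\<lambda>x. dq x * f x)" unfolding \<nu>_density using f by (subst integrable_density) auto
  finally show ?thesis .
qed

lemma expectation_X: "f \<in> borel_measurable borel \<Longrightarrow> (\<integral>x. f (X x) \<partial>\<mu>) = (\<integral>x. dq x * f x \<partial>lborel :: real)"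
proof -
  assume f: "f \<in> borel_measurable borel"
  have "(\<integral>x. f (X x) \<partial>\<mu>) = (\<integral>x. f x \<partial>\<nu>)" using f by (simp add: integral_distr)
  also have "\<dots> = (\<integral>x. dq x * f x \<partial>lborel)" unfolding \<nu>_density using f by (subst integral_density) auto
  finally show ?thesis .
qed

lemma AE_X_iff: "Measurable.pred borel P \<Longrightarrow> (AE x in \<mu>. P (X x)) \<longleftrightarrow> (AE x in lborel. 0 < dq x \<longrightarrow> P x)"
  using AE_comp_iff[of P] unfolding \<nu>_density by (subst (asm) AE_density) auto

lemma dq_integrable: "integrable lborel dq"
  using integrable_X_iff[of "\<lambda>_. 1"] by simp

lemma \<nu>_real_distribution: "real_distribution \<nu>" by (rule real_distribution_distr) simp

sublocale Q: cdf_distribution \<nu> by (simp add: cdf_distribution_def \<nu>_real_distribution)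

lemma prob_X_singleton: "measure \<mu> {x. X x = a} = 0"
proof -
  have "measure \<mu> {x. X x = a} = (\<integral>x. indicator {a} (X x) \<partial>\<mu>)" 
    by (subst Bochner_Integration.integral_cong[of \<mu> \<mu> _ "indicator {x. X x = a}"]) (auto simp: indicator_def sets_eq)
  also have "\<dots> = (\<integral>x. dq x * indicator {a} x \<partial>lborel)" by (rule expectation_X) simp
  also have "\<dots> = (\<integral>x. 0 \<partial>(lborel :: real measure))"
    using AE_lborel_singleton[of a] by (intro integral_cong_AE) (auto elim!: eventually_mono simp: indicator_def)
  finally show ?thesis by simp
qed

lemma cdf_continuous_of_atomless:
  assumes [measurable]: "Y \<in> borel_measurable borel" and at: "\<And>a. measure \<mu> {x. Y x = a} = 0"
  shows "continuous_on UNIV (cdf (distr \<mu> borel Y))"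
proof -
  interpret N: real_distribution "distr \<mu> borel Y" by (rule real_distribution_distr) simp
  have "measure (distr \<mu> borel Y) {a} = 0" for a
    using at[of a] by (subst measure_distr) (auto simp: vimage_def)
  then show ?thesis using N.isCont_cdf by (simp add: continuous_on_eq_continuous_at)
qed

lemma cdf_distr_eq:
  assumes [measurable]: "Y \<in> borel_measurable borel"
  shows "cdf (distr \<mu> borel Y) t = (\<integral>x. indicator {..t} (Y x) \<partial>\<mu>)"
proof -
  have "(\<integral>x. indicator {..t} (Y x) \<partial>\<mu>) = (\<integral>y. indicat_real {..t} y \<partial>distr \<mu> borel Y)"
    by (rule integral_distr[symmetric]) auto
  then show ?thesis by (simp add: cdf_def)
qed

abbreviation F\<nu> :: "real \<Rightarrow> real" where "F\<nu> \<equiv> cdf \<nu>"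

lemma F_cont: "continuous_on UNIV F\<nu>"
  by (rule cdf_continuous_of_atomless) (auto simp: prob_X_singleton)

lemma F_eq: "F\<nu> t = (\<integral>x. dq x * indicator {..t} x \<partial>lborel)"
proof -
  have "F\<nu> t = (\<integral>x. indicator {..t} (X x) \<partial>\<mu>)"
    by (rule cdf_distr_eq) measurable
  then show ?thesis using expectation_X[of "indicator {..t}"] by simp
qed

lemma F_increment:
  assumes "a \<le> b" and le: "\<And>x. x \<in> {a..b} \<Longrightarrow> \<delta> \<le> dq x"
  shows "F\<nu> a + \<delta> * (b - a) \<le> F\<nu> b"
proof -
  have i: "integrable lborel (\<lambda>x. dq x * indicat_real A x)" if "A \<in> sets borel" for A
    using integrable_mult_indicator[OF _ dq_integrable, of A] that by (simp add: mult.commute)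
  have ii: "integrable lborel (\<lambda>x. indicat_real {a<..b} x)" 
    by (rule integrable_real_indicator) (auto simp: assms(1))
  have "\<delta> * (b - a) = (\<integral>x. \<delta> * indicator {a<..b} x \<partial>lborel)" using assms(1) by simp
  also have "\<dots> \<le> (\<integral>x. dq x * indicator {a<..b} x \<partial>lborel)"
    by (intro integral_mono i integrable_mult_right ii) (use le in \<open>auto simp: indicator_def\<close>)
  also have "\<dots> = (\<integral>x. dq x * indicator {..b} x - dq x * indicator {..a} x \<partial>lborel)"
    using assms(1) by (intro Bochner_Integration.integral_cong) (auto simp: indicator_def)
  also have "\<dots> = F\<nu> b - F\<nu> a" unfolding F_eq by (rule Bochner_Integration.integral_diff) (auto intro: i)
  finally show ?thesis by simp
qed

text \<open>This set is open and carries the law of \<open>X\<close>, hence is exhausted by compact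
  sets on which the density is bounded above and away from 0.\<close>

definition U :: "real set" where "U = {x \<in> interior J. 0 < q0 x}"

lemma open_U: "open U"
proof -
  have "open (interior J \<inter> q0 -` {0<..})"
    by (rule continuous_open_preimage[OF continuous_on_subset[OF q0_cont interior_subset]]) auto
  moreover have "U = interior J \<inter> q0 -` {0<..}" by (auto simp: U_def)
  ultimately show ?thesis by simp
qed

lemma U_borel [measurable]: "U \<in> sets borel" using open_U by (rule borel_open)

lemma U_subset: "U \<subseteq> J" using subsetD[OF interior_subset] by (auto simp: U_def)

lemma dq_U: "x \<in> U \<Longrightarrow> dq x = q0 x" using subsetD[OF U_subset, of x] by (auto simp: dq_def)

lemma AE_X_U: "AE x in \<mu>. X x \<in> U"
proof (subst AE_X_iff)
  have "AE x in lborel. x \<notin> J - interior J"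
    using finite_interval_boundary[OF J] by (intro AE_not_in finite_imp_null_set_lborel)
  then show "AE x in lborel. 0 < dq x \<longrightarrow> x \<in> U"
    by eventually_elim (auto simp: dq_def U_def indicator_def split: if_splits)
qed simp

text \<open>\<open>X'\<close> is the monotone rearrangement of \<open>Y\<close>. Around
  \<open>K\<close> the target distribution function grows with slope at least
  \<open>\<delta>\<close>, so an error in the level displaces the quantile by at most that error
  divided by \<open>\<delta>\<close>. Off \<open>K\<close> the levels agree and nothing
  moves.\<close>

lemma rearrangement:
  fixes Y :: "plane \<Rightarrow> real" and K :: "real set"
  defines "G \<equiv> cdf (distr \<mu> borel Y)"
  assumes Y[measurable]: "Y \<in> borel_measurable borel" and at: "\<And>a. measure \<mu> {x. Y x = a} = 0"
    and \<delta>: "\<delta> > 0" and h: "h > 0"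
    and incr: "\<And>y s. y \<in> K \<Longrightarrow> 0 \<le> s \<Longrightarrow> s \<le> h \<Longrightarrow> F\<nu> y + \<delta> * s \<le> F\<nu> (y + s) \<and> F\<nu> (y - s) + \<delta> * s \<le> F\<nu> y"
    and close: "\<And>y. y \<in> K \<Longrightarrow> \<bar>G y - F\<nu> y\<bar> < \<delta> * h"
    and off: "\<And>y. y \<notin> K \<Longrightarrow> G y = F\<nu> y" and same: "\<And>x. Y x \<notin> K \<Longrightarrow> Y x = X x"
  shows "\<exists>X'\<in>borel_measurable borel. distr \<mu> borel X' = \<nu> \<and> (AE x in \<mu>. \<bar>X' x - Y x\<bar> \<le> \<bar>G (Y x) - F\<nu> (Y x)\<bar> / \<delta>)"
proof -
  interpret N: real_distribution "distr \<mu> borel Y" by (rule real_distribution_distr) simp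
  have cG: "continuous_on UNIV G" unfolding G_def by (rule cdf_continuous_of_atomless[OF Y at])
  have [measurable]: "G \<in> borel_measurable borel" using cG by (rule borel_measurable_continuous_onI)
  define X' where "X' x = Q.quantile (G (Y x))" for x
  have [measurable]: "X' \<in> borel_measurable borel" unfolding X'_def by measurable
  have "distr (distr \<mu> borel Y) borel (\<lambda>y. Q.quantile (G y)) = distr \<mu> borel ((\<lambda>y. Q.quantile (G y)) \<circ> Y)"
    by (rule distr_distr) auto
  then have law: "distr \<mu> borel X' = \<nu>"
    using Q.quantile_transform[OF N.real_distribution_axioms] cG unfolding G_def X'_def by (simp add: o_def)
  have m1: "Measurable.pred borel (\<lambda>y. 0 < G y \<and> G y < 1)" by measurable
  have unit: "AE x in \<mu>. 0 < G (Y x) \<and> G (Y x) < 1"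
    using N.AE_cdf_in_unit[OF cG[unfolded G_def]] unfolding G_def[symmetric]
    by (subst (asm) AE_distr_iff) (use m1 in auto)
  have [measurable]: "F\<nu> \<in> borel_measurable borel" using F_cont by (rule borel_measurable_continuous_onI)
  have qX: "AE x in \<mu>. Q.quantile (F\<nu> (X x)) = X x"
    using Q.AE_quantile_cdf[OF F_cont] by (subst (asm) AE_distr_iff) auto
  have "AE x in \<mu>. \<bar>X' x - Y x\<bar> \<le> \<bar>G (Y x) - F\<nu> (Y x)\<bar> / \<delta>"
    using unit qX
  proof eventually_elim
    case (elim x)
    define y z where "y = Y x" and "z = G y"
    have z: "0 < z" "z < 1" using elim by (auto simp: y_def z_def)
    show ?case
    proof (cases "y \<in> K")
      case False
      have "G y = F\<nu> y" "y = X x" using off[OF False] same[of x] False by (auto simp: y_def)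
      then show ?thesis using elim by (simp add: X'_def y_def)
    next
      case True
      define s where "s = \<bar>z - F\<nu> y\<bar> / \<delta>"
      have s: "0 \<le> s" "s < h" using close[OF True] \<delta> by (auto simp: s_def z_def field_simps)
      have ds: "\<delta> * s = \<bar>z - F\<nu> y\<bar>" using \<delta> by (simp add: s_def)
      have "z \<le> F\<nu> (y + s)" using incr[OF True s(1)] s ds by auto
      then have up: "Q.quantile z \<le> y + s" using Q.quantile_le_iff[OF z] by simp
      have lo: "y - s \<le> Q.quantile z"
      proof (rule ccontr)
        assume "\<not> ?thesis"
        then have lt: "Q.quantile z < y - s" by simp
        \<comment> \<open>The slope is controlled only up to distance \<open>h\<close>, so a
          quantile lying further away is compared at the capped distance; strictness
          \<open>s < h\<close> keeps the contradiction.\<close>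
        define t where "t = min h (y - Q.quantile z)"
        have t: "s < t" "t \<le> h" "0 \<le> t" using lt s by (auto simp: t_def)
        have "z \<le> F\<nu> (Q.quantile z)" using Q.quantile_le_iff[OF z, of "Q.quantile z"] by simp
        also have "\<dots> \<le> F\<nu> (y - t)" by (rule Q.cdf_nondecreasing) (auto simp: t_def)
        also have "\<dots> \<le> F\<nu> y - \<delta> * t" using incr[OF True t(3,2)] by simp
        also have "\<dots> < F\<nu> y - \<delta> * s" using t \<delta> by simp
        also have "\<dots> \<le> z" using ds by linarith
        finally show False by simp
      qed
      have "\<bar>Q.quantile z - y\<bar> \<le> s" using up lo by (simp add: abs_le_iff)
      then show ?thesis by (simp add: X'_def s_def y_def z_def)
    qed
  qed
  then show ?thesis using law by (intro bexI[of _ X']) auto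
qed

text \<open>Mass with label \<open>k\<close> is translated by \<open>r * (\<eta> * k)\<close> as a
  whole. Its share of the law of \<open>X\<close> has as density \<open>w k\<close> the density of
  \<open>X\<close> times the conditional probability of the label.\<close>

lemma cdf_label_diff:
  fixes L :: "plane \<Rightarrow> int" and \<eta> r :: real
  assumes L: "L \<in> measurable borel (count_space UNIV)" and Z: "finite Z" "\<And>x. L x \<in> Z"
  defines "w \<equiv> \<lambda>k t. dq t * ce (\<lambda>x. indicator {k} (L x)) t"
  shows "integrable lborel (w k)"
    "cdf (distr \<mu> borel (\<lambda>x. X x + r * (\<eta> * L x))) t - F\<nu> t = (\<Sum>k\<in>Z. shift_diff (w k) (r * (\<eta> * k)) t)"
proof -
  have indm[measurable]: "(\<lambda>x. indicat_real {k} (L x)) \<in> borel_measurable borel" for k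
    by (rule measurable_compose[OF L]) simp
  have Lreal[measurable]: "(\<lambda>x. real_of_int (L x)) \<in> borel_measurable borel"
    by (rule measurable_compose[OF L]) simp
  have indi: "integrable \<mu> (\<lambda>x. indicat_real {k} (L x))" for k
    by (rule integrable_const_bound[where B=1]) (simp add: indicator_def, measurable)
  have wi: "integrable lborel (w k)" for k
  proof -
    have "integrable \<mu> (\<lambda>x. ce (\<lambda>x. indicator {k} (L x)) (X x))"
      using cexp_integrable[OF indi[of k]] unfolding cexp_factor[abs_def] .
    then show ?thesis unfolding w_def by (subst (asm) integrable_X_iff) auto
  qed
  then show "integrable lborel (w k)" .
  have key: "(\<integral>x. indicator {..a} (X x) * indicator {k} (L x) \<partial>\<mu>) = (\<integral>x. w k x * indicator {..a} x \<partial>lborel)" for a k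
  proof -
    have "integrable \<mu> (\<lambda>x. indicat_real {..a} (X x) * indicator {k} (L x))"
      by (rule integrable_const_bound[where B=1]) (simp add: indicator_def, measurable)
    then have "(\<integral>x. indicator {..a} (X x) * indicator {k} (L x) \<partial>\<mu>) = (\<integral>x. indicator {..a} (X x) * cexp \<mu> X (\<lambda>x. indicator {k} (L x)) x \<partial>\<mu>)"
      by (subst cexp_integral(2)) auto
    also have "\<dots> = (\<integral>x. indicator {..a} (X x) * ce (\<lambda>x. indicator {k} (L x)) (X x) \<partial>\<mu>)" by (simp add: cexp_factor)
    also have "\<dots> = (\<integral>x. dq x * (indicator {..a} x * ce (\<lambda>x. indicator {k} (L x)) x) \<partial>lborel)"
      by (rule expectation_X) measurable
    also have "\<dots> = (\<integral>x. w k x * indicator {..a} x \<partial>lborel)" by (simp add: w_def mult_ac)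
    finally show ?thesis .
  qed
  have prodint: "integrable \<mu> (\<lambda>x. indicat_real {..a} (X x) * indicator {k} (L x))" for a k
    by (rule integrable_const_bound[where B=1]) (simp add: indicator_def, measurable)
  have one: "(\<Sum>k\<in>Z. f k * indicat_real {k} (L x)) = f (L x)" for f x
    using Z by (subst sum.remove[of Z "L x"]) (auto intro!: sum.neutral)
  have [measurable]: "(\<lambda>x. X x + r * (\<eta> * real_of_int (L x))) \<in> borel_measurable borel" by measurable
  have "cdf (distr \<mu> borel (\<lambda>x. X x + r * (\<eta> * L x))) t = (\<integral>x. indicator {..t} (X x + r * (\<eta> * L x)) \<partial>\<mu>)"
    by (rule cdf_distr_eq) measurable
  also have "\<dots> = (\<integral>x. (\<Sum>k\<in>Z. indicator {..t - r * (\<eta> * k)} (X x) * indicat_real {k} (L x)) \<partial>\<mu>)"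
    unfolding one by (intro Bochner_Integration.integral_cong) (auto simp: indicator_def)
  also have "\<dots> = (\<Sum>k\<in>Z. \<integral>x. w k x * indicator {..t - r * (\<eta> * k)} x \<partial>lborel)"
    using prodint by (subst Bochner_Integration.integral_sum) (auto simp: key)
  finally have 1: "cdf (distr \<mu> borel (\<lambda>x. X x + r * (\<eta> * L x))) t = \<dots>" .
  have "F\<nu> t = (\<integral>x. indicator {..t} (X x) \<partial>\<mu>)"
    by (rule cdf_distr_eq) measurable
  also have "\<dots> = (\<integral>x. (\<Sum>k\<in>Z. indicator {..t} (X x) * indicat_real {k} (L x)) \<partial>\<mu>)"
    unfolding one ..
  also have "\<dots> = (\<Sum>k\<in>Z. \<integral>x. w k x * indicator {..t} x \<partial>lborel)"
    using prodint by (subst Bochner_Integration.integral_sum) (auto simp: key)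
  finally have 2: "F\<nu> t = \<dots>" .
  have i: "integrable lborel (\<lambda>x. w k x * indicat_real A x)" if "A \<in> sets borel" for A k
    using integrable_mult_indicator[OF _ wi[of k], of A] that by (simp add: mult.commute)
  have "shift_diff (w k) s t = (\<integral>x. w k x * indicator {..t - s} x \<partial>lborel) - (\<integral>x. w k x * indicator {..t} x \<partial>lborel)" for k s
    unfolding shift_diff_def right_diff_distrib by (rule Bochner_Integration.integral_diff) (auto intro: i)
  then show "cdf (distr \<mu> borel (\<lambda>x. X x + r * (\<eta> * L x))) t - F\<nu> t = (\<Sum>k\<in>Z. shift_diff (w k) (r * (\<eta> * k)) t)"
    unfolding 1 2 by (simp add: sum_subtractf)
qed

end

section \<open>Perturbation by a bounded field supported over a compact set\<close>

context coord_density
begin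

text \<open>The sum is the density of \<open>X\<close> times the conditional mean of
  \<open>\<eta> * L\<close>. Conditional expectation preserves the bounds on
  \<open>\<eta> * L - T\<close>, and the conditional mean of \<open>T\<close> vanishes.\<close>

lemma weighted_label_bound:
  fixes L :: "plane \<Rightarrow> int" and \<eta> :: real
  assumes L: "L \<in> measurable borel (count_space UNIV)" and Z: "finite Z" "\<And>x. L x \<in> Z"
    and T: "integrable \<mu> T" "AE x in \<mu>. cexp \<mu> X T x = 0" and near: "\<And>x. \<bar>\<eta> * L x - T x\<bar> \<le> \<eta>"
  shows "AE t in lborel. \<bar>\<Sum>k\<in>Z. \<eta> * k * (dq t * ce (\<lambda>x. indicator {k} (L x)) t)\<bar> \<le> \<eta> * dq t"
proof -
  have indm[measurable]: "(\<lambda>x. indicat_real {k} (L x)) \<in> borel_measurable borel" for k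
    by (rule measurable_compose[OF L]) simp
  have Lreal[measurable]: "(\<lambda>x. real_of_int (L x)) \<in> borel_measurable borel"
    by (rule measurable_compose[OF L]) simp
  have indi: "integrable \<mu> (\<lambda>x. indicat_real {k} (L x))" for k
    by (rule integrable_const_bound[where B=1]) (simp add: indicator_def, measurable)
  have cei: "integrable \<mu> (\<lambda>x. ce (\<lambda>x. indicator {k} (L x)) (X x))" for k
    using cexp_integrable[OF indi[of k]] unfolding cexp_factor[abs_def] .
  define c where "c t = (\<Sum>k\<in>Z. \<eta> * k * ce (\<lambda>x. indicator {k} (L x)) t)" for t
  have [measurable]: "c \<in> borel_measurable borel" unfolding c_def by measurable
  have ci: "integrable \<mu> (\<lambda>x. c (X x))" unfolding c_def using cei by auto
  have one: "(\<Sum>k\<in>Z. f k * indicat_real {k} (L x)) = f (L x)" for f x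
    using Z by (subst sum.remove[of Z "L x"]) (auto intro!: sum.neutral)
  have Ldec: "\<eta> * L x = (\<Sum>k\<in>Z. (\<eta> * k) * indicat_real {k} (L x))" for x unfolding one ..
  have Li: "integrable \<mu> (\<lambda>x. \<eta> * real_of_int (L x))" unfolding Ldec using indi by auto
  have cX: "AE x in \<mu>. cexp \<mu> X (\<lambda>x. \<eta> * L x) x = c (X x)"
  proof (rule cexp_char[OF Li ci])
    fix A :: "real set" assume [measurable]: "A \<in> sets borel"
    have pi: "integrable \<mu> (\<lambda>x. indicat_real A (X x) * indicator {k} (L x))" for k
      by (rule integrable_const_bound[where B=1]) (simp add: indicator_def, measurable)
    have pc: "integrable \<mu> (\<lambda>x. indicat_real A (X x) * ce (\<lambda>x. indicator {k} (L x)) (X x))" for k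
      by (rule Bochner_Integration.integrable_bound[OF cei[of k]]) (measurable, simp add: indicator_def)
    have eq: "(\<integral>x. indicat_real A (X x) * indicator {k} (L x) \<partial>\<mu>) = (\<integral>x. indicat_real A (X x) * ce (\<lambda>x. indicator {k} (L x)) (X x) \<partial>\<mu>)" for k
      using cexp_integral(2)[OF pi[of k]] by (simp add: cexp_factor)
    have "(\<integral>x. indicator A (X x) * (\<eta> * L x) \<partial>\<mu>) = (\<integral>x. (\<Sum>k\<in>Z. \<eta> * k * (indicator A (X x) * indicator {k} (L x))) \<partial>\<mu>)"
      unfolding Ldec by (simp add: sum_distrib_left mult_ac)
    also have "\<dots> = (\<Sum>k\<in>Z. \<eta> * k * (\<integral>x. indicator A (X x) * indicator {k} (L x) \<partial>\<mu>))"
      using pi by (subst Bochner_Integration.integral_sum) auto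
    also have "\<dots> = (\<Sum>k\<in>Z. \<eta> * k * (\<integral>x. indicator A (X x) * ce (\<lambda>x. indicator {k} (L x)) (X x) \<partial>\<mu>))"
      unfolding eq ..
    also have "\<dots> = (\<integral>x. (\<Sum>k\<in>Z. \<eta> * k * (indicator A (X x) * ce (\<lambda>x. indicator {k} (L x)) (X x))) \<partial>\<mu>)"
      using pc by (subst Bochner_Integration.integral_sum) auto
    also have "\<dots> = (\<integral>x. indicator A (X x) * c (X x) \<partial>\<mu>)"
      unfolding c_def by (simp add: sum_distrib_left mult_ac)
    finally show "(\<integral>x. indicator A (X x) * (\<eta> * L x) \<partial>\<mu>) = (\<integral>x. indicator A (X x) * c (X x) \<partial>\<mu>)" .
  qed measurable
  have near_lo: "- \<eta> \<le> \<eta> * L x - T x" and near_up: "\<eta> * L x - T x \<le> \<eta>" for x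
    using near[of x] by (auto simp: abs_le_iff)
  have "AE x in \<mu>. cexp \<mu> X (\<lambda>x. \<eta> * L x - T x) x = cexp \<mu> X (\<lambda>x. \<eta> * L x) x - cexp \<mu> X T x"
    by (rule cexp_diff[OF Li T(1)])
  moreover have "AE x in \<mu>. cexp \<mu> X (\<lambda>x. \<eta> * L x - T x) x \<ge> - \<eta>"
    unfolding cexp_eq by (intro ce.real_cond_exp_ge_c Bochner_Integration.integrable_diff Li T(1) AE_I2 near_lo)
  moreover have "AE x in \<mu>. cexp \<mu> X (\<lambda>x. \<eta> * L x - T x) x \<le> \<eta>"
    unfolding cexp_eq by (intro ce.real_cond_exp_le_c Bochner_Integration.integrable_diff Li T(1) AE_I2 near_up)
  ultimately have "AE x in \<mu>. \<bar>c (X x)\<bar> \<le> \<eta>" using T(2) cX by eventually_elim (auto simp: abs_le_iff)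
  then have "AE t in lborel. 0 < dq t \<longrightarrow> \<bar>c t\<bar> \<le> \<eta>" by (subst (asm) AE_X_iff) auto
  then show ?thesis
  proof eventually_elim
    case (elim t)
    have "(\<Sum>k\<in>Z. \<eta> * k * (dq t * ce (\<lambda>x. indicator {k} (L x)) t)) = dq t * c t"
      unfolding c_def by (simp add: sum_distrib_left mult_ac)
    moreover have "\<bar>dq t * c t\<bar> \<le> \<eta> * dq t"
    proof (cases "dq t = 0")
      case False
      then have "0 < dq t" using dq_nonneg[of t] by linarith
      then show ?thesis using elim by (simp add: abs_mult mult.commute)
    qed simp
    ultimately show ?case by simp
  qed
qed

text \<open>\<open>T\<close> is replaced by the finitely valued \<open>\<eta> L\<close>, and \<open>Y = X + r \<eta> L\<close> is rearranged monotonically to the law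
  of \<open>X\<close>. The distribution function of \<open>Y\<close> differs from that of \<open>X\<close> by \<open>- r v + o(r)\<close> in \<open>L\<^sup>1\<close>, where \<open>v\<close> is the
  density of \<open>X\<close> times the conditional mean of \<open>\<eta> L\<close>. Since \<open>T\<close> has conditional mean zero, \<open>\<bar>v\<bar>\<close> is at most
  \<open>\<eta>\<close> times that density, so that the rearrangement moves mass by little more than \<open>r \<eta>\<close>.\<close>

lemma perturbation_bounded:
  assumes p: "p > 1" and C: "compact C" "C \<subseteq> U" and Tm[measurable]: "T \<in> borel_measurable borel"
    and TM: "\<And>x. \<bar>T x\<bar> \<le> M" and TC: "\<And>x. X x \<notin> C \<Longrightarrow> T x = 0" and T0: "AE x in \<mu>. cexp \<mu> X T x = 0"
    and \<epsilon>: "\<epsilon> > 0"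
  shows "\<exists>r0>0. \<forall>r. 0 < r \<and> r < r0 \<longrightarrow> (\<exists>X'\<in>borel_measurable borel. distr \<mu> borel X' = \<nu> \<and>
      in_Lp p \<mu> (\<lambda>x. X' x - X x - r * T x) \<and> Lnorm p \<mu> (\<lambda>x. X' x - X x - r * T x) \<le> \<epsilon> * r)"
proof -
  have M0: "M \<ge> 0" using TM[of undefined] by linarith
  have Tint: "integrable \<mu> T" by (rule integrable_const_bound[where B=M]) (use TM in auto)
  obtain d where d: "d > 0" "(\<Union>x\<in>C. cball x d) \<subseteq> U"
    using compact_subset_open_imp_cball_epsilon_subset[OF C(1) open_U C(2)] by blast
  \<comment> \<open>Two thickenings of \<open>C\<close>: perturbed points starting in
    \<open>C\<close> land in \<open>K1\<close>, and within distance \<open>d / 2\<close> of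
    \<open>K1\<close> one is still in \<open>K\<close>, where the density lies between
    \<open>\<delta>\<close> and \<open>Q\<close>.\<close>
  define K where "K = (\<Union>x\<in>C. cball x d)"
  define K1 where "K1 = (\<Union>x\<in>C. cball x (d / 2))"
  have cK: "compact K" and cK1: "compact K1" unfolding K_def K1_def by (intro compact_minkowski_sum_cball C)+
  have CK: "C \<subseteq> K" and K1K: "K1 \<subseteq> K" using d(1) by (auto simp: K_def K1_def)
  have K1near: "t \<in> K" if "y \<in> K1" "\<bar>t - y\<bar> \<le> d / 2" for t y
  proof -
    obtain x where x: "x \<in> C" "dist x y \<le> d / 2" using \<open>y \<in> K1\<close> by (auto simp: K1_def)
    have "dist x t \<le> d" using x(2) that(2) unfolding dist_real_def by linarith
    then show ?thesis using x(1) by (auto simp: K_def)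
  qed
  have KU: "K \<subseteq> U" using d(2) by (simp add: K_def)
  have [measurable]: "K \<in> sets borel" "K1 \<in> sets borel" "C \<in> sets borel" using cK cK1 C(1) by (auto simp: borel_compact)
  have cq: "continuous_on K q0" using q0_cont KU U_subset by (meson continuous_on_subset subset_trans)
  have "\<exists>\<delta>>0. \<exists>Q\<ge>1. \<forall>x\<in>K. \<delta> \<le> dq x \<and> dq x \<le> Q"
  proof (cases "K = {}")
    case False
    obtain a where a: "a \<in> K" "\<And>y. y \<in> K \<Longrightarrow> q0 a \<le> q0 y" using continuous_attains_inf[OF cK False cq] by blast
    obtain b where b: "b \<in> K" "\<And>y. y \<in> K \<Longrightarrow> q0 y \<le> q0 b" using continuous_attains_sup[OF cK False cq] by blast
    have "q0 a > 0" using a(1) KU by (auto simp: U_def)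
    moreover have "dq x = q0 x" if "x \<in> K" for x using dq_U KU that by auto
    ultimately show ?thesis using a b by (intro exI[of _ "q0 a"] conjI exI[of _ "max 1 (q0 b)"]) force+
  qed (auto intro: exI[of _ 1])
  then obtain \<delta> Q where \<delta>: "\<delta> > 0" and Q: "Q \<ge> 1" and dqK: "\<And>x. x \<in> K \<Longrightarrow> \<delta> \<le> dq x" "\<And>x. x \<in> K \<Longrightarrow> dq x \<le> Q" by blast
  define vol where "vol = measure lborel K1"
  have vol: "vol \<ge> 0" by (simp add: vol_def)
  have K1fin: "emeasure lborel K1 < \<infinity>" using emeasure_bounded_finite[OF compact_imp_bounded[OF cK1]] by simp
  define M' where "M' = M + 1"
  have M': "M' \<ge> 1" using M0 by (simp add: M'_def)
  \<comment> \<open>Uniform bound on \<open>D r t + r * v t\<close> divided by \<open>r\<close>: the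
    summand \<open>2 * Q * M'\<close> comes from \<open>D\<close>, and \<open>Q\<close> from
    \<open>v\<close>, as \<open>\<eta> \<le> 1\<close>.\<close>
  define B where "B = Q * (2 * M' + 1)"
  have B: "B > 0" using Q M' by (simp add: B_def)
  \<comment> \<open>The \<open>p\<close>-th moment of \<open>X' - Y\<close> may be
    \<open>(r * (\<epsilon> / 2)) powr p\<close>. One half of this pays for the discretization, of
    order \<open>\<eta> powr (p - 1)\<close>, the other for the error of differentiation. The order
    of choice matters: \<open>\<eta>\<close> determines the bound \<open>n\<close> on the number of
    labels, and only then is \<open>\<epsilon>'\<close> chosen, since its contribution is multiplied
    by \<open>n\<close>.\<close>
  define E where "E = (\<epsilon> / 2) powr p / 2"
  have E: "E > 0" using \<epsilon> by (simp add: E_def)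
  define A where "A = \<delta> powr (- p) * (5 * M') * Q * 2 powr p * (Q powr p * vol) + 1"
  have A: "A > 0" unfolding A_def using Q M' vol by (intro add_nonneg_pos mult_nonneg_nonneg) auto
  define \<eta> where "\<eta> = min 1 (min (\<epsilon> / 2) ((E / A) powr (1 / (p - 1))))"
  have \<eta>: "0 < \<eta>" "\<eta> \<le> 1" "\<eta> \<le> \<epsilon> / 2" using \<epsilon> E A by (auto simp: \<eta>_def)
  have \<eta>p: "A * \<eta> powr (p - 1) \<le> E"
  proof -
    have "\<eta> powr (p - 1) \<le> ((E / A) powr (1 / (p - 1))) powr (p - 1)" using \<eta> p by (intro powr_mono2) (auto simp: \<eta>_def)
    also have "\<dots> = E / A" using p E A by (simp add: powr_powr)
    finally show ?thesis using A by (simp add: field_simps)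
  qed
  define n where "n = 5 * M' / \<eta>"
  have n: "n > 0" using M' \<eta> by (simp add: n_def)
  define A2 where "A2 = \<delta> powr (- p) * n * Q * 2 powr p * B powr (p - 1)"
  have A2: "A2 > 0" unfolding A2_def using \<delta> n Q B by simp
  define \<epsilon>' where "\<epsilon>' = E / A2"
  have \<epsilon>': "\<epsilon>' > 0" using E A2 by (simp add: \<epsilon>'_def)
  define L where "L x = \<lfloor>T x / \<eta>\<rfloor>" for x
  have Lm: "L \<in> measurable borel (count_space UNIV)" unfolding L_def by measurable
  have Lreal[measurable]: "(\<lambda>x. real_of_int (L x)) \<in> borel_measurable borel"
    by (rule measurable_compose[OF Lm]) simp
  have near: "\<bar>\<eta> * L x - T x\<bar> \<le> \<eta>" for x
  proof -
    have "real_of_int (L x) \<le> T x / \<eta>" "T x / \<eta> < L x + 1" unfolding L_def by linarith+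
    then have "\<eta> * L x \<le> T x" "T x < \<eta> * L x + \<eta>" using \<eta>(1) by (auto simp: field_simps)
    then show ?thesis by linarith
  qed
  have LM: "\<bar>\<eta> * L x\<bar> \<le> M'" for x using near[of x] TM[of x] \<eta> unfolding M'_def by linarith
  have L0: "L x = 0" if "X x \<notin> C" for x using TC[OF that] by (simp add: L_def)
  define N where "N = \<lfloor>M' / \<eta>\<rfloor>"
  define Z where "Z = {- N..N}"
  have LZ: "L x \<in> Z" for x
  proof -
    have "\<bar>real_of_int (L x)\<bar> \<le> M' / \<eta>" using LM[of x] \<eta>(1) by (simp add: abs_mult field_simps)
    then have "real_of_int \<bar>L x\<bar> \<le> M' / \<eta>" by simp
    then have "\<bar>L x\<bar> \<le> N" unfolding N_def by (simp only: le_floor_iff)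
    then show ?thesis by (auto simp: Z_def)
  qed
  have Zfin: "finite Z" by (simp add: Z_def)
  have Zcard: "real (card Z) \<le> n"
  proof -
    have "1 \<le> M' / \<eta>" using M' \<eta> by simp
    then have N0: "N \<ge> 0" by (simp add: N_def)
    have "real (card Z) = 2 * real_of_int N + 1" using N0 by (simp add: Z_def)
    also have "\<dots> \<le> 2 * (M' / \<eta>) + 1 * (M' / \<eta>)" using \<open>1 \<le> M' / \<eta>\<close> unfolding N_def by linarith
    also have "\<dots> \<le> n" using M' \<eta> by (simp add: n_def field_simps)
    finally show ?thesis .
  qed
  have Zbound: "\<bar>\<eta> * k\<bar> \<le> M'" if "k \<in> Z" for k
  proof -
    have "real_of_int \<bar>k\<bar> \<le> real_of_int N" using that by (auto simp: Z_def)
    also have "\<dots> \<le> M' / \<eta>" unfolding N_def by linarith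
    finally show ?thesis using \<eta>(1) by (simp add: abs_mult field_simps)
  qed
  define w where "w k t = dq t * ce (\<lambda>x. indicator {k} (L x)) t" for k t
  have wi: "integrable lborel (w k)" for k using cdf_label_diff(1)[OF Lm Zfin LZ] unfolding w_def by blast
  define v where "v t = (\<Sum>k\<in>Z. \<eta> * k * w k t)" for t
  have vi: "integrable lborel v" unfolding v_def using wi by auto
  have vb: "AE t in lborel. \<bar>v t\<bar> \<le> \<eta> * dq t"
    using weighted_label_bound[OF Lm Zfin LZ Tint T0 near] unfolding v_def w_def .
  define D where "D r t = cdf (distr \<mu> borel (\<lambda>x. X x + r * (\<eta> * L x))) t - F\<nu> t" for r t
  have D_eq: "D r t = (\<Sum>k\<in>Z. shift_diff (w k) (r * (\<eta> * k)) t)" for r t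
    unfolding D_def w_def by (rule cdf_label_diff(2)[OF Lm Zfin LZ])
  have Di: "integrable lborel (D r)" for r unfolding D_eq[abs_def] using shift_diff_L1(1)[OF wi] by auto
  have [measurable]: "D r \<in> borel_measurable borel" "v \<in> borel_measurable borel" for r 
    using borel_measurable_integrable[OF Di[of r]] borel_measurable_integrable[OF vi] by auto
  have "\<forall>k\<in>Z. \<exists>s0>0. \<forall>s. \<bar>s\<bar> < s0 \<longrightarrow> (\<integral>t. \<bar>shift_diff (w k) s t + s * w k t\<bar> \<partial>lborel) \<le> (\<epsilon>' / (n * M')) * \<bar>s\<bar>"
    using \<epsilon>' n M' by (intro ballI shift_diff_derivative[OF wi]) simp
  then obtain s0 where s0: "\<And>k. k \<in> Z \<Longrightarrow> s0 k > 0" 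
     "\<And>k s. k \<in> Z \<Longrightarrow> \<bar>s\<bar> < s0 k \<Longrightarrow> (\<integral>t. \<bar>shift_diff (w k) s t + s * w k t\<bar> \<partial>lborel) \<le> (\<epsilon>' / (n * M')) * \<bar>s\<bar>"
    by metis
  have Zne: "Z \<noteq> {}" using LZ by auto
  \<comment> \<open>Three requirements: every shift lies in the range of its derivative estimate,
    perturbed points stay within \<open>d / 2\<close>, and the distribution functions differ by less
    than \<open>\<delta> * (d / 2)\<close>, as the rearrangement demands.\<close>
  define r0 where "r0 = min (Min (s0 ` Z) / M') (min (d / (2 * M')) (\<delta> * (d / 2) / (4 * Q * M')))"
  have r0: "r0 > 0" unfolding r0_def using s0(1) Zfin Zne M' d \<delta> Q by auto
  show ?thesis
  proof (intro exI[of _ r0] conjI allI impI r0)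
    fix r assume r': "0 < r \<and> r < r0"
    then have r: "0 < r" "r < r0" by auto
    have rd: "r * M' \<le> d / 2" using r M' by (auto simp: r0_def field_simps)
    have rQ: "r * (2 * Q * M') < \<delta> * (d / 2)"
    proof -
      have "r < \<delta> * (d / 2) / (4 * Q * M')" using r by (simp add: r0_def)
      then have "r * (4 * Q * M') < \<delta> * (d / 2)" using Q M' by (simp add: pos_less_divide_eq)
      moreover have "r * (2 * Q * M') \<le> r * (4 * Q * M')" using r Q M' by (intro mult_left_mono) auto
      ultimately show ?thesis by linarith
    qed
    have L1: "(\<integral>t. \<bar>D r t + r * v t\<bar> \<partial>lborel) \<le> \<epsilon>' * r"
    proof -
      have i: "integrable lborel (\<lambda>t. \<bar>shift_diff (w k) (r * (\<eta> * k)) t + (r * (\<eta> * k)) * w k t\<bar>)" for k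
        using shift_diff_L1(1)[OF wi[of k], of "r * (\<eta> * k)"] wi[of k] by auto
      have "(\<integral>t. \<bar>D r t + r * v t\<bar> \<partial>lborel) \<le> (\<integral>t. (\<Sum>k\<in>Z. \<bar>shift_diff (w k) (r * (\<eta> * k)) t + (r * (\<eta> * k)) * w k t\<bar>) \<partial>lborel)"
      proof (rule integral_mono)
        show "integrable lborel (\<lambda>t. \<bar>D r t + r * v t\<bar>)" using Di[of r] vi by auto
        show "integrable lborel (\<lambda>t. \<Sum>k\<in>Z. \<bar>shift_diff (w k) (r * (\<eta> * k)) t + (r * (\<eta> * k)) * w k t\<bar>)" using i by auto
        show "\<bar>D r t + r * v t\<bar> \<le> (\<Sum>k\<in>Z. \<bar>shift_diff (w k) (r * (\<eta> * k)) t + (r * (\<eta> * k)) * w k t\<bar>)" for t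
        proof -
          have "D r t + r * v t = (\<Sum>k\<in>Z. shift_diff (w k) (r * (\<eta> * k)) t + (r * (\<eta> * k)) * w k t)"
            unfolding D_eq v_def by (simp add: sum.distrib sum_distrib_left mult_ac)
          then show ?thesis by (simp only: sum_abs)
        qed
      qed
      also have "\<dots> = (\<Sum>k\<in>Z. \<integral>t. \<bar>shift_diff (w k) (r * (\<eta> * k)) t + (r * (\<eta> * k)) * w k t\<bar> \<partial>lborel)"
        using i by (subst Bochner_Integration.integral_sum) auto
      also have "\<dots> \<le> (\<Sum>k\<in>Z. \<epsilon>' / n * r)"
      proof (rule sum_mono)
        fix k assume k: "k \<in> Z"
        have ab: "\<bar>r * (\<eta> * k)\<bar> \<le> r * M'" using Zbound[OF k] r by (simp add: abs_mult mult_left_mono)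
        have "r < Min (s0 ` Z) / M'" using r by (simp add: r0_def)
        also have "\<dots> \<le> s0 k / M'" using k Zfin M' by (intro divide_right_mono) auto
        finally have "r * M' < s0 k" using M' by (simp add: field_simps)
        then have "(\<integral>t. \<bar>shift_diff (w k) (r * (\<eta> * k)) t + (r * (\<eta> * k)) * w k t\<bar> \<partial>lborel) \<le> (\<epsilon>' / (n * M')) * \<bar>r * (\<eta> * k)\<bar>"
          using ab by (intro s0(2) k) linarith
        also have "\<dots> \<le> (\<epsilon>' / (n * M')) * (r * M')" using ab \<epsilon>' n M' by (intro mult_left_mono) auto
        also have "\<dots> = \<epsilon>' / n * r" using M' by simp
        finally show "(\<integral>t. \<bar>shift_diff (w k) (r * (\<eta> * k)) t + (r * (\<eta> * k)) * w k t\<bar> \<partial>lborel) \<le> \<epsilon>' / n * r" .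
      qed
      also have "\<dots> = real (card Z) * (\<epsilon>' / n * r)" by simp
      also have "\<dots> \<le> n * (\<epsilon>' / n * r)" using Zcard \<epsilon>' n r by (intro mult_right_mono) auto
      also have "\<dots> = \<epsilon>' * r" using n by simp
      finally show ?thesis .
    qed
    define Y where "Y x = X x + r * (\<eta> * L x)" for x
    have [measurable]: "Y \<in> borel_measurable borel" unfolding Y_def by measurable
    have YX: "\<bar>Y x - X x\<bar> \<le> r * M'" for x using LM[of x] r by (simp add: Y_def abs_mult mult_left_mono)
    have Ydist: "\<bar>Y x - X x\<bar> \<le> d / 2" for x using YX[of x] rd by linarith
    have YC: "Y x = X x" if "X x \<notin> C" for x using L0[OF that] by (simp add: Y_def)
    have Yin: "Y x \<in> K1" if "X x \<in> C" for x
      using that Ydist[of x] by (auto simp: K1_def dist_real_def abs_minus_commute intro!: bexI[of _ "X x"])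
    have D_int: "D r t = (\<integral>x. indicator {..t} (Y x) - indicator {..t} (X x) \<partial>\<mu>)" for t
    proof -
      have "integrable \<mu> (\<lambda>x. indicat_real {..t} (Y x))" 
        by (rule integrable_const_bound[where B=1]) (simp add: indicator_def, measurable)
      moreover have "integrable \<mu> (\<lambda>x. indicat_real {..t} (X x))"
        by (rule integrable_const_bound[where B=1]) (simp add: indicator_def, measurable)
      ultimately show ?thesis unfolding D_def Y_def[symmetric] by (simp add: cdf_distr_eq)
    qed
    have kern: "\<bar>indicat_real {..t} (Y x) - indicator {..t} (X x)\<bar> \<le> indicator (C \<inter> {t - r * M'..t + r * M'}) (X x)" for x t
    proof (cases "X x \<in> C")
      case False then show ?thesis using YC[OF False] by simp
    next
      case True
      then show ?thesis using YX[of x] by (auto simp: indicator_def abs_le_iff)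
    qed
    \<comment> \<open>Only points of \<open>C\<close> within \<open>r * M'\<close> of
      \<open>t\<close> can change sides, and the density there is at most \<open>Q\<close>.\<close>
    have Dbound: "\<bar>D r t\<bar> \<le> r * (2 * Q * M')" for t
    proof -
      let ?S = "C \<inter> {t - r * M'..t + r * M'}"
      have ii: "integrable \<mu> (\<lambda>x. indicat_real ?S (X x))"
        by (rule integrable_const_bound[where B=1]) (simp add: indicator_def, measurable)
      have i0: "integrable \<mu> (\<lambda>x. \<bar>indicat_real {..t} (Y x) - indicator {..t} (X x)\<bar>)"
        by (rule integrable_const_bound[where B=1]) (simp add: indicator_def, measurable)
      have i1: "integrable lborel (\<lambda>x. dq x * indicat_real ?S x)" using ii by (subst (asm) integrable_X_iff) auto
      have i2: "integrable lborel (\<lambda>x. indicat_real {t - r * M'..t + r * M'} x)" 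
        using emeasure_bounded_finite[of "{t - r * M'..t + r * M'}"] by (intro integrable_real_indicator) auto
      have "\<bar>D r t\<bar> \<le> (\<integral>x. \<bar>indicat_real {..t} (Y x) - indicator {..t} (X x)\<bar> \<partial>\<mu>)" unfolding D_int by (rule integral_abs_bound)
      also have "\<dots> \<le> (\<integral>x. indicat_real ?S (X x) \<partial>\<mu>)" by (rule integral_mono[OF i0 ii kern])
      also have "\<dots> = (\<integral>x. dq x * indicat_real ?S x \<partial>lborel)" by (rule expectation_X) measurable
      also have "\<dots> \<le> (\<integral>x. Q * indicat_real {t - r * M'..t + r * M'} x \<partial>lborel)"
      proof (rule integral_mono[OF i1])
        show "integrable lborel (\<lambda>x. Q * indicat_real {t - r * M'..t + r * M'} x)" using i2 by (rule integrable_mult_right)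
        show "dq x * indicat_real ?S x \<le> Q * indicat_real {t - r * M'..t + r * M'} x" for x
          using dqK(2)[of x] CK Q by (auto simp: indicator_def)
      qed
      also have "\<dots> = r * (2 * Q * M')" using r M' by simp
      finally show ?thesis .
    qed
    have Doff: "D r t = 0" if t: "t \<notin> K1" for t
    proof -
      have "indicat_real {..t} (Y x) - indicator {..t} (X x) = 0" for x
      proof (rule ccontr)
        assume ne: "indicat_real {..t} (Y x) - indicator {..t} (X x) \<noteq> 0"
        then have xC: "X x \<in> C" using YC[of x] by fastforce
        have "\<bar>t - X x\<bar> \<le> d / 2" using ne Ydist[of x] by (cases "Y x \<le> t"; cases "X x \<le> t") auto
        then have "t \<in> K1" using xC by (auto simp: K1_def dist_real_def abs_minus_commute intro!: bexI[of _ "X x"])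
        then show False using t by simp
      qed
      then show ?thesis unfolding D_int by simp
    qed
    have atomless: "measure \<mu> {x. Y x = a} = 0" for a
    proof -
      have "{x. Y x = a} \<subseteq> (\<Union>k\<in>Z. {x. X x = a - r * (\<eta> * k)})"
      proof
        fix x assume "x \<in> {x. Y x = a}"
        then have "x \<in> {x. X x = a - r * (\<eta> * L x)}" by (auto simp: Y_def)
        then show "x \<in> (\<Union>k\<in>Z. {x. X x = a - r * (\<eta> * k)})" using LZ[of x] by blast
      qed
      then have "measure \<mu> {x. Y x = a} \<le> measure \<mu> (\<Union>k\<in>Z. {x. X x = a - r * (\<eta> * k)})"
        using Zfin by (intro finite_measure_mono sets.finite_UN) (auto simp: sets_eq)
      also have "\<dots> \<le> (\<Sum>k\<in>Z. measure \<mu> {x. X x = a - r * (\<eta> * k)})"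
        using Zfin by (intro finite_measure_subadditive_finite) (auto simp: sets_eq)
      also have "\<dots> = 0" by (simp add: prob_X_singleton)
      finally show ?thesis using measure_nonneg[of \<mu> "{x. Y x = a}"] by linarith
    qed
    have "\<exists>X'\<in>borel_measurable borel. distr \<mu> borel X' = \<nu> \<and> (AE x in \<mu>. \<bar>X' x - Y x\<bar> \<le> \<bar>cdf (distr \<mu> borel Y) (Y x) - F\<nu> (Y x)\<bar> / \<delta>)"
    proof (rule rearrangement[where K=K1 and h="d / 2"])
      show "\<delta> > 0" "d / 2 > 0" using \<delta> d by auto
      show "F\<nu> y + \<delta> * s \<le> F\<nu> (y + s) \<and> F\<nu> (y - s) + \<delta> * s \<le> F\<nu> y" if y: "y \<in> K1" and s: "0 \<le> s" "s \<le> d / 2" for y s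
      proof
        show "F\<nu> y + \<delta> * s \<le> F\<nu> (y + s)" using F_increment[of y "y + s" \<delta>] s K1near[OF y] dqK(1) by fastforce
        show "F\<nu> (y - s) + \<delta> * s \<le> F\<nu> y" using F_increment[of "y - s" y \<delta>] s K1near[OF y] dqK(1) by fastforce
      qed
      show "\<bar>cdf (distr \<mu> borel Y) y - F\<nu> y\<bar> < \<delta> * (d / 2)" for y
        using Dbound[of y] rQ unfolding D_def Y_def[symmetric] by linarith
      show "cdf (distr \<mu> borel Y) y = F\<nu> y" if "y \<notin> K1" for y using Doff[OF that] unfolding D_def Y_def[symmetric] by simp
      show "Y x = X x" if "Y x \<notin> K1" for x using YC[of x] Yin[of x] that by blast
    qed (auto simp: atomless)
    then obtain X' where X'[measurable]: "X' \<in> borel_measurable borel" and law: "distr \<mu> borel X' = \<nu>"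
      and X'D: "AE x in \<mu>. \<bar>X' x - Y x\<bar> \<le> \<bar>D r (Y x)\<bar> / \<delta>"
      unfolding D_def Y_def[symmetric] by blast
    define \<psi> where "\<psi> t = \<bar>D r t\<bar> powr p" for t
    have [measurable]: "\<psi> \<in> borel_measurable borel" unfolding \<psi>_def by measurable
    have \<psi>0: "\<psi> t \<ge> 0" for t by (simp add: \<psi>_def)
    have \<psi>off: "\<psi> t = 0" if "t \<notin> K1" for t using Doff[OF that] by (simp add: \<psi>_def)
    have \<psi>b: "\<psi> t \<le> (r * (2 * Q * M')) powr p" for t unfolding \<psi>_def using Dbound[of t] p by (intro powr_mono2) auto
    have K1i: "integrable lborel (\<lambda>t. indicat_real K1 t)" using K1fin by (intro integrable_real_indicator) auto
    have \<psi>i: "integrable lborel \<psi>"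
    proof (rule Bochner_Integration.integrable_bound)
      show "integrable lborel (\<lambda>t. (r * (2 * Q * M')) powr p * indicat_real K1 t)" using K1i by (rule integrable_mult_right)
      show "AE t in lborel. norm (\<psi> t) \<le> norm ((r * (2 * Q * M')) powr p * indicat_real K1 t)"
        using \<psi>b \<psi>0 \<psi>off by (intro AE_I2) (auto simp: indicator_def)
    qed simp
    \<comment> \<open>Interpolation: split \<open>D r\<close> into \<open>D r + r * v\<close> and
      \<open>- r * v\<close>. The first is of order \<open>r\<close> uniformly and at most
      \<open>\<epsilon>' * r\<close> in \<open>L\<^sup>1\<close>, so \<open>p - 1\<close> powers are
      taken from the uniform bound; the second is at most \<open>r * \<eta> * Q\<close> on a set of
      finite volume.\<close>
    have \<psi>int: "(\<integral>t. \<psi> t \<partial>lborel) \<le> r powr p * (2 powr p * (B powr (p - 1) * \<epsilon>' + (\<eta> * Q) powr p * vol))"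
    proof -
      have i1: "integrable lborel (\<lambda>t. \<bar>D r t + r * v t\<bar>)" using Di[of r] vi by auto
      have "(\<integral>t. \<psi> t \<partial>lborel) \<le> (\<integral>t. 2 powr p * ((r * B) powr (p - 1) * \<bar>D r t + r * v t\<bar> + (r * (\<eta> * Q)) powr p * indicat_real K1 t) \<partial>lborel)"
      proof (rule integral_mono_AE[OF \<psi>i])
        show "integrable lborel (\<lambda>t. 2 powr p * ((r * B) powr (p - 1) * \<bar>D r t + r * v t\<bar> + (r * (\<eta> * Q)) powr p * indicat_real K1 t))"
          using i1 K1i by auto
        show "AE t in lborel. \<psi> t \<le> 2 powr p * ((r * B) powr (p - 1) * \<bar>D r t + r * v t\<bar> + (r * (\<eta> * Q)) powr p * indicat_real K1 t)"
          using vb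
        proof eventually_elim
          case (elim t)
          show ?case
          proof (cases "t \<in> K1")
            case False
            then show ?thesis using \<psi>off[OF False] by simp
          next
            case True
            have vQ: "\<bar>v t\<bar> \<le> \<eta> * Q" using elim dqK(2)[of t] True K1K \<eta> by (meson mult_left_mono order_trans subsetD less_imp_le)
            have rv: "\<bar>r * v t\<bar> \<le> r * (\<eta> * Q)" using vQ r by (simp add: abs_mult mult_left_mono)
            let ?a = "\<bar>D r t + r * v t\<bar>"
            have "\<eta> * Q \<le> 1 * Q" using \<eta> Q by (intro mult_right_mono) auto
            then have "r * (\<eta> * Q) \<le> r * Q" using r by simp
            then have aB: "?a \<le> r * B" using Dbound[of t] rv r unfolding B_def by (simp add: algebra_simps)
            have "\<psi> t \<le> (?a + r * (\<eta> * Q)) powr p" unfolding \<psi>_def using rv p by (intro powr_mono2) auto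
            also have "\<dots> \<le> 2 powr p * (?a powr p + (r * (\<eta> * Q)) powr p)" using r \<eta> Q p by (intro add_powr_le) auto
            also have "?a powr p \<le> (r * B) powr (p - 1) * ?a"
            proof (cases "?a = 0")
              case False
              then have "?a powr p = ?a powr (p - 1) * ?a" by (simp add: powr_diff)
              also have "\<dots> \<le> (r * B) powr (p - 1) * ?a" using aB p by (intro mult_right_mono powr_mono2) auto
              finally show ?thesis .
            qed simp
            finally show ?thesis using True by simp
          qed
        qed
      qed
      also have "\<dots> = 2 powr p * ((r * B) powr (p - 1) * (\<integral>t. \<bar>D r t + r * v t\<bar> \<partial>lborel) + (r * (\<eta> * Q)) powr p * vol)"
        using i1 K1i by (simp add: vol_def)
      also have "\<dots> \<le> 2 powr p * ((r * B) powr (p - 1) * (\<epsilon>' * r) + (r * (\<eta> * Q)) powr p * vol)"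
        using L1 by (intro mult_left_mono add_right_mono) auto
      also have "\<dots> = r powr p * (2 powr p * (B powr (p - 1) * \<epsilon>' + (\<eta> * Q) powr p * vol))"
      proof -
        have "(r * B) powr (p - 1) * (\<epsilon>' * r) = (r powr (p - 1) * r) * (B powr (p - 1) * \<epsilon>')" using r B by (simp add: powr_mult)
        also have "r powr (p - 1) * r = r powr p" using r by (simp add: powr_diff)
        finally have 1: "(r * B) powr (p - 1) * (\<epsilon>' * r) = r powr p * (B powr (p - 1) * \<epsilon>')" .
        have 2: "(r * (\<eta> * Q)) powr p = r powr p * (\<eta> * Q) powr p" using r \<eta> Q by (simp add: powr_mult)
        show ?thesis unfolding 1 2 by (simp add: algebra_simps)
      qed
      finally show ?thesis .
    qed
    \<comment> \<open>Replacing the actual label by a sum over all labels bounds the law of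
      \<open>Y\<close> on \<open>K1\<close> by at most \<open>n\<close> translates, each of density
      at most \<open>Q\<close>.\<close>
    have \<psi>Y: "(\<integral>x. \<psi> (Y x) \<partial>\<mu>) \<le> n * Q * (\<integral>t. \<psi> t \<partial>lborel)"
    proof -
      have shift: "integrable lborel (\<lambda>x. \<psi> (x + c))" "(\<integral>x. \<psi> (x + c) \<partial>lborel) = (\<integral>x. \<psi> x \<partial>lborel)" for c
        using lborel_integrable_real_affine_iff[of 1 \<psi> c] \<psi>i lborel_integral_real_affine[of 1 \<psi> c] by (auto simp: add.commute)
      have ki: "integrable lborel (\<lambda>x. dq x * (indicat_real K x * \<psi> (x + c)))" for c
      proof (rule Bochner_Integration.integrable_bound)
        show "integrable lborel (\<lambda>x. Q * \<psi> (x + c))" using shift(1) by (rule integrable_mult_right)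
        show "AE x in lborel. norm (dq x * (indicat_real K x * \<psi> (x + c))) \<le> norm (Q * \<psi> (x + c))"
        proof (intro AE_I2)
          fix x show "norm (dq x * (indicat_real K x * \<psi> (x + c))) \<le> norm (Q * \<psi> (x + c))"
            using dqK(2)[of x] \<psi>0[of "x + c"] Q by (cases "x \<in> K") (auto simp: abs_mult mult_right_mono)
        qed
      qed measurable
      have kX: "integrable \<mu> (\<lambda>x. indicat_real K (X x) * \<psi> (X x + c))" for c
        using integrable_X_iff[of "\<lambda>x. indicat_real K x * \<psi> (x + c)"] ki[of c] by simp
      have pw: "\<psi> (Y x) \<le> (\<Sum>k\<in>Z. indicat_real K (X x) * \<psi> (X x + r * (\<eta> * k)))" for x
      proof (cases "Y x \<in> K1")
        case False
        then show ?thesis using \<psi>off[OF False] \<psi>0 by (auto intro!: sum_nonneg)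
      next
        case True
        have "X x \<in> K"
        proof (cases "X x \<in> C")
          case False then show ?thesis using YC[OF False] True K1K by auto
        qed (use CK in auto)
        then have "\<psi> (Y x) = indicat_real K (X x) * \<psi> (X x + r * (\<eta> * L x))" by (simp add: Y_def)
        also have "\<dots> \<le> (\<Sum>k\<in>Z. indicat_real K (X x) * \<psi> (X x + r * (\<eta> * k)))"
          by (rule member_le_sum[of "L x" Z "\<lambda>k. indicat_real K (X x) * \<psi> (X x + r * (\<eta> * real_of_int k))", OF LZ _ Zfin])
            (simp add: \<psi>0)
        finally show ?thesis .
      qed
      have "integrable \<mu> (\<lambda>x. \<psi> (Y x))"
        by (rule integrable_const_bound[where B="(r * (2 * Q * M')) powr p"]) (use \<psi>b \<psi>0 in auto)
      then have "(\<integral>x. \<psi> (Y x) \<partial>\<mu>) \<le> (\<integral>x. (\<Sum>k\<in>Z. indicat_real K (X x) * \<psi> (X x + r * (\<eta> * k))) \<partial>\<mu>)"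
        using kX pw by (intro integral_mono) auto
      also have "\<dots> = (\<Sum>k\<in>Z. \<integral>x. indicat_real K (X x) * \<psi> (X x + r * (\<eta> * k)) \<partial>\<mu>)"
        using kX by (subst Bochner_Integration.integral_sum) auto
      also have "\<dots> \<le> (\<Sum>k\<in>Z. Q * (\<integral>t. \<psi> t \<partial>lborel))"
      proof (rule sum_mono)
        fix k
        have "(\<integral>x. indicat_real K (X x) * \<psi> (X x + r * (\<eta> * k)) \<partial>\<mu>) = (\<integral>x. dq x * (indicat_real K x * \<psi> (x + r * (\<eta> * k))) \<partial>lborel)"
          by (rule expectation_X) measurable
        also have "\<dots> \<le> (\<integral>x. Q * \<psi> (x + r * (\<eta> * k)) \<partial>lborel)"
        proof (rule integral_mono[OF ki])
          show "integrable lborel (\<lambda>x. Q * \<psi> (x + r * (\<eta> * k)))" using shift(1) by (rule integrable_mult_right)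
          show "dq x * (indicat_real K x * \<psi> (x + r * (\<eta> * k))) \<le> Q * \<psi> (x + r * (\<eta> * k))" for x
            using dqK(2)[of x] \<psi>0[of "x + r * (\<eta> * k)"] Q by (cases "x \<in> K") (auto simp: mult_right_mono)
        qed
        also have "\<dots> = Q * (\<integral>t. \<psi> t \<partial>lborel)" using shift by simp
        finally show "(\<integral>x. indicat_real K (X x) * \<psi> (X x + r * (\<eta> * k)) \<partial>\<mu>) \<le> Q * (\<integral>t. \<psi> t \<partial>lborel)" .
      qed
      also have "\<dots> = real (card Z) * (Q * (\<integral>t. \<psi> t \<partial>lborel))" by simp
      also have "\<dots> \<le> n * (Q * (\<integral>t. \<psi> t \<partial>lborel))" using Zcard Q \<psi>0 by (intro mult_right_mono) auto
      finally show ?thesis by (simp add: mult.assoc)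
    qed
    have int1: "integrable \<mu> (\<lambda>x. \<psi> (Y x))"
      by (rule integrable_const_bound[where B="(r * (2 * Q * M')) powr p"]) (use \<psi>b \<psi>0 in auto)
    have pwAE: "AE x in \<mu>. norm (X' x - Y x) powr p \<le> \<delta> powr (- p) * \<psi> (Y x)"
      using X'D
    proof eventually_elim
      case (elim x)
      then have "norm (X' x - Y x) powr p \<le> (\<bar>D r (Y x)\<bar> / \<delta>) powr p" using p by (intro powr_mono2) auto
      also have "\<dots> = \<delta> powr (- p) * \<psi> (Y x)" using \<delta> by (simp add: \<psi>_def powr_divide powr_minus field_simps)
      finally show ?case .
    qed
    have XYint: "integrable \<mu> (\<lambda>x. norm (X' x - Y x) powr p)"
      by (rule Bochner_Integration.integrable_bound[OF integrable_mult_right[OF int1, of "\<delta> powr (- p)"]])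
         (use pwAE \<psi>0 \<delta> in \<open>auto simp: abs_mult\<close>)
    have f1: "\<delta> powr (- p) * n * Q * 2 powr p * ((\<eta> * Q) powr p * vol) \<le> A * \<eta> powr (p - 1)"
    proof -
      have "n * (\<eta> * Q) powr p = 5 * M' * \<eta> powr (p - 1) * Q powr p"
        using \<eta> Q by (simp add: n_def powr_mult powr_diff)
      then have "\<delta> powr (- p) * n * Q * 2 powr p * ((\<eta> * Q) powr p * vol) = (A - 1) * \<eta> powr (p - 1)"
        unfolding A_def by (simp add: mult_ac)
      also have "\<dots> \<le> A * \<eta> powr (p - 1)" by (intro mult_right_mono) auto
      finally show ?thesis .
    qed
    have f2: "A2 * \<epsilon>' = E" using A2 by (simp add: \<epsilon>'_def)
    have "(\<integral>x. norm (X' x - Y x) powr p \<partial>\<mu>) \<le> (\<integral>x. \<delta> powr (- p) * \<psi> (Y x) \<partial>\<mu>)"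
      using XYint int1 pwAE by (intro integral_mono_AE) auto
    also have "\<dots> = \<delta> powr (- p) * (\<integral>x. \<psi> (Y x) \<partial>\<mu>)" by simp
    also have "\<dots> \<le> \<delta> powr (- p) * (n * Q * (r powr p * (2 powr p * (B powr (p - 1) * \<epsilon>' + (\<eta> * Q) powr p * vol))))"
      using \<psi>Y \<psi>int n Q by (intro mult_left_mono order_trans[OF \<psi>Y]) auto
    also have "\<dots> = r powr p * (A2 * \<epsilon>' + \<delta> powr (- p) * n * Q * 2 powr p * ((\<eta> * Q) powr p * vol))"
      unfolding A2_def by (simp add: algebra_simps)
    also have "\<dots> \<le> r powr p * (E + E)" using f1 f2 \<eta>p by (intro mult_left_mono) auto
    also have "\<dots> = (r * (\<epsilon> / 2)) powr p" by (subst powr_mult) (use r \<epsilon> in \<open>auto simp: E_def\<close>)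
    finally have "(\<integral>x. norm (X' x - Y x) powr p \<partial>\<mu>) \<le> (r * (\<epsilon> / 2)) powr p" .
    then have "Lnorm p \<mu> (\<lambda>x. X' x - Y x) \<le> ((r * (\<epsilon> / 2)) powr p) powr (1 / p)"
      unfolding Lnorm_def using p by (intro powr_mono2) (auto intro: integral_nonneg_AE)
    then have n1: "Lnorm p \<mu> (\<lambda>x. X' x - Y x) \<le> r * (\<epsilon> / 2)" using p r \<epsilon> by (simp add: powr_powr)
    have L2: "in_Lp p \<mu> (\<lambda>x. X' x - Y x)" using XYint by (auto simp: in_Lp_def)
    have nr: "norm (r * (\<eta> * L x - T x)) \<le> r * (\<epsilon> / 2)" for x
      using near[of x] \<eta> r by (simp add: abs_mult mult_left_mono)
    have L3: "in_Lp p \<mu> (\<lambda>x. r * (\<eta> * L x - T x))"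
      by (rule in_Lp_bounded[OF finite_measure_axioms, where B="r * (\<epsilon> / 2)"]) (use nr p in auto)
    have "Lnorm p \<mu> (\<lambda>x. r * (\<eta> * L x - T x)) \<le> Lnorm p \<mu> (\<lambda>x. r * (\<epsilon> / 2))"
      using nr r \<epsilon> p by (intro Lnorm_mono in_Lp_const finite_measure_axioms) (auto simp: abs_mult)
    also have "\<dots> = r * (\<epsilon> / 2)" using r \<epsilon> p by (simp add: Lnorm_def powr_powr)
    finally have n2: "Lnorm p \<mu> (\<lambda>x. r * (\<eta> * L x - T x)) \<le> r * (\<epsilon> / 2)" .
    have "Lnorm p \<mu> (\<lambda>x. (X' x - Y x) + r * (\<eta> * L x - T x)) \<le> r * (\<epsilon> / 2) + r * (\<epsilon> / 2)"
      using Lnorm_triangle[OF L2 L3 p] n1 n2 by linarith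
    moreover have eq: "(\<lambda>x. (X' x - Y x) + r * (\<eta> * L x - T x)) = (\<lambda>x. X' x - X x - r * T x)" by (auto simp: Y_def algebra_simps)
    ultimately have "Lnorm p \<mu> (\<lambda>x. X' x - X x - r * T x) \<le> \<epsilon> * r" by (simp add: mult.commute)
    moreover have "in_Lp p \<mu> (\<lambda>x. X' x - X x - r * T x)" using in_Lp_add[OF L2 L3] p unfolding eq by simp
    ultimately show "\<exists>X'\<in>borel_measurable borel. distr \<mu> borel X' = \<nu> \<and> in_Lp p \<mu> (\<lambda>x. X' x - X x - r * T x) \<and> Lnorm p \<mu> (\<lambda>x. X' x - X x - r * T x) \<le> \<epsilon> * r"
      using law by (intro bexI[of _ X']) auto
  qed
qed

end

section \<open>Reduction of a general field to a bounded one over a compact set\<close>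

context coord_density
begin

text \<open>The field is approximated in \<open>L\<^sup>p\<close> by bounded fields living over
  compact subsets of \<open>U\<close>, keeping the conditional mean zero. The remaining error is
  linear in \<open>r\<close> and joins the estimate of the bounded case.\<close>

theorem perturbation:
  assumes p: "p > 1" and T: "in_Lp p \<mu> T" and T0: "AE x in \<mu>. cexp \<mu> X T x = 0" and \<epsilon>: "\<epsilon> > 0"
  shows "\<exists>r0>0. \<forall>r. 0 < r \<and> r < r0 \<longrightarrow> (\<exists>X'\<in>borel_measurable borel. distr \<mu> borel X' = \<nu> \<and>
      in_Lp p \<mu> (\<lambda>x. X' x - X x - r * T x) \<and> Lnorm p \<mu> (\<lambda>x. X' x - X x - r * T x) \<le> \<epsilon> * r)"
proof -
  have Tm[measurable]: "T \<in> borel_measurable borel" using T by (simp add: in_Lp_def cong: measurable_cong_sets add: sets_eq)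
  have Tint: "integrable \<mu> T" using in_Lp_imp_integrable[OF finite_measure_axioms T] p by simp
  obtain C :: "nat \<Rightarrow> real set" where C: "\<And>n. compact (C n)" "\<And>n. C n \<subseteq> U" "\<And>n. C n \<subseteq> interior (C (Suc n))" "\<Union>(range C) = U"
    using open_Union_compact_subsets[OF open_U] by metis
  have Cmono: "C n \<subseteq> C m" if "n \<le> m" for n m
    using that by (rule lift_Suc_mono_le[where f=C, rotated]) (meson C(3) interior_subset order_trans)
  have [measurable]: "C n \<in> sets borel" for n using C(1) by (simp add: borel_compact)
  define S where "S n x = max (- real n) (min (real n) (T x))" for n x
  have [measurable]: "S n \<in> borel_measurable borel" for n unfolding S_def by measurable
  have Sb: "\<bar>S n x\<bar> \<le> real n" for n x by (auto simp: S_def)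
  have Si: "integrable \<mu> (S n)" for n by (rule integrable_const_bound[where B="real n"]) (use Sb in auto)
  have SL: "in_Lp p \<mu> (S n)" for n by (rule in_Lp_bounded[OF finite_measure_axioms, where B="real n"]) (use Sb p in auto)
  \<comment> \<open>The conditional mean of the truncation is bounded by \<open>n\<close> only
    almost surely; clamping gives a version bounded everywhere.\<close>
  define c where "c n t = max (- real n) (min (real n) (ce (S n) t))" for n t
  have [measurable]: "c n \<in> borel_measurable borel" for n unfolding c_def by measurable
  have cb: "\<bar>c n t\<bar> \<le> real n" for n t by (auto simp: c_def)
  have c_eq: "AE x in \<mu>. c n (X x) = cexp \<mu> X (S n) x" for n
  proof -
    have "AE x in \<mu>. cexp \<mu> X (S n) x \<ge> - real n"
      unfolding cexp_eq by (rule ce.real_cond_exp_ge_c[OF Si]) (auto simp: S_def)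
    moreover have "AE x in \<mu>. cexp \<mu> X (S n) x \<le> real n"
      unfolding cexp_eq by (rule ce.real_cond_exp_le_c[OF Si]) (auto simp: S_def)
    ultimately show ?thesis by eventually_elim (auto simp: c_def cexp_factor)
  qed
  \<comment> \<open>Truncation destroys the vanishing conditional mean, so the mean is subtracted.
    The cutoff depends on \<open>X\<close> alone and therefore does no harm to it.\<close>
  define T1 where "T1 n x = indicator (C n) (X x) * (S n x - c n (X x))" for n x
  have [measurable]: "T1 n \<in> borel_measurable borel" for n unfolding T1_def by measurable
  have T1b: "\<bar>T1 n x\<bar> \<le> 2 * real n" for n x
    using Sb[of n x] cb[of n "X x"] by (auto simp: T1_def indicator_def)
  have T1C: "T1 n x = 0" if "X x \<notin> C n" for n x using that by (simp add: T1_def)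
  have T1i: "integrable \<mu> (T1 n)" for n by (rule integrable_const_bound[where B="2 * real n"]) (use T1b in auto)
  have T1L: "in_Lp p \<mu> (T1 n)" for n by (rule in_Lp_bounded[OF finite_measure_axioms, where B="2 * real n"]) (use T1b p in auto)
  have T10: "AE x in \<mu>. cexp \<mu> X (T1 n) x = 0" for n
    unfolding cexp_zero_iff[OF T1i]
  proof
    fix A :: "real set" assume [measurable]: "A \<in> sets borel"
    have i1: "integrable \<mu> (\<lambda>x. indicat_real (A \<inter> C n) (X x) * S n x)"
      by (rule Bochner_Integration.integrable_bound[OF Si[of n]]) (measurable, simp add: indicator_def)
    have i2: "integrable \<mu> (\<lambda>x. indicat_real (A \<inter> C n) (X x) * c n (X x))"
      by (rule integrable_const_bound[where B="real n"]) (simp add: indicator_def cb, measurable)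
    have "(\<integral>x. indicator A (X x) * T1 n x \<partial>\<mu>) = (\<integral>x. indicator (A \<inter> C n) (X x) * S n x - indicator (A \<inter> C n) (X x) * c n (X x) \<partial>\<mu>)"
      by (intro Bochner_Integration.integral_cong) (auto simp: T1_def indicator_def)
    also have "\<dots> = (\<integral>x. indicator (A \<inter> C n) (X x) * S n x \<partial>\<mu>) - (\<integral>x. indicator (A \<inter> C n) (X x) * c n (X x) \<partial>\<mu>)"
      by (rule Bochner_Integration.integral_diff[OF i1 i2])
    also have "(\<integral>x. indicator (A \<inter> C n) (X x) * c n (X x) \<partial>\<mu>) = (\<integral>x. indicator (A \<inter> C n) (X x) * cexp \<mu> X (S n) x \<partial>\<mu>)"
    proof (rule integral_cong_AE)
      show "AE x in \<mu>. indicat_real (A \<inter> C n) (X x) * c n (X x) = indicator (A \<inter> C n) (X x) * cexp \<mu> X (S n) x"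
        using c_eq[of n] by eventually_elim simp
    qed measurable
    also have "\<dots> = (\<integral>x. indicator (A \<inter> C n) (X x) * S n x \<partial>\<mu>)"
      by (rule cexp_integral(2)[OF i1]) measurable
    finally show "(\<integral>x. indicator A (X x) * T1 n x \<partial>\<mu>) = 0" by simp
  qed
  have lim1: "(\<lambda>n. Lnorm p \<mu> (\<lambda>x. T x - S n x)) \<longlonglongrightarrow> 0"
  proof (rule Lnorm_tendsto_0[OF _ T])
    show "AE x in \<mu>. (\<lambda>n. T x - S n x) \<longlonglongrightarrow> 0"
    proof (intro AE_I2)
      fix x
      obtain N where "\<bar>T x\<bar> \<le> real N" using real_arch_simple by blast
      then have "T x - S n x = 0" if "n \<ge> N" for n using that by (auto simp: S_def)
      then show "(\<lambda>n. T x - S n x) \<longlonglongrightarrow> 0" by (intro tendsto_eventually) (auto simp: eventually_sequentially)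
    qed
  qed (use p in \<open>auto simp: S_def\<close>)
  have lim2: "(\<lambda>n. Lnorm p \<mu> (\<lambda>x. (1 - indicat_real (C n) (X x)) * T x)) \<longlonglongrightarrow> 0"
  proof (rule Lnorm_tendsto_0[OF _ T])
    show "AE x in \<mu>. (\<lambda>n. (1 - indicat_real (C n) (X x)) * T x) \<longlonglongrightarrow> 0"
      using AE_X_U
    proof eventually_elim
      case (elim x)
      then obtain N where N: "X x \<in> C N" using C(4) by blast
      then have "(1 - indicat_real (C n) (X x)) * T x = 0" if "n \<ge> N" for n using Cmono[OF that] by auto
      then show ?case by (intro tendsto_eventually) (auto simp: eventually_sequentially)
    qed
  qed (use p in \<open>auto simp: indicator_def\<close>)
  have conv: "(\<lambda>n. Lnorm p \<mu> (\<lambda>x. (1 - indicat_real (C n) (X x)) * T x) + (Lnorm p \<mu> (\<lambda>x. T x - S n x) + Lnorm p \<mu> (\<lambda>x. T x - S n x))) \<longlonglongrightarrow> 0 + (0 + 0)"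
    by (intro tendsto_add lim1 lim2)
  have "\<forall>\<^sub>F n in sequentially. Lnorm p \<mu> (\<lambda>x. (1 - indicat_real (C n) (X x)) * T x) + (Lnorm p \<mu> (\<lambda>x. T x - S n x) + Lnorm p \<mu> (\<lambda>x. T x - S n x)) < \<epsilon> / 2"
    using order_tendstoD(2)[OF conv, of "\<epsilon> / 2"] \<epsilon> by simp
  then obtain n where n: "Lnorm p \<mu> (\<lambda>x. (1 - indicat_real (C n) (X x)) * T x) + (Lnorm p \<mu> (\<lambda>x. T x - S n x) + Lnorm p \<mu> (\<lambda>x. T x - S n x)) < \<epsilon> / 2"
    by (auto simp: eventually_sequentially)
  have TSL: "in_Lp p \<mu> (\<lambda>x. T x - S n x)" using T SL p by (intro in_Lp_diff) auto
  have I1: "in_Lp p \<mu> (\<lambda>x. (1 - indicat_real (C n) (X x)) * T x)"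
    by (rule in_Lp_bound[OF T]) (use p in \<open>auto simp: indicator_def\<close>)
  have I3: "in_Lp p \<mu> (\<lambda>x. c n (X x))" by (rule in_Lp_bounded[OF finite_measure_axioms, where B="real n"]) (use cb p in auto)
  \<comment> \<open>As \<open>T\<close> has conditional mean zero, the recentring term is up to sign
    the conditional mean of the truncation error, and conditional expectation is a
    contraction.\<close>
  have cn: "Lnorm p \<mu> (\<lambda>x. c n (X x)) \<le> Lnorm p \<mu> (\<lambda>x. T x - S n x)"
  proof -
    have "AE x in \<mu>. cexp \<mu> X (\<lambda>x. T x - S n x) x = cexp \<mu> X T x - cexp \<mu> X (S n) x" by (rule cexp_diff[OF Tint Si])
    then have "AE x in \<mu>. norm (c n (X x)) = norm (cexp \<mu> X (\<lambda>x. T x - S n x) x)"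
      using T0 c_eq[of n] by eventually_elim simp
    then have "Lnorm p \<mu> (\<lambda>x. c n (X x)) = Lnorm p \<mu> (cexp \<mu> X (\<lambda>x. T x - S n x))"
      by (intro Lnorm_cong_AE) auto
    also have "\<dots> \<le> Lnorm p \<mu> (\<lambda>x. T x - S n x)" by (rule cexp_in_Lp(2)[OF TSL p])
    finally show ?thesis .
  qed
  have I2: "in_Lp p \<mu> (\<lambda>x. \<bar>T x - S n x\<bar> + \<bar>c n (X x)\<bar>)"
    using in_Lp_add[of p \<mu> "\<lambda>x. norm (T x - S n x)" "\<lambda>x. norm (c n (X x))"] TSL I3 p by (simp add: in_Lp_def)
  have "Lnorm p \<mu> (\<lambda>x. T x - T1 n x) \<le> Lnorm p \<mu> (\<lambda>x. (1 - indicat_real (C n) (X x)) * T x) + Lnorm p \<mu> (\<lambda>x. \<bar>T x - S n x\<bar> + \<bar>c n (X x)\<bar>)"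
    by (rule Lnorm_le_add[OF I1 I2 p]) (auto simp: T1_def indicator_def)
  also have "Lnorm p \<mu> (\<lambda>x. \<bar>T x - S n x\<bar> + \<bar>c n (X x)\<bar>) \<le> Lnorm p \<mu> (\<lambda>x. T x - S n x) + Lnorm p \<mu> (\<lambda>x. c n (X x))"
    by (rule Lnorm_le_add[OF TSL I3 p]) auto
  finally have close: "Lnorm p \<mu> (\<lambda>x. T x - T1 n x) \<le> \<epsilon> / 2" using n cn by linarith
  have T1m: "T1 n \<in> borel_measurable borel" for n by measurable
  have half: "\<epsilon> / 2 > 0" using \<epsilon> by simp
  obtain r0 where r0: "r0 > 0" "\<And>r. 0 < r \<and> r < r0 \<Longrightarrow> (\<exists>X'\<in>borel_measurable borel. distr \<mu> borel X' = \<nu> \<and>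
      in_Lp p \<mu> (\<lambda>x. X' x - X x - r * T1 n x) \<and> Lnorm p \<mu> (\<lambda>x. X' x - X x - r * T1 n x) \<le> \<epsilon> / 2 * r)"
    using perturbation_bounded[OF p C(1)[of n] C(2)[of n] T1m[of n] T1b T1C T10 half] by blast
  show ?thesis
  proof (intro exI[of _ r0] conjI allI impI r0(1))
    fix r assume r: "0 < r \<and> r < r0"
    obtain X' where X': "X' \<in> borel_measurable borel" "distr \<mu> borel X' = \<nu>"
      "in_Lp p \<mu> (\<lambda>x. X' x - X x - r * T1 n x)" "Lnorm p \<mu> (\<lambda>x. X' x - X x - r * T1 n x) \<le> \<epsilon> / 2 * r"
      using r0(2)[OF r] by blast
    have D: "in_Lp p \<mu> (\<lambda>x. r * (T x - T1 n x))" using T T1L p by (intro in_Lp_cmult in_Lp_diff) auto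
    have Dn: "Lnorm p \<mu> (\<lambda>x. r * (T x - T1 n x)) \<le> r * (\<epsilon> / 2)"
      using Lnorm_scaleR[of p \<mu> r "\<lambda>x. T x - T1 n x"] close r p by (simp add: mult_left_mono)
    have eq: "(\<lambda>x. (X' x - X x - r * T1 n x) - r * (T x - T1 n x)) = (\<lambda>x. X' x - X x - r * T x)" by (auto simp: algebra_simps)
    have "in_Lp p \<mu> (\<lambda>x. X' x - X x - r * T x)" using in_Lp_diff[OF X'(3) D] p unfolding eq by simp
    moreover have "Lnorm p \<mu> (\<lambda>x. X' x - X x - r * T x) \<le> \<epsilon> * r"
      using Lnorm_triangle_diff[OF X'(3) D p] Dn X'(4) unfolding eq by (simp add: field_simps)
    ultimately show "\<exists>X'\<in>borel_measurable borel. distr \<mu> borel X' = \<nu> \<and>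
      in_Lp p \<mu> (\<lambda>x. X' x - X x - r * T x) \<and> Lnorm p \<mu> (\<lambda>x. X' x - X x - r * T x) \<le> \<epsilon> * r"
      using X'(1,2) by blast
  qed
qed

end

section \<open>Mixtures and couplings\<close>

text \<open>Generalizes \<open>mix\<close> to any space, because couplings are mixed as well as
  measures on the plane.\<close>

definition mixture :: "real \<Rightarrow> 'a measure \<Rightarrow> 'a measure \<Rightarrow> 'a measure" where
  "mixture l M N = measure_of (space M) (sets M) (\<lambda>A. ennreal (1 - l) * emeasure M A + ennreal l * emeasure N A)"

lemma sets_mixture [simp, measurable_cong]: "sets (mixture l M N) = sets M"
  by (simp add: mixture_def)

lemma space_mixture [simp]: "space (mixture l M N) = space M"
  by (simp add: mixture_def)

lemma emeasure_mixture:
  assumes s: "sets N = sets M" and A: "A \<in> sets M"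
  shows "emeasure (mixture l M N) A = ennreal (1 - l) * emeasure M A + ennreal l * emeasure N A"
proof (rule emeasure_measure_of[OF mixture_def sets.space_closed])
  show "A \<in> sets (mixture l M N)" using A by simp
  show "positive (sets (mixture l M N)) (\<lambda>A. ennreal (1 - l) * emeasure M A + ennreal l * emeasure N A)"
    by (simp add: positive_def)
  show "countably_additive (sets (mixture l M N)) (\<lambda>A. ennreal (1 - l) * emeasure M A + ennreal l * emeasure N A)"
  proof (rule countably_additiveI)
    fix B :: "nat \<Rightarrow> 'a set" assume B: "range B \<subseteq> sets (mixture l M N)" "disjoint_family B"
    have "(\<Sum>i. ennreal (1 - l) * emeasure M (B i) + ennreal l * emeasure N (B i)) =
        (\<Sum>i. ennreal (1 - l) * emeasure M (B i)) + (\<Sum>i. ennreal l * emeasure N (B i))"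
      by (rule suminf_add[symmetric]) auto
    also have "\<dots> = ennreal (1 - l) * (\<Sum>i. emeasure M (B i)) + ennreal l * (\<Sum>i. emeasure N (B i))"
      by (simp only: ennreal_suminf_cmult)
    also have "(\<Sum>i. emeasure M (B i)) = emeasure M (\<Union>i. B i)" using B by (intro suminf_emeasure) auto
    also have "(\<Sum>i. emeasure N (B i)) = emeasure N (\<Union>i. B i)" using B s by (intro suminf_emeasure) auto
    finally show "(\<Sum>i. ennreal (1 - l) * emeasure M (B i) + ennreal l * emeasure N (B i)) =
      ennreal (1 - l) * emeasure M (\<Union> (range B)) + ennreal l * emeasure N (\<Union> (range B))" .
  qed
qed

lemma nn_integral_mixture:
  assumes s: "sets N = sets M" and f: "f \<in> borel_measurable M"
  shows "(\<integral>\<^sup>+x. f x \<partial>mixture l M N) = ennreal (1 - l) * (\<integral>\<^sup>+x. f x \<partial>M) + ennreal l * (\<integral>\<^sup>+x. f x \<partial>N)"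
  using f
proof induct
  case (cong f g)
  have "(\<integral>\<^sup>+x. f x \<partial>mixture l M N) = (\<integral>\<^sup>+x. g x \<partial>mixture l M N)"
    "(\<integral>\<^sup>+x. f x \<partial>M) = (\<integral>\<^sup>+x. g x \<partial>M)" "(\<integral>\<^sup>+x. f x \<partial>N) = (\<integral>\<^sup>+x. g x \<partial>N)"
    using cong(3) sets_eq_imp_space_eq[OF s] by (auto intro!: nn_integral_cong)
  then show ?case using cong(4) by simp
next
  case (set A)
  then show ?case using s by (simp add: emeasure_mixture)
next
  case (mult u v)
  have [measurable]: "u \<in> borel_measurable N" using mult(2) s by (simp cong: measurable_cong_sets)
  show ?case using mult by (simp add: nn_integral_cmult algebra_simps)
next
  case (add u v)
  have [measurable]: "u \<in> borel_measurable N" "v \<in> borel_measurable N" using add s by (simp_all cong: measurable_cong_sets)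
  show ?case using add by (simp add: nn_integral_add algebra_simps)
next
  case (seq U)
  have [measurable]: "U i \<in> borel_measurable N" "U i \<in> borel_measurable M" for i using seq s by (simp_all cong: measurable_cong_sets)
  have "incseq U" by fact
  then have inc: "incseq (\<lambda>i. \<integral>\<^sup>+x. U i x \<partial>M)" "incseq (\<lambda>i. \<integral>\<^sup>+x. U i x \<partial>N)"
    by (auto simp: incseq_def le_fun_def intro!: nn_integral_mono)
  have SE: "(SUP i. U i) x = (SUP i. U i x)" for x by (simp add: image_image)
  have "(\<integral>\<^sup>+x. (SUP i. U i) x \<partial>mixture l M N) = (SUP i. \<integral>\<^sup>+x. U i x \<partial>mixture l M N)"
    unfolding SE by (rule nn_integral_monotone_convergence_SUP) (use seq in auto)
  also have "\<dots> = (SUP i. ennreal (1 - l) * (\<integral>\<^sup>+x. U i x \<partial>M) + ennreal l * (\<integral>\<^sup>+x. U i x \<partial>N))"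
    using seq by simp
  also have "\<dots> = (SUP i. ennreal (1 - l) * (\<integral>\<^sup>+x. U i x \<partial>M)) + (SUP i. ennreal l * (\<integral>\<^sup>+x. U i x \<partial>N))"
    using inc by (intro ennreal_SUP_add) (auto simp: incseq_def intro!: mult_left_mono)
  also have "\<dots> = ennreal (1 - l) * (SUP i. \<integral>\<^sup>+x. U i x \<partial>M) + ennreal l * (SUP i. \<integral>\<^sup>+x. U i x \<partial>N)"
    by (simp add: SUP_mult_left_ennreal)
  also have "(SUP i. \<integral>\<^sup>+x. U i x \<partial>M) = (\<integral>\<^sup>+x. (SUP i. U i) x \<partial>M)"
    unfolding SE by (rule nn_integral_monotone_convergence_SUP[symmetric]) (use seq in auto)
  also have "(SUP i. \<integral>\<^sup>+x. U i x \<partial>N) = (\<integral>\<^sup>+x. (SUP i. U i) x \<partial>N)"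
    unfolding SE by (rule nn_integral_monotone_convergence_SUP[symmetric]) (use seq in auto)
  finally show ?case .
qed

lemma integrable_mixture:
  fixes f :: "'a \<Rightarrow> real"
  assumes s: "sets N = sets M" and f: "integrable M f" "integrable N f" and l: "0 \<le> l" "l \<le> 1"
  shows "integrable (mixture l M N) f" "(\<integral>x. f x \<partial>mixture l M N) = (1 - l) * (\<integral>x. f x \<partial>M) + l * (\<integral>x. f x \<partial>N)"
proof -
  have [measurable]: "f \<in> borel_measurable M" "f \<in> borel_measurable N" using f by auto
  have fin: "(\<integral>\<^sup>+x. ennreal (h x) \<partial>M) < \<infinity>" "(\<integral>\<^sup>+x. ennreal (h x) \<partial>N) < \<infinity>" 
     if "integrable M h" "integrable N h" for h :: "'a \<Rightarrow> real"
    using that by (auto simp: real_integrable_def less_top[symmetric])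
  show int: "integrable (mixture l M N) f"
  proof (rule integrableI_bounded)
    have "integrable M (\<lambda>x. norm (f x))" "integrable N (\<lambda>x. norm (f x))" using f by auto
    then have fin: "(\<integral>\<^sup>+x. ennreal (norm (f x)) \<partial>M) < \<infinity>" "(\<integral>\<^sup>+x. ennreal (norm (f x)) \<partial>N) < \<infinity>" by (rule fin)+
    have "(\<integral>\<^sup>+x. ennreal (norm (f x)) \<partial>mixture l M N) = ennreal (1 - l) * (\<integral>\<^sup>+x. ennreal (norm (f x)) \<partial>M) + ennreal l * (\<integral>\<^sup>+x. ennreal (norm (f x)) \<partial>N)"
      by (rule nn_integral_mixture[OF s]) measurable
    also have "\<dots> < \<infinity>" using fin by (auto simp: ennreal_mult_less_top)
    finally show "(\<integral>\<^sup>+x. ennreal (norm (f x)) \<partial>mixture l M N) < \<infinity>" .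
  qed measurable
  have part: "enn2real (\<integral>\<^sup>+x. ennreal (h x) \<partial>mixture l M N) = (1 - l) * enn2real (\<integral>\<^sup>+x. ennreal (h x) \<partial>M) + l * enn2real (\<integral>\<^sup>+x. ennreal (h x) \<partial>N)"
     if h: "integrable M h" "integrable N h" for h :: "'a \<Rightarrow> real"
  proof -
    have "(\<integral>\<^sup>+x. ennreal (h x) \<partial>mixture l M N) = ennreal (1 - l) * (\<integral>\<^sup>+x. ennreal (h x) \<partial>M) + ennreal l * (\<integral>\<^sup>+x. ennreal (h x) \<partial>N)"
      by (rule nn_integral_mixture[OF s]) (use h in measurable)
    moreover have "enn2real (ennreal (1 - l) * a + ennreal l * b) = (1 - l) * enn2real a + l * enn2real b" if "a < \<infinity>" "b < \<infinity>" for a b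
      using that l by (subst enn2real_plus) (auto simp: enn2real_mult ennreal_mult_less_top)
    ultimately show ?thesis using fin[OF h] by simp
  qed
  have "(\<integral>x. f x \<partial>mixture l M N) = enn2real (\<integral>\<^sup>+x. ennreal (f x) \<partial>mixture l M N) - enn2real (\<integral>\<^sup>+x. ennreal (- f x) \<partial>mixture l M N)"
    by (rule real_lebesgue_integral_def[OF int])
  also have "\<dots> = (1 - l) * (enn2real (\<integral>\<^sup>+x. ennreal (f x) \<partial>M) - enn2real (\<integral>\<^sup>+x. ennreal (- f x) \<partial>M)) + l * (enn2real (\<integral>\<^sup>+x. ennreal (f x) \<partial>N) - enn2real (\<integral>\<^sup>+x. ennreal (- f x) \<partial>N))"
    using part[OF f] part[of "\<lambda>x. - f x"] f by (simp add: algebra_simps)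
  also have "\<dots> = (1 - l) * (\<integral>x. f x \<partial>M) + l * (\<integral>x. f x \<partial>N)"
    using real_lebesgue_integral_def[OF f(1)] real_lebesgue_integral_def[OF f(2)] by simp
  finally show "(\<integral>x. f x \<partial>mixture l M N) = (1 - l) * (\<integral>x. f x \<partial>M) + l * (\<integral>x. f x \<partial>N)" .
qed

lemma prob_space_mixture:
  assumes "prob_space M" "prob_space N" "sets N = sets M" "0 \<le> l" "l \<le> 1"
  shows "prob_space (mixture l M N)"
proof
  interpret M: prob_space M by fact
  interpret N: prob_space N by fact
  have "space N = space M" by (rule sets_eq_imp_space_eq) fact
  then have "emeasure (mixture l M N) (space M) = ennreal (1 - l) + ennreal l"
    using assms(3) M.emeasure_space_1 N.emeasure_space_1 by (simp add: emeasure_mixture)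
  then show "emeasure (mixture l M N) (space (mixture l M N)) = 1" using assms(4,5) by (simp flip: ennreal_plus)
qed

lemma distr_mixture:
  assumes s: "sets N = sets M" and f: "f \<in> measurable M K"
  shows "distr (mixture l M N) K f = mixture l (distr M K f) (distr N K f)"
proof (rule measure_eqI)
  fix A assume A: "A \<in> sets (distr (mixture l M N) K f)"
  have fN: "f \<in> measurable N K" and fm: "f \<in> measurable (mixture l M N) K" using f s by (simp_all cong: measurable_cong_sets)
  have sp: "space N = space M" by (rule sets_eq_imp_space_eq) fact
  show "emeasure (distr (mixture l M N) K f) A = emeasure (mixture l (distr M K f) (distr N K f)) A"
    using A f fN fm s by (simp add: emeasure_distr emeasure_mixture sp measurable_sets)
qed simp

lemma mixture_same: "0 \<le> l \<Longrightarrow> l \<le> 1 \<Longrightarrow> mixture l M M = M"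
  by (rule measure_eqI) (auto simp: emeasure_mixture simp flip: distrib_right ennreal_plus)

section \<open>Segments of plane measures with finite moment\<close>

lemma sets_Pp: "m \<in> Pp p \<Longrightarrow> sets m = sets borel" by (simp add: Pp_def)

lemma space_Pp: "m \<in> Pp p \<Longrightarrow> space m = UNIV" using sets_eq_imp_space_eq[OF sets_Pp] by fastforce

lemma plane_prob_Pp: "m \<in> Pp p \<Longrightarrow> plane_prob m"
  by (simp add: Pp_def plane_prob_def borel_prob_def borel_prob_axioms_def)

lemma mix_eq_mixture: "m \<in> Pp p \<Longrightarrow> m' \<in> Pp p \<Longrightarrow> mix l m m' = mixture l m m'"
  by (simp add: mix_def mixture_def sets_Pp space_Pp)

lemma id_in_Lp: "m \<in> Pp p \<Longrightarrow> in_Lp p m (\<lambda>x. x)"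
  using measurable_ident_sets[OF sets_Pp, of m p] by (simp add: Pp_def in_Lp_def)

lemma mix_Pp:
  assumes m: "m \<in> Pp p" "m' \<in> Pp p" and l: "0 \<le> l" "l \<le> 1"
  shows "mix l m m' \<in> Pp p"
proof -
  have "prob_space (mixture l m m')" using m l by (intro prob_space_mixture) (auto simp: Pp_def)
  moreover have "integrable (mixture l m m') (\<lambda>x. norm x powr p)"
    using m l by (intro integrable_mixture) (auto simp: Pp_def)
  ultimately show ?thesis unfolding mix_eq_mixture[OF m] using m by (simp add: Pp_def)
qed

lemma integral_mix:
  fixes f :: "plane \<Rightarrow> real"
  assumes m: "m \<in> Pp p" "m' \<in> Pp p" and l: "0 \<le> l" "l \<le> 1" and f: "integrable m f" "integrable m' f"
  shows "(\<integral>x. f x \<partial>mix l m m') = (1 - l) * (\<integral>x. f x \<partial>m) + l * (\<integral>x. f x \<partial>m')"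
  unfolding mix_eq_mixture[OF m] using sets_Pp[OF m(1)] sets_Pp[OF m(2)] by (intro integrable_mixture f l) simp

text \<open>Restarting from an interior point of a segment toward either endpoint stays on the
  segment. The linear functional derivative is a limit at the start of a segment; these
  reparametrizations turn it into one-sided derivatives at every point.\<close>

lemma mix_mix:
  assumes m: "m \<in> Pp p" "m' \<in> Pp p" and l: "0 \<le> l" "l \<le> 1" and s: "0 \<le> s" "s \<le> 1"
  shows "mix s (mix l m m') m' = mix (l + s * (1 - l)) m m'" "mix s (mix l m m') m = mix (l * (1 - s)) m m'"
proof -
  have M: "mix l m m' \<in> Pp p" by (rule mix_Pp[OF m l])
  have em: "emeasure (mix l m m') A = ennreal (1 - l) * emeasure m A + ennreal l * emeasure m' A" if "A \<in> sets borel" for l A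
    unfolding mix_eq_mixture[OF m] using sets_Pp[OF m(1)] sets_Pp[OF m(2)] that by (intro emeasure_mixture) auto
  have em2: "emeasure (mix s (mix l m m') n) A = ennreal (1 - s) * emeasure (mix l m m') A + ennreal s * emeasure n A" if "A \<in> sets borel" "n \<in> Pp p" for n A
    unfolding mix_eq_mixture[OF M that(2)] using sets_Pp[OF M] sets_Pp[OF that(2)] that(1) by (intro emeasure_mixture) auto
  have sets: "sets (mix a n n') = sets borel" if "n \<in> Pp p" "n' \<in> Pp p" for a n n'
    using that by (simp add: mix_eq_mixture sets_Pp)
  show "mix s (mix l m m') m' = mix (l + s * (1 - l)) m m'"
  proof (rule measure_eqI)
    fix A assume "A \<in> sets (mix s (mix l m m') m')"
    then have A: "A \<in> sets borel" using sets[OF M m(2)] by simp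
    have e1: "ennreal (1 - s) * ennreal (1 - l) = ennreal (1 - (l + s * (1 - l)))"
      using l s by (simp add: ennreal_mult[symmetric] algebra_simps)
    have "ennreal (1 - s) * ennreal l + ennreal s = ennreal ((1 - s) * l + s)"
      using l s by (simp only: ennreal_mult ennreal_plus mult_nonneg_nonneg diff_ge_0_iff_ge)
    also have "(1 - s) * l + s = l + s * (1 - l)" by (simp add: algebra_simps)
    finally have e2: "ennreal (1 - s) * ennreal l + ennreal s = ennreal (l + s * (1 - l))" .
    show "emeasure (mix s (mix l m m') m') A = emeasure (mix (l + s * (1 - l)) m m') A"
      unfolding em2[OF A m(2)] em[OF A] e1[symmetric] e2[symmetric] by (simp add: algebra_simps)
  qed (simp add: sets m M)
  show "mix s (mix l m m') m = mix (l * (1 - s)) m m'"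
  proof (rule measure_eqI)
    fix A assume "A \<in> sets (mix s (mix l m m') m)"
    then have A: "A \<in> sets borel" using sets[OF M m(1)] by simp
    have e1: "ennreal (1 - s) * ennreal l = ennreal (l * (1 - s))"
      using l s by (simp add: ennreal_mult[symmetric] algebra_simps)
    have "ennreal (1 - s) * ennreal (1 - l) + ennreal s = ennreal ((1 - s) * (1 - l) + s)"
      using l s by (simp only: ennreal_mult ennreal_plus mult_nonneg_nonneg diff_ge_0_iff_ge)
    also have "(1 - s) * (1 - l) + s = 1 - l * (1 - s)" by (simp add: algebra_simps)
    finally have e2: "ennreal (1 - s) * ennreal (1 - l) + ennreal s = ennreal (1 - l * (1 - s))" .
    show "emeasure (mix s (mix l m m') m) A = emeasure (mix (l * (1 - s)) m m') A"
      unfolding em2[OF A m(1)] em[OF A] e1[symmetric] e2[symmetric] by (simp add: algebra_simps)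
  qed (simp add: sets m M)
qed

section \<open>Couplings and transport cost\<close>

lemma fst_plane2 [measurable]: "(fst :: plane \<times> plane \<Rightarrow> plane) \<in> borel_measurable borel"
  by (intro borel_measurable_continuous_onI continuous_intros)

lemma snd_plane2 [measurable]: "(snd :: plane \<times> plane \<Rightarrow> plane) \<in> borel_measurable borel"
  by (intro borel_measurable_continuous_onI continuous_intros)

lemma Pair_plane2 [measurable]:
  assumes "f \<in> borel_measurable M" "g \<in> borel_measurable M"
  shows "(\<lambda>x. (f x :: plane, g x :: plane)) \<in> borel_measurable M"
  using assms by (rule borel_measurable_Pair)

lemma transport_cost_Lnorm: "transport_cost p \<pi> = Lnorm p \<pi> (\<lambda>z. fst z - snd z)"
  by (simp add: transport_cost_def Lnorm_def)

locale coupling =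
  fixes p :: real and m m' :: "plane measure" and \<pi> :: "(plane \<times> plane) measure"
  assumes p: "p > 1" and m: "m \<in> Pp p" and m': "m' \<in> Pp p" and \<pi>: "\<pi> \<in> couplings m m'"
begin

sublocale prob_space \<pi> using \<pi> by (simp add: couplings_def)

lemma sets_\<pi> [measurable_cong]: "sets \<pi> = sets borel" using \<pi> by (simp add: couplings_def)

lemma space_\<pi> [simp]: "space \<pi> = UNIV" using sets_eq_imp_space_eq[OF sets_\<pi>] by simp

lemma fst_law: "distr \<pi> borel fst = m" and snd_law: "distr \<pi> borel snd = m'" using \<pi> by (auto simp: couplings_def)

lemma integral_fst: "f \<in> borel_measurable borel \<Longrightarrow> (\<integral>z. f (fst z) \<partial>\<pi>) = (\<integral>x. f x \<partial>m :: real)"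
  unfolding fst_law[symmetric] by (subst integral_distr) auto

lemma integral_snd: "f \<in> borel_measurable borel \<Longrightarrow> (\<integral>z. f (snd z) \<partial>\<pi>) = (\<integral>x. f x \<partial>m' :: real)"
  unfolding snd_law[symmetric] by (subst integral_distr) auto

lemma integrable_fst_iff: "f \<in> borel_measurable borel \<Longrightarrow> integrable \<pi> (\<lambda>z. f (fst z) :: real) \<longleftrightarrow> integrable m f"
  unfolding fst_law[symmetric] by (subst integrable_distr_eq) auto

lemma integrable_snd_iff: "f \<in> borel_measurable borel \<Longrightarrow> integrable \<pi> (\<lambda>z. f (snd z) :: real) \<longleftrightarrow> integrable m' f"
  unfolding snd_law[symmetric] by (subst integrable_distr_eq) auto

lemma in_Lp_fst: 
  fixes f :: "plane \<Rightarrow> 'b::{real_normed_vector, second_countable_topology}"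
  assumes [measurable]: "f \<in> borel_measurable borel"
  shows "in_Lp q m f \<Longrightarrow> in_Lp q \<pi> (\<lambda>z. f (fst z))" "Lnorm q \<pi> (\<lambda>z. f (fst z)) = Lnorm q m f"
  using integrable_fst_iff[of "\<lambda>x. norm (f x) powr q"] integral_fst[of "\<lambda>x. norm (f x) powr q"]
  by (auto simp: in_Lp_def Lnorm_def)

lemma in_Lp_snd:
  fixes f :: "plane \<Rightarrow> 'b::{real_normed_vector, second_countable_topology}"
  assumes [measurable]: "f \<in> borel_measurable borel"
  shows "in_Lp q m' f \<Longrightarrow> in_Lp q \<pi> (\<lambda>z. f (snd z))" "Lnorm q \<pi> (\<lambda>z. f (snd z)) = Lnorm q m' f"
  using integrable_snd_iff[of "\<lambda>x. norm (f x) powr q"] integral_snd[of "\<lambda>x. norm (f x) powr q"]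
  by (auto simp: in_Lp_def Lnorm_def)

definition \<Delta> :: "plane \<times> plane \<Rightarrow> plane" where "\<Delta> z = snd z - fst z"

lemma \<Delta>_meas [measurable]: "\<Delta> \<in> borel_measurable borel" unfolding \<Delta>_def by measurable

lemma \<Delta>_Lp: "in_Lp p \<pi> \<Delta>"
  unfolding \<Delta>_def using in_Lp_fst(1)[of "\<lambda>x. x" p] in_Lp_snd(1)[of "\<lambda>x. x" p] id_in_Lp[OF m] id_in_Lp[OF m'] p
  by (intro in_Lp_diff) auto

lemma cost_eq: "transport_cost p \<pi> = Lnorm p \<pi> \<Delta>"
  by (simp add: transport_cost_Lnorm Lnorm_def \<Delta>_def norm_minus_commute)

abbreviation cost :: real where "cost \<equiv> transport_cost p \<pi>"

lemma cost_nonneg: "cost \<ge> 0" by (simp add: cost_eq)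

lemma cost_powr: "(\<integral>z. norm (\<Delta> z) powr p \<partial>\<pi>) = cost powr p"
  using Lnorm_powr[of p \<pi> \<Delta>] p by (simp add: cost_eq)

lemma norm_\<Delta>_integrable: "integrable \<pi> (\<lambda>z. norm (\<Delta> z))"
  using in_Lp_imp_integrable[OF finite_measure_axioms \<Delta>_Lp] p by simp

lemma norm_\<Delta>_le: "(\<integral>z. norm (\<Delta> z) \<partial>\<pi>) \<le> cost"
proof -
  have 1: "in_Lp p \<pi> (\<lambda>z. norm (\<Delta> z))" using \<Delta>_Lp by (simp add: in_Lp_def)
  have "\<bar>\<integral>z. norm (\<Delta> z) * 1 \<partial>\<pi>\<bar> \<le> Lnorm p \<pi> (\<lambda>z. norm (\<Delta> z)) * Lnorm (conj_exp p) \<pi> (\<lambda>z. 1 :: real)"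
    using p conj_exp_props[OF p] by (intro Holder_integral 1 in_Lp_const finite_measure_axioms) auto
  moreover have "Lnorm (conj_exp p) \<pi> (\<lambda>z. 1 :: real) = 1" using prob_space by (simp add: Lnorm_def)
  ultimately show ?thesis by (simp add: cost_eq)
qed

lemma wasserstein_le_cost: "wasserstein p m m' \<le> cost"
  unfolding wasserstein_def by (rule cINF_lower[OF _ \<pi>]) (auto intro!: bdd_belowI[of _ 0] simp: transport_cost_def)

end

lemma diag_coupling:
  assumes m: "m \<in> Pp p"
  shows "distr m borel (\<lambda>x. (x, x)) \<in> couplings m m"
proof -
  interpret plane_prob m by (rule plane_prob_Pp[OF m])
  have id: "distr m borel (\<lambda>x. x) = m" by (rule distr_id2) (simp add: sets_Pp[OF m])
  show ?thesis unfolding couplings_def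
    by (auto intro!: prob_space_distr simp: distr_distr o_def id)
qed

lemma transport_cost_distr:
  assumes m: "m \<in> Pp p" and [measurable]: "f \<in> borel_measurable borel"
  shows "transport_cost p (distr m borel f) = (\<integral>x. norm (fst (f x) - snd (f x)) powr p \<partial>m) powr (1 / p)"
proof -
  interpret plane_prob m by (rule plane_prob_Pp[OF m])
  show ?thesis unfolding transport_cost_def by (subst integral_distr) auto
qed

lemma wasserstein_self: 
  assumes m: "m \<in> Pp p" and p: "p > 1"
  shows "wasserstein p m m = 0"
proof (rule antisym)
  interpret c: coupling p m m "distr m borel (\<lambda>x. (x, x))"
    by unfold_locales (use m p diag_coupling in auto)
  show "wasserstein p m m \<le> 0" using c.wasserstein_le_cost transport_cost_distr[OF m, of "\<lambda>x. (x, x)"] p by simp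
  show "0 \<le> wasserstein p m m" unfolding wasserstein_def
    using diag_coupling[OF m] by (intro cINF_greatest) (auto simp: transport_cost_def)
qed

context coupling
begin

text \<open>Mixing \<open>\<pi>\<close> with the diagonal coupling couples \<open>m\<close> to the
  point of the segment at no greater cost. Hence whole segments stay in the neighbourhood where the
  local hypotheses on the derivative hold.\<close>

lemma wasserstein_mix_le:
  assumes l: "0 \<le> l" "l \<le> 1"
  shows "wasserstein p m (mix l m m') \<le> cost"
proof -
  define D where "D = distr m borel (\<lambda>x. (x, x))"
  have D: "D \<in> couplings m m" unfolding D_def by (rule diag_coupling[OF m])
  have sD: "sets D = sets borel" by (simp add: D_def)
  have sE: "sets \<pi> = sets D" by (simp add: sD sets_\<pi>)
  have fm: "fst \<in> measurable D borel" "snd \<in> measurable D borel" using sD by (simp_all cong: measurable_cong_sets)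
  have pc: "mixture l D \<pi> \<in> couplings m (mix l m m')"
  proof -
    have "prob_space (mixture l D \<pi>)" using D prob_space_axioms sE l by (intro prob_space_mixture) (auto simp: couplings_def)
    moreover have "distr (mixture l D \<pi>) borel fst = m"
      using D l distr_mixture[OF sE fm(1), of l] by (simp add: couplings_def fst_law mixture_same)
    moreover have "distr (mixture l D \<pi>) borel snd = mix l m m'"
      using D l distr_mixture[OF sE fm(2), of l] by (simp add: couplings_def snd_law mix_eq_mixture[OF m m'])
    ultimately show ?thesis by (simp add: couplings_def sD)
  qed
  interpret c: coupling p m "mix l m m'" "mixture l D \<pi>"
    by unfold_locales (use p m pc mix_Pp[OF m m' l] in auto)
  interpret d: coupling p m m D by unfold_locales (use p m D in auto)
  have D0: "(\<integral>z. norm (fst z - snd z) powr p \<partial>D) = 0"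
    unfolding D_def using plane_prob_Pp[OF m] by (subst integral_distr) (auto simp: sets_Pp[OF m] cong: measurable_cong_sets)
  have iD: "integrable D (\<lambda>z. norm (fst z - snd z) powr p)"
    using d.\<Delta>_Lp by (simp add: in_Lp_def d.\<Delta>_def norm_minus_commute)
  have i\<pi>: "integrable \<pi> (\<lambda>z. norm (fst z - snd z) powr p)"
    using \<Delta>_Lp by (simp add: in_Lp_def \<Delta>_def norm_minus_commute)
  have "(\<integral>z. norm (fst z - snd z) powr p \<partial>mixture l D \<pi>) = l * (\<integral>z. norm (fst z - snd z) powr p \<partial>\<pi>)"
    using integrable_mixture(2)[OF sE iD i\<pi> l] D0 by simp
  also have "\<dots> \<le> 1 * (\<integral>z. norm (fst z - snd z) powr p \<partial>\<pi>)" using l by (intro mult_right_mono) auto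
  finally have "transport_cost p (mixture l D \<pi>) \<le> cost"
    unfolding transport_cost_def using p by (intro powr_mono2) auto
  then show ?thesis using c.wasserstein_le_cost by linarith
qed

end

section \<open>First-order expansion of the functional\<close>

text \<open>The total derivative is linear, hence given by its values on the two unit vectors, which
  are the derivatives along the coordinate lines.\<close>

lemma has_derivative_grad:
  assumes "u differentiable (at z)"
  shows "(u has_derivative (\<lambda>h. grad u z \<bullet> h)) (at z)"
proof -
  obtain D where D: "(u has_derivative D) (at z)" using assms by (auto simp: differentiable_def)
  interpret D: bounded_linear D using D by (rule has_derivative_bounded_linear)
  have z: "(fst z, snd z) = z" by simp
  have d1: "((\<lambda>t. u (t, snd z)) has_derivative (\<lambda>t. D (t, 0))) (at (fst z))"
    by (rule has_derivative_compose[of "\<lambda>t. (t, snd z)" "\<lambda>t. (t, 0)" "fst z" UNIV u D]) (auto intro!: derivative_eq_intros simp: z D)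
  have d2: "((\<lambda>t. u (fst z, t)) has_derivative (\<lambda>t. D (0, t))) (at (snd z))"
    by (rule has_derivative_compose[of "\<lambda>t. (fst z, t)" "\<lambda>t. (0, t)" "snd z" UNIV u D]) (auto intro!: derivative_eq_intros simp: z D)
  define a b where "a = D (1, 0)" and "b = D (0, 1)"
  have s1: "D (t, 0) = a * t" and s2: "D (0, t) = b * t" for t
    using D.scaleR[of t "(1, 0)"] D.scaleR[of t "(0, 1)"] by (simp_all add: a_def b_def)
  have "((\<lambda>t. u (t, snd z)) has_real_derivative a) (at (fst z))"
    using d1 unfolding has_field_derivative_def s1 .
  then have p1: "partial1 u z = a" unfolding partial1_def by (rule DERIV_imp_deriv)
  have "((\<lambda>t. u (fst z, t)) has_real_derivative b) (at (snd z))"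
    using d2 unfolding has_field_derivative_def s2 .
  then have p2: "partial2 u z = b" unfolding partial2_def by (rule DERIV_imp_deriv)
  have "D h = grad u z \<bullet> h" for h
  proof -
    have "D h = D ((fst h, 0) + (0, snd h))" by simp
    also have "\<dots> = D (fst h, 0) + D (0, snd h)" by (rule D.add)
    finally show ?thesis unfolding s1[of "fst h"] s2[of "snd h"] by (simp add: grad_def p1 p2 inner_prod_def)
  qed
  then have "D = (\<lambda>h. grad u z \<bullet> h)" by (rule ext)
  then show ?thesis using D by (simp only:)
qed

lemma segment_mean_value:
  assumes "\<And>z. u differentiable (at z)"
  shows "\<exists>\<xi>. norm (\<xi> - x) \<le> norm (y - x) \<and> u y - u x = grad u \<xi> \<bullet> (y - x)"
proof -
  define f where "f t = u (x + t *\<^sub>R (y - x))" for t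
  have d: "(f has_derivative (\<lambda>h. grad u (x + t *\<^sub>R (y - x)) \<bullet> (h *\<^sub>R (y - x)))) (at t within {0..1})" for t
    unfolding f_def
    by (rule has_derivative_compose[where g=u and f="\<lambda>t. x + t *\<^sub>R (y - x)"])
       (auto intro!: derivative_eq_intros has_derivative_grad assms)
  obtain t where t: "t \<in> {0..1}" "f 1 - f 0 = grad u (x + t *\<^sub>R (y - x)) \<bullet> ((1 - 0) *\<^sub>R (y - x))"
    using mvt_very_simple[of 0 1 f "\<lambda>t h. grad u (x + t *\<^sub>R (y - x)) \<bullet> (h *\<^sub>R (y - x))"] d by auto
  have "norm (t *\<^sub>R (y - x)) \<le> 1 * norm (y - x)" using t(1) unfolding norm_scaleR by (intro mult_right_mono) auto
  then show ?thesis using t(2) by (intro exI[of _ "x + t *\<^sub>R (y - x)"]) (auto simp: f_def)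
qed

locale mean_field =
  fixes p :: real and g :: "plane measure \<Rightarrow> real" and \<delta>g :: "plane measure \<Rightarrow> plane \<Rightarrow> real"
  assumes p: "p > 1" and R: "cond_R p g \<delta>g"
begin

abbreviation q :: real where "q \<equiv> conj_exp p"

lemmas q1 = conj_exp_props(1)[OF p]

lemma diff: "m \<in> Pp p \<Longrightarrow> \<delta>g m differentiable (at x)"
  using R unfolding cond_R_def by blast

lemma \<delta>g_meas: "m \<in> Pp p \<Longrightarrow> \<delta>g m \<in> borel_measurable borel"
  using diff by (intro borel_measurable_continuous_onI differentiable_imp_continuous_on) (simp add: differentiable_on_def differentiable_at_withinI)

lemma grad_cont: "m \<in> Pp p \<Longrightarrow> continuous_on UNIV (grad (\<delta>g m))"
  using R by (simp add: cond_R_def)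

lemma grad_meas: "m \<in> Pp p \<Longrightarrow> grad (\<delta>g m) \<in> borel_measurable borel"
  using grad_cont by (rule borel_measurable_continuous_onI)

lemma \<delta>g_integrable:
  assumes m: "m \<in> Pp p" and n: "n \<in> Pp p"
  shows "integrable n (\<delta>g m)"
proof -
  interpret n: plane_prob n by (rule plane_prob_Pp[OF n])
  have "locally_poly_growth p p \<delta>g" using R by (simp add: cond_R_def linear_functional_derivative_def)
  then obtain s C where sC: "s > 0" "\<And>m'. m' \<in> Pp p \<Longrightarrow> wasserstein p m m' < s \<Longrightarrow> (\<forall>x. norm (\<delta>g m' x) \<le> C * (1 + norm x powr p))"
    using m unfolding locally_poly_growth_def by blast
  have b: "norm (\<delta>g m x) \<le> C * (1 + norm x powr p)" for x
  proof -
    have "wasserstein p m m < s" using sC(1) wasserstein_self[OF m p] by simp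
    then show ?thesis using sC(2)[OF m] by blast
  qed
  show ?thesis
  proof (rule Bochner_Integration.integrable_bound)
    show "integrable n (\<lambda>x. C * (1 + norm x powr p))" using n by (auto simp: Pp_def)
    show "\<delta>g m \<in> borel_measurable n" using \<delta>g_meas[OF m] by (simp add: n.sets_eq cong: measurable_cong_sets)
    show "AE x in n. norm (\<delta>g m x) \<le> norm (C * (1 + norm x powr p))"
      using b by (intro AE_I2) (metis abs_ge_self order_trans real_norm_def)
  qed
qed

text \<open>Along the segment both one-sided derivatives of \<open>g\<close> exist and agree, the
  right one by moving toward \<open>m'\<close>, the left one by moving toward \<open>m\<close>. The
  mean value theorem then gives a single intermediate measure, with no integration over the
  segment.\<close>

lemma mean_value:
  assumes m: "m \<in> Pp p" and m': "m' \<in> Pp p"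
  shows "\<exists>l\<in>{0..1}. g m' - g m = (\<integral>x. \<delta>g (mix l m m') x \<partial>m') - (\<integral>x. \<delta>g (mix l m m') x \<partial>m)"
proof -
  define \<phi> where "\<phi> l = g (mix l m m')" for l
  define D where "D l = (\<integral>x. \<delta>g (mix l m m') x \<partial>m') - (\<integral>x. \<delta>g (mix l m m') x \<partial>m)" for l
  have lim: "((\<lambda>l. (g (mix l n n') - g n) / l) \<longlongrightarrow> (\<integral>x. \<delta>g n x \<partial>n') - (\<integral>x. \<delta>g n x \<partial>n)) (at_right 0)" 
    if "n \<in> Pp p" "n' \<in> Pp p" for n n'
    using R that by (simp add: cond_R_def linear_functional_derivative_def)
  have right: "((\<lambda>y. (\<phi> y - \<phi> l) / (y - l)) \<longlongrightarrow> D l) (at_right l)" if l: "0 \<le> l" "l < 1" for l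
  proof -
    define M where "M = mix l m m'"
    have M: "M \<in> Pp p" unfolding M_def using m m' l by (intro mix_Pp) auto
    have "(\<integral>x. \<delta>g M x \<partial>M) = (1 - l) * (\<integral>x. \<delta>g M x \<partial>m) + l * (\<integral>x. \<delta>g M x \<partial>m')"
      unfolding M_def by (rule integral_mix[OF m m' _ _ \<delta>g_integrable[OF M[unfolded M_def] m] \<delta>g_integrable[OF M[unfolded M_def] m']]) (use l in auto)
    then have val: "(\<integral>x. \<delta>g M x \<partial>m') - (\<integral>x. \<delta>g M x \<partial>M) = (1 - l) * D l"
      unfolding D_def M_def[symmetric] by (simp add: algebra_simps)
    \<comment> \<open>The fraction of the way from position \<open>l\<close> to the endpoint 1 at
      which position \<open>y\<close> lies. The factor \<open>1 - l\<close> it introduces cancels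
      the one in \<open>val\<close>.\<close>
    have fl: "filterlim (\<lambda>y. (y - l) / (1 - l)) (at_right 0) (at_right l)"
      unfolding filterlim_at
    proof
      show "\<forall>\<^sub>F y in at_right l. (y - l) / (1 - l) \<in> {0<..} \<and> (y - l) / (1 - l) \<noteq> 0"
        using l by (auto simp: eventually_at_right_field intro!: exI[of _ 1])
      have "((\<lambda>y. (y - l) / (1 - l)) \<longlongrightarrow> (l - l) / (1 - l)) (at_right l)" using l by (intro tendsto_intros) auto
      then show "((\<lambda>y. (y - l) / (1 - l)) \<longlongrightarrow> 0) (at_right l)" by simp
    qed
    have "((\<lambda>y. (g (mix ((y - l) / (1 - l)) M m') - g M) / ((y - l) / (1 - l))) \<longlongrightarrow> (1 - l) * D l) (at_right l)"
      using filterlim_compose[OF lim[OF M m'] fl] unfolding val .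
    then have t1: "((\<lambda>y. (g (mix ((y - l) / (1 - l)) M m') - g M) / ((y - l) / (1 - l)) / (1 - l)) \<longlongrightarrow> (1 - l) * D l / (1 - l)) (at_right l)"
      using l by (intro tendsto_divide tendsto_const) auto
    have eqv: "(1 - l) * D l / (1 - l) = D l" using l by simp
    have ev: "\<forall>\<^sub>F y in at_right l. (g (mix ((y - l) / (1 - l)) M m') - g M) / ((y - l) / (1 - l)) / (1 - l) = (\<phi> y - \<phi> l) / (y - l)"
      unfolding eventually_at_right_field
    proof (intro exI[of _ 1] conjI allI impI)
      fix y assume y: "l < y" "y < 1"
      have "mix ((y - l) / (1 - l)) M m' = mix (l + (y - l) / (1 - l) * (1 - l)) m m'"
        unfolding M_def using y l by (intro mix_mix(1)[OF m m']) auto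
      also have "l + (y - l) / (1 - l) * (1 - l) = y" using l by simp
      finally show "(g (mix ((y - l) / (1 - l)) M m') - g M) / ((y - l) / (1 - l)) / (1 - l) = (\<phi> y - \<phi> l) / (y - l)"
        using l by (simp add: \<phi>_def M_def)
    qed (use l in auto)
    show ?thesis using Lim_transform_eventually[OF t1 ev] unfolding eqv .
  qed
  have left: "((\<lambda>y. (\<phi> y - \<phi> l) / (y - l)) \<longlongrightarrow> D l) (at_left l)" if l: "0 < l" "l \<le> 1" for l
  proof -
    define M where "M = mix l m m'"
    have M: "M \<in> Pp p" unfolding M_def using m m' l by (intro mix_Pp) auto
    have "(\<integral>x. \<delta>g M x \<partial>M) = (1 - l) * (\<integral>x. \<delta>g M x \<partial>m) + l * (\<integral>x. \<delta>g M x \<partial>m')"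
      unfolding M_def by (rule integral_mix[OF m m' _ _ \<delta>g_integrable[OF M[unfolded M_def] m] \<delta>g_integrable[OF M[unfolded M_def] m']]) (use l in auto)
    then have val: "(\<integral>x. \<delta>g M x \<partial>m) - (\<integral>x. \<delta>g M x \<partial>M) = - l * D l"
      unfolding D_def M_def[symmetric] by (simp add: algebra_simps)
    have fl: "filterlim (\<lambda>y. (l - y) / l) (at_right 0) (at_left l)"
      unfolding filterlim_at
    proof
      show "\<forall>\<^sub>F y in at_left l. (l - y) / l \<in> {0<..} \<and> (l - y) / l \<noteq> 0"
        using l by (auto simp: eventually_at_left_field intro!: exI[of _ 0])
      have "((\<lambda>y. (l - y) / l) \<longlongrightarrow> (l - l) / l) (at_left l)" using l by (intro tendsto_intros) auto
      then show "((\<lambda>y. (l - y) / l) \<longlongrightarrow> 0) (at_left l)" by simp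
    qed
    have "((\<lambda>y. (g (mix ((l - y) / l) M m) - g M) / ((l - y) / l)) \<longlongrightarrow> - l * D l) (at_left l)"
      using filterlim_compose[OF lim[OF M m] fl] unfolding val .
    then have t1: "((\<lambda>y. (g (mix ((l - y) / l) M m) - g M) / ((l - y) / l) / (- l)) \<longlongrightarrow> - l * D l / (- l)) (at_left l)"
      using l by (intro tendsto_divide tendsto_const) auto
    have eqv: "- l * D l / (- l) = D l" using l by simp
    have ev: "\<forall>\<^sub>F y in at_left l. (g (mix ((l - y) / l) M m) - g M) / ((l - y) / l) / (- l) = (\<phi> y - \<phi> l) / (y - l)"
      unfolding eventually_at_left_field
    proof (intro exI[of _ 0] conjI allI impI)
      fix y assume y: "0 < y" "y < l"
      have "mix ((l - y) / l) M m = mix (l * (1 - (l - y) / l)) m m'"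
        unfolding M_def using y l by (intro mix_mix(2)[OF m m']) auto
      also have "l * (1 - (l - y) / l) = y" using l by (simp add: field_simps)
      finally have "mix ((l - y) / l) M m = mix y m m'" .
      then have "(g (mix ((l - y) / l) M m) - g M) / ((l - y) / l) / (- l) = (\<phi> y - \<phi> l) / ((l - y) / l * (- l))"
        by (simp add: \<phi>_def M_def)
      also have "(l - y) / l * (- l) = y - l" using l by simp
      finally show "(g (mix ((l - y) / l) M m) - g M) / ((l - y) / l) / (- l) = (\<phi> y - \<phi> l) / (y - l)" .
    qed (use l in auto)
    show ?thesis using Lim_transform_eventually[OF t1 ev] unfolding eqv .
  qed
  have "(\<phi> has_real_derivative D l) (at l within {0..1})" if l: "l \<in> {0..1}" for l
    unfolding has_field_derivative_iff
  proof -
    consider "l = 0" | "l = 1" | "0 < l" "l < 1" using l by fastforce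
    then show "((\<lambda>y. (\<phi> y - \<phi> l) / (y - l)) \<longlongrightarrow> D l) (at l within {0..1})"
    proof cases
      case 1 then show ?thesis using right[of 0] by (simp add: at_within_Icc_at_right)
    next
      case 2 then show ?thesis using left[of 1] by (simp add: at_within_Icc_at_left)
    next
      case 3 then show ?thesis using left[of l] right[of l] by (simp add: at_within_Icc_at filterlim_split_at)
    qed
  qed
  then have "\<exists>l\<in>{0..1}. \<phi> 1 - \<phi> 0 = D l * (1 - 0)"
    by (intro mvt_very_simple) (auto simp: has_field_derivative_def)
  moreover have "mix 1 m m' = m'" "mix 0 m m' = m"
    unfolding mix_eq_mixture[OF m m'] 
    by (rule measure_eqI; use sets_Pp[OF m] sets_Pp[OF m'] in \<open>auto simp: emeasure_mixture\<close>)+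
  ultimately show ?thesis by (auto simp: \<phi>_def D_def)
qed

lemma grad_growth:
  assumes m: "m \<in> Pp p"
  shows "\<exists>s>0. \<exists>C\<ge>0. \<forall>m'\<in>Pp p. wasserstein p m m' < s \<longrightarrow> (\<forall>x. norm (grad (\<delta>g m') x) \<le> C * (1 + norm x powr (p - 1)))"
proof -
  have "locally_poly_growth p (p - 1) (\<lambda>m. grad (\<delta>g m))" using R by (simp add: cond_R_def)
  then obtain s C where sC: "s > 0" "\<And>m'. m' \<in> Pp p \<Longrightarrow> wasserstein p m m' < s \<Longrightarrow> (\<forall>x. norm (grad (\<delta>g m') x) \<le> C * (1 + norm x powr (p - 1)))"
    using m unfolding locally_poly_growth_def by blast
  have "wasserstein p m m < s" using sC(1) wasserstein_self[OF m p] by simp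
  then have "norm (grad (\<delta>g m) 0) \<le> C * (1 + norm (0::plane) powr (p - 1))" using sC(2)[OF m] by blast
  also have "\<dots> = C" using p by simp
  finally have "C \<ge> 0" using norm_ge_zero order_trans by blast
  then show ?thesis using sC by blast
qed

text \<open>The dual exponent matches the growth exponent since
  \<open>(p - 1) * q = p\<close>.\<close>

lemma weight_in_Lq:
  assumes m: "m \<in> Pp p"
  shows "in_Lp q m (\<lambda>x. C * (1 + norm x powr (p - 1)))"
proof -
  interpret plane_prob m by (rule plane_prob_Pp[OF m])
  have "(norm x powr (p - 1)) powr q = norm x powr p" for x :: plane
    using conj_exp_props(5)[OF p] by (simp add: powr_powr)
  then have "in_Lp q m (\<lambda>x. norm x powr (p - 1))" using m by (simp add: in_Lp_def Pp_def)
  then show ?thesis using q1 by (intro in_Lp_cmult in_Lp_add in_Lp_const finite_measure_axioms) auto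
qed

lemma grad_in_Lq:
  assumes m: "m \<in> Pp p"
  shows "in_Lp q m (grad (\<delta>g m))"
proof -
  interpret plane_prob m by (rule plane_prob_Pp[OF m])
  obtain s C where sC: "s > 0" "C \<ge> 0" "\<And>m'. m' \<in> Pp p \<Longrightarrow> wasserstein p m m' < s \<Longrightarrow> (\<forall>x. norm (grad (\<delta>g m') x) \<le> C * (1 + norm x powr (p - 1)))"
    using grad_growth[OF m] by blast
  have b: "norm (grad (\<delta>g m) x) \<le> C * (1 + norm x powr (p - 1))" for x
  proof -
    have "wasserstein p m m < s" using sC(1) wasserstein_self[OF m p] by simp
    then show ?thesis using sC(3)[OF m] by blast
  qed
  show ?thesis
  proof (rule in_Lp_bound[OF weight_in_Lq[OF m, of C]])
    show "grad (\<delta>g m) \<in> borel_measurable m" using grad_meas[OF m] by (simp add: sets_eq cong: measurable_cong_sets)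
    show "AE x in m. norm (grad (\<delta>g m) x) \<le> norm (C * (1 + norm x powr (p - 1)))"
      using b by (intro AE_I2) (metis abs_ge_self order_trans real_norm_def)
  qed (use q1 in auto)
qed

text \<open>Joint continuity gives a radius for each point separately. A finite cover of the compact
  ball by balls of half that radius makes it uniform in the point and in the nearby measure.\<close>

lemma grad_uniform:
  assumes m: "m \<in> Pp p" and e: "e > 0"
  shows "\<exists>s>0. \<forall>m'\<in>Pp p. wasserstein p m m' < s \<longrightarrow> (\<forall>x \<xi>. norm x \<le> B \<longrightarrow> norm (\<xi> - x) < s \<longrightarrow> norm (grad (\<delta>g m') \<xi> - grad (\<delta>g m) x) < e)"
proof -
  have "jointly_continuous p (\<lambda>m. grad (\<delta>g m))" using R by (simp add: cond_R_def)
  then have "\<forall>x. \<exists>s>0. \<forall>m'\<in>Pp p. \<forall>x'. wasserstein p m m' < s \<and> dist x x' < s \<longrightarrow> dist (grad (\<delta>g m) x) (grad (\<delta>g m') x') < e / 2"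
    using m e unfolding jointly_continuous_def by (meson half_gt_zero)
  then obtain s where s: "\<And>x. s x > 0" "\<And>x m' x'. m' \<in> Pp p \<Longrightarrow> wasserstein p m m' < s x \<Longrightarrow> dist x x' < s x \<Longrightarrow> dist (grad (\<delta>g m) x) (grad (\<delta>g m') x') < e / 2"
    by metis
  have "cball (0::plane) B \<subseteq> (\<Union>x. ball x (s x / 2))" 
  proof
    fix x :: plane show "x \<in> (\<Union>x. ball x (s x / 2))" using s(1)[of x] by (intro UN_I[of x]) simp_all
  qed
  then obtain T where T: "T \<subseteq> UNIV" "finite T" "cball (0::plane) B \<subseteq> (\<Union>x\<in>T. ball x (s x / 2))"
    using compactE_image[OF compact_cball, of UNIV "\<lambda>x. ball x (s x / 2)" 0 B] by (metis open_ball)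
  define s' where "s' = Min (insert 1 ((\<lambda>x. s x / 2) ` T))"
  have s': "s' > 0" unfolding s'_def using T(2) s(1) by (subst Min_gr_iff) auto
  have s'le: "s' \<le> s x / 2" if "x \<in> T" for x unfolding s'_def using T(2) that by (intro Min_le) auto
  show ?thesis
  proof (intro exI[of _ s'] conjI ballI allI impI s')
    fix m' and x \<xi> :: plane assume m': "m' \<in> Pp p" "wasserstein p m m' < s'" and x: "norm x \<le> B" "norm (\<xi> - x) < s'"
    have "x \<in> (\<Union>x\<in>T. ball x (s x / 2))" by (rule subsetD[OF T(3)]) (simp add: x(1))
    then obtain y where "y \<in> T" "x \<in> ball y (s y / 2)" by blast
    then have y: "y \<in> T" "dist y x < s y / 2" by simp_all
    have d1: "dist (grad (\<delta>g m) y) (grad (\<delta>g m) x) < e / 2"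
      using y s(1)[of y] wasserstein_self[OF m p] by (intro s(2) m) (auto simp: dist_commute)
    have "dist y \<xi> \<le> dist y x + dist x \<xi>" by (rule dist_triangle)
    also have "dist x \<xi> < s y / 2" using x(2) s'le[OF y(1)] by (simp add: dist_norm norm_minus_commute)
    finally have "dist y \<xi> < s y" using y(2) by simp
    then have d2: "dist (grad (\<delta>g m) y) (grad (\<delta>g m') \<xi>) < e / 2"
      using m' s'le[OF y(1)] s(1)[of y] by (intro s(2)) auto
    show "norm (grad (\<delta>g m') \<xi> - grad (\<delta>g m) x) < e"
      using d1 d2 dist_triangle2[of "grad (\<delta>g m') \<xi>" "grad (\<delta>g m) x" "grad (\<delta>g m) y"] by (simp add: dist_norm norm_minus_commute)
  qed
qed

text \<open>By \<open>mean_value\<close> the increment of \<open>g\<close> is an integral of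
  increments of \<open>\<delta>g\<close> at one measure of the segment. These are linearized
  pointwise, with an error that is small after Hoelder, small by uniform continuity, or of higher
  order in the displacement. One \<open>\<rho>\<close> works for all couplings, including nearly
  optimal ones.\<close>

theorem expansion:
  assumes m: "m \<in> Pp p" and e: "e > 0"
  shows "\<exists>\<rho>>0. \<forall>m'\<in>Pp p. \<forall>\<pi>\<in>couplings m m'. transport_cost p \<pi> \<le> \<rho> \<longrightarrow>
     \<bar>g m' - g m - (\<integral>z. grad (\<delta>g m) (fst z) \<bullet> (snd z - fst z) \<partial>\<pi>)\<bar> \<le> e * transport_cost p \<pi>"
proof -
  interpret M: plane_prob m by (rule plane_prob_Pp[OF m])
  define u where "u = grad (\<delta>g m)"
  obtain s1 C where s1: "s1 > 0" "C \<ge> 0" "\<And>m'. m' \<in> Pp p \<Longrightarrow> wasserstein p m m' < s1 \<Longrightarrow> (\<forall>x. norm (grad (\<delta>g m') x) \<le> C * (1 + norm x powr (p - 1)))"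
    using grad_growth[OF m] by blast
  have ub: "norm (u x) \<le> C * (1 + norm x powr (p - 1))" for x
  proof -
    have "wasserstein p m m < s1" using s1(1) wasserstein_self[OF m p] by simp
    then show ?thesis using s1(3)[OF m] unfolding u_def by blast
  qed
  define C' where "C' = C * (2 + 2 powr (p - 1))"
  have C': "C' \<ge> 0" using s1(2) by (simp add: C'_def)
  \<comment> \<open>Tail of the growth bound; it is small in the dual Lebesgue space and so
    contributes a small multiple of the cost.\<close>
  define W where "W n x = C' * (1 + norm x powr (p - 1)) * indicator {x. real n < norm x} x" for n and x :: plane
  have Wm[measurable]: "W n \<in> borel_measurable borel" for n unfolding W_def by measurable
  have W0: "W n x \<ge> 0" for n x using C' by (auto simp: W_def)
  have Wle: "norm (W n x) \<le> norm (C' * (1 + norm x powr (p - 1)))" for n x using C' by (auto simp: W_def indicator_def)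
  have WL: "in_Lp q m (W n)" for n
    by (rule in_Lp_bound[OF weight_in_Lq[OF m, of C']]) (use Wle q1 in auto)
  have "(\<lambda>n. Lnorm q m (W n)) \<longlonglongrightarrow> 0"
  proof (rule Lnorm_tendsto_0[OF _ weight_in_Lq[OF m, of C'] Wle])
    show "AE x in m. (\<lambda>n. W n x) \<longlonglongrightarrow> 0"
    proof (intro AE_I2)
      fix x :: plane
      obtain N where "norm x \<le> real N" using real_arch_simple by blast
      then have "W n x = 0" if "n \<ge> N" for n using that by (auto simp: W_def)
      then show "(\<lambda>n. W n x) \<longlonglongrightarrow> 0" by (intro tendsto_eventually) (auto simp: eventually_sequentially)
    qed
  qed (use q1 in auto)
  then have "\<forall>\<^sub>F n in sequentially. Lnorm q m (W n) < e / 3" using e by (intro order_tendstoD) auto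
  then obtain n where n: "Lnorm q m (W n) < e / 3" by (auto simp: eventually_sequentially)
  obtain s2 where s2: "s2 > 0" "\<And>m' x \<xi>. m' \<in> Pp p \<Longrightarrow> wasserstein p m m' < s2 \<Longrightarrow> norm x \<le> real n \<Longrightarrow> norm (\<xi> - x) < s2 \<Longrightarrow> norm (grad (\<delta>g m') \<xi> - grad (\<delta>g m) x) < e / 3"
    using grad_uniform[OF m, of "e / 3" "real n"] e by (metis divide_pos_pos zero_less_numeral)
  define s where "s = min s1 s2"
  have s: "s > 0" using s1 s2 by (simp add: s_def)
  \<comment> \<open>For displacements of size at least \<open>s\<close> the displacement is at most
    \<open>s powr (1 - p)\<close> times its \<open>p\<close>-th power, which gives the first
    summand. The second is the growth in the displacement itself.\<close>
  define K where "K = C' * (1 + real n powr (p - 1)) * s powr (1 - p) + C'"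
  have K: "K \<ge> 0" using C' by (simp add: K_def)
  \<comment> \<open>The first entry keeps the segment in the neighbourhood, the second makes
    \<open>K\<close> times the \<open>p\<close>-th power of the cost at most \<open>e / 3\<close>
    times the cost.\<close>
  define \<rho> where "\<rho> = min (s / 2) ((e / 3 / (K + 1)) powr (1 / (p - 1)))"
  have \<rho>: "\<rho> > 0" using s e K by (simp add: \<rho>_def)
  have K\<rho>: "K * \<rho> powr (p - 1) \<le> e / 3"
  proof -
    have "\<rho> powr (p - 1) \<le> ((e / 3 / (K + 1)) powr (1 / (p - 1))) powr (p - 1)" using p \<rho> by (intro powr_mono2) (auto simp: \<rho>_def)
    also have "\<dots> = e / 3 / (K + 1)" using p e K by (simp add: powr_powr)
    finally have "(K + 1) * \<rho> powr (p - 1) \<le> e / 3" using K by (simp add: field_simps)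
    moreover have "K * \<rho> powr (p - 1) \<le> (K + 1) * \<rho> powr (p - 1)" by (intro mult_right_mono) auto
    ultimately show ?thesis by linarith
  qed
  have pt: "\<bar>\<delta>g M y - \<delta>g M x - u x \<bullet> (y - x)\<bar> \<le> e / 3 * norm (y - x) + norm (y - x) * W n x + K * norm (y - x) powr p"
    if M: "M \<in> Pp p" "wasserstein p m M < s" for M x y
  proof -
    obtain \<xi> where \<xi>: "norm (\<xi> - x) \<le> norm (y - x)" "\<delta>g M y - \<delta>g M x = grad (\<delta>g M) \<xi> \<bullet> (y - x)"
      using segment_mean_value[OF diff[OF M(1)]] by blast
    let ?d = "norm (y - x)" and ?N = "norm (grad (\<delta>g M) \<xi> - u x)"
    have "\<delta>g M y - \<delta>g M x - u x \<bullet> (y - x) = (grad (\<delta>g M) \<xi> - u x) \<bullet> (y - x)" by (simp add: \<xi>(2) inner_diff_left)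
    then have le: "\<bar>\<delta>g M y - \<delta>g M x - u x \<bullet> (y - x)\<bar> \<le> ?N * ?d" by (simp add: Cauchy_Schwarz_ineq2)
    have dp: "?d * ?d powr (p - 1) = ?d powr p" by (cases "?d = 0") (auto simp: powr_diff)
    have big: "?N * ?d \<le> C' * (1 + norm x powr (p - 1)) * ?d + C' * ?d powr p"
    proof -
      have "norm \<xi> \<le> norm x + ?d" using \<xi>(1) norm_triangle_ineq[of x "\<xi> - x"] by simp
      then have "norm \<xi> powr (p - 1) \<le> (norm x + ?d) powr (p - 1)" using p by (intro powr_mono2) auto
      also have "\<dots> \<le> 2 powr (p - 1) * (norm x powr (p - 1) + ?d powr (p - 1))" using p by (intro add_powr_le) auto
      finally have x1: "norm \<xi> powr (p - 1) \<le> 2 powr (p - 1) * (norm x powr (p - 1) + ?d powr (p - 1))" .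
      have M1: "norm (grad (\<delta>g M) \<xi>) \<le> C * (1 + norm \<xi> powr (p - 1))" 
        using s1(3)[OF M(1)] M(2) unfolding s_def min_less_iff_conj by blast
      also have "\<dots> \<le> C * (1 + 2 powr (p - 1) * (norm x powr (p - 1) + ?d powr (p - 1)))"
        using x1 s1(2) by (intro mult_left_mono) auto
      finally have "?N \<le> C * (1 + 2 powr (p - 1) * (norm x powr (p - 1) + ?d powr (p - 1))) + C * (1 + norm x powr (p - 1))"
        using ub[of x] norm_triangle_ineq4[of "grad (\<delta>g M) \<xi>" "u x"] by linarith
      also have "\<dots> = C * (2 + (2 powr (p - 1) + 1) * norm x powr (p - 1) + 2 powr (p - 1) * ?d powr (p - 1))"
        by (simp add: algebra_simps)
      also have "\<dots> \<le> C * ((2 + 2 powr (p - 1)) * (1 + norm x powr (p - 1) + ?d powr (p - 1)))"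
        using s1(2) by (intro mult_left_mono) (simp_all add: algebra_simps)
      also have "\<dots> = C' * (1 + norm x powr (p - 1) + ?d powr (p - 1))" by (simp add: C'_def)
      finally have "?N * ?d \<le> C' * (1 + norm x powr (p - 1) + ?d powr (p - 1)) * ?d" by (intro mult_right_mono) auto
      also have "\<dots> = C' * (1 + norm x powr (p - 1)) * ?d + C' * (?d * ?d powr (p - 1))" by (simp add: algebra_simps)
      finally show ?thesis unfolding dp .
    qed
    consider "norm x > real n" | "norm x \<le> real n" "?d < s" | "norm x \<le> real n" "s \<le> ?d" by linarith
    then show ?thesis
    proof cases
      case 1
      have "C' * ?d powr p \<le> K * ?d powr p" using C' by (intro mult_right_mono) (auto simp: K_def)
      moreover have "C' * (1 + norm x powr (p - 1)) * ?d = ?d * W n x" using 1 by (simp add: W_def)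
      ultimately show ?thesis using le big e by (smt (verit) divide_nonneg_nonneg mult_nonneg_nonneg norm_ge_zero)
    next
      case 2
      have "?N < e / 3" unfolding u_def using 2 M \<xi>(1) by (intro s2(2)) (auto simp: s_def)
      then have "?N * ?d \<le> e / 3 * ?d" by (intro mult_right_mono) auto
      moreover have "0 \<le> ?d * W n x" "0 \<le> K * ?d powr p" using W0 K by auto
      ultimately show ?thesis using le by linarith
    next
      case 3
      have "?d powr (1 - p) \<le> s powr (1 - p)" using 3 s p by (intro powr_mono2') auto
      then have "?d powr p * ?d powr (1 - p) \<le> ?d powr p * s powr (1 - p)" by (intro mult_left_mono) auto
      moreover have "?d powr p * ?d powr (1 - p) = ?d" using 3 s by (simp add: powr_add[symmetric])
      ultimately have d: "?d \<le> s powr (1 - p) * ?d powr p" by (simp add: mult.commute)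
      have "norm x powr (p - 1) \<le> real n powr (p - 1)" using 3 p by (intro powr_mono2) auto
      then have "C' * (1 + norm x powr (p - 1)) * ?d \<le> C' * (1 + real n powr (p - 1)) * (s powr (1 - p) * ?d powr p)"
        using C' d by (intro mult_mono mult_left_mono) auto
      then have "?N * ?d \<le> K * ?d powr p" using big unfolding K_def by (simp add: algebra_simps)
      moreover have "0 \<le> ?d * W n x" "0 \<le> e / 3 * ?d" using W0 e by auto
      ultimately show ?thesis using le by linarith
    qed
  qed
  show ?thesis
  proof (intro exI[of _ \<rho>] conjI ballI impI \<rho>)
    fix m' \<pi> assume m': "m' \<in> Pp p" and \<pi>: "\<pi> \<in> couplings m m'" and c: "transport_cost p \<pi> \<le> \<rho>"
    interpret c: coupling p m m' \<pi> by unfold_locales (use p m m' \<pi> in auto)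
    obtain l where l: "l \<in> {0..1}" "g m' - g m = (\<integral>x. \<delta>g (mix l m m') x \<partial>m') - (\<integral>x. \<delta>g (mix l m m') x \<partial>m)"
      using mean_value[OF m m'] by blast
    define M where "M = mix l m m'"
    have M: "M \<in> Pp p" unfolding M_def using l by (intro mix_Pp m m') auto
    have Ws: "wasserstein p m M < s" 
      using c.wasserstein_mix_le[of l] l c s unfolding M_def \<rho>_def by (auto simp: min_def split: if_splits)
    note [measurable] = \<delta>g_meas[OF M] grad_meas[OF m]
    have um[measurable]: "u \<in> borel_measurable borel" unfolding u_def by measurable
    have uL: "in_Lp q \<pi> (\<lambda>z. u (fst z))" using grad_in_Lq[OF m] unfolding u_def[symmetric] by (intro c.in_Lp_fst) auto
    have i1: "integrable \<pi> (\<lambda>z. \<delta>g M (snd z))" using \<delta>g_integrable[OF M m'] by (simp add: c.integrable_snd_iff)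
    have i2: "integrable \<pi> (\<lambda>z. \<delta>g M (fst z))" using \<delta>g_integrable[OF M m] by (simp add: c.integrable_fst_iff)
    have i3: "integrable \<pi> (\<lambda>z. u (fst z) \<bullet> (snd z - fst z))"
      using Holder_inner(1)[OF uL c.\<Delta>_Lp q1 p conj_exp_props(3)[OF p]] by (simp add: c.\<Delta>_def)
    have WL\<pi>: "in_Lp q \<pi> (\<lambda>z. W n (fst z))" "Lnorm q \<pi> (\<lambda>z. W n (fst z)) = Lnorm q m (W n)"
      using c.in_Lp_fst[OF Wm] WL by auto
    have dL: "in_Lp p \<pi> (\<lambda>z. norm (c.\<Delta> z))" using c.\<Delta>_Lp by (simp add: in_Lp_def)
    have iW: "integrable \<pi> (\<lambda>z. norm (c.\<Delta> z) * W n (fst z))" "(\<integral>z. norm (c.\<Delta> z) * W n (fst z) \<partial>\<pi>) \<le> c.cost * (e / 3)"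
    proof -
      show "integrable \<pi> (\<lambda>z. norm (c.\<Delta> z) * W n (fst z))"
        by (rule Holder_integral(1)[OF dL WL\<pi>(1) p q1 conj_exp_props(2)[OF p]])
      have "(\<integral>z. norm (c.\<Delta> z) * W n (fst z) \<partial>\<pi>) \<le> Lnorm p \<pi> (\<lambda>z. norm (c.\<Delta> z)) * Lnorm q \<pi> (\<lambda>z. W n (fst z))"
        using Holder_integral(3)[OF dL WL\<pi>(1) p q1 conj_exp_props(2)[OF p]] by linarith
      also have "\<dots> \<le> c.cost * (e / 3)" unfolding WL\<pi>(2) Lnorm_norm c.cost_eq using n by (intro mult_left_mono) auto
      finally show "(\<integral>z. norm (c.\<Delta> z) * W n (fst z) \<partial>\<pi>) \<le> c.cost * (e / 3)" .
    qed
    have ip: "integrable \<pi> (\<lambda>z. norm (c.\<Delta> z) powr p)" using c.\<Delta>_Lp by (simp add: in_Lp_def)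
    have "g m' - g m - (\<integral>z. u (fst z) \<bullet> (snd z - fst z) \<partial>\<pi>) = (\<integral>z. \<delta>g M (snd z) - \<delta>g M (fst z) - u (fst z) \<bullet> (snd z - fst z) \<partial>\<pi>)"
      using i1 i2 i3 l(2) by (simp add: M_def[symmetric] c.integral_fst c.integral_snd)
    then have "\<bar>g m' - g m - (\<integral>z. u (fst z) \<bullet> (snd z - fst z) \<partial>\<pi>)\<bar> \<le> (\<integral>z. \<bar>\<delta>g M (snd z) - \<delta>g M (fst z) - u (fst z) \<bullet> (snd z - fst z)\<bar> \<partial>\<pi>)"
      by (simp only: integral_abs_bound)
    also have "\<dots> \<le> (\<integral>z. e / 3 * norm (c.\<Delta> z) + norm (c.\<Delta> z) * W n (fst z) + K * norm (c.\<Delta> z) powr p \<partial>\<pi>)"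
    proof (rule integral_mono)
      show "integrable \<pi> (\<lambda>z. \<bar>\<delta>g M (snd z) - \<delta>g M (fst z) - u (fst z) \<bullet> (snd z - fst z)\<bar>)"
        by (intro integrable_abs Bochner_Integration.integrable_diff i1 i2 i3)
      show "integrable \<pi> (\<lambda>z. e / 3 * norm (c.\<Delta> z) + norm (c.\<Delta> z) * W n (fst z) + K * norm (c.\<Delta> z) powr p)"
        by (intro Bochner_Integration.integrable_add integrable_mult_right iW(1) ip c.norm_\<Delta>_integrable)
      show "\<bar>\<delta>g M (snd z) - \<delta>g M (fst z) - u (fst z) \<bullet> (snd z - fst z)\<bar> \<le> e / 3 * norm (c.\<Delta> z) + norm (c.\<Delta> z) * W n (fst z) + K * norm (c.\<Delta> z) powr p" for z
        unfolding c.\<Delta>_def by (rule pt[OF M Ws])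
    qed
    also have "\<dots> = e / 3 * (\<integral>z. norm (c.\<Delta> z) \<partial>\<pi>) + (\<integral>z. norm (c.\<Delta> z) * W n (fst z) \<partial>\<pi>) + K * (\<integral>z. norm (c.\<Delta> z) powr p \<partial>\<pi>)"
      using iW(1) ip c.norm_\<Delta>_integrable by simp
    also have "\<dots> \<le> e / 3 * c.cost + c.cost * (e / 3) + e / 3 * c.cost"
    proof (intro add_mono mult_left_mono iW c.norm_\<Delta>_le)
      have "c.cost powr p = c.cost powr (p - 1) * c.cost" using c.cost_nonneg by (cases "c.cost = 0") (auto simp: powr_diff)
      also have "K * \<dots> \<le> K * (\<rho> powr (p - 1) * c.cost)"
        using c c.cost_nonneg p K by (intro mult_left_mono mult_right_mono powr_mono2) auto
      also have "\<dots> = K * \<rho> powr (p - 1) * c.cost" by simp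
      also have "\<dots> \<le> e / 3 * c.cost" using K\<rho> c.cost_nonneg by (intro mult_right_mono) auto
      finally show "K * (\<integral>z. norm (c.\<Delta> z) powr p \<partial>\<pi>) \<le> e / 3 * c.cost" unfolding c.cost_powr .
    qed (use e in auto)
    also have "\<dots> = e * c.cost" by simp
    finally show "\<bar>g m' - g m - (\<integral>z. grad (\<delta>g m) (fst z) \<bullet> (snd z - fst z) \<partial>\<pi>)\<bar> \<le> e * c.cost" unfolding u_def .
  qed
qed

end

section \<open>Causal couplings\<close>

lemma fst_fst_measurable [measurable]: "(\<lambda>z :: plane \<times> plane. fst (fst z)) \<in> borel_measurable borel"
  by (rule measurable_compose[OF fst_plane2]) simp

lemma fst_snd_measurable [measurable]: "(\<lambda>z :: plane \<times> plane. fst (snd z)) \<in> borel_measurable borel"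
  by (rule measurable_compose[OF snd_plane2]) simp

lemma comp_fst_plane2 [measurable (raw)]:
  "f \<in> measurable borel N \<Longrightarrow> (\<lambda>z :: plane \<times> plane. f (fst z)) \<in> measurable borel N"
  by (rule measurable_compose[OF fst_plane2])

locale plane2_prob = borel_prob \<pi> for \<pi> :: "(plane \<times> plane) measure"
begin

sublocale cX: coord \<pi> "\<lambda>z. fst (fst z)" "\<lambda>t. ((t, 0), (0, 0))"
  by unfold_locales (auto intro!: borel_measurable_continuous_onI continuous_intros)

text \<open>Then \<open>g\<close> of the second first coordinate is almost surely a function of the
  conditioning variable and can be pulled out of the conditional expectation.\<close>

lemma causal_if_first_fixed:
  assumes fixed: "AE z in \<pi>. fst (snd z) = fst (fst z)"
  shows "causal \<pi>"
  unfolding causal_def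
proof (intro ballI impI)
  fix f :: "plane \<Rightarrow> real" and g :: "real \<Rightarrow> real"
  assume [measurable]: "f \<in> borel_measurable borel" "g \<in> borel_measurable borel" and b: "bounded (range f)" "bounded (range g)"
  obtain B C where B: "\<And>x. \<bar>f x\<bar> \<le> B" and C: "\<And>x. \<bar>g x\<bar> \<le> C" using b unfolding bounded_iff by auto
  have B0: "B \<ge> 0" using B[of undefined] by linarith
  have [measurable]: "(\<lambda>z :: plane \<times> plane. g (fst (fst z))) \<in> borel_measurable borel"
    by (rule measurable_compose[OF fst_fst_measurable]) fact
  have [measurable]: "(\<lambda>z :: plane \<times> plane. g (fst (snd z))) \<in> borel_measurable borel"
    by (rule measurable_compose[OF fst_snd_measurable]) fact
  have if1: "integrable \<pi> (\<lambda>z. f (fst z))" by (rule integrable_const_bound[where B=B]) (use B in auto)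
  have ig: "integrable \<pi> (\<lambda>z. g (fst (fst z)))" by (rule integrable_const_bound[where B=C]) (use C in auto)
  have igf: "integrable \<pi> (\<lambda>z. g (fst (fst z)) * f (fst z))"
    by (rule integrable_const_bound[where B="C * B"]) (use B C in \<open>auto simp: abs_mult intro!: mult_mono order_trans[OF abs_ge_zero C]\<close>)
  have "AE z in \<pi>. real_cond_exp \<pi> cX.F (\<lambda>z. f (fst z) * g (fst (snd z))) z = real_cond_exp \<pi> cX.F (\<lambda>z. g (fst (fst z)) * f (fst z)) z"
    by (rule cX.ce.real_cond_exp_cong) (use fixed in \<open>auto elim!: eventually_mono\<close>)
  moreover have "AE z in \<pi>. real_cond_exp \<pi> cX.F (\<lambda>z. g (fst (fst z)) * f (fst z)) z = g (fst (fst z)) * real_cond_exp \<pi> cX.F (\<lambda>z. f (fst z)) z"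
    by (rule cX.ce.real_cond_exp_mult[OF cX.measurable_F_comp _ igf]) auto
  moreover have "AE z in \<pi>. real_cond_exp \<pi> cX.F (\<lambda>z. g (fst (snd z))) z = real_cond_exp \<pi> cX.F (\<lambda>z. g (fst (fst z))) z"
    by (rule cX.ce.real_cond_exp_cong) (use fixed in \<open>auto elim!: eventually_mono\<close>)
  moreover have "AE z in \<pi>. real_cond_exp \<pi> cX.F (\<lambda>z. g (fst (fst z))) z = g (fst (fst z))"
    by (rule cX.ce.real_cond_exp_F_meas[OF ig cX.measurable_F_comp]) simp
  ultimately show "AE z in \<pi>. cexp \<pi> (\<lambda>z. fst (fst z)) (\<lambda>z. f (fst z) * g (fst (snd z))) z =
       cexp \<pi> (\<lambda>z. fst (fst z)) (\<lambda>z. f (fst z)) z * cexp \<pi> (\<lambda>z. fst (fst z)) (\<lambda>z. g (fst (snd z))) z"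
    unfolding cX.cexp_eq by eventually_elim simp
qed

end

lemma bicausal_if_first_fixed:
  assumes \<pi>: "prob_space \<pi>" "sets \<pi> = sets borel" and fixed: "AE z in \<pi>. fst (snd z) = fst (fst z)"
  shows "bicausal \<pi>"
proof -
  interpret plane2_prob \<pi> using \<pi> by (simp add: plane2_prob_def borel_prob_def borel_prob_axioms_def)
  have sw[measurable]: "(prod.swap :: plane \<times> plane \<Rightarrow> plane \<times> plane) \<in> borel_measurable borel"
    by (intro borel_measurable_continuous_onI continuous_on_swap)
  interpret S: plane2_prob "distr \<pi> borel prod.swap"
    by (auto simp: plane2_prob_def borel_prob_def borel_prob_axioms_def intro!: prob_space_distr)
  have "AE z in distr \<pi> borel prod.swap. fst (snd z) = fst (fst z)"
    using fixed by (subst AE_distr_iff) (auto elim!: eventually_mono)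
  then show ?thesis unfolding bicausal_def using causal_if_first_fixed[OF fixed] S.causal_if_first_fixed by blast
qed

context coupling
begin

sublocale plane2_prob \<pi> by unfold_locales (rule sets_\<pi>)

sublocale M: plane_prob m by (rule plane_prob_Pp[OF m])

text \<open>Conditioning a function of the first point on the first coordinate of that point
  involves only the first marginal.\<close>

lemma cexp_lift:
  assumes f[measurable]: "f \<in> borel_measurable borel" and i: "integrable m f"
  shows "AE z in \<pi>. cexp \<pi> (\<lambda>z. fst (fst z)) (\<lambda>z. f (fst z)) z = cexp m fst f (fst z)"
proof -
  have "AE z in \<pi>. cexp \<pi> (\<lambda>z. fst (fst z)) (\<lambda>z. f (fst z)) z = M.c1.ce f (fst (fst z))"
  proof (rule cX.cexp_char)
    show "integrable \<pi> (\<lambda>z. f (fst z))" using i by (simp add: integrable_fst_iff)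
    show "integrable \<pi> (\<lambda>z. M.c1.ce f (fst (fst z)))"
      using M.c1.cexp_integrable[OF i] integrable_fst_iff[of "\<lambda>x. M.c1.ce f (fst x)"] by (simp add: M.c1.cexp_factor[abs_def])
    fix A :: "real set" assume [measurable]: "A \<in> sets borel"
    have ii: "integrable m (\<lambda>x. indicat_real A (fst x) * f x)"
      by (rule Bochner_Integration.integrable_bound[OF i]) (measurable, simp add: indicator_def)
    have "(\<integral>z. indicator A (fst (fst z)) * f (fst z) \<partial>\<pi>) = (\<integral>x. indicator A (fst x) * f x \<partial>m)"
      by (rule integral_fst) measurable
    also have "\<dots> = (\<integral>x. indicator A (fst x) * cexp m fst f x \<partial>m)"
      using M.c1.cexp_integral(2)[OF ii] by simp
    also have "\<dots> = (\<integral>z. indicator A (fst (fst z)) * M.c1.ce f (fst (fst z)) \<partial>\<pi>)"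
      unfolding M.c1.cexp_factor[abs_def] by (rule integral_fst[symmetric]) measurable
    finally show "(\<integral>z. indicator A (fst (fst z)) * f (fst z) \<partial>\<pi>) = (\<integral>z. indicator A (fst (fst z)) * M.c1.ce f (fst (fst z)) \<partial>\<pi>)" .
  qed measurable
  then show ?thesis by (simp add: M.c1.cexp_factor)
qed

text \<open>Causality factorizes the conditional expectation of the product; integrating, and moving
  the conditioning from one factor to the other, replaces \<open>f\<close> by its conditional
  mean.\<close>

lemma causal_orthogonal_bounded:
  assumes causal: "causal \<pi>" and fm[measurable]: "f \<in> borel_measurable borel" and hm0[measurable]: "h \<in> borel_measurable borel"
    and B: "\<And>x. \<bar>f x\<bar> \<le> B" and C: "\<And>x. \<bar>h x\<bar> \<le> C"
  shows "(\<integral>z. (f (fst z) - cexp m fst f (fst z)) * h (fst (snd z)) \<partial>\<pi>) = 0"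
proof -
  have b: "bounded (range f)" "bounded (range h)" using B C unfolding bounded_iff by auto
  have fi: "integrable m f" by (rule M.integrable_const_bound[where B=B]) (use B in auto)
  have i1: "integrable \<pi> (\<lambda>z. f (fst z))" using fi by (simp add: integrable_fst_iff)
  have ch: "integrable \<pi> (\<lambda>z. a z * h (fst (snd z)))" if "integrable \<pi> a" for a
  proof (rule Bochner_Integration.integrable_bound[OF integrable_mult_right[OF integrable_norm[OF that], of C]])
    have [measurable]: "a \<in> borel_measurable \<pi>" using that by auto
    show "(\<lambda>z. a z * h (fst (snd z))) \<in> borel_measurable \<pi>" by measurable
    show "AE x in \<pi>. norm (a x * h (fst (snd x))) \<le> norm (C * norm (a x))"
    proof (intro AE_I2)
      fix x
      have "\<bar>a x\<bar> * \<bar>h (fst (snd x))\<bar> \<le> \<bar>a x\<bar> * \<bar>C\<bar>" using C[of "fst (snd x)"] by (intro mult_left_mono) auto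
      then show "norm (a x * h (fst (snd x))) \<le> norm (C * norm (a x))" by (simp add: abs_mult mult.commute)
    qed
  qed
  define E where "E = cexp \<pi> (\<lambda>z. fst (fst z)) (\<lambda>z. f (fst z))"
  have Ei: "integrable \<pi> E" unfolding E_def by (rule cX.cexp_integrable[OF i1])
  have [measurable]: "E \<in> borel_measurable borel" unfolding E_def by measurable
  have EF: "E \<in> borel_measurable cX.F" unfolding E_def by (rule cX.cexp_meas_F)
  have hm: "(\<lambda>z. h (fst (snd z))) \<in> borel_measurable \<pi>" by measurable
  have "(\<integral>z. f (fst z) * h (fst (snd z)) \<partial>\<pi>) = (\<integral>z. real_cond_exp \<pi> cX.F (\<lambda>z. f (fst z) * h (fst (snd z))) z \<partial>\<pi>)"
    by (rule cX.ce.real_cond_exp_int(2)[symmetric]) (rule ch[OF i1])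
  also have "\<dots> = (\<integral>z. E z * real_cond_exp \<pi> cX.F (\<lambda>z. h (fst (snd z))) z \<partial>\<pi>)"
  proof (rule integral_cong_AE)
    show "AE z in \<pi>. real_cond_exp \<pi> cX.F (\<lambda>z. f (fst z) * h (fst (snd z))) z = E z * real_cond_exp \<pi> cX.F (\<lambda>z. h (fst (snd z))) z"
      using causal b unfolding causal_def E_def cX.cexp_eq by simp
  qed measurable
  also have "\<dots> = (\<integral>z. E z * h (fst (snd z)) \<partial>\<pi>)"
    by (rule cX.ce.real_cond_exp_intg(2)[OF ch[OF Ei] EF hm])
  also have "\<dots> = (\<integral>z. cexp m fst f (fst z) * h (fst (snd z)) \<partial>\<pi>)"
  proof (rule integral_cong_AE)
    show "AE z in \<pi>. E z * h (fst (snd z)) = cexp m fst f (fst z) * h (fst (snd z))"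
      using cexp_lift[OF fm fi] unfolding E_def by eventually_elim simp
  qed measurable
  finally have eq: "(\<integral>z. f (fst z) * h (fst (snd z)) \<partial>\<pi>) = (\<integral>z. cexp m fst f (fst z) * h (fst (snd z)) \<partial>\<pi>)" .
  have i2: "integrable \<pi> (\<lambda>z. cexp m fst f (fst z))"
    using M.c1.cexp_integrable[OF fi] by (simp add: integrable_fst_iff)
  show ?thesis using eq ch[OF i1] ch[OF i2] by (simp add: left_diff_distrib)
qed

text \<open>Causality speaks of bounded functions, whereas the gradient and the coordinate are only
  integrable to conjugate powers. Both factors are truncated and the errors controlled by
  Hoelder.\<close>

lemma causal_orthogonal:
  assumes causal: "causal \<pi>" and b: "in_Lp (conj_exp p) m b" and [measurable]: "b \<in> borel_measurable borel" and b0: "AE x in m. cexp m fst b x = 0"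
  shows "(\<integral>z. b (fst z) * fst (snd z) \<partial>\<pi>) = 0"
proof -
  let ?q = "conj_exp p"
  have q: "?q > 1" "1 / ?q + 1 / p = 1" "?q \<ge> 0" using conj_exp_props[OF p] by auto
  define bn where "bn n x = max (- real n) (min (real n) (b x))" for n x
  define hn where "hn n t = max (- real n) (min (real n) t)" for n and t :: real
  have [measurable]: "bn n \<in> borel_measurable borel" "hn n \<in> borel_measurable borel" for n unfolding bn_def hn_def by measurable
  have bnb: "\<bar>bn n x\<bar> \<le> real n" and hnb: "\<bar>hn n t\<bar> \<le> real n" for n x t by (auto simp: bn_def hn_def)
  \<comment> \<open>The truncation is recentred to stay orthogonal. Its conditional mean is small,
    because that of \<open>b\<close> vanishes.\<close>
  define dn where "dn n x = bn n x - cexp m fst (bn n) x" for n x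
  have [measurable]: "dn n \<in> borel_measurable borel" for n unfolding dn_def by measurable
  have zero: "(\<integral>z. dn n (fst z) * hn n (fst (snd z)) \<partial>\<pi>) = 0" for n
    unfolding dn_def by (rule causal_orthogonal_bounded[OF causal _ _ bnb hnb]) measurable
  have bnL: "in_Lp ?q m (bn n)" for n by (rule in_Lp_bounded[OF M.finite_measure_axioms, where B="real n"]) (use bnb q in auto)
  have cL: "in_Lp ?q m (cexp m fst (bn n))" for n by (rule M.c1.cexp_in_Lp(1)[OF bnL q(1)])
  have dnL: "in_Lp ?q m (dn n)" for n unfolding dn_def using q by (intro in_Lp_diff bnL cL)
  have bi: "integrable m b" and bni: "integrable m (bn n)" for n
    using in_Lp_imp_integrable[OF M.finite_measure_axioms b] in_Lp_imp_integrable[OF M.finite_measure_axioms bnL] q by auto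
  have bbL: "in_Lp ?q m (\<lambda>x. b x - bn n x)" for n using q by (intro in_Lp_diff b bnL)
  have cn: "Lnorm ?q m (cexp m fst (bn n)) \<le> Lnorm ?q m (\<lambda>x. b x - bn n x)" for n
  proof -
    have "AE x in m. cexp m fst (\<lambda>x. b x - bn n x) x = cexp m fst b x - cexp m fst (bn n) x" by (rule M.c1.cexp_diff[OF bi bni])
    then have "AE x in m. norm (cexp m fst (bn n) x) = norm (cexp m fst (\<lambda>x. b x - bn n x) x)"
      using b0 by eventually_elim simp
    then have "Lnorm ?q m (cexp m fst (bn n)) = Lnorm ?q m (cexp m fst (\<lambda>x. b x - bn n x))"
      by (intro Lnorm_cong_AE) auto
    then show ?thesis using M.c1.cexp_in_Lp(2)[OF bbL q(1)] by simp
  qed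
  have n1: "Lnorm ?q m (\<lambda>x. b x - dn n x) \<le> 2 * Lnorm ?q m (\<lambda>x. b x - bn n x)" for n
  proof -
    have "Lnorm ?q m (\<lambda>x. (b x - bn n x) + cexp m fst (bn n) x) \<le> Lnorm ?q m (\<lambda>x. b x - bn n x) + Lnorm ?q m (cexp m fst (bn n))"
      by (rule Lnorm_triangle[OF bbL cL q(1)])
    moreover have "(\<lambda>x. (b x - bn n x) + cexp m fst (bn n) x) = (\<lambda>x. b x - dn n x)" by (auto simp: dn_def)
    ultimately show ?thesis using cn[of n] by simp
  qed
  have n2: "Lnorm ?q m (dn n) \<le> 2 * Lnorm ?q m b" for n
  proof -
    have "Lnorm ?q m (dn n) \<le> Lnorm ?q m (bn n) + Lnorm ?q m (cexp m fst (bn n))"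
      unfolding dn_def by (rule Lnorm_triangle_diff[OF bnL cL q(1)])
    also have "Lnorm ?q m (cexp m fst (bn n)) \<le> Lnorm ?q m (bn n)" by (rule M.c1.cexp_in_Lp(2)[OF bnL q(1)])
    also have "Lnorm ?q m (bn n) \<le> Lnorm ?q m b"
      by (intro Lnorm_mono b AE_I2) (use q in \<open>auto simp: bn_def\<close>)
    finally show ?thesis by simp
  qed
  have XL: "in_Lp p \<pi> (\<lambda>z. fst (snd z))"
  proof -
    have "in_Lp p m' fst"
      by (rule in_Lp_bound[OF id_in_Lp[OF m']])
         (use p plane_prob_Pp[OF m'] in \<open>auto simp: abs_fst_le_norm sets_Pp[OF m'] cong: measurable_cong_sets intro!: AE_I2 simp del: split_paired_All\<close>)
    then show ?thesis by (rule in_Lp_snd(1)[rotated]) simp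
  qed
  have hL: "in_Lp p \<pi> (\<lambda>z. hn n (fst (snd z)))" for n by (rule in_Lp_bounded[OF finite_measure_axioms, where B="real n"]) (use hnb p in auto)
  have hdL: "in_Lp p \<pi> (\<lambda>z. fst (snd z) - hn n (fst (snd z)))" for n using p by (intro in_Lp_diff XL hL) auto
  have lim1: "(\<lambda>n. Lnorm ?q m (\<lambda>x. b x - bn n x)) \<longlonglongrightarrow> 0"
  proof (rule Lnorm_tendsto_0[OF _ b])
    show "AE x in m. (\<lambda>n. b x - bn n x) \<longlonglongrightarrow> 0"
    proof (intro AE_I2)
      fix x
      obtain N where "\<bar>b x\<bar> \<le> real N" using real_arch_simple by blast
      then have "b x - bn n x = 0" if "n \<ge> N" for n using that by (auto simp: bn_def)
      then show "(\<lambda>n. b x - bn n x) \<longlonglongrightarrow> 0" by (intro tendsto_eventually) (auto simp: eventually_sequentially)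
    qed
  qed (use q in \<open>auto simp: bn_def\<close>)
  have lim2: "(\<lambda>n. Lnorm p \<pi> (\<lambda>z. fst (snd z) - hn n (fst (snd z)))) \<longlonglongrightarrow> 0"
  proof (rule Lnorm_tendsto_0[OF _ XL])
    show "AE z in \<pi>. (\<lambda>n. fst (snd z) - hn n (fst (snd z))) \<longlonglongrightarrow> 0"
    proof (intro AE_I2)
      fix z :: "plane \<times> plane"
      obtain N where "\<bar>fst (snd z)\<bar> \<le> real N" using real_arch_simple by blast
      then have "fst (snd z) - hn n (fst (snd z)) = 0" if "n \<ge> N" for n using that by (auto simp: hn_def)
      then show "(\<lambda>n. fst (snd z) - hn n (fst (snd z))) \<longlonglongrightarrow> 0" by (intro tendsto_eventually) (auto simp: eventually_sequentially)
    qed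
  qed (use p in \<open>auto simp: hn_def\<close>)
  \<comment> \<open>Telescoping from the product of \<open>b\<close> with the coordinate to the
    product of \<open>dn n\<close> with its truncation, whose integral is 0 by the bounded
    case.\<close>
  have bound: "\<bar>\<integral>z. b (fst z) * fst (snd z) \<partial>\<pi>\<bar> \<le> 2 * Lnorm ?q m (\<lambda>x. b x - bn n x) * Lnorm p \<pi> (\<lambda>z. fst (snd z))
       + 2 * Lnorm ?q m b * Lnorm p \<pi> (\<lambda>z. fst (snd z) - hn n (fst (snd z)))" for n
  proof -
    have bdm: "(\<lambda>x. b x - dn n x) \<in> borel_measurable borel" by measurable
    have bdL: "in_Lp ?q m (\<lambda>x. b x - dn n x)" using q by (intro in_Lp_diff b dnL)
    have L1: "in_Lp ?q \<pi> (\<lambda>z. b (fst z) - dn n (fst z))" "Lnorm ?q \<pi> (\<lambda>z. b (fst z) - dn n (fst z)) = Lnorm ?q m (\<lambda>x. b x - dn n x)"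
      using in_Lp_fst[OF bdm] bdL by auto
    have L2: "in_Lp ?q \<pi> (\<lambda>z. dn n (fst z))" "Lnorm ?q \<pi> (\<lambda>z. dn n (fst z)) = Lnorm ?q m (dn n)"
      using in_Lp_fst[of "dn n"] dnL by auto
    note H1 = Holder_integral[OF L1(1) XL q(1) p q(2)]
    note H2 = Holder_integral[OF L2(1) hdL[of n] q(1) p q(2)]
    note H3 = Holder_integral(1)[OF L2(1) hL[of n] q(1) p q(2)]
    have "(\<integral>z. b (fst z) * fst (snd z) \<partial>\<pi>) = (\<integral>z. (b (fst z) - dn n (fst z)) * fst (snd z) + dn n (fst z) * (fst (snd z) - hn n (fst (snd z))) + dn n (fst z) * hn n (fst (snd z)) \<partial>\<pi>)"
      by (intro Bochner_Integration.integral_cong) (auto simp: algebra_simps)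
    also have "\<dots> = (\<integral>z. (b (fst z) - dn n (fst z)) * fst (snd z) \<partial>\<pi>) + (\<integral>z. dn n (fst z) * (fst (snd z) - hn n (fst (snd z))) \<partial>\<pi>) + (\<integral>z. dn n (fst z) * hn n (fst (snd z)) \<partial>\<pi>)"
      by (subst Bochner_Integration.integral_add[OF Bochner_Integration.integrable_add[OF H1(1) H2(1)] H3]) (subst Bochner_Integration.integral_add[OF H1(1) H2(1)], rule refl)
    finally have "\<bar>\<integral>z. b (fst z) * fst (snd z) \<partial>\<pi>\<bar> \<le> Lnorm ?q m (\<lambda>x. b x - dn n x) * Lnorm p \<pi> (\<lambda>z. fst (snd z)) + Lnorm ?q m (dn n) * Lnorm p \<pi> (\<lambda>z. fst (snd z) - hn n (fst (snd z)))"
      using H1(3) H2(3) zero[of n] unfolding L1(2) L2(2) by linarith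
    also have "\<dots> \<le> 2 * Lnorm ?q m (\<lambda>x. b x - bn n x) * Lnorm p \<pi> (\<lambda>z. fst (snd z)) + 2 * Lnorm ?q m b * Lnorm p \<pi> (\<lambda>z. fst (snd z) - hn n (fst (snd z)))"
      using n1[of n] n2[of n] by (intro add_mono mult_right_mono) auto
    finally show ?thesis .
  qed
  have "(\<lambda>n. 2 * Lnorm ?q m (\<lambda>x. b x - bn n x) * Lnorm p \<pi> (\<lambda>z. fst (snd z))
       + 2 * Lnorm ?q m b * Lnorm p \<pi> (\<lambda>z. fst (snd z) - hn n (fst (snd z)))) \<longlonglongrightarrow> 2 * 0 * Lnorm p \<pi> (\<lambda>z. fst (snd z)) + 2 * Lnorm ?q m b * 0"
    by (intro tendsto_intros lim1 lim2)
  then have "\<bar>\<integral>z. b (fst z) * fst (snd z) \<partial>\<pi>\<bar> \<le> 2 * 0 * Lnorm p \<pi> (\<lambda>z. fst (snd z)) + 2 * Lnorm ?q m b * 0"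
    by (rule LIMSEQ_le_const) (use bound in auto)
  then show ?thesis by simp
qed

end

text \<open>Shows that bicausal couplings exist, so that the adapted distance is an infimum over a
  nonempty set.\<close>

lemma product_causal:
  assumes p: "p > 1" and m: "m \<in> Pp p" and n: "n \<in> Pp p"
  shows "m \<Otimes>\<^sub>M n \<in> couplings m n" "causal (m \<Otimes>\<^sub>M n)" "distr (m \<Otimes>\<^sub>M n) borel prod.swap = n \<Otimes>\<^sub>M m"
proof -
  interpret M: plane_prob m by (rule plane_prob_Pp[OF m])
  interpret N: plane_prob n by (rule plane_prob_Pp[OF n])
  interpret P: pair_prob_space m n ..
  have sets: "sets (m \<Otimes>\<^sub>M n) = sets borel"
    using sets_pair_measure_cong[OF M.sets_eq N.sets_eq] by (simp only: borel_prod)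
  have f: "distr (m \<Otimes>\<^sub>M n) borel fst = m"
  proof (rule measure_eqI)
    fix A assume "A \<in> sets (distr (m \<Otimes>\<^sub>M n) borel fst)"
    then have A: "A \<in> sets m" "A \<in> sets borel" by (auto simp: M.sets_eq)
    have "emeasure (distr (m \<Otimes>\<^sub>M n) borel fst) A = emeasure (m \<Otimes>\<^sub>M n) (A \<times> space n)"
      using A sets by (subst emeasure_distr) (auto simp: space_pair_measure cong: measurable_cong_sets intro!: arg_cong[where f="emeasure (m \<Otimes>\<^sub>M n)"])
    also have "\<dots> = emeasure m A" using A by (simp add: N.emeasure_pair_measure_Times N.emeasure_space_1[simplified])
    finally show "emeasure (distr (m \<Otimes>\<^sub>M n) borel fst) A = emeasure m A" .
  qed (simp add: M.sets_eq)
  have s: "distr (m \<Otimes>\<^sub>M n) borel snd = n"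
  proof (rule measure_eqI)
    fix A assume "A \<in> sets (distr (m \<Otimes>\<^sub>M n) borel snd)"
    then have A: "A \<in> sets n" "A \<in> sets borel" by (auto simp: N.sets_eq)
    have "emeasure (distr (m \<Otimes>\<^sub>M n) borel snd) A = emeasure (m \<Otimes>\<^sub>M n) (space m \<times> A)"
      using A sets by (subst emeasure_distr) (auto simp: space_pair_measure cong: measurable_cong_sets intro!: arg_cong[where f="emeasure (m \<Otimes>\<^sub>M n)"])
    also have "\<dots> = emeasure n A" using A by (simp add: N.emeasure_pair_measure_Times M.emeasure_space_1[simplified])
    finally show "emeasure (distr (m \<Otimes>\<^sub>M n) borel snd) A = emeasure n A" .
  qed (simp add: N.sets_eq)
  show coup: "m \<Otimes>\<^sub>M n \<in> couplings m n"
    unfolding couplings_def using f s sets P.P.prob_space_axioms by simp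
  interpret c: coupling p m n "m \<Otimes>\<^sub>M n" by unfold_locales (use p m n coup in auto)
  have prod: "(\<integral>z. a (fst z) * b (snd z) \<partial>(m \<Otimes>\<^sub>M n)) = (\<integral>x. a x \<partial>m) * (\<integral>y. b y \<partial>n)"
    if "integrable m a" "integrable n b" for a b :: "plane \<Rightarrow> real"
  proof -
    have ab: "integrable (m \<Otimes>\<^sub>M n) (\<lambda>(x, y). a x * b y)" 
    proof (rule P.Fubini_integrable)
      show "(\<lambda>(x, y). a x * b y) \<in> borel_measurable (m \<Otimes>\<^sub>M n)" using that by measurable
    qed (use that in \<open>auto simp: abs_mult\<close>)
    show ?thesis using P.integral_fst'[OF ab] by (simp add: case_prod_unfold)
  qed
  show "causal (m \<Otimes>\<^sub>M n)"
    unfolding causal_def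
  proof (intro ballI impI)
    fix f :: "plane \<Rightarrow> real" and g :: "real \<Rightarrow> real"
    assume fm[measurable]: "f \<in> borel_measurable borel" and gm[measurable]: "g \<in> borel_measurable borel" and b: "bounded (range f)" "bounded (range g)"
    obtain B C where B: "\<And>x. \<bar>f x\<bar> \<le> B" and C: "\<And>x. \<bar>g x\<bar> \<le> C" using b unfolding bounded_iff by auto
    have fi: "integrable m f" by (rule M.integrable_const_bound[where B=B]) (use B in auto)
    have gi: "integrable n (\<lambda>y. g (fst y))" by (rule N.integrable_const_bound[where B=C]) (use C in auto)
    define G where "G = (\<integral>y. g (fst y) \<partial>n)"
    have Ai: "integrable m (\<lambda>x. indicat_real A (fst x) * f x)" if [measurable]: "A \<in> sets borel" for A
      by (rule Bochner_Integration.integrable_bound[OF fi]) (measurable, simp add: indicator_def)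
    have A1: "integrable m (\<lambda>x. indicat_real A (fst x))" if [measurable]: "A \<in> sets borel" for A
      by (rule M.integrable_const_bound[where B=1]) (simp add: indicator_def, measurable)
    have ci: "integrable m (\<lambda>x. M.c1.ce f (fst x))"
      using M.c1.cexp_integrable[OF fi] by (simp add: M.c1.cexp_factor[abs_def])
    have "AE z in m \<Otimes>\<^sub>M n. cexp (m \<Otimes>\<^sub>M n) (\<lambda>z. fst (fst z)) (\<lambda>z. f (fst z) * g (fst (snd z))) z = G * M.c1.ce f (fst (fst z))"
    proof (rule c.cX.cexp_char[where \<psi>="\<lambda>t. G * M.c1.ce f t"])
      show "integrable (m \<Otimes>\<^sub>M n) (\<lambda>z. f (fst z) * g (fst (snd z)))"
      proof (rule P.P.integrable_const_bound[where B="B * C"])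
        show "AE z in m \<Otimes>\<^sub>M n. norm (f (fst z) * g (fst (snd z))) \<le> B * C"
          using B C by (intro AE_I2) (auto simp: abs_mult intro!: mult_mono order_trans[OF abs_ge_zero B])
      qed measurable
      show "integrable (m \<Otimes>\<^sub>M n) (\<lambda>z. G * M.c1.ce f (fst (fst z)))"
        using c.integrable_fst_iff[of "\<lambda>x. G * M.c1.ce f (fst x)"] ci by simp
      fix A :: "real set" assume A[measurable]: "A \<in> sets borel"
      have "(\<integral>z. indicator A (fst (fst z)) * (f (fst z) * g (fst (snd z))) \<partial>(m \<Otimes>\<^sub>M n)) = (\<integral>x. indicator A (fst x) * f x \<partial>m) * G"
        using prod[OF Ai[OF A] gi] by (simp add: G_def mult.assoc)
      also have "(\<integral>x. indicator A (fst x) * f x \<partial>m) = (\<integral>x. indicator A (fst x) * M.c1.ce f (fst x) \<partial>m)"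
        using M.c1.cexp_integral(2)[OF Ai[OF A]] by (simp add: M.c1.cexp_factor)
      also have "\<dots> * G = (\<integral>x. indicator A (fst x) * (G * M.c1.ce f (fst x)) \<partial>m)" by (simp add: mult_ac flip: integral_mult_right_zero integral_mult_left_zero)
      also have "\<dots> = (\<integral>z. indicator A (fst (fst z)) * (G * M.c1.ce f (fst (fst z))) \<partial>(m \<Otimes>\<^sub>M n))"
        by (rule c.integral_fst[symmetric]) measurable
      finally show "(\<integral>z. indicator A (fst (fst z)) * (f (fst z) * g (fst (snd z))) \<partial>(m \<Otimes>\<^sub>M n)) = (\<integral>z. indicator A (fst (fst z)) * (G * M.c1.ce f (fst (fst z))) \<partial>(m \<Otimes>\<^sub>M n))" .
    qed measurable
    moreover have "AE z in m \<Otimes>\<^sub>M n. cexp (m \<Otimes>\<^sub>M n) (\<lambda>z. fst (fst z)) (\<lambda>z. g (fst (snd z))) z = G"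
    proof (rule c.cX.cexp_char[where \<psi>="\<lambda>t. G"])
      show "integrable (m \<Otimes>\<^sub>M n) (\<lambda>z. g (fst (snd z)))"
        by (rule P.P.integrable_const_bound[where B=C]) (use C in auto)
      fix A :: "real set" assume A[measurable]: "A \<in> sets borel"
      have "(\<integral>z. indicator A (fst (fst z)) * g (fst (snd z)) \<partial>(m \<Otimes>\<^sub>M n)) = (\<integral>x. indicator A (fst x) \<partial>m) * G"
        using prod[OF A1[OF A] gi] by (simp add: G_def)
      also have "\<dots> = (\<integral>x. indicator A (fst x) * G \<partial>m)" by simp
      also have "\<dots> = (\<integral>z. indicator A (fst (fst z)) * G \<partial>(m \<Otimes>\<^sub>M n))"
        by (rule c.integral_fst[symmetric]) measurable
      finally show "(\<integral>z. indicator A (fst (fst z)) * g (fst (snd z)) \<partial>(m \<Otimes>\<^sub>M n)) = (\<integral>z. indicator A (fst (fst z)) * G \<partial>(m \<Otimes>\<^sub>M n))" .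
    qed auto
    moreover have "AE z in m \<Otimes>\<^sub>M n. cexp (m \<Otimes>\<^sub>M n) (\<lambda>z. fst (fst z)) (\<lambda>z. f (fst z)) z = M.c1.ce f (fst (fst z))"
      using c.cexp_lift[OF fm fi] by (simp add: M.c1.cexp_factor)
    ultimately show "AE z in m \<Otimes>\<^sub>M n. cexp (m \<Otimes>\<^sub>M n) (\<lambda>z. fst (fst z)) (\<lambda>z. f (fst z) * g (fst (snd z))) z =
       cexp (m \<Otimes>\<^sub>M n) (\<lambda>z. fst (fst z)) (\<lambda>z. f (fst z)) z * cexp (m \<Otimes>\<^sub>M n) (\<lambda>z. fst (fst z)) (\<lambda>z. g (fst (snd z))) z"
      by eventually_elim simp
  qed
  interpret Q: pair_prob_space n m ..
  have sets': "sets (n \<Otimes>\<^sub>M m) = sets borel"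
    using sets_pair_measure_cong[OF N.sets_eq M.sets_eq] by (simp only: borel_prod)
  have "n \<Otimes>\<^sub>M m = distr (m \<Otimes>\<^sub>M n) (n \<Otimes>\<^sub>M m) (\<lambda>(x, y). (y, x))" by (rule Q.distr_pair_swap)
  also have "\<dots> = distr (m \<Otimes>\<^sub>M n) borel prod.swap"
    by (rule distr_cong) (auto simp: sets')
  finally show "distr (m \<Otimes>\<^sub>M n) borel prod.swap = n \<Otimes>\<^sub>M m" ..
qed

text \<open>A coupling slightly above the infimum exists whether or not the infimum is attained. Of
  bicausality only the forward half is retained, which is the one that averages the first partial
  derivative of the functional at \<open>m\<close>.\<close>

lemma near_optimal_coupling:
  assumes p: "p > 1" and m: "m \<in> Pp p" and m': "m' \<in> dball d p m r" and e: "e > 0"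
  shows "\<exists>\<pi>\<in>couplings m m'. transport_cost p \<pi> < r + e \<and> (d = AdWass \<longrightarrow> causal \<pi>)"
proof -
  have m'P: "m' \<in> Pp p" and dist: "distance d p m m' < r + e" using m' e by (auto simp: dball_def)
  have bi: "bicausal (m \<Otimes>\<^sub>M m')"
    unfolding bicausal_def product_causal(3)[OF p m m'P] using product_causal(2)[OF p m m'P] product_causal(2)[OF p m'P m] by simp
  show ?thesis
  proof (cases d)
    case Wass
    have "(INF \<pi>\<in>couplings m m'. transport_cost p \<pi>) < r + e" using dist Wass by (simp add: wasserstein_def)
    then obtain \<pi> where "\<pi> \<in> couplings m m'" "transport_cost p \<pi> < r + e"
      using product_causal(1)[OF p m m'P] by (subst (asm) cINF_less_iff) (auto intro!: bdd_belowI[of _ 0] simp: transport_cost_def)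
    then show ?thesis using Wass by auto
  next
    case AdWass
    have "(INF \<pi>\<in>{\<pi>\<in>couplings m m'. bicausal \<pi>}. transport_cost p \<pi>) < r + e" using dist AdWass by (simp add: adapted_wasserstein_def)
    then obtain \<pi> where "\<pi> \<in> couplings m m'" "bicausal \<pi>" "transport_cost p \<pi> < r + e"
      using product_causal(1)[OF p m m'P] bi by (subst (asm) cINF_less_iff) (auto intro!: bdd_belowI[of _ 0] simp: transport_cost_def)
    then show ?thesis by (auto simp: bicausal_def)
  qed
qed

lemma distance_le_cost:
  assumes \<pi>: "\<pi> \<in> couplings m m'" and bi: "d = AdWass \<Longrightarrow> bicausal \<pi>"
  shows "distance d p m m' \<le> transport_cost p \<pi>"
proof (cases d)
  case Wass
  then show ?thesis using \<pi> by (auto simp: wasserstein_def transport_cost_def intro!: cINF_lower bdd_belowI[of _ 0])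
next
  case AdWass
  then show ?thesis using \<pi> bi by (auto simp: adapted_wasserstein_def transport_cost_def intro!: cINF_lower bdd_belowI[of _ 0])
qed

section \<open>The upper bound\<close>

lemma bounded_support_bounded:
  fixes \<phi> :: "real \<Rightarrow> real"
  assumes c: "continuous_on UNIV \<phi>" and supp: "\<And>x. R < \<bar>x\<bar> \<Longrightarrow> \<phi> x = 0"
  shows "\<exists>B\<ge>0. \<forall>x. \<bar>\<phi> x\<bar> \<le> B"
proof -
  have "compact (\<phi> ` cball 0 R)" by (intro compact_continuous_image continuous_on_subset[OF c]) auto
  then obtain B where B: "\<And>x. x \<in> cball 0 R \<Longrightarrow> norm (\<phi> x) \<le> B" by (metis bounded_iff compact_imp_bounded imageI)
  have "\<bar>\<phi> x\<bar> \<le> max B 0" for x using B[of x] supp[of x] by (cases "\<bar>x\<bar> \<le> R") (auto simp: max_def)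
  then show ?thesis by (intro exI[of _ "max B 0"]) auto
qed

text \<open>The antiderivative is constant on both sides of the support, hence bounded.\<close>

lemma bounded_support_antiderivative:
  fixes \<phi> :: "real \<Rightarrow> real"
  assumes c: "continuous_on UNIV \<phi>" and supp: "\<And>x. R < \<bar>x\<bar> \<Longrightarrow> \<phi> x = 0"
  shows "\<exists>\<Phi>\<in>Cb1. \<forall>x. (\<Phi> has_real_derivative \<phi> x) (at x)"
proof -
  have ic: "isCont \<phi> x" for x using c by (simp add: continuous_on_eq_continuous_at)
  have "\<exists>F. \<forall>x :: real. (-\<infinity>::ereal) < x \<longrightarrow> x < (\<infinity>::ereal) \<longrightarrow> (F has_vector_derivative \<phi> x) (at x)"
    by (rule einterval_antiderivative) (auto simp: ic)
  then obtain \<Phi> where d: "\<And>x. (\<Phi> has_real_derivative \<phi> x) (at x)"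
    by (auto simp: has_real_derivative_iff_has_vector_derivative)
  have cont: "continuous_on S \<Phi>" for S
    using d by (meson DERIV_continuous continuous_at_imp_continuous_on)
  define A where "A = \<bar>R\<bar> + 1"
  have A: "A > 0" "R < A" by (auto simp: A_def)
  obtain B where B: "\<And>x. x \<in> cball 0 A \<Longrightarrow> norm (\<Phi> x) \<le> B"
    using compact_continuous_image[OF cont compact_cball, of 0 A] by (metis bounded_iff compact_imp_bounded imageI)
  have up: "\<Phi> x = \<Phi> A" if "x > A" for x
  proof (rule DERIV_isconst_end[OF that cont])
    fix y assume "A < y" "y < x"
    then have "\<phi> y = 0" using A by (intro supp) linarith
    then show "DERIV \<Phi> y :> 0" using d[of y] by simp
  qed
  have lo: "\<Phi> (- A) = \<Phi> x" if "x < - A" for x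
  proof (rule DERIV_isconst_end[OF that cont])
    fix y assume "x < y" "y < - A"
    then have "\<phi> y = 0" using A by (intro supp) linarith
    then show "DERIV \<Phi> y :> 0" using d[of y] by simp
  qed
  have "norm (\<Phi> x) \<le> B" for x
    using up[of x] lo[of x] B[of x] B[of A] B[of "- A"] A by (cases "x > A"; cases "x < - A") auto
  then have "bounded (range \<Phi>)" unfolding bounded_iff by blast
  moreover obtain B' where "\<And>x. \<bar>\<phi> x\<bar> \<le> B'" using bounded_support_bounded[OF c supp] by blast
  then have "bounded (range \<phi>)" unfolding bounded_iff by auto
  ultimately have "\<Phi> \<in> Cb1" using d c unfolding Cb1_def by blast
  then show ?thesis using d by blast
qed

text \<open>Short displacements are handled by uniform continuity of the derivative. For those of
  length at least \<open>s\<close>, boundedness suffices, as the length is at most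
  \<open>s powr (1 - p)\<close> times its \<open>p\<close>-th power.\<close>

lemma bounded_support_taylor:
  fixes \<phi> \<Phi> :: "real \<Rightarrow> real"
  assumes c: "continuous_on UNIV \<phi>" and supp: "\<And>x. R < \<bar>x\<bar> \<Longrightarrow> \<phi> x = 0"
    and d: "\<And>x. (\<Phi> has_real_derivative \<phi> x) (at x)" and p: "p > 1" and e: "e > 0"
  shows "\<exists>K\<ge>0. \<forall>x y. \<bar>\<Phi> y - \<Phi> x - \<phi> x * (y - x)\<bar> \<le> e * \<bar>y - x\<bar> + K * \<bar>y - x\<bar> powr p"
proof -
  obtain B where B: "B \<ge> 0" "\<And>x. \<bar>\<phi> x\<bar> \<le> B" using bounded_support_bounded[OF c supp] by blast
  define A where "A = \<bar>R\<bar> + 2"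
  have "uniformly_continuous_on (cball 0 A) \<phi>"
    by (intro compact_uniformly_continuous continuous_on_subset[OF c]) auto
  then obtain s0 where s0: "s0 > 0" "\<And>x y. x \<in> cball 0 A \<Longrightarrow> y \<in> cball 0 A \<Longrightarrow> dist y x < s0 \<Longrightarrow> dist (\<phi> y) (\<phi> x) < e"
    unfolding uniformly_continuous_on_def using e by metis
  define s where "s = min s0 1"
  have s: "s > 0" using s0(1) by (simp add: s_def)
  have uc: "\<bar>\<phi> y - \<phi> x\<bar> \<le> e" if "\<bar>y - x\<bar> < s" for x y
  proof (cases "\<bar>x\<bar> \<le> \<bar>R\<bar> + 1")
    case True
    then have "dist (\<phi> y) (\<phi> x) < e" using that by (intro s0(2)) (auto simp: dist_real_def s_def A_def)
    then show ?thesis by (simp add: dist_real_def)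
  next
    case False
    then have "\<phi> x = 0" "\<phi> y = 0" using that by (auto intro!: supp simp: s_def)
    then show ?thesis using e by simp
  qed
  have mv: "\<exists>\<xi>. \<bar>\<xi> - x\<bar> \<le> \<bar>y - x\<bar> \<and> \<Phi> y - \<Phi> x = \<phi> \<xi> * (y - x)" for x y
  proof -
    consider "x < y" | "y < x" | "x = y" by linarith
    then show ?thesis
    proof cases
      case 1
      obtain z where "x < z" "z < y" "\<Phi> y - \<Phi> x = (y - x) * \<phi> z" using MVT2[OF 1, of \<Phi> \<phi>] d by blast
      then show ?thesis by (intro exI[of _ z]) (auto simp: mult.commute)
    next
      case 2
      obtain z where z: "y < z" "z < x" "\<Phi> x - \<Phi> y = (x - y) * \<phi> z" using MVT2[OF 2, of \<Phi> \<phi>] d by blast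
      then have "\<Phi> y - \<Phi> x = \<phi> z * (y - x)" by (simp add: algebra_simps)
      then show ?thesis using z by (intro exI[of _ z]) auto
    qed auto
  qed
  define K where "K = 2 * B * s powr (1 - p)"
  have K: "K \<ge> 0" using B by (simp add: K_def)
  have "\<bar>\<Phi> y - \<Phi> x - \<phi> x * (y - x)\<bar> \<le> e * \<bar>y - x\<bar> + K * \<bar>y - x\<bar> powr p" for x y
  proof -
    obtain \<xi> where \<xi>: "\<bar>\<xi> - x\<bar> \<le> \<bar>y - x\<bar>" "\<Phi> y - \<Phi> x = \<phi> \<xi> * (y - x)" using mv by blast
    have eq: "\<bar>\<Phi> y - \<Phi> x - \<phi> x * (y - x)\<bar> = \<bar>\<phi> \<xi> - \<phi> x\<bar> * \<bar>y - x\<bar>"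
      unfolding \<xi>(2) by (simp add: abs_mult[symmetric] left_diff_distrib)
    show ?thesis
    proof (cases "\<bar>y - x\<bar> < s")
      case True
      then have "\<bar>\<phi> \<xi> - \<phi> x\<bar> * \<bar>y - x\<bar> \<le> e * \<bar>y - x\<bar>" using \<xi>(1) by (intro mult_right_mono uc) auto
      moreover have "0 \<le> K * \<bar>y - x\<bar> powr p" using K by simp
      ultimately show ?thesis unfolding eq by linarith
    next
      case False
      let ?d = "\<bar>y - x\<bar>"
      have "?d powr (1 - p) \<le> s powr (1 - p)" using False s p by (intro powr_mono2') auto
      then have "?d powr p * ?d powr (1 - p) \<le> ?d powr p * s powr (1 - p)" by (intro mult_left_mono) auto
      moreover have "?d powr p * ?d powr (1 - p) = ?d" using False s by (simp add: powr_add[symmetric])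
      ultimately have d: "?d \<le> s powr (1 - p) * ?d powr p" by (simp add: mult.commute)
      have "\<bar>\<phi> \<xi> - \<phi> x\<bar> \<le> 2 * B" using B(2)[of \<xi>] B(2)[of x] by linarith
      then have "\<bar>\<phi> \<xi> - \<phi> x\<bar> * ?d \<le> 2 * B * (s powr (1 - p) * ?d powr p)" using d B by (intro mult_mono) auto
      moreover have "0 \<le> e * ?d" using e by simp
      ultimately show ?thesis unfolding eq K_def by (simp add: mult.assoc)
    qed
  qed
  then show ?thesis using K by blast
qed

section \<open>The expansion at the reference measure, in terms of the gradient adapted to the
  distance\<close>

locale sens = mean_field p g \<delta>g for p g \<delta>g +
  fixes d :: distance_kind and \<mu> :: "plane measure"
  assumes \<mu>: "\<mu> \<in> Pp p"
begin

abbreviation u :: "plane \<Rightarrow> real" where "u \<equiv> \<delta>g \<mu>"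

sublocale P: plane_prob \<mu> by (rule plane_prob_Pp[OF \<mu>])

lemma u_grad_meas [measurable]: "grad u \<in> borel_measurable borel" by (rule grad_meas[OF \<mu>])

lemma partial_eq: "partial1 u x = fst (grad u x)" "partial2 u x = snd (grad u x)" by (auto simp: grad_def)

lemma partial_meas [measurable]: "partial1 u \<in> borel_measurable borel" "partial2 u \<in> borel_measurable borel"
  unfolding partial_eq[abs_def] by measurable

lemma partial_Lq: "in_Lp q \<mu> (partial1 u)" "in_Lp q \<mu> (partial2 u)"
  unfolding partial_eq[abs_def]
  by (rule in_Lp_plane_fst in_Lp_plane_snd; use grad_in_Lq[OF \<mu>] q1 in simp)+

lemma partial_int: "integrable \<mu> (partial1 u)" "integrable \<mu> (partial2 u)"
  using in_Lp_imp_integrable[OF P.finite_measure_axioms partial_Lq(1)] in_Lp_imp_integrable[OF P.finite_measure_axioms partial_Lq(2)] q1 by auto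

lemma dgrad_meas [measurable]: "dgrad d \<mu> u \<in> borel_measurable borel"
proof (cases d)
  case Wass
  then have "dgrad d \<mu> u = grad u" by (auto simp: fun_eq_iff)
  then show ?thesis by simp
next
  case AdWass
  then have "dgrad d \<mu> u = (\<lambda>x. (cexp \<mu> fst (partial1 u) x, partial2 u x))" by (auto simp: fun_eq_iff)
  then show ?thesis by simp
qed

lemma dgrad_Lq: "in_Lp q \<mu> (dgrad d \<mu> u)"
proof (cases d)
  case Wass
  then have "dgrad d \<mu> u = grad u" by (auto simp: fun_eq_iff)
  then show ?thesis using grad_in_Lq[OF \<mu>] by simp
next
  case AdWass
  have c: "in_Lp q \<mu> (cexp \<mu> fst (partial1 u))" by (rule P.c1.cexp_in_Lp(1)[OF partial_Lq(1) q1])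
  have "in_Lp q \<mu> (\<lambda>x. norm (cexp \<mu> fst (partial1 u) x) + norm (partial2 u x))"
    using c partial_Lq q1 by (intro in_Lp_add) (auto simp: in_Lp_def)
  then show ?thesis
  proof (rule in_Lp_bound)
    show "AE x in \<mu>. norm (dgrad d \<mu> u x) \<le> norm (norm (cexp \<mu> fst (partial1 u) x) + norm (partial2 u x))"
    proof (intro AE_I2)
      fix x
      show "norm (dgrad d \<mu> u x) \<le> norm (norm (cexp \<mu> fst (partial1 u) x) + norm (partial2 u x))"
        using norm_plane_le[of "cexp \<mu> fst (partial1 u) x" "partial2 u x"] by (simp add: AdWass)
    qed
  qed (use q1 in \<open>simp_all add: P.sets_eq cong: measurable_cong_sets\<close>)
qed

sublocale L: Lq_problem \<mu> p "dgrad d \<mu> u"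
  by unfold_locales (use p dgrad_Lq in auto)

lemma U_eq: "U d p \<mu> u f = L.UU f" by (simp add: U_def L.UU_def resid_def)

text \<open>The difference \<open>b\<close> between the first partial derivative and its conditional
  mean is orthogonal to the second first coordinate by causality, and to the first one by
  conditioning; hence it does not contribute against the displacement.\<close>

lemma inner_dgrad_eq:
  assumes m': "m' \<in> Pp p" and \<pi>: "\<pi> \<in> couplings \<mu> m'" and causal: "d = AdWass \<Longrightarrow> causal \<pi>"
  shows "(\<integral>z. grad u (fst z) \<bullet> (snd z - fst z) \<partial>\<pi>) = (\<integral>z. dgrad d \<mu> u (fst z) \<bullet> (snd z - fst z) \<partial>\<pi>)"
proof (cases d)
  case Wass then show ?thesis by simp
next
  case AdWass
  interpret c: coupling p \<mu> m' \<pi> by unfold_locales (use p \<mu> m' \<pi> in auto)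
  define b where "b x = partial1 u x - cexp \<mu> fst (partial1 u) x" for x
  have [measurable]: "b \<in> borel_measurable borel" unfolding b_def by measurable
  have cL: "in_Lp q \<mu> (cexp \<mu> fst (partial1 u))" by (rule P.c1.cexp_in_Lp(1)[OF partial_Lq(1) q1])
  have bL: "in_Lp q \<mu> b" unfolding b_def using q1 by (intro in_Lp_diff partial_Lq cL) auto
  have ci: "integrable \<mu> (cexp \<mu> fst (partial1 u))" by (rule P.c1.cexp_integrable[OF partial_int(1)])
  have cc: "AE x in \<mu>. cexp \<mu> fst (cexp \<mu> fst (partial1 u)) x = cexp \<mu> fst (partial1 u) x"
    using P.c1.cexp_of_X[of "P.c1.ce (partial1 u)"] ci unfolding P.c1.cexp_factor[of "partial1 u", abs_def] by simp
  have b0: "AE x in \<mu>. cexp \<mu> fst b x = 0"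
    unfolding b_def using P.c1.cexp_diff[OF partial_int(1) ci] cc by eventually_elim simp
  have z1: "(\<integral>z. b (fst z) * fst (snd z) \<partial>\<pi>) = 0"
    by (rule c.causal_orthogonal[OF causal[OF AdWass] bL _ b0]) simp
  have X1: "in_Lp p \<mu> fst" using in_Lp_plane_fst[OF id_in_Lp[OF \<mu>]] p by simp
  have xb: "integrable \<mu> (\<lambda>x. fst x * b x)"
    using Holder_integral(1)[OF X1 bL p q1 conj_exp_props(2)[OF p]] .
  have "(\<integral>x. fst x * b x \<partial>\<mu>) = 0"
    using P.c1.cexp_zero_integral[of "\<lambda>t. t" b] xb b0 by simp
  then have z2: "(\<integral>z. b (fst z) * fst (fst z) \<partial>\<pi>) = 0"
    using c.integral_fst[of "\<lambda>x. b x * fst x"] by (simp add: mult.commute)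
  have i2: "integrable \<pi> (\<lambda>z. b (fst z) * fst (fst z))"
    using xb by (subst c.integrable_fst_iff[of "\<lambda>x. b x * fst x"]) (auto simp: mult.commute)
  have bL\<pi>: "in_Lp q \<pi> (\<lambda>z. b (fst z))" by (rule c.in_Lp_fst(1)[OF _ bL]) simp
  have D1: "in_Lp p \<pi> (\<lambda>z. fst (c.\<Delta> z))" by (rule in_Lp_plane_fst[OF c.\<Delta>_Lp]) (use p in simp)
  have iD: "integrable \<pi> (\<lambda>z. b (fst z) * fst (c.\<Delta> z))"
    by (rule Holder_integral(1)[OF bL\<pi> D1 q1 p conj_exp_props(3)[OF p]])
  have i1: "integrable \<pi> (\<lambda>z. b (fst z) * fst (snd z))"
    using Bochner_Integration.integrable_add[OF iD i2] by (simp add: c.\<Delta>_def algebra_simps)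
  have bz: "(\<integral>z. b (fst z) * fst (c.\<Delta> z) \<partial>\<pi>) = 0"
    using z1 z2 i1 i2 by (simp add: c.\<Delta>_def right_diff_distrib)
  have dL\<pi>: "in_Lp q \<pi> (\<lambda>z. dgrad d \<mu> u (fst z))" by (rule c.in_Lp_fst(1)[OF _ dgrad_Lq]) simp
  have id: "integrable \<pi> (\<lambda>z. dgrad d \<mu> u (fst z) \<bullet> c.\<Delta> z)"
    by (rule Holder_inner(1)[OF dL\<pi> c.\<Delta>_Lp q1 p conj_exp_props(3)[OF p]])
  have "(\<integral>z. grad u (fst z) \<bullet> c.\<Delta> z \<partial>\<pi>) = (\<integral>z. dgrad d \<mu> u (fst z) \<bullet> c.\<Delta> z + b (fst z) * fst (c.\<Delta> z) \<partial>\<pi>)"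
    by (intro Bochner_Integration.integral_cong) (auto simp: AdWass grad_def b_def inner_prod_def algebra_simps)
  also have "\<dots> = (\<integral>z. dgrad d \<mu> u (fst z) \<bullet> c.\<Delta> z \<partial>\<pi>)" using id iD bz by simp
  finally show ?thesis by (simp add: c.\<Delta>_def)
qed

lemma G_upper_le:
  assumes f: "f \<in> Lpair q \<mu>" and e: "e > 0"
  shows "\<exists>r0>0. \<forall>r. 0 < r \<and> r < r0 \<longrightarrow> G_upper d p g \<mu> r \<le> ereal (g \<mu> + r * (Lnorm q \<mu> (L.R f) + e))"
proof -
  define V where "V = Lnorm q \<mu> (L.R f)"
  have V: "V \<ge> 0" by (simp add: V_def)
  \<comment> \<open>Five errors \<open>e1\<close> per unit of cost occur: one from expanding
    \<open>g\<close>, three from the test functions, one from replacing \<open>f\<close> by a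
    continuous pair. The factor \<open>1 + e1\<close> is the tolerance of the nearly optimal
    coupling.\<close>
  define e1 where "e1 = min 1 (e / (V + 10))"
  have e1: "0 < e1" "e1 \<le> 1" using e V by (auto simp: e1_def)
  have e1V: "(V + 5 * e1) * (1 + e1) \<le> V + e"
  proof -
    have "e1 \<le> e / (V + 10)" by (simp add: e1_def)
    then have "e1 * (V + 10) \<le> e" using V by (simp add: field_simps)
    moreover have "e1 * e1 \<le> e1 * 1" using e1 by (intro mult_left_mono) auto
    ultimately show ?thesis by (simp add: algebra_simps)
  qed
  have [measurable]: "fst f \<in> borel_measurable borel" "snd f \<in> borel_measurable borel" using f by (auto simp: P.Lpair_iff)
  have fL: "in_Lp q (marg1 \<mu>) (fst f)" "in_Lp q (marg2 \<mu>) (snd f)"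
    using f P.c1.in_Lp_distr_iff[of "fst f"] P.c2.in_Lp_distr_iff[of "snd f"] by (auto simp: P.Lpair_iff P.marg1_eq P.marg2_eq)
  have fin: "finite_measure (marg1 \<mu>)" "finite_measure (marg2 \<mu>)"
    using P.prob_space_distr[of fst borel] P.prob_space_distr[of snd borel] by (auto simp: P.marg1_eq P.marg2_eq prob_space_def)
  have sm: "sets (marg1 \<mu>) = sets borel" "sets (marg2 \<mu>) = sets borel" by (auto simp: P.marg1_eq P.marg2_eq)
  obtain \<phi>1 R1 where \<phi>1: "continuous_on UNIV \<phi>1" "\<And>x. R1 < \<bar>x\<bar> \<Longrightarrow> \<phi>1 x = 0" "in_Lp q (marg1 \<mu>) \<phi>1" "Lnorm q (marg1 \<mu>) (\<lambda>x. fst f x - \<phi>1 x) < e1 / 2"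
    using Lp_density_continuous[OF fin(1) sm(1) fL(1) q1, of "e1 / 2"] e1 by auto
  obtain \<phi>2 R2 where \<phi>2: "continuous_on UNIV \<phi>2" "\<And>x. R2 < \<bar>x\<bar> \<Longrightarrow> \<phi>2 x = 0" "in_Lp q (marg2 \<mu>) \<phi>2" "Lnorm q (marg2 \<mu>) (\<lambda>x. snd f x - \<phi>2 x) < e1 / 2"
    using Lp_density_continuous[OF fin(2) sm(2) fL(2) q1, of "e1 / 2"] e1 by auto
  have [measurable]: "\<phi>1 \<in> borel_measurable borel" "\<phi>2 \<in> borel_measurable borel"
    using \<phi>1(1) \<phi>2(1) by (auto intro: borel_measurable_continuous_onI)
  define h where "h = (\<phi>1, \<phi>2)"
  have h: "h \<in> Lpair q \<mu>"
    using \<phi>1(3) \<phi>2(3) P.c1.in_Lp_distr_iff[of \<phi>1] P.c2.in_Lp_distr_iff[of \<phi>2] by (auto simp: h_def P.Lpair_iff P.marg1_eq P.marg2_eq)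
  have Rh: "Lnorm q \<mu> (L.R h) \<le> V + e1"
  proof -
    have "pair_norm q \<mu> (pair_lin 1 h (-1) f) = Lnorm q (marg1 \<mu>) (\<lambda>x. fst f x - \<phi>1 x) + Lnorm q (marg2 \<mu>) (\<lambda>x. snd f x - \<phi>2 x)"
      by (simp add: pair_norm_def pair_lin_def h_def Lnorm_def abs_minus_commute)
    then show ?thesis using L.Lnorm_R_diff[OF f h] \<phi>1(4) \<phi>2(4) by (simp add: V_def)
  qed
  obtain \<Phi>1 where \<Phi>1: "\<Phi>1 \<in> Cb1" "\<And>x. (\<Phi>1 has_real_derivative \<phi>1 x) (at x)" using bounded_support_antiderivative[OF \<phi>1(1,2)] by blast
  obtain \<Phi>2 where \<Phi>2: "\<Phi>2 \<in> Cb1" "\<And>x. (\<Phi>2 has_real_derivative \<phi>2 x) (at x)" using bounded_support_antiderivative[OF \<phi>2(1,2)] by blast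
  obtain K1 where K1: "K1 \<ge> 0" "\<And>x y. \<bar>\<Phi>1 y - \<Phi>1 x - \<phi>1 x * (y - x)\<bar> \<le> e1 * \<bar>y - x\<bar> + K1 * \<bar>y - x\<bar> powr p"
    using bounded_support_taylor[OF \<phi>1(1,2) \<Phi>1(2) p e1(1)] by blast
  obtain K2 where K2: "K2 \<ge> 0" "\<And>x y. \<bar>\<Phi>2 y - \<Phi>2 x - \<phi>2 x * (y - x)\<bar> \<le> e1 * \<bar>y - x\<bar> + K2 * \<bar>y - x\<bar> powr p"
    using bounded_support_taylor[OF \<phi>2(1,2) \<Phi>2(2) p e1(1)] by blast
  define K where "K = K1 + K2"
  have K: "K \<ge> 0" using K1 K2 by (simp add: K_def)
  have \<Phi>c: "continuous_on UNIV \<Phi>1" "continuous_on UNIV \<Phi>2"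
    using \<Phi>1(2) \<Phi>2(2) by (meson DERIV_continuous continuous_at_imp_continuous_on)+
  then have [measurable]: "\<Phi>1 \<in> borel_measurable borel" "\<Phi>2 \<in> borel_measurable borel" by (auto intro: borel_measurable_continuous_onI)
  obtain B where B: "\<And>x. \<bar>\<Phi>1 x\<bar> \<le> B" using \<Phi>1(1) unfolding Cb1_def bounded_iff by auto
  obtain B' where B': "\<And>x. \<bar>\<Phi>2 x\<bar> \<le> B'" using \<Phi>2(1) unfolding Cb1_def bounded_iff by auto
  define S where "S x = \<Phi>1 (fst x) + \<Phi>2 (snd x)" for x :: plane
  have Sm[measurable]: "S \<in> borel_measurable borel" unfolding S_def by measurable
  have Sb: "\<bar>S x\<bar> \<le> B + B'" for x using B[of "fst x"] B'[of "snd x"] by (simp add: S_def abs_le_iff)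
  have Staylor: "\<bar>S y - S x - pair_vec h x \<bullet> (y - x)\<bar> \<le> 2 * e1 * norm (y - x) + K * norm (y - x) powr p" for x y
  proof -
    have n1: "\<bar>fst y - fst x\<bar> \<le> norm (y - x)" and n2: "\<bar>snd y - snd x\<bar> \<le> norm (y - x)"
      using abs_fst_le_norm[of "y - x"] abs_snd_le_norm[of "y - x"] by simp_all
    have "S y - S x - pair_vec h x \<bullet> (y - x) = (\<Phi>1 (fst y) - \<Phi>1 (fst x) - \<phi>1 (fst x) * (fst y - fst x)) + (\<Phi>2 (snd y) - \<Phi>2 (snd x) - \<phi>2 (snd x) * (snd y - snd x))"
      by (simp add: S_def pair_vec_def h_def inner_prod_def)
    also have "\<bar>\<dots>\<bar> \<le> (e1 * \<bar>fst y - fst x\<bar> + K1 * \<bar>fst y - fst x\<bar> powr p) + (e1 * \<bar>snd y - snd x\<bar> + K2 * \<bar>snd y - snd x\<bar> powr p)"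
      using K1(2)[of "fst y" "fst x"] K2(2)[of "snd y" "snd x"] by linarith
    also have "\<dots> \<le> (e1 * norm (y - x) + K1 * norm (y - x) powr p) + (e1 * norm (y - x) + K2 * norm (y - x) powr p)"
      using n1 n2 e1 K1 K2 p by (intro add_mono mult_left_mono powr_mono2) auto
    finally show ?thesis by (simp add: K_def algebra_simps)
  qed
  obtain \<rho> where \<rho>: "\<rho> > 0" "\<And>m' \<pi>. m' \<in> Pp p \<Longrightarrow> \<pi> \<in> couplings \<mu> m' \<Longrightarrow> transport_cost p \<pi> \<le> \<rho> \<Longrightarrow>
     \<bar>g m' - g \<mu> - (\<integral>z. grad u (fst z) \<bullet> (snd z - fst z) \<partial>\<pi>)\<bar> \<le> e1 * transport_cost p \<pi>"
    using expansion[OF \<mu> e1(1)] by blast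
  define \<rho>' where "\<rho>' = min \<rho> ((e1 / (K + 1)) powr (1 / (p - 1)))"
  have \<rho>': "\<rho>' > 0" using \<rho> e1 K by (simp add: \<rho>'_def)
  have K\<rho>: "K * \<rho>' powr (p - 1) \<le> e1"
  proof -
    have "\<rho>' powr (p - 1) \<le> ((e1 / (K + 1)) powr (1 / (p - 1))) powr (p - 1)" using p \<rho>' by (intro powr_mono2) (auto simp: \<rho>'_def)
    also have "\<dots> = e1 / (K + 1)" using p e1 K by (simp add: powr_powr)
    finally have "(K + 1) * \<rho>' powr (p - 1) \<le> e1" using K by (simp add: field_simps)
    moreover have "K * \<rho>' powr (p - 1) \<le> (K + 1) * \<rho>' powr (p - 1)" by (intro mult_right_mono) auto
    ultimately show ?thesis by linarith
  qed
  show ?thesis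
  proof (intro exI[of _ "\<rho>' / 2"] conjI allI impI)
    show "\<rho>' / 2 > 0" using \<rho>' by simp
    fix r assume r: "0 < r \<and> r < \<rho>' / 2"
    have val: "g m' + ((\<integral>x. S x \<partial>m') - (\<integral>x. S x \<partial>\<mu>)) \<le> g \<mu> + r * (V + e)" if m': "m' \<in> dball d p \<mu> r" for m'
    proof -
      have m'P: "m' \<in> Pp p" using m' by (simp add: dball_def)
      interpret M': plane_prob m' by (rule plane_prob_Pp[OF m'P])
      \<comment> \<open>The tolerance is relative to \<open>r\<close>, so that it survives division
        by \<open>r\<close>.\<close>
      obtain \<pi> where \<pi>: "\<pi> \<in> couplings \<mu> m'" "transport_cost p \<pi> < r + r * e1" "d = AdWass \<Longrightarrow> causal \<pi>"
        using near_optimal_coupling[OF p \<mu> m', of "r * e1"] r e1 by auto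
      interpret c: coupling p \<mu> m' \<pi> by unfold_locales (use p \<mu> m'P \<pi> in auto)
      have "r * e1 \<le> r * 1" using r e1 by (intro mult_left_mono) auto
      then have c\<rho>': "c.cost \<le> \<rho>'" using \<pi>(2) r by linarith
      then have c\<rho>: "c.cost \<le> \<rho>" by (simp add: \<rho>'_def)
      have dL\<pi>: "in_Lp q \<pi> (\<lambda>z. dgrad d \<mu> u (fst z))" by (rule c.in_Lp_fst(1)[OF _ dgrad_Lq]) simp
      have hL\<pi>: "in_Lp q \<pi> (\<lambda>z. pair_vec h (fst z))" by (rule c.in_Lp_fst(1)[OF _ L.pair_vec_in_Lp[OF h]]) (rule L.pair_vec_meas[OF h])
      have RL\<pi>: "in_Lp q \<pi> (\<lambda>z. L.R h (fst z))" "Lnorm q \<pi> (\<lambda>z. L.R h (fst z)) = Lnorm q \<mu> (L.R h)"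
        using c.in_Lp_fst[OF L.R_meas[OF h]] L.R_in_Lp[OF h] by auto
      have id: "integrable \<pi> (\<lambda>z. dgrad d \<mu> u (fst z) \<bullet> c.\<Delta> z)"
        by (rule Holder_inner(1)[OF dL\<pi> c.\<Delta>_Lp q1 p conj_exp_props(3)[OF p]])
      have ih: "integrable \<pi> (\<lambda>z. pair_vec h (fst z) \<bullet> c.\<Delta> z)"
        by (rule Holder_inner(1)[OF hL\<pi> c.\<Delta>_Lp q1 p conj_exp_props(3)[OF p]])
      have ip: "integrable \<pi> (\<lambda>z. norm (c.\<Delta> z) powr p)" using c.\<Delta>_Lp by (simp add: in_Lp_def)
      have iS: "integrable m' S" "integrable \<mu> S"
        by (rule M'.integrable_const_bound[where B="B + B'"] P.integrable_const_bound[where B="B + B'"]; use Sb in auto)+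
      have i1: "integrable \<pi> (\<lambda>z. S (snd z))" "integrable \<pi> (\<lambda>z. S (fst z))" using iS by (auto simp: c.integrable_snd_iff c.integrable_fst_iff)
      have "g m' - g \<mu> \<le> (\<integral>z. dgrad d \<mu> u (fst z) \<bullet> c.\<Delta> z \<partial>\<pi>) + e1 * c.cost"
        using \<rho>(2)[OF m'P \<pi>(1) c\<rho>] inner_dgrad_eq[OF m'P \<pi>(1,3)] unfolding c.\<Delta>_def by linarith
      moreover have "(\<integral>x. S x \<partial>m') - (\<integral>x. S x \<partial>\<mu>) \<le> (\<integral>z. pair_vec h (fst z) \<bullet> c.\<Delta> z \<partial>\<pi>) + (3 * e1) * c.cost"
      proof -
        have "(\<integral>x. S x \<partial>m') - (\<integral>x. S x \<partial>\<mu>) = (\<integral>z. S (snd z) - S (fst z) \<partial>\<pi>)" using i1 by (simp add: c.integral_snd c.integral_fst)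
        also have "\<dots> \<le> (\<integral>z. pair_vec h (fst z) \<bullet> c.\<Delta> z + (2 * e1 * norm (c.\<Delta> z) + K * norm (c.\<Delta> z) powr p) \<partial>\<pi>)"
        proof (rule integral_mono)
          show "integrable \<pi> (\<lambda>z. S (snd z) - S (fst z))" by (intro Bochner_Integration.integrable_diff i1)
          show "integrable \<pi> (\<lambda>z. pair_vec h (fst z) \<bullet> c.\<Delta> z + (2 * e1 * norm (c.\<Delta> z) + K * norm (c.\<Delta> z) powr p))"
            by (intro Bochner_Integration.integrable_add ih integrable_mult_right ip c.norm_\<Delta>_integrable)
          show "S (snd z) - S (fst z) \<le> pair_vec h (fst z) \<bullet> c.\<Delta> z + (2 * e1 * norm (c.\<Delta> z) + K * norm (c.\<Delta> z) powr p)" for z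
            using Staylor[of "snd z" "fst z"] unfolding c.\<Delta>_def by linarith
        qed
        also have "\<dots> = (\<integral>z. pair_vec h (fst z) \<bullet> c.\<Delta> z \<partial>\<pi>) + (2 * e1 * (\<integral>z. norm (c.\<Delta> z) \<partial>\<pi>) + K * (\<integral>z. norm (c.\<Delta> z) powr p \<partial>\<pi>))"
          using ih ip c.norm_\<Delta>_integrable by simp
        also have "\<dots> \<le> (\<integral>z. pair_vec h (fst z) \<bullet> c.\<Delta> z \<partial>\<pi>) + (2 * e1 * c.cost + e1 * c.cost)"
        proof (intro add_left_mono add_mono mult_left_mono c.norm_\<Delta>_le)
          have "c.cost powr p = c.cost powr (p - 1) * c.cost" using c.cost_nonneg by (cases "c.cost = 0") (auto simp: powr_diff)
          also have "K * \<dots> \<le> K * (\<rho>' powr (p - 1) * c.cost)"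
            using c\<rho>' c.cost_nonneg p K by (intro mult_left_mono mult_right_mono powr_mono2) auto
          also have "\<dots> = K * \<rho>' powr (p - 1) * c.cost" by simp
          also have "\<dots> \<le> e1 * c.cost" using K\<rho> c.cost_nonneg by (intro mult_right_mono) auto
          finally show "K * (\<integral>z. norm (c.\<Delta> z) powr p \<partial>\<pi>) \<le> e1 * c.cost" unfolding c.cost_powr .
        qed (use e1 in auto)
        finally show ?thesis by (simp add: algebra_simps)
      qed
      moreover have "(\<integral>z. dgrad d \<mu> u (fst z) \<bullet> c.\<Delta> z \<partial>\<pi>) + (\<integral>z. pair_vec h (fst z) \<bullet> c.\<Delta> z \<partial>\<pi>) = (\<integral>z. L.R h (fst z) \<bullet> c.\<Delta> z \<partial>\<pi>)"
        using id ih by (simp add: inner_add_left)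
      moreover have "(\<integral>z. L.R h (fst z) \<bullet> c.\<Delta> z \<partial>\<pi>) \<le> (V + e1) * c.cost"
      proof -
        have "(\<integral>z. L.R h (fst z) \<bullet> c.\<Delta> z \<partial>\<pi>) \<le> Lnorm q \<mu> (L.R h) * c.cost"
          using Holder_inner(2)[OF RL\<pi>(1) c.\<Delta>_Lp q1 p conj_exp_props(3)[OF p]] unfolding RL\<pi>(2) c.cost_eq by linarith
        also have "\<dots> \<le> (V + e1) * c.cost" using Rh c.cost_nonneg by (intro mult_right_mono) auto
        finally show ?thesis .
      qed
      ultimately have "g m' + ((\<integral>x. S x \<partial>m') - (\<integral>x. S x \<partial>\<mu>)) \<le> g \<mu> + (V + 5 * e1) * c.cost"
        by (simp add: algebra_simps)
      also have "(V + 5 * e1) * c.cost \<le> (V + 5 * e1) * (r * (1 + e1))"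
        using \<pi>(2) V e1 by (intro mult_left_mono) (auto simp: algebra_simps)
      also have "\<dots> = r * ((V + 5 * e1) * (1 + e1))" by simp
      also have "\<dots> \<le> r * (V + e)" using e1V r by (intro mult_left_mono) auto
      finally show ?thesis by simp
    qed
    have "G_upper d p g \<mu> r \<le> (SUP \<mu>'\<in>dball d p \<mu> r. ereal (g \<mu>' + ((\<integral>x. S x \<partial>\<mu>') - (\<integral>x. S x \<partial>\<mu>))))"
      unfolding G_upper_def by (rule INF_lower2[of "(\<Phi>1, \<Phi>2)"]) (auto simp: \<Phi>1 \<Phi>2 S_def)
    also have "\<dots> \<le> ereal (g \<mu> + r * (V + e))" by (rule SUP_least) (use val in auto)
    finally show "G_upper d p g \<mu> r \<le> ereal (g \<mu> + r * (Lnorm q \<mu> (L.R f) + e))" by (simp add: V_def)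
  qed
qed

end

section \<open>The lower bound\<close>

text \<open>The adapted condition provides a kernel; integrating out the first coordinate yields the
  density of the second marginal, which may be cut off outside the supporting interval.\<close>

lemma (in plane_prob) marg2_density:
  assumes k[measurable]: "k \<in> borel_measurable borel" and k0: "\<And>x. 0 \<le> k x" and kb: "bounded (range k)"
    and dens: "\<mu> = density (marg1 \<mu> \<Otimes>\<^sub>M lborel) (\<lambda>x. ennreal (k x))"
    and I: "is_interval I" "AE x in marg2 \<mu>. x \<in> I"
  defines "q2 \<equiv> \<lambda>x2. \<integral>x1. k (x1, x2) \<partial>marg1 \<mu>"
  shows "distr \<mu> borel snd = density lborel (\<lambda>x. ennreal (q2 x) * indicator I x)" "\<And>x. 0 \<le> q2 x"
proof -
  interpret N: prob_space "marg1 \<mu>" unfolding marg1_eq by (rule prob_space_distr) simp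
  interpret PP: pair_sigma_finite "marg1 \<mu>" lborel ..
  have sN[measurable_cong]: "sets (marg1 \<mu>) = sets borel" by (simp add: marg1_eq)
  have sP: "sets (marg1 \<mu> \<Otimes>\<^sub>M lborel) = sets borel"
    using sets_pair_measure_cong[OF sN sets_lborel] by (simp only: borel_prod)
  have kP[measurable]: "k \<in> borel_measurable (marg1 \<mu> \<Otimes>\<^sub>M lborel)" using k measurable_cong_sets[OF sP refl] by blast
  have I_borel[measurable]: "I \<in> sets borel" by (rule interval_borel[OF I(1)])
  obtain B where B: "\<And>x. \<bar>k x\<bar> \<le> B" using kb unfolding bounded_iff by auto
  have pm: "(\<lambda>x1. (x1, x2)) \<in> borel_measurable borel" for x2 :: real
    by (intro borel_measurable_continuous_onI continuous_intros)
  have km: "(\<lambda>x1. k (x1, x2)) \<in> borel_measurable (marg1 \<mu>)" for x2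
    using measurable_compose[OF pm k] by (simp add: sN cong: measurable_cong_sets)
  have ki: "integrable (marg1 \<mu>) (\<lambda>x1. k (x1, x2))" for x2
    by (rule N.integrable_const_bound[where B=B]) (use B km in auto)
  show q20: "0 \<le> q2 x" for x unfolding q2_def using k0 by simp
  have q2e: "(\<integral>\<^sup>+x1. ennreal (k (x1, x2)) \<partial>marg1 \<mu>) = ennreal (q2 x2)" for x2
    unfolding q2_def using k0 by (intro nn_integral_eq_integral ki) auto
  have q2m[measurable]: "(\<lambda>x. ennreal (q2 x)) \<in> borel_measurable lborel"
  proof -
    have "(\<lambda>z. k (prod.swap z)) \<in> borel_measurable (lborel \<Otimes>\<^sub>M marg1 \<mu>)"
      using measurable_compose[OF measurable_pair_swap' kP] by (simp add: case_prod_unfold prod.swap_def)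
    then have "(\<lambda>(x2, x1). ennreal (k (x1, x2))) \<in> borel_measurable (lborel \<Otimes>\<^sub>M marg1 \<mu>)"
      by (simp add: case_prod_unfold prod.swap_def)
    then show ?thesis unfolding q2e[symmetric] by (rule N.borel_measurable_nn_integral)
  qed
  have eq: "distr \<mu> borel snd = density lborel (\<lambda>x. ennreal (q2 x))"
  proof (rule measure_eqI)
    fix A assume "A \<in> sets (distr \<mu> borel snd)"
    then have A[measurable]: "A \<in> sets borel" by simp
    have sA: "snd -` A \<in> sets (marg1 \<mu> \<Otimes>\<^sub>M lborel)" using measurable_sets_borel[OF borel_measurable_snd_plane A] unfolding sP .
    have "emeasure (distr \<mu> borel snd) A = emeasure \<mu> (snd -` A)" by (subst emeasure_distr) auto
    also have "\<dots> = emeasure (density (marg1 \<mu> \<Otimes>\<^sub>M lborel) (\<lambda>x. ennreal (k x))) (snd -` A)"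
      by (rule arg_cong[where f="\<lambda>M. emeasure M (snd -` A)", OF dens])
    also have "\<dots> = (\<integral>\<^sup>+z. ennreal (k z) * indicator (snd -` A) z \<partial>(marg1 \<mu> \<Otimes>\<^sub>M lborel))"
      by (rule emeasure_density[OF _ sA]) measurable
    also have "\<dots> = (\<integral>\<^sup>+x2. (\<integral>\<^sup>+x1. ennreal (k (x1, x2)) * indicator (snd -` A) (x1, x2) \<partial>marg1 \<mu>) \<partial>lborel)"
      using sA by (intro PP.nn_integral_snd[symmetric, of "\<lambda>z. ennreal (k z) * indicator (snd -` A) z", simplified]) measurable
    also have "\<dots> = (\<integral>\<^sup>+x2. ennreal (q2 x2) * indicator A x2 \<partial>lborel)"
    proof (rule nn_integral_cong)
      fix x2
      have "(\<integral>\<^sup>+x1. ennreal (k (x1, x2)) * indicator (snd -` A) (x1, x2) \<partial>marg1 \<mu>) = (\<integral>\<^sup>+x1. ennreal (k (x1, x2)) * indicator A x2 \<partial>marg1 \<mu>)"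
        by (intro nn_integral_cong) (auto simp: indicator_def)
      also have "\<dots> = ennreal (q2 x2) * indicator A x2" unfolding q2e[symmetric] using km by (intro nn_integral_multc) measurable
      finally show "(\<integral>\<^sup>+x1. ennreal (k (x1, x2)) * indicator (snd -` A) (x1, x2) \<partial>marg1 \<mu>) = ennreal (q2 x2) * indicator A x2" .
    qed
    also have "\<dots> = emeasure (density lborel (\<lambda>x. ennreal (q2 x))) A" by (subst emeasure_density) auto
    finally show "emeasure (distr \<mu> borel snd) A = emeasure (density lborel (\<lambda>x. ennreal (q2 x))) A" .
  qed simp
  have "AE x in density lborel (\<lambda>x. ennreal (q2 x)). x \<in> I" using I(2) unfolding marg2_eq eq .
  then have "AE x in lborel. 0 < ennreal (q2 x) \<longrightarrow> x \<in> I" by (subst (asm) AE_density) auto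
  then have "density lborel (\<lambda>x. ennreal (q2 x)) = density lborel (\<lambda>x. ennreal (q2 x) * indicator I x)"
    by (intro density_cong) (auto elim!: eventually_mono simp: indicator_def not_less ennreal_neg)
  then show "distr \<mu> borel snd = density lborel (\<lambda>x. ennreal (q2 x) * indicator I x)" using eq by simp
qed

text \<open>\<open>X + r * T\<close> can be corrected by \<open>o(r)\<close> in
  \<open>L\<^sup>p\<close> to have exactly the law of \<open>X\<close>: to first order,
  \<open>T\<close> is tangent to the constraint on the marginal.\<close>

definition perturbable :: "real \<Rightarrow> plane measure \<Rightarrow> (plane \<Rightarrow> real) \<Rightarrow> (plane \<Rightarrow> real) \<Rightarrow> bool" where
  "perturbable p \<mu> X T \<longleftrightarrow> (\<forall>\<epsilon>>0. \<exists>r0>0. \<forall>r. 0 < r \<and> r < r0 \<longrightarrow> (\<exists>X'\<in>borel_measurable borel. distr \<mu> borel X' = distr \<mu> borel X \<and>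
      in_Lp p \<mu> (\<lambda>x. X' x - X x - r * T x) \<and> Lnorm p \<mu> (\<lambda>x. X' x - X x - r * T x) \<le> \<epsilon> * r))"

lemma perturbableD:
  assumes "perturbable p \<mu> X T" "\<epsilon> > 0"
  shows "\<exists>r0>0. \<forall>r. 0 < r \<and> r < r0 \<longrightarrow> (\<exists>X'\<in>borel_measurable borel. distr \<mu> borel X' = distr \<mu> borel X \<and>
      in_Lp p \<mu> (\<lambda>x. X' x - X x - r * T x) \<and> Lnorm p \<mu> (\<lambda>x. X' x - X x - r * T x) \<le> \<epsilon> * r)"
  using assms(1)[unfolded perturbable_def, rule_format, OF assms(2)] .

context sens
begin

lemma perturbable_snd:
  assumes B: "cond_B d \<mu>" and T: "in_Lp p \<mu> T" "AE x in \<mu>. cexp \<mu> snd T x = 0"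
  shows "perturbable p \<mu> snd T"
proof -
  have "\<exists>I q0. is_interval I \<and> continuous_on I q0 \<and> (\<forall>x\<in>I. 0 \<le> q0 x) \<and> distr \<mu> borel snd = density lborel (\<lambda>x. ennreal (q0 x) * indicator I x)"
  proof (cases d)
    case Wass then show ?thesis using B by (simp add: P.marg2_eq)
  next
    case AdWass
    then have "cond_B AdWass \<mu>" using B by simp
    then obtain k I where k: "k \<in> borel_measurable borel" "\<And>x. 0 \<le> k x" "bounded (range k)"
        "\<mu> = density (marg1 \<mu> \<Otimes>\<^sub>M lborel) (\<lambda>x. ennreal (k x))" "is_interval I" "AE x in marg2 \<mu>. x \<in> I"
        "continuous_on I (\<lambda>x2. \<integral>x1. k (x1, x2) \<partial>marg1 \<mu>)"
      unfolding cond_B.simps by blast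
    show ?thesis using P.marg2_density[OF k(1-6)] k(5,7) by blast
  qed
  then obtain I q0 where I: "is_interval I" "continuous_on I q0" "\<And>x. x \<in> I \<Longrightarrow> 0 \<le> q0 x" "distr \<mu> borel snd = density lborel (\<lambda>x. ennreal (q0 x) * indicator I x)"
    by blast
  interpret D: coord_density \<mu> snd "\<lambda>t. (0, t)" I q0 by unfold_locales (use I in auto)
  show ?thesis unfolding perturbable_def using D.perturbation[OF p T] by blast
qed

text \<open>Restricted to \<open>Wass\<close>, because the adapted condition puts no density on the
  first marginal.\<close>

lemma perturbable_fst:
  assumes d: "d = Wass" and B: "cond_B d \<mu>" and T: "in_Lp p \<mu> T" "AE x in \<mu>. cexp \<mu> fst T x = 0"
  shows "perturbable p \<mu> fst T"
proof -
  obtain I q0 where I: "is_interval I" "continuous_on I q0" "\<And>x. x \<in> I \<Longrightarrow> 0 \<le> q0 x" "distr \<mu> borel fst = density lborel (\<lambda>x. ennreal (q0 x) * indicator I x)"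
    using B d by (auto simp: P.marg1_eq)
  interpret D: coord_density \<mu> fst "\<lambda>t. (t, 0)" I q0 by unfold_locales (use I in auto)
  show ?thesis unfolding perturbable_def using D.perturbation[OF p T] by blast
qed

text \<open>Both coordinates are perturbed separately and put together; the law of the resulting
  point has the marginals of \<open>\<mu>\<close> and lies in the ball, and the expansion gives its
  value.\<close>

lemma G_lower_ge:
  assumes B: "cond_B d \<mu>" and T[measurable]: "T \<in> borel_measurable borel" and TL: "in_Lp p \<mu> T" and T1: "Lnorm p \<mu> T = 1"
    and z1: "AE x in \<mu>. cexp \<mu> fst (\<lambda>x. fst (T x)) x = 0" and z2: "AE x in \<mu>. cexp \<mu> snd (\<lambda>x. snd (T x)) x = 0"
    and ad: "d = AdWass \<Longrightarrow> AE x in \<mu>. fst (T x) = 0" and e: "e > 0"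
  shows "\<exists>r0>0. \<forall>r. 0 < r \<and> r < r0 \<longrightarrow> ereal (g \<mu> + r * ((\<integral>x. grad u x \<bullet> T x \<partial>\<mu>) - e)) \<le> G_lower d p g \<mu> r"
proof -
  define W where "W = (\<integral>x. grad u x \<bullet> T x \<partial>\<mu>)"
  define N where "N = Lnorm q \<mu> (grad u)"
  have N: "N \<ge> 0" by (simp add: N_def)
  \<comment> \<open>The three terms of the denominator account for shrinking the radius, for the
    correction paired with the gradient, and for the expansion error.\<close>
  define e1 where "e1 = e / (2 * \<bar>W\<bar> + 2 * N + 1)"
  have e1: "e1 > 0" unfolding e1_def using e N by (intro divide_pos_pos) auto
  have e1e: "2 * e1 * \<bar>W\<bar> + 2 * e1 * N + e1 = e"
  proof -
    have "2 * \<bar>W\<bar> + 2 * N + 1 \<noteq> 0" using N abs_ge_zero[of W] by linarith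
    then have "e1 * (2 * \<bar>W\<bar> + 2 * N + 1) = e" by (simp add: e1_def)
    then show ?thesis by (simp add: algebra_simps)
  qed
  have TL1: "in_Lp p \<mu> (\<lambda>x. fst (T x))" by (rule in_Lp_plane_fst[OF TL]) (use p in simp)
  have TL2: "in_Lp p \<mu> (\<lambda>x. snd (T x))" by (rule in_Lp_plane_snd[OF TL]) (use p in simp)
  have "\<exists>r1>0. \<forall>r. 0 < r \<and> r < r1 \<longrightarrow> (\<exists>X'\<in>borel_measurable borel. distr \<mu> borel X' = distr \<mu> borel fst \<and>
      in_Lp p \<mu> (\<lambda>x. X' x - fst x - r * fst (T x)) \<and> Lnorm p \<mu> (\<lambda>x. X' x - fst x - r * fst (T x)) \<le> e1 * r \<and> (d = AdWass \<longrightarrow> X' = fst))"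
  proof (cases d)
    case Wass
    then show ?thesis using perturbableD[OF perturbable_fst[OF Wass B TL1 z1] e1] by simp
  next
    case AdWass
    show ?thesis
    proof (intro exI[of _ 1] conjI allI impI bexI[of _ fst])
      fix r :: real assume r: "0 < r \<and> r < 1"
      have z: "AE x in \<mu>. fst x - fst x - r * fst (T x) = 0" using ad[OF AdWass] by eventually_elim simp
      show L: "in_Lp p \<mu> (\<lambda>x. fst x - fst x - r * fst (T x))"
        using in_Lp_uminus[OF in_Lp_cmult[OF TL1, of r]] by simp
      have "Lnorm p \<mu> (\<lambda>x. fst x - fst x - r * fst (T x)) = 0" using Lnorm_eq_0_iff[OF L] p z by simp
      then show "Lnorm p \<mu> (\<lambda>x. fst x - fst x - r * fst (T x)) \<le> e1 * r" using e1 r by simp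
    qed auto
  qed
  then obtain r1 where r1: "r1 > 0" "\<And>r. 0 < r \<Longrightarrow> r < r1 \<Longrightarrow> (\<exists>X'\<in>borel_measurable borel. distr \<mu> borel X' = distr \<mu> borel fst \<and>
      in_Lp p \<mu> (\<lambda>x. X' x - fst x - r * fst (T x)) \<and> Lnorm p \<mu> (\<lambda>x. X' x - fst x - r * fst (T x)) \<le> e1 * r \<and> (d = AdWass \<longrightarrow> X' = fst))"
    by blast
  obtain r2 where r2: "r2 > 0" "\<And>r. 0 < r \<Longrightarrow> r < r2 \<Longrightarrow> (\<exists>X'\<in>borel_measurable borel. distr \<mu> borel X' = distr \<mu> borel snd \<and>
      in_Lp p \<mu> (\<lambda>x. X' x - snd x - r * snd (T x)) \<and> Lnorm p \<mu> (\<lambda>x. X' x - snd x - r * snd (T x)) \<le> e1 * r)"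
    using perturbableD[OF perturbable_snd[OF B TL2 z2] e1] by blast
  obtain \<rho> where \<rho>: "\<rho> > 0" "\<And>m' \<pi>. m' \<in> Pp p \<Longrightarrow> \<pi> \<in> couplings \<mu> m' \<Longrightarrow> transport_cost p \<pi> \<le> \<rho> \<Longrightarrow>
     \<bar>g m' - g \<mu> - (\<integral>z. grad u (fst z) \<bullet> (snd z - fst z) \<partial>\<pi>)\<bar> \<le> e1 * transport_cost p \<pi>"
    using expansion[OF \<mu> e1] by blast
  show ?thesis
  proof (intro exI[of _ "min r1 (min r2 \<rho>)"] conjI allI impI)
    show "min r1 (min r2 \<rho>) > 0" using r1 r2 \<rho> by simp
    fix r assume r: "0 < r \<and> r < min r1 (min r2 \<rho>)"
    \<comment> \<open>The two corrections may add \<open>2 * e1 * r'\<close> to the displacement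
      \<open>r'\<close>; the shrunken step keeps the competitor within radius
      \<open>r\<close>.\<close>
    define r' where "r' = r / (1 + 2 * e1)"
    have r': "0 < r'" "r' \<le> r" "r' * (1 + 2 * e1) = r" using r e1 by (auto simp: r'_def field_simps)
    obtain X1 where X1[measurable]: "X1 \<in> borel_measurable borel" and X1law: "distr \<mu> borel X1 = distr \<mu> borel fst"
      and X1L: "in_Lp p \<mu> (\<lambda>x. X1 x - fst x - r' * fst (T x))" "Lnorm p \<mu> (\<lambda>x. X1 x - fst x - r' * fst (T x)) \<le> e1 * r'"
      and X1ad: "d = AdWass \<Longrightarrow> X1 = fst"
      using r1(2)[of r'] r r' by auto
    obtain X2 where X2[measurable]: "X2 \<in> borel_measurable borel" and X2law: "distr \<mu> borel X2 = distr \<mu> borel snd"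
      and X2L: "in_Lp p \<mu> (\<lambda>x. X2 x - snd x - r' * snd (T x))" "Lnorm p \<mu> (\<lambda>x. X2 x - snd x - r' * snd (T x)) \<le> e1 * r'"
      using r2(2)[of r'] r r' by auto
    define Y where "Y x = (X1 x, X2 x)" for x
    have [measurable]: "Y \<in> borel_measurable borel" unfolding Y_def by measurable
    define E where "E x = Y x - x - r' *\<^sub>R T x" for x
    have [measurable]: "E \<in> borel_measurable borel" unfolding E_def by measurable
    have E_eq: "E x = (X1 x - fst x - r' * fst (T x), X2 x - snd x - r' * snd (T x))" for x
      by (simp add: E_def Y_def prod_eq_iff)
    have EL: "in_Lp p \<mu> E"
    proof (rule in_Lp_bound)
      show "in_Lp p \<mu> (\<lambda>x. norm (X1 x - fst x - r' * fst (T x)) + norm (X2 x - snd x - r' * snd (T x)))"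
        using X1L(1) X2L(1) p by (intro in_Lp_add) (auto simp: in_Lp_def)
      show "AE x in \<mu>. norm (E x) \<le> norm (norm (X1 x - fst x - r' * fst (T x)) + norm (X2 x - snd x - r' * snd (T x)))"
        unfolding E_eq by (intro AE_I2) (simp add: norm_plane_le)
    qed (use p in auto)
    have En: "Lnorm p \<mu> E \<le> 2 * e1 * r'"
    proof -
      have "Lnorm p \<mu> E \<le> Lnorm p \<mu> (\<lambda>x. X1 x - fst x - r' * fst (T x)) + Lnorm p \<mu> (\<lambda>x. X2 x - snd x - r' * snd (T x))"
      proof (rule Lnorm_le_add[OF X1L(1) X2L(1) p])
        show "AE x in \<mu>. norm (E x) \<le> norm (X1 x - fst x - r' * fst (T x)) + norm (X2 x - snd x - r' * snd (T x))"
          unfolding E_eq by (intro AE_I2) (simp add: norm_plane_le)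
      qed measurable
      then show ?thesis using X1L(2) X2L(2) by linarith
    qed
    have rT: "in_Lp p \<mu> (\<lambda>x. r' *\<^sub>R T x)" by (rule in_Lp_scaleR[OF TL])
    have YE: "Y x - x = r' *\<^sub>R T x + E x" for x by (simp add: E_def)
    have DL: "in_Lp p \<mu> (\<lambda>x. Y x - x)" unfolding YE using p by (intro in_Lp_add rT EL) auto
    have Dn: "Lnorm p \<mu> (\<lambda>x. Y x - x) \<le> r"
    proof -
      have "Lnorm p \<mu> (\<lambda>x. Y x - x) \<le> Lnorm p \<mu> (\<lambda>x. r' *\<^sub>R T x) + Lnorm p \<mu> E" unfolding YE by (rule Lnorm_triangle[OF rT EL p])
      also have "Lnorm p \<mu> (\<lambda>x. r' *\<^sub>R T x) = r'" using Lnorm_scaleR[of p \<mu> r' T] T1 p r' by simp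
      also have "r' + Lnorm p \<mu> E \<le> r' * (1 + 2 * e1)" using En by (simp add: algebra_simps)
      finally show ?thesis using r'(3) by simp
    qed
    define m' where "m' = distr \<mu> borel Y"
    define \<pi> where "\<pi> = distr \<mu> borel (\<lambda>x. (x, Y x))"
    have YL: "in_Lp p \<mu> Y" using in_Lp_add[OF DL id_in_Lp[OF \<mu>]] p by simp
    have m'P: "m' \<in> Pp p" unfolding m'_def Pp_def using YL
      by (auto simp: in_Lp_def integrable_distr_eq intro!: P.prob_space_distr)
    have pim[measurable]: "(\<lambda>x. (x, Y x)) \<in> borel_measurable \<mu>" by (rule Pair_plane2) measurable
    have \<pi>P: "prob_space \<pi>" unfolding \<pi>_def by (rule P.prob_space_distr) measurable
    have \<pi>c: "\<pi> \<in> couplings \<mu> m'"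
    proof -
      have "distr \<pi> borel fst = distr \<mu> borel (\<lambda>x. x)" unfolding \<pi>_def by (subst distr_distr) (auto simp: o_def)
      also have "\<dots> = \<mu>" by (rule distr_id2) (simp add: P.sets_eq)
      finally have 1: "distr \<pi> borel fst = \<mu>" .
      have 2: "distr \<pi> borel snd = m'" unfolding \<pi>_def m'_def by (subst distr_distr) (auto simp: o_def)
      show ?thesis using 1 2 \<pi>P by (simp add: couplings_def \<pi>_def)
    qed
    have cost: "transport_cost p \<pi> = Lnorm p \<mu> (\<lambda>x. Y x - x)"
      unfolding \<pi>_def using transport_cost_distr[OF \<mu>, of "\<lambda>x. (x, Y x)"] pim
      by (simp add: Lnorm_def norm_minus_commute P.sets_eq cong: measurable_cong_sets)
    have bi: "bicausal \<pi>" if "d = AdWass"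
    proof (rule bicausal_if_first_fixed[OF \<pi>P])
      show "sets \<pi> = sets borel" by (simp add: \<pi>_def)
      show "AE z in \<pi>. fst (snd z) = fst (fst z)"
        unfolding \<pi>_def by (subst AE_distr_iff) (auto simp: Y_def X1ad[OF that])
    qed
    have ball: "m' \<in> dball d p \<mu> r"
    proof -
      have "distance d p \<mu> m' \<le> transport_cost p \<pi>" by (rule distance_le_cost[OF \<pi>c bi])
      then show ?thesis using m'P cost Dn by (simp add: dball_def)
    qed
    have marg: "m' \<in> couplings (marg1 \<mu>) (marg2 \<mu>)"
    proof -
      have "distr m' borel fst = distr \<mu> borel X1" "distr m' borel snd = distr \<mu> borel X2"
        unfolding m'_def by (subst distr_distr; auto simp: o_def Y_def)+
      then show ?thesis using m'P X1law X2law by (simp add: couplings_def Pp_def P.marg1_eq P.marg2_eq)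
    qed
    have gL: "in_Lp q \<mu> (grad u)" by (rule grad_in_Lq[OF \<mu>])
    have iT: "integrable \<mu> (\<lambda>x. grad u x \<bullet> T x)" by (rule Holder_inner(1)[OF gL TL q1 p conj_exp_props(3)[OF p]])
    note HE = Holder_inner[OF gL EL q1 p conj_exp_props(3)[OF p]]
    have "(\<integral>z. grad u (fst z) \<bullet> (snd z - fst z) \<partial>\<pi>) = (\<integral>x. grad u x \<bullet> (Y x - x) \<partial>\<mu>)"
    proof -
      have "(\<lambda>z. grad u (fst z) \<bullet> (snd z - fst z)) \<in> borel_measurable borel"
        by (intro borel_measurable_inner borel_measurable_diff comp_fst_plane2 u_grad_meas snd_plane2 fst_plane2)
      then show ?thesis unfolding \<pi>_def using pim by (subst integral_distr) auto
    qed
    also have "\<dots> = r' * W + (\<integral>x. grad u x \<bullet> E x \<partial>\<mu>)"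
      unfolding YE W_def using iT HE(1) by (simp add: inner_add_right)
    finally have main: "(\<integral>z. grad u (fst z) \<bullet> (snd z - fst z) \<partial>\<pi>) = r' * W + (\<integral>x. grad u x \<bullet> E x \<partial>\<mu>)" .
    have b1: "(\<integral>x. grad u x \<bullet> E x \<partial>\<mu>) \<ge> - (N * (2 * e1 * r))"
    proof -
      have "\<bar>\<integral>x. grad u x \<bullet> E x \<partial>\<mu>\<bar> \<le> N * Lnorm p \<mu> E" using HE(2) by (simp add: N_def)
      also have "\<dots> \<le> N * (2 * e1 * r)"
        using En r' e1 N by (intro mult_left_mono order_trans[OF En]) auto
      finally show ?thesis by linarith
    qed
    have b2: "r' * W \<ge> r * W - 2 * e1 * r * \<bar>W\<bar>"
    proof -
      have "r - r' = 2 * e1 * r'" using r'(3) by (simp add: algebra_simps)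
      also have "\<dots> \<le> 2 * e1 * r" using r' e1 by simp
      finally have "(r - r') * W \<le> 2 * e1 * r * \<bar>W\<bar>"
        using r' by (intro order_trans[OF mult_left_mono[OF abs_ge_self] mult_right_mono]) auto
      then show ?thesis by (simp add: algebra_simps)
    qed
    have b3: "e1 * transport_cost p \<pi> \<le> e1 * r" using cost Dn e1 by simp
    have "g m' - g \<mu> \<ge> (\<integral>z. grad u (fst z) \<bullet> (snd z - fst z) \<partial>\<pi>) - e1 * transport_cost p \<pi>"
      using \<rho>(2)[OF m'P \<pi>c] cost Dn r by (simp add: abs_le_iff)
    then have "g m' - g \<mu> \<ge> r * W - 2 * e1 * r * \<bar>W\<bar> - N * (2 * e1 * r) - e1 * r"
      unfolding main using b1 b2 b3 by linarith
    moreover have "r * W - 2 * e1 * r * \<bar>W\<bar> - N * (2 * e1 * r) - e1 * r = r * (W - e)"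
      unfolding e1e[symmetric] by (simp add: algebra_simps)
    ultimately have "g \<mu> + r * (W - e) \<le> g m'" by linarith
    then show "ereal (g \<mu> + r * ((\<integral>x. grad u x \<bullet> T x \<partial>\<mu>) - e)) \<le> G_lower d p g \<mu> r"
      unfolding G_lower_def W_def[symmetric] using ball marg by (intro SUP_upper2[of m']) auto
  qed
qed

end

section \<open>Sensitivities\<close>

lemma has_deriv0_I:
  assumes G0: "G 0 = ereal a"
    and up: "\<And>e. e > 0 \<Longrightarrow> \<exists>r0>0. \<forall>r. 0 < r \<and> r < r0 \<longrightarrow> G r \<le> ereal (a + r * (V + e))"
    and lo: "\<And>e. e > 0 \<Longrightarrow> \<exists>r0>0. \<forall>r. 0 < r \<and> r < r0 \<longrightarrow> ereal (a + r * (V - e)) \<le> G r"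
  shows "has_deriv0 G V"
proof -
  have ex: "\<exists>r0>0. \<forall>r. 0 < r \<and> r < r0 \<longrightarrow> \<bar>G r\<bar> \<noteq> \<infinity> \<and> \<bar>(real_of_ereal (G r) - a) / r - V\<bar> \<le> e" if e: "e > 0" for e
  proof -
    obtain r1 where r1: "r1 > 0" "\<And>r. 0 < r \<Longrightarrow> r < r1 \<Longrightarrow> G r \<le> ereal (a + r * (V + e))" using up[OF e] by blast
    obtain r2 where r2: "r2 > 0" "\<And>r. 0 < r \<Longrightarrow> r < r2 \<Longrightarrow> ereal (a + r * (V - e)) \<le> G r" using lo[OF e] by blast
    show ?thesis
    proof (intro exI[of _ "min r1 r2"] conjI allI impI)
      show "min r1 r2 > 0" using r1 r2 by simp
      fix r assume r: "0 < r \<and> r < min r1 r2"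
      have l: "ereal (a + r * (V - e)) \<le> G r" and up': "G r \<le> ereal (a + r * (V + e))" using r1 r2 r by auto
      then obtain x where x: "G r = ereal x" by (cases "G r") auto
      then show "\<bar>G r\<bar> \<noteq> \<infinity>" by simp
      have "r * (V - e) \<le> x - a" "x - a \<le> r * (V + e)" using l up' unfolding x by simp_all
      then have "V - e \<le> (x - a) / r" "(x - a) / r \<le> V + e" using r by (auto simp: field_simps)
      then show "\<bar>(real_of_ereal (G r) - a) / r - V\<bar> \<le> e" unfolding x by (simp add: abs_le_iff)
    qed
  qed
  have fin: "\<forall>\<^sub>F r in at_right 0. \<bar>G r\<bar> \<noteq> \<infinity>"
  proof -
    obtain r0 where "r0 > 0" "\<And>r. 0 < r \<Longrightarrow> r < r0 \<Longrightarrow> \<bar>G r\<bar> \<noteq> \<infinity>" using ex[of 1] by auto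
    then show ?thesis unfolding eventually_at_right_field by blast
  qed
  have "((\<lambda>r. (real_of_ereal (G r) - a) / r) \<longlongrightarrow> V) (at_right 0)"
  proof (rule tendstoI)
    fix e :: real assume e: "e > 0"
    then obtain r0 where "r0 > 0" "\<And>r. 0 < r \<Longrightarrow> r < r0 \<Longrightarrow> \<bar>(real_of_ereal (G r) - a) / r - V\<bar> \<le> e / 2"
      using ex[of "e / 2"] by auto
    moreover have "e / 2 < e" using e by simp
    ultimately show "\<forall>\<^sub>F r in at_right 0. dist ((real_of_ereal (G r) - a) / r) V < e"
      unfolding eventually_at_right_field dist_real_def by (meson le_less_trans)
  qed
  then have "((\<lambda>r. real_of_ereal (G r)) has_real_derivative V) (at 0 within {0..})"
    unfolding has_field_derivative_iff at_within_Ici_at_right by (simp add: G0)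
  then show ?thesis unfolding has_deriv0_def using G0 fin by simp
qed

lemma Cb1_meas: "f \<in> Cb1 \<Longrightarrow> f \<in> borel_measurable borel"
proof -
  assume "f \<in> Cb1"
  then obtain f' where "\<And>x. (f has_real_derivative f' x) (at x)" unfolding Cb1_def by auto
  then have "continuous_on UNIV f" by (meson DERIV_continuous continuous_at_imp_continuous_on)
  then show ?thesis by (rule borel_measurable_continuous_onI)
qed

lemma (in coord) cexp_cong:
  assumes "AE x in \<mu>. f x = h x" "f \<in> borel_measurable borel" "h \<in> borel_measurable borel"
  shows "AE x in \<mu>. cexp \<mu> X f x = cexp \<mu> X h x"
  unfolding cexp_eq using assms by (intro ce.real_cond_exp_cong) (simp_all add: sets_eq cong: measurable_cong_sets)

text \<open>Reconciles the componentwise normalization of the adapted case with the gradient of the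
  Euclidean functional: at an optimum the first component vanishes.\<close>

lemma Nmap_fst_zero: "fst y = 0 \<Longrightarrow> (Nmap p (fst y), Nmap p (snd y)) = Nmap p (y :: plane)"
  by (cases y) (simp add: Nmap_eq norm_Pair)

lemma Nmap_2: "Nmap 2 y = y"
  by (simp add: Nmap_def conj_exp_def)

context sens
begin

lemma solution_iff: "is_solution d p \<mu> u f \<longleftrightarrow> f \<in> Lpair q \<mu> \<and> (\<forall>h\<in>Lpair q \<mu>. L.UU f \<le> L.UU h)"
proof -
  have "L.UU h powr (1 / q) < L.UU f powr (1 / q) \<longleftrightarrow> L.UU h < L.UU f" for f h
    using powr_less_mono2[of "1 / q" "L.UU h" "L.UU f"] powr_mono2[of "1 / q" "L.UU f" "L.UU h"] L.UU_nonneg q1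
    by (cases "L.UU h < L.UU f") (auto simp: not_less)
  then show ?thesis unfolding is_solution_def is_arg_min_def U_eq by (auto simp: not_less)
qed

lemma INF_eq_Lnorm:
  assumes f: "f \<in> Lpair q \<mu>" and min: "\<forall>h\<in>Lpair q \<mu>. L.UU f \<le> L.UU h"
  shows "(INF h\<in>Lpair q \<mu>. U d p \<mu> u h powr (1 / q)) = Lnorm q \<mu> (L.R f)"
proof (rule cInf_eq_minimum)
  show "Lnorm q \<mu> (L.R f) \<in> (\<lambda>h. U d p \<mu> u h powr (1 / q)) ` Lpair q \<mu>"
    using f by (intro image_eqI[of _ _ f]) (simp_all only: U_eq L.UU_root)
  fix x assume "x \<in> (\<lambda>h. U d p \<mu> u h powr (1 / q)) ` Lpair q \<mu>"
  then obtain h where h: "h \<in> Lpair q \<mu>" "x = L.UU h powr (1 / q)" by (auto simp: U_eq)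
  show "Lnorm q \<mu> (L.R f) \<le> x"
    unfolding h(2) L.UU_root[symmetric] using min h L.UU_nonneg q1 by (intro powr_mono2) auto
qed

lemma adapted_fst:
  assumes "d = AdWass"
  shows "fst (L.R f x) = P.c1.ce (partial1 u) (fst x) + fst f (fst x)"
  using P.c1.cexp_factor[of "partial1 u" x] by (simp add: assms pair_vec_def)

text \<open>In the adapted case the first component of the residual is a function of the first coordinate
  alone, so the optimal \<open>f\<close> cancels it.\<close>

lemma first_zero:
  assumes ad: "d = AdWass" and f: "f \<in> Lpair q \<mu>" and min: "\<forall>h\<in>Lpair q \<mu>. L.UU f \<le> L.UU h"
  shows "AE x in \<mu>. fst (L.R f x) = 0"
proof -
  define Y where "Y x = L.R f x" for x
  define \<rho> where "\<rho> t = P.c1.ce (partial1 u) t + fst f t" for t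
  have Y\<rho>: "fst (Y x) = \<rho> (fst x)" for x unfolding Y_def \<rho>_def by (rule adapted_fst[OF ad])
  have [measurable]: "fst f \<in> borel_measurable borel" using f by (simp add: P.Lpair_iff)
  have \<rho>m[measurable]: "\<rho> \<in> borel_measurable borel" unfolding \<rho>_def by measurable
  have YL: "in_Lp q \<mu> Y" unfolding Y_def by (rule L.R_in_Lp[OF f])
  have \<rho>L: "in_Lp q \<mu> (\<lambda>x. \<rho> (fst x))"
  proof (rule in_Lp_bound[OF YL])
    show "AE x in \<mu>. norm (\<rho> (fst x)) \<le> norm (Y x)"
      unfolding Y\<rho>[symmetric] by (intro AE_I2) (simp only: real_norm_def abs_fst_le_norm)
    show "(\<lambda>x. \<rho> (fst x)) \<in> borel_measurable \<mu>"
      using measurable_compose[OF borel_measurable_fst_plane \<rho>m] by (simp add: P.sets_eq cong: measurable_cong_sets)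
  qed (use q1 in simp)
  \<comment> \<open>The first component of the residual is itself admissible as a variation, and the
    first variation becomes the integral of a nonnegative function.\<close>
  define h :: fpair where "h = (\<rho>, \<lambda>_. 0)"
  have h: "h \<in> Lpair q \<mu>" using \<rho>L L.zero_Lpair by (simp add: h_def P.Lpair_iff)
  define w where "w x = norm (Y x) powr (q - 2) * (fst (Y x))\<^sup>2" for x
  have w: "Nmap p (L.R f x) \<bullet> pair_vec h x = w x" for x
  proof -
    have "pair_vec h x = (fst (Y x), 0)" unfolding Y\<rho> by (simp add: pair_vec_def h_def)
    then show ?thesis unfolding Y_def[symmetric] w_def by (simp add: Nmap_eq inner_prod_def power2_eq_square)
  qed
  have "(\<integral>x. Nmap p (L.R f x) \<bullet> pair_vec h x \<partial>\<mu>) = 0" using L.minimizer_iff_variation[OF f] min h by blast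
  then have "(\<integral>x. w x \<partial>\<mu>) = 0" unfolding w .
  moreover have "integrable \<mu> w" using L.Nmap_inner_integrable[OF f h] unfolding w by simp
  moreover have "AE x in \<mu>. 0 \<le> w x" by (intro AE_I2) (simp add: w_def)
  ultimately have "AE x in \<mu>. w x = 0" using integral_nonneg_eq_0_iff_AE by blast
  then have "AE x in \<mu>. fst (Y x) = 0"
  proof eventually_elim
    case (elim x)
    then have "Y x = 0 \<or> fst (Y x) = 0" by (simp add: w_def)
    then show ?case by auto
  qed
  then show ?thesis unfolding Y_def .
qed

text \<open>Equality in Hoelder: \<open>N\<close> is orthogonal to all admissible pairs, in
  particular to \<open>f\<close>, so pairing it with the gradient is the same as pairing it with the
  residual, which gives \<open>V powr q\<close>. Nonvanishing of the residual permits the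
  normalization of \<open>N\<close>.\<close>

lemma G_lower_ge_opt:
  assumes B: "cond_B d \<mu>" and f: "f \<in> Lpair q \<mu>" and min: "\<forall>h\<in>Lpair q \<mu>. L.UU f \<le> L.UU h"
    and nz: "\<not> (AE x in \<mu>. L.R f x = 0)" and e: "e > 0"
  shows "\<exists>r0>0. \<forall>r. 0 < r \<and> r < r0 \<longrightarrow> ereal (g \<mu> + r * (Lnorm q \<mu> (L.R f) - e)) \<le> G_lower d p g \<mu> r"
proof -
  define Y where "Y x = L.R f x" for x
  have YL: "in_Lp q \<mu> Y" and Ym[measurable]: "Y \<in> borel_measurable borel"
    unfolding Y_def by (rule L.R_in_Lp[OF f], rule L.R_meas[OF f])
  define V where "V = Lnorm q \<mu> Y"
  have V: "V > 0" using Lnorm_eq_0_iff[OF YL] nz q1 Lnorm_nonneg[of q \<mu> Y] unfolding V_def Y_def[symmetric] by linarith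
  \<comment> \<open>This is the \<open>L\<^sup>p\<close> norm of \<open>N\<close>, so that
    \<open>T\<close> has norm 1.\<close>
  define c where "c = V powr (q - 1)"
  have c: "c > 0" using V by (simp add: c_def)
  define N where "N x = Nmap p (Y x)" for x
  have NL: "in_Lp p \<mu> N" "Lnorm p \<mu> N = c" unfolding N_def[abs_def] c_def V_def using L.Nmap_R_in_Lp[OF YL] by auto
  note [measurable] = Nmap_measurable[OF p]
  have Nm[measurable]: "N \<in> borel_measurable borel" unfolding N_def[abs_def] by measurable
  have N1: "in_Lp p \<mu> (\<lambda>x. fst (N x))" by (rule in_Lp_plane_fst[OF NL(1)]) (use p in simp)
  have N2: "in_Lp p \<mu> (\<lambda>x. snd (N x))" by (rule in_Lp_plane_snd[OF NL(1)]) (use p in simp)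
  have i1: "integrable \<mu> (\<lambda>x. fst (N x))" and i2: "integrable \<mu> (\<lambda>x. snd (N x))"
    using in_Lp_imp_integrable[OF P.finite_measure_axioms N1] in_Lp_imp_integrable[OF P.finite_measure_axioms N2] p by auto
  have zN: "AE x in \<mu>. cexp \<mu> fst (\<lambda>x. fst (N x)) x = 0" "AE x in \<mu>. cexp \<mu> snd (\<lambda>x. snd (N x)) x = 0"
    using L.minimizer_iff_cexp[OF f] min unfolding N_def Y_def by blast+
  define T where "T x = (1 / c) *\<^sub>R N x" for x
  have Tm[measurable]: "T \<in> borel_measurable borel" unfolding T_def by measurable
  have TL: "in_Lp p \<mu> T" unfolding T_def by (rule in_Lp_scaleR[OF NL(1)])
  have T1: "Lnorm p \<mu> T = 1" unfolding T_def using Lnorm_scaleR[of p \<mu> "1 / c" N] NL(2) c p by simp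
  have z1: "AE x in \<mu>. cexp \<mu> fst (\<lambda>x. fst (T x)) x = 0"
    using P.c1.cexp_cmult[OF i1, of "1 / c"] zN(1) by eventually_elim (simp add: T_def)
  have z2: "AE x in \<mu>. cexp \<mu> snd (\<lambda>x. snd (T x)) x = 0"
    using P.c2.cexp_cmult[OF i2, of "1 / c"] zN(2) by eventually_elim (simp add: T_def)
  have ad: "AE x in \<mu>. fst (T x) = 0" if "d = AdWass"
    using first_zero[OF that f min] unfolding Y_def[symmetric] by eventually_elim (simp add: T_def N_def Nmap_eq)
  have "(\<integral>x. grad u x \<bullet> T x \<partial>\<mu>) = (\<integral>x. dgrad d \<mu> u x \<bullet> T x \<partial>\<mu>)"
  proof (cases d)
    case Wass then show ?thesis by simp
  next
    case AdWass
    show ?thesis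
    proof (rule integral_cong_AE)
      show "AE x in \<mu>. grad u x \<bullet> T x = dgrad d \<mu> u x \<bullet> T x"
        using ad[OF AdWass] by eventually_elim (simp add: AdWass grad_def inner_prod_def)
    qed (simp_all add: P.sets_eq cong: measurable_cong_sets)
  qed
  also have "\<dots> = V"
  proof -
    have iG: "integrable \<mu> (\<lambda>x. dgrad d \<mu> u x \<bullet> N x)"
      by (rule Holder_inner(1)[OF dgrad_Lq NL(1) q1 p conj_exp_props(3)[OF p]])
    have iv: "integrable \<mu> (\<lambda>x. N x \<bullet> pair_vec f x)" "(\<integral>x. N x \<bullet> pair_vec f x \<partial>\<mu>) = 0"
      using L.Nmap_inner_integrable[OF f f] L.minimizer_iff_variation[OF f] min f unfolding N_def Y_def by blast+
    have "V powr q = (\<integral>x. norm (Y x) powr q \<partial>\<mu>)" unfolding V_def using q1 by (intro Lnorm_powr) auto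
    also have "\<dots> = (\<integral>x. dgrad d \<mu> u x \<bullet> N x + N x \<bullet> pair_vec f x \<partial>\<mu>)"
    proof (rule Bochner_Integration.integral_cong[OF refl])
      fix x
      have "norm (Y x) powr q = N x \<bullet> Y x" unfolding N_def by (simp only: Nmap_inner_self)
      also have "\<dots> = dgrad d \<mu> u x \<bullet> N x + N x \<bullet> pair_vec f x"
        unfolding Y_def by (simp only: inner_add_right inner_commute[of "N x" "dgrad d \<mu> u x"])
      finally show "norm (Y x) powr q = dgrad d \<mu> u x \<bullet> N x + N x \<bullet> pair_vec f x" .
    qed
    also have "\<dots> = (\<integral>x. dgrad d \<mu> u x \<bullet> N x \<partial>\<mu>)" using iG iv by simp
    finally have "(\<integral>x. dgrad d \<mu> u x \<bullet> T x \<partial>\<mu>) = V powr q / c" by (simp add: T_def)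
    also have "\<dots> = V" using V unfolding c_def by (simp add: powr_diff)
    finally show ?thesis .
  qed
  finally have "(\<integral>x. grad u x \<bullet> T x \<partial>\<mu>) = Lnorm q \<mu> (L.R f)" unfolding V_def Y_def .
  then show ?thesis using G_lower_ge[OF B Tm TL T1 z1 z2 ad e] by simp
qed

text \<open>Weak duality: if the marginals of a competitor are those of \<open>\<mu>\<close>, the
  test functions integrate to the same value under both.\<close>

lemma G_lower_le_upper: "G_lower d p g \<mu> r \<le> G_upper d p g \<mu> r"
  unfolding G_lower_def G_upper_def
proof (intro SUP_least INF_greatest)
  fix m' f assume m': "m' \<in> dball d p \<mu> r \<inter> couplings (marg1 \<mu>) (marg2 \<mu>)" and f: "f \<in> Cb1 \<times> Cb1"
  have m'P: "m' \<in> Pp p" using m' by (simp add: dball_def)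
  interpret M: plane_prob m' by (rule plane_prob_Pp[OF m'P])
  have fC: "fst f \<in> Cb1" "snd f \<in> Cb1" using f by auto
  note [measurable] = Cb1_meas[OF fC(1)] Cb1_meas[OF fC(2)]
  obtain K1 where K1: "\<And>x. \<bar>fst f x\<bar> \<le> K1" using fC(1) unfolding Cb1_def bounded_iff by auto
  obtain K2 where K2: "\<And>x. \<bar>snd f x\<bar> \<le> K2" using fC(2) unfolding Cb1_def bounded_iff by auto
  have split: "(\<integral>x. fst f (fst x) + snd f (snd x) \<partial>m) = (\<integral>t. fst f t \<partial>marg1 m) + (\<integral>t. snd f t \<partial>marg2 m)" if m: "plane_prob m" for m
  proof -
    interpret m: plane_prob m by fact
    have "integrable m (\<lambda>x. fst f (fst x))" "integrable m (\<lambda>x. snd f (snd x))"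
      by (rule m.integrable_const_bound[where B=K1] m.integrable_const_bound[where B=K2]; use K1 K2 in auto)+
    then have "(\<integral>x. fst f (fst x) + snd f (snd x) \<partial>m) = (\<integral>x. fst f (fst x) \<partial>m) + (\<integral>x. snd f (snd x) \<partial>m)" by simp
    moreover have "(\<integral>x. fst f (fst x) \<partial>m) = (\<integral>t. fst f t \<partial>marg1 m)" unfolding marg1_def by (subst integral_distr) auto
    moreover have "(\<integral>x. snd f (snd x) \<partial>m) = (\<integral>t. snd f t \<partial>marg2 m)" unfolding marg2_def by (subst integral_distr) auto
    ultimately show ?thesis by simp
  qed
  have "marg1 m' = marg1 \<mu>" "marg2 m' = marg2 \<mu>" using m' by (auto simp: couplings_def marg1_def marg2_def)
  then have "(\<integral>x. fst f (fst x) + snd f (snd x) \<partial>m') = (\<integral>x. fst f (fst x) + snd f (snd x) \<partial>\<mu>)"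
    using split[OF M.plane_prob_axioms] split[OF P.plane_prob_axioms] by simp
  then show "ereal (g m') \<le> (SUP \<mu>'\<in>dball d p \<mu> r.
     ereal (g \<mu>' + ((\<integral>x. fst f (fst x) + snd f (snd x) \<partial>\<mu>') - (\<integral>x. fst f (fst x) + snd f (snd x) \<partial>\<mu>))))"
    using m' by (intro SUP_upper2[of m']) auto
qed

lemma G_upper_mono: "r \<le> r' \<Longrightarrow> G_upper d p g \<mu> r \<le> G_upper d p g \<mu> r'"
  unfolding G_upper_def by (intro INF_mono' SUP_subset_mono) (auto simp: dball_def)

lemma center_in_ball: "\<mu> \<in> dball d p \<mu> 0"
proof -
  let ?\<pi> = "distr \<mu> borel (\<lambda>x. (x, x))"
  have dm: "(\<lambda>x :: plane. (x, x)) \<in> borel_measurable borel"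
    by (intro borel_measurable_continuous_onI continuous_intros)
  then have dm': "(\<lambda>x. (x, x)) \<in> measurable \<mu> borel" by (simp add: P.sets_eq cong: measurable_cong_sets)
  have "bicausal ?\<pi>"
  proof (rule bicausal_if_first_fixed)
    show "prob_space ?\<pi>" by (rule P.prob_space_distr[OF dm'])
    show "AE z in ?\<pi>. fst (snd z) = fst (fst z)"
    proof (subst AE_distr_iff[OF dm'])
      have "{x \<in> space borel. fst (snd x) = fst (fst (x :: plane \<times> plane))} = {x. fst (snd x) = fst (fst x)}" by simp
      moreover have "closed {x. fst (snd x) = fst (fst (x :: plane \<times> plane))}"
        by (intro closed_Collect_eq continuous_intros)
      ultimately show "{x \<in> space borel. fst (snd x) = fst (fst (x :: plane \<times> plane))} \<in> sets borel" by simp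
    qed simp
  qed simp
  then have "distance d p \<mu> \<mu> \<le> transport_cost p ?\<pi>" by (intro distance_le_cost diag_coupling[OF \<mu>])
  also have "\<dots> = 0" using transport_cost_distr[OF \<mu> dm] p by simp
  finally show ?thesis using \<mu> by (simp add: dball_def)
qed

text \<open>The upper value at radius 0 is obtained from the bounds at small positive radii by
  monotonicity, which bypasses the question of which measures are at distance 0. Weak duality
  transfers this to the lower value.\<close>

lemma G_at_0: "G_lower d p g \<mu> 0 = ereal (g \<mu>)" "G_upper d p g \<mu> 0 = ereal (g \<mu>)"
proof -
  have self: "\<mu> \<in> couplings (marg1 \<mu>) (marg2 \<mu>)"
    using \<mu> by (simp add: couplings_def marg1_def marg2_def Pp_def)
  have 1: "ereal (g \<mu>) \<le> G_lower d p g \<mu> 0"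
    unfolding G_lower_def using center_in_ball self by (intro SUP_upper2[of \<mu>]) auto
  define V where "V = Lnorm q \<mu> (L.R ((\<lambda>_. 0), (\<lambda>_. 0)))"
  have V: "V \<ge> 0" by (simp add: V_def)
  obtain r0 where r0: "r0 > 0" "\<And>r. 0 < r \<Longrightarrow> r < r0 \<Longrightarrow> G_upper d p g \<mu> r \<le> ereal (g \<mu> + r * (V + 1))"
    using G_upper_le[OF L.zero_Lpair, of 1] unfolding V_def by auto
  have 2: "G_upper d p g \<mu> 0 \<le> ereal (g \<mu>)"
  proof (rule ereal_le_epsilon2)
    fix e :: real assume e: "0 < e"
    define r where "r = min (r0 / 2) (e / (V + 1))"
    have r: "0 < r" "r < r0" "r \<le> e / (V + 1)" using r0(1) e V by (auto simp: r_def)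
    have "r * (V + 1) \<le> e" using r(3) V by (simp add: pos_le_divide_eq)
    have "G_upper d p g \<mu> 0 \<le> G_upper d p g \<mu> r" using r by (intro G_upper_mono) simp
    also have "\<dots> \<le> ereal (g \<mu> + r * (V + 1))" by (rule r0(2)[OF r(1,2)])
    also have "\<dots> \<le> ereal (g \<mu>) + ereal e" using \<open>r * (V + 1) \<le> e\<close> by simp
    finally show "G_upper d p g \<mu> 0 \<le> ereal (g \<mu>) + ereal e" .
  qed
  show "G_lower d p g \<mu> 0 = ereal (g \<mu>)" "G_upper d p g \<mu> 0 = ereal (g \<mu>)"
    using 1 2 G_lower_le_upper[of 0] by (auto intro: antisym order_trans)
qed

lemma sensitivities:
  assumes B: "cond_B d \<mu>" and f: "f \<in> Lpair q \<mu>" and min: "\<forall>h\<in>Lpair q \<mu>. L.UU f \<le> L.UU h"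
    and nz: "\<not> (AE x in \<mu>. L.R f x = 0)"
  shows "has_deriv0 (G_upper d p g \<mu>) (Lnorm q \<mu> (L.R f))" "has_deriv0 (G_lower d p g \<mu>) (Lnorm q \<mu> (L.R f))"
proof -
  show "has_deriv0 (G_upper d p g \<mu>) (Lnorm q \<mu> (L.R f))"
  proof (rule has_deriv0_I[OF G_at_0(2) G_upper_le[OF f]])
    fix e :: real assume "e > 0"
    from G_lower_ge_opt[OF B f min nz this]
    show "\<exists>r0>0. \<forall>r. 0 < r \<and> r < r0 \<longrightarrow> ereal (g \<mu> + r * (Lnorm q \<mu> (L.R f) - e)) \<le> G_upper d p g \<mu> r"
      using order_trans[OF _ G_lower_le_upper] by blast
  qed
  show "has_deriv0 (G_lower d p g \<mu>) (Lnorm q \<mu> (L.R f))"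
  proof (rule has_deriv0_I[OF G_at_0(1) _ G_lower_ge_opt[OF B f min nz]])
    fix e :: real assume "e > 0"
    from G_upper_le[OF f this]
    show "\<exists>r0>0. \<forall>r. 0 < r \<and> r < r0 \<longrightarrow> G_lower d p g \<mu> r \<le> ereal (g \<mu> + r * (Lnorm q \<mu> (L.R f) + e))"
      using order_trans[OF G_lower_le_upper] by blast
  qed
qed

section \<open>The first-order condition\<close>

lemma Nd_in_Lp:
  assumes f: "f \<in> Lpair q \<mu>"
  shows "in_Lp p \<mu> (\<lambda>x. Nd d p (L.R f x))" "(\<lambda>x. Nd d p (L.R f x)) \<in> borel_measurable borel"
proof -
  define Y where "Y x = L.R f x" for x
  have YL: "in_Lp q \<mu> Y" and Ym[measurable]: "Y \<in> borel_measurable borel"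
    unfolding Y_def by (rule L.R_in_Lp[OF f], rule L.R_meas[OF f])
  note [measurable] = Nmap_measurable[OF p]
  have "in_Lp p \<mu> (\<lambda>x. Nd d p (Y x)) \<and> (\<lambda>x. Nd d p (Y x)) \<in> borel_measurable borel"
  proof (cases d)
    case Wass
    then show ?thesis using L.Nmap_R_in_Lp(1)[OF YL] by simp
  next
    case AdWass
    have Y1: "in_Lp q \<mu> (\<lambda>x. fst (Y x))" by (rule in_Lp_plane_fst[OF YL]) (use q1 in simp)
    have Y2: "in_Lp q \<mu> (\<lambda>x. snd (Y x))" by (rule in_Lp_plane_snd[OF YL]) (use q1 in simp)
    have m: "(\<lambda>x. (Nmap p (fst (Y x)), Nmap p (snd (Y x)))) \<in> borel_measurable borel" by measurable
    have "in_Lp p \<mu> (\<lambda>x. (Nmap p (fst (Y x)), Nmap p (snd (Y x))))"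
    proof (rule in_Lp_bound)
      show "in_Lp p \<mu> (\<lambda>x. norm (Nmap p (fst (Y x))) + norm (Nmap p (snd (Y x))))"
        using L.Nmap_R_in_Lp(1)[OF Y1] L.Nmap_R_in_Lp(1)[OF Y2] p by (intro in_Lp_add) (auto simp: in_Lp_def)
      show "AE x in \<mu>. norm (Nmap p (fst (Y x)), Nmap p (snd (Y x))) \<le> norm (norm (Nmap p (fst (Y x))) + norm (Nmap p (snd (Y x))))"
        by (intro AE_I2) (simp add: norm_plane_le)
    qed (use m p in \<open>simp_all add: P.sets_eq cong: measurable_cong_sets\<close>)
    then show ?thesis using m AdWass by simp
  qed
  then show "in_Lp p \<mu> (\<lambda>x. Nd d p (L.R f x))" "(\<lambda>x. Nd d p (L.R f x)) \<in> borel_measurable borel"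
    unfolding Y_def by auto
qed

lemma Nd_eq_Nmap:
  assumes "d = AdWass \<Longrightarrow> AE x in \<mu>. fst (L.R f x) = 0"
  shows "AE x in \<mu>. Nd d p (L.R f x) = Nmap p (L.R f x)"
proof (cases d)
  case Wass then show ?thesis by simp
next
  case AdWass
  define Y where "Y x = L.R f x" for x
  have "AE x in \<mu>. Nd d p (Y x) = Nmap p (Y x)"
    using assms[OF AdWass] unfolding Y_def[symmetric]
  proof eventually_elim
    case (elim x)
    then show ?case using Nmap_fst_zero[of "Y x" p] by (simp only: AdWass Nd.simps)
  qed
  then show ?thesis unfolding Y_def .
qed

lemma Nd_components:
  assumes f: "f \<in> Lpair q \<mu>"
  shows "integrable \<mu> (\<lambda>x. fst (Nd d p (L.R f x)))" "(\<lambda>x. fst (Nd d p (L.R f x))) \<in> borel_measurable borel"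
    "integrable \<mu> (\<lambda>x. snd (Nd d p (L.R f x)))" "(\<lambda>x. snd (Nd d p (L.R f x))) \<in> borel_measurable borel"
proof -
  define M where "M x = Nd d p (L.R f x)" for x
  have MLp: "in_Lp p \<mu> M" and Mm: "M \<in> borel_measurable borel" using Nd_in_Lp[OF f] unfolding M_def by auto
  have iM: "integrable \<mu> M" using in_Lp_imp_integrable[OF P.finite_measure_axioms MLp] p by simp
  show "integrable \<mu> (\<lambda>x. fst (Nd d p (L.R f x)))" "integrable \<mu> (\<lambda>x. snd (Nd d p (L.R f x)))"
    using integrable_fst[OF iM] integrable_snd[OF iM] unfolding M_def by auto
  show "(\<lambda>x. fst (Nd d p (L.R f x))) \<in> borel_measurable borel" "(\<lambda>x. snd (Nd d p (L.R f x))) \<in> borel_measurable borel"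
    using measurable_compose[OF Mm borel_measurable_fst_plane] measurable_compose[OF Mm borel_measurable_snd_plane] unfolding M_def by auto
qed

text \<open>In the adapted case \<open>Nd\<close> is not the gradient of the functional, but the two
  agree where the first residual component vanishes. Each side of the equivalence forces this:
  minimality by \<open>first_zero\<close>, and the first-order condition as explained below.\<close>

lemma minimizer_iff_Nd:
  assumes f: "f \<in> Lpair q \<mu>"
  shows "(\<forall>h\<in>Lpair q \<mu>. L.UU f \<le> L.UU h) \<longleftrightarrow>
    (AE x in \<mu>. cexp \<mu> fst (\<lambda>y. fst (Nd d p (L.R f y))) x = 0) \<and>
    (AE x in \<mu>. cexp \<mu> snd (\<lambda>y. snd (Nd d p (L.R f y))) x = 0)"
proof -
  define Y where "Y x = L.R f x" for x
  have Ym[measurable]: "Y \<in> borel_measurable borel" unfolding Y_def by (rule L.R_meas[OF f])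
  note [measurable] = Nmap_measurable[OF p]
  note comp = Nd_components[OF f, folded Y_def]
  have "(\<lambda>x. Nmap p (Y x)) \<in> borel_measurable borel" by measurable
  note Nm = measurable_compose[OF this borel_measurable_fst_plane] measurable_compose[OF this borel_measurable_snd_plane]
  have eq: ?thesis if "d = AdWass \<Longrightarrow> AE x in \<mu>. fst (Y x) = 0"
  proof -
    have ae: "AE x in \<mu>. Nd d p (Y x) = Nmap p (Y x)" using Nd_eq_Nmap that unfolding Y_def by blast
    have ae': "AE x in \<mu>. fst (Nd d p (Y x)) = fst (Nmap p (Y x))" "AE x in \<mu>. snd (Nd d p (Y x)) = snd (Nmap p (Y x))"
      using ae by (eventually_elim, simp)+
    have e1: "AE x in \<mu>. (cexp \<mu> fst (\<lambda>y. fst (Nd d p (Y y))) x = 0) = (cexp \<mu> fst (\<lambda>y. fst (Nmap p (Y y))) x = 0)"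
      using P.c1.cexp_cong[OF ae'(1) comp(2) Nm(1)] by eventually_elim simp
    have e2: "AE x in \<mu>. (cexp \<mu> snd (\<lambda>y. snd (Nd d p (Y y))) x = 0) = (cexp \<mu> snd (\<lambda>y. snd (Nmap p (Y y))) x = 0)"
      using P.c2.cexp_cong[OF ae'(2) comp(4) Nm(2)] by eventually_elim simp
    show ?thesis
      unfolding Y_def[symmetric] L.minimizer_iff_cexp[OF f, folded Y_def]
      by (rule sym, rule arg_cong2[where f="(\<and>)", OF eventually_cong[OF e1] eventually_cong[OF e2]])
  qed
  show ?thesis
  proof (cases d)
    case Wass then show ?thesis by (intro eq) simp
  next
    case AdWass
    \<comment> \<open>The first component depends on the first coordinate only, so conditioning
      leaves its normalization unchanged, and normalization vanishes only at 0.\<close>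
    have "AE x in \<mu>. fst (Y x) = 0" if z: "AE x in \<mu>. cexp \<mu> fst (\<lambda>y. fst (Nd d p (Y y))) x = 0"
    proof -
      define \<rho> where "\<rho> t = P.c1.ce (partial1 u) t + fst f t" for t
      have Y\<rho>: "fst (Y x) = \<rho> (fst x)" for x unfolding Y_def \<rho>_def by (rule adapted_fst[OF AdWass])
      have [measurable]: "fst f \<in> borel_measurable borel" using f by (simp add: P.Lpair_iff)
      have \<rho>m[measurable]: "\<rho> \<in> borel_measurable borel" unfolding \<rho>_def by measurable
      have M1: "fst (Nd d p (Y x)) = Nmap p (\<rho> (fst x))" for x unfolding AdWass Nd.simps fst_conv Y\<rho> ..
      have "AE x in \<mu>. cexp \<mu> fst (\<lambda>y. Nmap p (\<rho> (fst y))) x = Nmap p (\<rho> (fst x))"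
        by (rule P.c1.cexp_of_X) (use comp(1) in \<open>simp_all add: M1\<close>)
      then show ?thesis using z unfolding M1 Y\<rho> by eventually_elim simp
    qed
    then show ?thesis using eq first_zero[OF AdWass f] unfolding Y_def by blast
  qed
qed

lemma Tmap_eq: "Tmap d p \<mu> u c f = (\<lambda>x. (1 / c) *\<^sub>R Nd d p (L.R f x))"
  by (simp add: fun_eq_iff Tmap_def resid_def del: split_paired_All)

lemma Lnorm_Tmap: "c > 0 \<Longrightarrow> Lnorm p \<mu> (Tmap d p \<mu> u c f) = Lnorm p \<mu> (\<lambda>x. Nd d p (L.R f x)) / c"
  unfolding Tmap_eq using Lnorm_scaleR[of p \<mu> "1 / c" "\<lambda>x. Nd d p (L.R f x)"] p by simp

lemma Lnorm_Nd_pos: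
  assumes f: "f \<in> Lpair q \<mu>" and min: "\<forall>h\<in>Lpair q \<mu>. L.UU f \<le> L.UU h" and nz: "\<not> (AE x in \<mu>. L.R f x = 0)"
  shows "Lnorm p \<mu> (\<lambda>x. Nd d p (L.R f x)) > 0"
proof -
  define Y where "Y x = L.R f x" for x
  have "AE x in \<mu>. Nd d p (Y x) = Nmap p (Y x)" using Nd_eq_Nmap first_zero[OF _ f min] unfolding Y_def by blast
  then have "AE x in \<mu>. Y x = 0" if "AE x in \<mu>. Nd d p (Y x) = 0"
    using that by eventually_elim simp
  then have "Lnorm p \<mu> (\<lambda>x. Nd d p (Y x)) \<noteq> 0"
    using Lnorm_eq_0_iff[OF Nd_in_Lp(1)[OF f, folded Y_def]] nz[folded Y_def] p by auto
  then show ?thesis using Lnorm_nonneg[of p \<mu> "\<lambda>x. Nd d p (Y x)"] unfolding Y_def by linarith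
qed

lemma cexp_Tmap:
  assumes f: "f \<in> Lpair q \<mu>" and c: "c > 0"
  shows "(AE x in \<mu>. cexp \<mu> fst (\<lambda>y. fst (Tmap d p \<mu> u c f y)) x = 0) \<longleftrightarrow> (AE x in \<mu>. cexp \<mu> fst (\<lambda>y. fst (Nd d p (L.R f y))) x = 0)"
    "(AE x in \<mu>. cexp \<mu> snd (\<lambda>y. snd (Tmap d p \<mu> u c f y)) x = 0) \<longleftrightarrow> (AE x in \<mu>. cexp \<mu> snd (\<lambda>y. snd (Nd d p (L.R f y))) x = 0)"
proof -
  define M where "M x = Nd d p (L.R f x)" for x
  note comp = Nd_components[OF f, folded M_def]
  have T: "Tmap d p \<mu> u c f = (\<lambda>x. (1 / c) *\<^sub>R M x)" unfolding M_def by (rule Tmap_eq)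
  have "AE x in \<mu>. cexp \<mu> fst (\<lambda>y. fst (Tmap d p \<mu> u c f y)) x = 1 / c * cexp \<mu> fst (\<lambda>y. fst (M y)) x"
    using P.c1.cexp_cmult[OF comp(1), of "1 / c"] by (simp add: T)
  then have 1: "AE x in \<mu>. cexp \<mu> fst (\<lambda>y. fst (Tmap d p \<mu> u c f y)) x = 0 \<longleftrightarrow> cexp \<mu> fst (\<lambda>y. fst (M y)) x = 0"
    by eventually_elim (use c in simp)
  have "AE x in \<mu>. cexp \<mu> snd (\<lambda>y. snd (Tmap d p \<mu> u c f y)) x = 1 / c * cexp \<mu> snd (\<lambda>y. snd (M y)) x"
    using P.c2.cexp_cmult[OF comp(3), of "1 / c"] by (simp add: T)
  then have 2: "AE x in \<mu>. cexp \<mu> snd (\<lambda>y. snd (Tmap d p \<mu> u c f y)) x = 0 \<longleftrightarrow> cexp \<mu> snd (\<lambda>y. snd (M y)) x = 0"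
    by eventually_elim (use c in simp)
  show "(AE x in \<mu>. cexp \<mu> fst (\<lambda>y. fst (Tmap d p \<mu> u c f y)) x = 0) \<longleftrightarrow> (AE x in \<mu>. cexp \<mu> fst (\<lambda>y. fst (Nd d p (L.R f y))) x = 0)"
    using eventually_cong[OF 1] unfolding M_def .
  show "(AE x in \<mu>. cexp \<mu> snd (\<lambda>y. snd (Tmap d p \<mu> u c f y)) x = 0) \<longleftrightarrow> (AE x in \<mu>. cexp \<mu> snd (\<lambda>y. snd (Nd d p (L.R f y))) x = 0)"
    using eventually_cong[OF 2] unfolding M_def .
qed

text \<open>The constant must be the norm of the normalized residual, which is positive for a
  solution by the standing assumption. Rescaling does not affect the vanishing of conditional
  means.\<close>

lemma solution_iff_first_order:
  assumes nz: "\<And>f. is_solution d p \<mu> u f \<Longrightarrow> \<not> (AE x in \<mu>. L.R f x = 0)" and f: "f \<in> Lpair q \<mu>"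
  shows "is_solution d p \<mu> u f \<longleftrightarrow> (\<exists>c>0. Lnorm p \<mu> (Tmap d p \<mu> u c f) = 1
     \<and> (AE x in \<mu>. cexp \<mu> fst (\<lambda>y. fst (Tmap d p \<mu> u c f y)) x = 0)
     \<and> (AE x in \<mu>. cexp \<mu> snd (\<lambda>y. snd (Tmap d p \<mu> u c f y)) x = 0))" (is "?S \<longleftrightarrow> (\<exists>c>0. ?T c)")
proof
  assume S: ?S
  then have min: "\<forall>h\<in>Lpair q \<mu>. L.UU f \<le> L.UU h" by (simp add: solution_iff)
  have c: "Lnorm p \<mu> (\<lambda>x. Nd d p (L.R f x)) > 0" by (rule Lnorm_Nd_pos[OF f min nz[OF S]])
  have "?T (Lnorm p \<mu> (\<lambda>x. Nd d p (L.R f x)))"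
    using minimizer_iff_Nd[OF f] min cexp_Tmap[OF f c] Lnorm_Tmap[OF c] c by simp
  then show "\<exists>c>0. ?T c" using c by blast
next
  assume "\<exists>c>0. ?T c"
  then obtain c where c: "c > 0" "?T c" by blast
  then show ?S using minimizer_iff_Nd[OF f] cexp_Tmap[OF f c(1)] f by (simp add: solution_iff)
qed

lemma unique_normalization:
  assumes S: "is_solution d p \<mu> u f" and nz: "\<not> (AE x in \<mu>. L.R f x = 0)"
  shows "\<exists>!c. c > 0 \<and> Lnorm p \<mu> (Tmap d p \<mu> u c f) = 1"
proof -
  have f: "f \<in> Lpair q \<mu>" and min: "\<forall>h\<in>Lpair q \<mu>. L.UU f \<le> L.UU h" using S by (auto simp: solution_iff)
  note c = Lnorm_Nd_pos[OF f min nz]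
  show ?thesis
  proof (rule ex1I[of _ "Lnorm p \<mu> (\<lambda>x. Nd d p (L.R f x))"])
    fix c' assume c': "c' > 0 \<and> Lnorm p \<mu> (Tmap d p \<mu> u c' f) = 1"
    then show "c' = Lnorm p \<mu> (\<lambda>x. Nd d p (L.R f x))" using Lnorm_Tmap[of c' f] by simp
  qed (use c Lnorm_Tmap[OF c] in simp)
qed

section \<open>The quadratic case\<close>

text \<open>In the adapted case this is idempotence of conditioning; it allows one formula for the
  optimal pair under both distances.\<close>

lemma dgrad_cexp: "AE x in \<mu>. cexp \<mu> fst (\<lambda>y. fst (dgrad d \<mu> u y)) x = cexp \<mu> fst (partial1 u) x"
proof (cases d)
  case Wass
  then show ?thesis by (simp add: grad_def cong: if_cong)
next
  case AdWass
  have ci: "integrable \<mu> (cexp \<mu> fst (partial1 u))" by (rule P.c1.cexp_integrable[OF partial_int(1)])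
  show ?thesis
    using P.c1.cexp_of_X[of "P.c1.ce (partial1 u)"] ci AdWass unfolding P.c1.cexp_factor[of "partial1 u", abs_def] by (simp add: P.c1.cexp_factor[of "partial1 u", abs_def])
qed

text \<open>For \<open>p = 2\<close> the normalization is the identity, so the first-order condition
  is linear and can be solved for each component.\<close>

lemma solution_quadratic:
  assumes p2: "p = 2" and f: "f \<in> Lpair q \<mu>"
  shows "is_solution d p \<mu> u f \<longleftrightarrow>
    (AE x in \<mu>. fst f (fst x) = - cexp \<mu> fst (partial1 u) x) \<and> (AE x in \<mu>. snd f (snd x) = - cexp \<mu> snd (partial2 u) x)"
proof -
  have fm: "fst f \<in> borel_measurable borel" "snd f \<in> borel_measurable borel"
    and fL: "in_Lp q \<mu> (\<lambda>x. fst f (fst x))" "in_Lp q \<mu> (\<lambda>x. snd f (snd x))"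
    using f by (auto simp: P.Lpair_iff)
  have fi: "integrable \<mu> (\<lambda>x. fst f (fst x))" "integrable \<mu> (\<lambda>x. snd f (snd x))"
    using in_Lp_imp_integrable[OF P.finite_measure_axioms fL(1)] in_Lp_imp_integrable[OF P.finite_measure_axioms fL(2)] q1 by auto
  have iD: "integrable \<mu> (dgrad d \<mu> u)" using in_Lp_imp_integrable[OF P.finite_measure_axioms dgrad_Lq] q1 by simp
  have s: "snd (dgrad d \<mu> u y) = partial2 u y" for y by (cases d) (auto simp: grad_def)
  have "AE x in \<mu>. cexp \<mu> fst (\<lambda>y. fst (L.R f y)) x = cexp \<mu> fst (partial1 u) x + fst f (fst x)"
    using P.c1.cexp_add[OF integrable_fst[OF iD] fi(1)] P.c1.cexp_of_X[OF fm(1) fi(1)] dgrad_cexp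
    by eventually_elim (simp add: pair_vec_def)
  then have 1: "AE x in \<mu>. cexp \<mu> fst (\<lambda>y. fst (L.R f y)) x = 0 \<longleftrightarrow> fst f (fst x) = - cexp \<mu> fst (partial1 u) x"
    by eventually_elim auto
  have "AE x in \<mu>. cexp \<mu> snd (\<lambda>y. snd (L.R f y)) x = cexp \<mu> snd (partial2 u) x + snd f (snd x)"
    using P.c2.cexp_add[OF partial_int(2) fi(2)] P.c2.cexp_of_X[OF fm(2) fi(2)]
    by eventually_elim (simp add: pair_vec_def s)
  then have 2: "AE x in \<mu>. cexp \<mu> snd (\<lambda>y. snd (L.R f y)) x = 0 \<longleftrightarrow> snd f (snd x) = - cexp \<mu> snd (partial2 u) x"
    by eventually_elim auto
  have N: "Nmap p y = y" for y :: plane using Nmap_2 p2 by simp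
  have A: "(\<forall>h\<in>Lpair q \<mu>. L.UU f \<le> L.UU h) \<longleftrightarrow>
      (AE x in \<mu>. cexp \<mu> fst (\<lambda>y. fst (L.R f y)) x = 0) \<and> (AE x in \<mu>. cexp \<mu> snd (\<lambda>y. snd (L.R f y)) x = 0)"
    using L.minimizer_iff_cexp[OF f] unfolding N .
  have "is_solution d p \<mu> u f \<longleftrightarrow> (\<forall>h\<in>Lpair q \<mu>. L.UU f \<le> L.UU h)"
    using f by (simp only: solution_iff simp_thms)
  also note A
  also have "(AE x in \<mu>. cexp \<mu> fst (\<lambda>y. fst (L.R f y)) x = 0) \<longleftrightarrow> (AE x in \<mu>. fst f (fst x) = - cexp \<mu> fst (partial1 u) x)"
    by (rule eventually_cong[OF 1])
  also have "(AE x in \<mu>. cexp \<mu> snd (\<lambda>y. snd (L.R f y)) x = 0) \<longleftrightarrow> (AE x in \<mu>. snd f (snd x) = - cexp \<mu> snd (partial2 u) x)"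
    by (rule eventually_cong[OF 2])
  finally show ?thesis .
qed

lemma Lnorm_2: "Lnorm 2 \<mu> T = sqrt (\<integral>x. (fst (T x))\<^sup>2 + (snd (T x))\<^sup>2 \<partial>\<mu>)" for T :: "plane \<Rightarrow> plane"
proof -
  have "norm (T x) powr 2 = (fst (T x))\<^sup>2 + (snd (T x))\<^sup>2" for x
    by (simp add: powr_numeral norm_prod_def)
  then show ?thesis unfolding Lnorm_def by (simp add: powr_half_sqrt)
qed

text \<open>In the adapted case the optimal first component cancels the averaged partial derivative,
  so that only the second summand survives.\<close>

lemma quadratic_value:
  assumes p2: "p = 2" and S: "is_solution d p \<mu> u f"
  shows "d = Wass \<Longrightarrow> Lnorm q \<mu> (L.R f) = sqrt (\<integral>x. (partial1 u x - cexp \<mu> fst (partial1 u) x)\<^sup>2 + (partial2 u x - cexp \<mu> snd (partial2 u) x)\<^sup>2 \<partial>\<mu>)"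
    and "d = AdWass \<Longrightarrow> Lnorm q \<mu> (L.R f) = sqrt (\<integral>x. (partial2 u x - cexp \<mu> snd (partial2 u) x)\<^sup>2 \<partial>\<mu>)"
proof -
  have f: "f \<in> Lpair q \<mu>" using S by (simp add: solution_iff)
  have [measurable]: "L.R f \<in> borel_measurable borel" by (rule L.R_meas[OF f])
  have q2: "q = 2" unfolding p2 conj_exp_def by simp
  have ae: "AE x in \<mu>. fst f (fst x) = - cexp \<mu> fst (partial1 u) x" "AE x in \<mu>. snd f (snd x) = - cexp \<mu> snd (partial2 u) x"
    using solution_quadratic[OF p2 f] S by blast+
  define Y where "Y x = L.R f x" for x
  have Ym[measurable]: "Y \<in> borel_measurable borel" unfolding Y_def by (rule L.R_meas[OF f])
  have V: "Lnorm q \<mu> (L.R f) = sqrt (\<integral>x. (fst (Y x))\<^sup>2 + (snd (Y x))\<^sup>2 \<partial>\<mu>)" unfolding q2 Lnorm_2 Y_def ..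
  show "Lnorm q \<mu> (L.R f) = sqrt (\<integral>x. (partial1 u x - cexp \<mu> fst (partial1 u) x)\<^sup>2 + (partial2 u x - cexp \<mu> snd (partial2 u) x)\<^sup>2 \<partial>\<mu>)" if "d = Wass"
    unfolding V
  proof (intro arg_cong[where f=sqrt] integral_cong_AE)
    show "AE x in \<mu>. (fst (Y x))\<^sup>2 + (snd (Y x))\<^sup>2 = (partial1 u x - cexp \<mu> fst (partial1 u) x)\<^sup>2 + (partial2 u x - cexp \<mu> snd (partial2 u) x)\<^sup>2"
      using ae by eventually_elim (simp add: Y_def that grad_def pair_vec_def)
  qed (simp_all add: P.sets_eq cong: measurable_cong_sets)
  show "Lnorm q \<mu> (L.R f) = sqrt (\<integral>x. (partial2 u x - cexp \<mu> snd (partial2 u) x)\<^sup>2 \<partial>\<mu>)" if "d = AdWass"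
    unfolding V
  proof (intro arg_cong[where f=sqrt] integral_cong_AE)
    show "AE x in \<mu>. (fst (Y x))\<^sup>2 + (snd (Y x))\<^sup>2 = (partial2 u x - cexp \<mu> snd (partial2 u) x)\<^sup>2"
      using ae by eventually_elim (simp add: Y_def that pair_vec_def)
  qed (simp_all add: P.sets_eq cong: measurable_cong_sets)
qed

end

text \<open>Elements of the Lebesgue spaces are represented by functions, and existence of a
  solution belongs to the conclusion; accordingly the standing assumption is imposed on every
  solution, and uniqueness is expressed by \<open>pair_eq\<close>.\<close>

theorem proposition3p7:
  fixes d :: distance_kind and p :: real
    and g :: "plane measure \<Rightarrow> real" and \<delta>g :: "plane measure \<Rightarrow> plane \<Rightarrow> real"
    and \<mu> :: "plane measure"
  assumes "p > 1"
    and "cond_R p g \<delta>g"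
    and "\<mu> \<in> Pp p"
    and "cond_B d \<mu>"
    and "\<And>f. is_solution d p \<mu> (\<delta>g \<mu>) f \<Longrightarrow> \<not> (AE x in \<mu>. resid d \<mu> (\<delta>g \<mu>) f x = 0)"
  shows
    "has_deriv0 (G_upper d p g \<mu>)
       (INF f\<in>Lpair (conj_exp p) \<mu>. U d p \<mu> (\<delta>g \<mu>) f powr (1 / conj_exp p))
     \<and> has_deriv0 (G_lower d p g \<mu>)
       (INF f\<in>Lpair (conj_exp p) \<mu>. U d p \<mu> (\<delta>g \<mu>) f powr (1 / conj_exp p))
     \<and> Lstrictly_convex (conj_exp p) \<mu> (U d p \<mu> (\<delta>g \<mu>))
     \<and> Lcontinuous (conj_exp p) \<mu> (U d p \<mu> (\<delta>g \<mu>))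
     \<and> Lcoercive (conj_exp p) \<mu> (U d p \<mu> (\<delta>g \<mu>))
     \<and> (\<exists>f. is_solution d p \<mu> (\<delta>g \<mu>) f
          \<and> (\<forall>h. is_solution d p \<mu> (\<delta>g \<mu>) h \<longrightarrow> pair_eq \<mu> h f))
     \<and> (\<forall>f. is_solution d p \<mu> (\<delta>g \<mu>) f \<longrightarrow>
          (\<exists>!c. c > 0 \<and> Lnorm p \<mu> (Tmap d p \<mu> (\<delta>g \<mu>) c f) = 1))
     \<and> (\<forall>f\<in>Lpair (conj_exp p) \<mu>. is_solution d p \<mu> (\<delta>g \<mu>) f \<longleftrightarrow>
          (\<exists>c>0. Lnorm p \<mu> (Tmap d p \<mu> (\<delta>g \<mu>) c f) = 1
             \<and> (AE x in \<mu>. cexp \<mu> fst (\<lambda>y. fst (Tmap d p \<mu> (\<delta>g \<mu>) c f y)) x = 0)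
             \<and> (AE x in \<mu>. cexp \<mu> snd (\<lambda>y. snd (Tmap d p \<mu> (\<delta>g \<mu>) c f y)) x = 0)))
     \<and> (p = 2 \<longrightarrow>
          (\<forall>f\<in>Lpair (conj_exp p) \<mu>. is_solution d p \<mu> (\<delta>g \<mu>) f \<longleftrightarrow>
             (AE x in \<mu>. fst f (fst x) = - cexp \<mu> fst (partial1 (\<delta>g \<mu>)) x)
             \<and> (AE x in \<mu>. snd f (snd x) = - cexp \<mu> snd (partial2 (\<delta>g \<mu>)) x)))
     \<and> (p = 2 \<and> d = Wass \<longrightarrow>
          (let S = sqrt (\<integral>x. (partial1 (\<delta>g \<mu>) x - cexp \<mu> fst (partial1 (\<delta>g \<mu>)) x)\<^sup>2
                          + (partial2 (\<delta>g \<mu>) x - cexp \<mu> snd (partial2 (\<delta>g \<mu>)) x)\<^sup>2 \<partial>\<mu>)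
           in has_deriv0 (G_upper d p g \<mu>) S \<and> has_deriv0 (G_lower d p g \<mu>) S))
     \<and> (p = 2 \<and> d = AdWass \<longrightarrow>
          (let S = sqrt (\<integral>x. (partial2 (\<delta>g \<mu>) x - cexp \<mu> snd (partial2 (\<delta>g \<mu>)) x)\<^sup>2 \<partial>\<mu>)
           in has_deriv0 (G_upper d p g \<mu>) S \<and> has_deriv0 (G_lower d p g \<mu>) S))"
proof -
  interpret sens p g \<delta>g d \<mu> by unfold_locales fact+
  have nz: "\<not> (AE x in \<mu>. L.R f x = 0)" if "is_solution d p \<mu> (\<delta>g \<mu>) f" for f
    using assms(5)[OF that] unfolding resid_def .
  obtain f where f: "f \<in> Lpair q \<mu>" "\<forall>h\<in>Lpair q \<mu>. L.UU f \<le> L.UU h" using L.exists_minimizer by blast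
  have S: "is_solution d p \<mu> (\<delta>g \<mu>) f" using f by (simp add: solution_iff)
  note deriv = sensitivities[OF assms(4) f nz[OF S]]
  have Ueq: "U d p \<mu> (\<delta>g \<mu>) = L.UU" by (rule ext) (rule U_eq)
  have uniq: "pair_eq \<mu> h f" if "is_solution d p \<mu> (\<delta>g \<mu>) h" for h
    using that f L.minimizer_unique[of f h] unfolding solution_iff by blast
  \<comment> \<open>The infimum is attained at \<open>f\<close>; replacing it by the residual norm
    of \<open>f\<close> puts all claims on derivatives into the form of
    \<open>sensitivities\<close>.\<close>
  show ?thesis
    unfolding INF_eq_Lnorm[OF f] Let_def
  proof (intro conjI impI allI ballI)
    show "has_deriv0 (G_upper d p g \<mu>) (Lnorm q \<mu> (L.R f))" "has_deriv0 (G_lower d p g \<mu>) (Lnorm q \<mu> (L.R f))"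
      by (rule deriv)+
    show "Lstrictly_convex q \<mu> (U d p \<mu> (\<delta>g \<mu>))" "Lcontinuous q \<mu> (U d p \<mu> (\<delta>g \<mu>))" "Lcoercive q \<mu> (U d p \<mu> (\<delta>g \<mu>))"
      unfolding Ueq by (rule L.UU_strictly_convex L.UU_continuous L.UU_coercive)+
    show "\<exists>f. is_solution d p \<mu> (\<delta>g \<mu>) f \<and> (\<forall>h. is_solution d p \<mu> (\<delta>g \<mu>) h \<longrightarrow> pair_eq \<mu> h f)"
      using S uniq by blast
    show "\<exists>!c. 0 < c \<and> Lnorm p \<mu> (Tmap d p \<mu> (\<delta>g \<mu>) c h) = 1" if "is_solution d p \<mu> (\<delta>g \<mu>) h" for h
      by (rule unique_normalization[OF that nz[OF that]])
  next
    fix h assume h: "h \<in> Lpair q \<mu>"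
    show "is_solution d p \<mu> (\<delta>g \<mu>) h \<longleftrightarrow> (\<exists>c>0. Lnorm p \<mu> (Tmap d p \<mu> (\<delta>g \<mu>) c h) = 1
             \<and> (AE x in \<mu>. cexp \<mu> fst (\<lambda>y. fst (Tmap d p \<mu> (\<delta>g \<mu>) c h y)) x = 0)
             \<and> (AE x in \<mu>. cexp \<mu> snd (\<lambda>y. snd (Tmap d p \<mu> (\<delta>g \<mu>) c h y)) x = 0))"
      by (rule solution_iff_first_order[OF nz h])
    assume p2: "p = 2"
    show "is_solution d p \<mu> (\<delta>g \<mu>) h \<longleftrightarrow> (AE x in \<mu>. fst h (fst x) = - cexp \<mu> fst (partial1 (\<delta>g \<mu>)) x)
       \<and> (AE x in \<mu>. snd h (snd x) = - cexp \<mu> snd (partial2 (\<delta>g \<mu>)) x)"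
      by (rule solution_quadratic[OF p2 h])
  next
    assume "p = 2 \<and> d = Wass"
    then show "has_deriv0 (G_upper d p g \<mu>) (sqrt (\<integral>x. (partial1 (\<delta>g \<mu>) x - cexp \<mu> fst (partial1 (\<delta>g \<mu>)) x)\<^sup>2
                          + (partial2 (\<delta>g \<mu>) x - cexp \<mu> snd (partial2 (\<delta>g \<mu>)) x)\<^sup>2 \<partial>\<mu>))"
      "has_deriv0 (G_lower d p g \<mu>) (sqrt (\<integral>x. (partial1 (\<delta>g \<mu>) x - cexp \<mu> fst (partial1 (\<delta>g \<mu>)) x)\<^sup>2
                          + (partial2 (\<delta>g \<mu>) x - cexp \<mu> snd (partial2 (\<delta>g \<mu>)) x)\<^sup>2 \<partial>\<mu>))"
      using deriv quadratic_value(1)[OF _ S] by auto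
  next
    assume "p = 2 \<and> d = AdWass"
    then show "has_deriv0 (G_upper d p g \<mu>) (sqrt (\<integral>x. (partial2 (\<delta>g \<mu>) x - cexp \<mu> snd (partial2 (\<delta>g \<mu>)) x)\<^sup>2 \<partial>\<mu>))"
      "has_deriv0 (G_lower d p g \<mu>) (sqrt (\<integral>x. (partial2 (\<delta>g \<mu>) x - cexp \<mu> snd (partial2 (\<delta>g \<mu>)) x)\<^sup>2 \<partial>\<mu>))"
      using deriv quadratic_value(2)[OF _ S] by auto
  qed
qed

end
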